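(* The following identities hold. (i) For every integer $n\ge 1$, $$\pi^{2n}\, m\!\left(1+\left(\tfrac{1-x_1}{1+x_1}\right)\cdots\left(\tfrac{1-x_{2n}}{1+x_{2n}}\right)z\right)=\frac{1}{(2n-1)!}\sum_{h=1}^{n}s_{n-h}(2^2,\dots,(2n-2)^2)\,\frac{(2h)!\,(2^{2h+1}-1)}{2}\,\pi^{2n-2h}\,\zeta(2h+1).$$ For every integer $n\ge 0$, $$\pi^{2n+1}\, m\!\left(1+\left(\tfrac{1-x_1}{1+x_1}\right)\cdots\left(\tfrac{1-x_{2n+1}}{1+x_{2n+1}}\right)z\right)=\frac{1}{(2n)!}\sum_{h=0}^{n}s_{n-h}(1^2,\dots,(2n-1)^2)\,(2h+1)!\,2^{2h+1}\,\pi^{2n-2h}\,\mathrm{L}(\chi_{-4},2h+2).$$ (ii) For every integer $n\ge 1$, $$\pi^{2n+2}\, m\!\left(1+x+\left(\tfrac{1-x_1}{1+x_1}\right)\cdots\left(\tfrac{1-x_{2n}}{1+x_{2n}}\right)(1+y)z\right)$$ $$=\frac{1}{(2n-1)!}\sum_{h=1}^{n}\frac{(2h+2)!\,(2^{2h+3}-1)}{8}\left(\sum_{l=0}^{n-h}s_{n-h-l}(2^2,\dots,(2n-2)^2)\binom{2(l+h)}{2h}(-1)^l\frac{2^{2l}}{l+h}B_{2l}\right)\pi^{2n-2h}\,\zeta(2h+3).$$ For every integer $n\ge 0$, $$\pi^{2n+3}\, m\!\left(1+x+\left(\tfrac{1-x_1}{1+x_1}\right)\cdots\left(\tfrac{1-x_{2n+1}}{1+x_{2n+1}}\right)(1+y)z\right)$$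 $$=\frac{1}{(2n)!}\sum_{h=0}^{n}s_{n-h}(1^2,\dots,(2n-1)^2)\,2^{2h+1}\pi^{2n-2h}\left(\mathrm{i}\,(2h)!\,\mathcal{L}_{3,2h+1}(\mathrm{i},\mathrm{i})+(2h+1)!\,\pi^2\,\mathrm{L}(\chi_{-4},2h+2)\right).$$ (iii) For every integer $n\ge 1$, writing $A=\left(\tfrac{1-x_1}{1+x_1}\right)\cdots\left(\tfrac{1-x_{2n}}{1+x_{2n}}\right)$, $$\pi^{2n+1}\, m\big(1+A\,x+(1-A)\,y\big)=\frac{\pi^{2n+1}}{2}\log 2+\frac{1}{(2n-1)!}\sum_{h=1}^{n}s_{n-h}(2^2,\dots,(2n-2)^2)\frac{(2h)!(2^{2h+1}-1)}{4}\pi^{2n-2h+1}\zeta(2h+1)$$ $$+\frac{1}{(2n-1)!}\sum_{h=1}^{n}\frac{(2h)!(2^{2h+1}-1)}{4}\left(\sum_{l=0}^{n-h}s_{n-h-l}(2^2,\dots,(2n-2)^2)\binom{2(l+h)}{2l}(-1)^{l+1}\frac{2^{2l}(2^{2l-1}-1)}{l+h}B_{2l}\right)\pi^{2n-2h+1}\zeta(2h+1).$$ For every integer $n\ge 0$, writing $A=\left(\tfrac{1-x_1}{1+x_1}\right)\cdots\left(\tfrac{1-x_{2n+1}}{1+x_{2n+1}}\right)$, $$\pi^{2n+2}\, m\big(1+A\,x+(1-A)\,y\big)=\frac{\pi^{2n+2}}{2}\log 2+\frac{1}{(2n+1)!}\sum_{h=0}^{n}s_{n-h}(2^2,\dots,(2n)^2)\frac{(2h+2)!(2^{2h+3}-1)}{4}\pi^{2n-2h}\zeta(2h+3)$$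 $$+\frac{1}{(2n-1)!}\sum_{h=1}^{n}\frac{(2h)!(2^{2h+1}-1)}{4}\left(\sum_{l=0}^{n-h}s_{n-h-l}(2^2,\dots,(2n-2)^2)\binom{2(l+h)}{2l}(-1)^{l+1}\frac{2^{2l}(2^{2l-1}-1)}{l+h}B_{2l}\right)\pi^{2n-2h+2}\zeta(2h+1),$$ where for $n=0$ the last term (an empty sum) is $0$.
   Context: Mahler measure: for $P$ a nonzero polynomial (or rational function) in $N$ variables with complex coefficients, $m(P)=\frac{1}{(2\pi \mathrm{i})^N}\int_{\mathbb{T}^N}\log|P(u_1,\dots,u_N)|\frac{\mathrm{d}u_1}{u_1}\cdots\frac{\mathrm{d}u_N}{u_N}$, where $\mathbb{T}^N=\{|u_1|=\dots=|u_N|=1\}$; the integration is over all variables occurring (the $x_j$ together with $z$, or $x,y,z$, or $x,y$). The rational functions in the statement have the same Mahler measure as the polynomials obtained by clearing the denominators $1+x_j$. $\zeta$ is the Riemann zeta function; $\mathrm{L}(\chi_{-4},s)=\sum_{n\ge1}\chi_{-4}(n)n^{-s}$, where $\chi_{-4}(n)=\left(\frac{-1}{n}\right)=(-1)^{(n-1)/2}$ for $n$ odd and $0$ for $n$ even. $B_n$ are the Bernoulli numbers, $\frac{x}{e^x-1}=\sum_{n\ge0}B_n\frac{x^n}{n!}$. $s_l(a_1,\dots,a_k)$ is the $l$-th elementary symmetric polynomial: $s_0=1$, $s_l=\sum_{i_1<\dots<i_l}a_{i_1}\cdots a_{i_l}$ for $0<l\le k$, and $s_l=0$ for $l>k$.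 The list $(2^2,\dots,(2n-2)^2)$ consists of $(2j)^2$, $1\le j\le n-1$; $(2^2,\dots,(2n)^2)$ of $(2j)^2$, $1\le j\le n$; $(1^2,\dots,(2n-1)^2)$ of $(2j-1)^2$, $1\le j\le n$ (lists may be empty). Multiple polylogarithms of length two: $\mathrm{Li}_{r,s}(x,y)=\sum_{0<k_1<k_2}\frac{x^{k_1}y^{k_2}}{k_1^r k_2^s}$ for $|x|,|y|<1$, extended analytically; at the points used here ($x,y\in\{\pm\mathrm{i}\}$) the value is the limit of the partial sums over $k_2\le N$ as $N\to\infty$. Then $$\mathcal{L}_{r,s}(\alpha,\alpha):=2\big(\mathrm{Li}_{r,s}(\alpha,\alpha)-\mathrm{Li}_{r,s}(-\alpha,\alpha)+\mathrm{Li}_{r,s}(\alpha,-\alpha)-\mathrm{Li}_{r,s}(-\alpha,-\alpha)\big).$$ *)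

theory Defs
  imports
    "HOL-Analysis.Analysis"
    "HOL-Computational_Algebra.Formal_Power_Series"
begin

text \<open>
  A function of \<open>N\<close> complex variables is a function of \<open>u :: nat \<Rightarrow> complex\<close> that only reads
  \<open>u 1, \<dots>, u N\<close>. The torus is parametrised by \<open>u j = e\<^sup>i\<^sup>\<theta>\<close> with \<open>\<theta> = \<theta> j\<close> in \<open>[0, 2\<pi>]\<close>, so that
  \<open>du j / (2 \<pi> i u j) = d\<theta> j / (2 \<pi>)\<close>; lemma \<open>mahler_measure_torus_form\<close> below has the
  differential forms written out. Zeros and poles of \<open>P\<close>, where \<open>ln 0 = 0\<close> and \<open>x / 0 = 0\<close> apply,
  form a null set when \<open>P\<close> is a nonzero rational function.
\<close>

definition mahler_measure :: "nat \<Rightarrow> ((nat \<Rightarrow> complex) \<Rightarrow> complex) \<Rightarrow> real" where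
  "mahler_measure N P =
     1 / (2 * pi) ^ N *
     (LINT \<theta>:({1..N} \<rightarrow>\<^sub>E {0..2*pi})|(\<Pi>\<^sub>M j\<in>{1..N}. lborel). ln (cmod (P (\<lambda>j. cis (\<theta> j)))))"

lemma mahler_measure_torus_form:
  "complex_of_real (mahler_measure N P) =
     1 / (2 * of_real pi * \<i>) ^ N *
     (LINT \<theta>:({1..N} \<rightarrow>\<^sub>E {0..2*pi})|(\<Pi>\<^sub>M j\<in>{1..N}. lborel).
        of_real (ln (cmod (P (\<lambda>j. cis (\<theta> j))))) * (\<Prod>j=1..N. (\<i> * cis (\<theta> j)) / cis (\<theta> j)))"
  by (simp add: mahler_measure_def set_integral_complex_of_real power_mult_distrib)

definition cayley_prod :: "nat \<Rightarrow> (nat \<Rightarrow> complex) \<Rightarrow> complex" where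
  "cayley_prod k u = (\<Prod>j=1..k. (1 - u j) / (1 + u j))"

definition elem_sym :: "nat \<Rightarrow> real list \<Rightarrow> real" where
  "elem_sym l as = (\<Sum>I | I \<subseteq> {..<length as} \<and> card I = l. \<Prod>i\<in>I. as ! i)"

text \<open>The lists \<open>2\<^sup>2, 4\<^sup>2, \<dots>, (2n)\<^sup>2\<close> and \<open>1\<^sup>2, 3\<^sup>2, \<dots>, (2n-1)\<^sup>2\<close>.\<close>

definition even_squares :: "nat \<Rightarrow> real list" where
  "even_squares n = map (\<lambda>j. (2 * real j)\<^sup>2) [1..<Suc n]"

definition odd_squares :: "nat \<Rightarrow> real list" where
  "odd_squares n = map (\<lambda>j. (2 * real j - 1)\<^sup>2) [1..<Suc n]"

text \<open>
  The quotient \<open>x / (e\<^sup>x - 1)\<close> is taken in the ring of formal power series, where division cancels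
  the common factor \<open>x\<close>.
\<close>

definition bernoulli_num :: "nat \<Rightarrow> real" where
  "bernoulli_num n = fact n * fps_nth (fps_X / (fps_exp 1 - 1)) n"

lemma bernoulli_num_egf:
  "(fps_exp 1 - 1) * Abs_fps (\<lambda>n. bernoulli_num n / fact n) = fps_X"
proof -
  have eq: "Abs_fps (\<lambda>n. bernoulli_num n / fact n) = fps_X / (fps_exp 1 - 1)"
    by (simp add: bernoulli_num_def fps_eq_iff)
  have nz: "fps_nth (fps_exp (1::real) - 1) 1 \<noteq> 0" by simp
  have "fps_exp (1::real) - 1 \<noteq> 0"
    using nz by (metis fps_zero_nth)
  moreover have "subdegree (fps_exp (1::real) - 1) \<le> subdegree (fps_X :: real fps)"
    using subdegree_leI[OF nz] by simp
  ultimately have "fps_exp (1::real) - 1 dvd fps_X"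
    by (subst fps_dvd_iff) auto
  thus ?thesis unfolding eq by simp
qed

text \<open>The Riemann zeta function at integers \<open>s \<ge> 2\<close>.\<close>

definition zeta_nat :: "nat \<Rightarrow> real" where
  "zeta_nat s = (\<Sum>n. 1 / real (Suc n) ^ s)"

definition chi_minus4 :: "nat \<Rightarrow> real" where
  "chi_minus4 n = (if even n then 0 else (-1) ^ ((n - 1) div 2))"

definition L_chi_minus4 :: "nat \<Rightarrow> real" where
  "L_chi_minus4 s = (\<Sum>n. chi_minus4 (Suc n) / real (Suc n) ^ s)"

text \<open>
  \<open>Li r s x y\<close> as the limit of its partial sums over \<open>0 < k1 < k2 \<le> N\<close>; on the unit circle the
  convergence may be conditional. The term \<open>k2 = 0\<close> has an empty inner sum.
\<close>

definition polylog2 :: "nat \<Rightarrow> nat \<Rightarrow> complex \<Rightarrow> complex \<Rightarrow> complex" where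
  "polylog2 r s x y =
     (\<Sum>k2. \<Sum>k1=1..<k2. (x ^ k1 * y ^ k2) / (of_nat k1 ^ r * of_nat k2 ^ s))"

definition L_script :: "nat \<Rightarrow> nat \<Rightarrow> complex \<Rightarrow> complex" where
  "L_script r s \<alpha> =
     2 * (polylog2 r s \<alpha> \<alpha> - polylog2 r s (-\<alpha>) \<alpha> + polylog2 r s \<alpha> (-\<alpha>) - polylog2 r s (-\<alpha>) (-\<alpha>))"

end

theory Submission
  imports Defs "HOL-Probability.Probability" "HOL-Real_Asymp.Real_Asymp"
begin

text \<open>
  If \<open>x\<close> is uniform on the unit circle, then \<open>(1 - x) / (1 + x) = -\<i> tan (\<theta> / 2)\<close>, and
  \<open>ln |tan (\<theta> / 2)|\<close> has density \<open>1 / (\<pi> cosh s)\<close>. So \<open>ln |A|\<close> for a product \<open>A\<close> of \<open>k\<close> such factors is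
  a sum of \<open>k\<close> independent variables with this law; the density \<open>G\<^sub>k\<close> of the sum satisfies
  \<open>G\<^sub>k\<^sub>+\<^sub>2 (s) = (4 s\<^sup>2 / \<pi>\<^sup>2 + k\<^sup>2) / (k (k + 1)) G\<^sub>k (s)\<close>, because its characteristic function is a power of
  \<open>sech\<close>. This is where the elementary symmetric polynomials of squares come from.

  Jensen's formula removes the variables in which the polynomial is linear and leaves moments:
  \<open>E|S| / 2\<close> in (i), \<open>E|S|\<^sup>3 / (k \<pi>\<^sup>2)\<close> in (ii), and \<open>E|S|\<close> together with \<open>E ln (2 cosh S)\<close> in (iii).
  Exchangeability of the summands gives \<open>E (T f (S)) = E (S f (S)) / k\<close> for a single summand \<open>T\<close>, which
  produces the cubic moment and a two-step recursion for \<open>E ln (2 cosh S)\<close>. The moments are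
  values of \<open>\<zeta>\<close> and \<open>L\<close> because \<open>1 / sinh\<close> and \<open>1 / cosh\<close> expand in exponentials. The Bernoulli numbers
  enter by inverting the difference operator \<open>e\<^sup>c\<^sup>D - 1\<close> on the polynomials \<open>y \<Prod> (y\<^sup>2 - (2 j)\<^sup>2)\<close>.
\<close>

section \<open>Densities\<close>

text \<open>A \<open>k\<close>-fold convolution never has to be computed. The densities are defined
  by the two-step recursion from the seeds for one and two steps, and characteristic functions
  identify them afterwards; two seeds are needed because two derivatives link \<open>sech^k\<close>
  to \<open>sech^(k+2)\<close> only. Hence two formulas in every family: sums of an even number of
  steps carry \<open>s / sinh s\<close> and lead to zeta, odd ones carry \<open>1 / cosh s\<close>
  and lead to \<open>L\<close>. In (iii) parity enters a second time through the phase: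
  \<open>A = (-i)^k q\<close> with \<open>q\<close> real, so \<open>A\<close> is real or purely
  imaginary, and the average over \<open>x\<close> is a different integral in the two cases. The
  obstacle in (ii) is the law of \<open>ln |1 + y| - ln |1 + x|\<close>; its convolution with a
  single step is a mixture of indicators of intervals \<open>[-b, b]\<close>, and this produces the
  shape \<open>T f (S)\<close> to which exchangeability applies. No moment yields a Bernoulli
  number: the moments give closed forms in elementary symmetric polynomials, and the Bernoulli sums
  of the statement are shown equal to these by solving a difference equation in two ways.\<close>

lemma has_real_derivative_integral:
  fixes f :: "real \<Rightarrow> 'a \<Rightarrow> real"
  assumes int: "\<And>t. integrable M (f t)"
    and der: "\<And>t s. s \<in> space M \<Longrightarrow> ((\<lambda>t. f t s) has_real_derivative f' t s) (at t)"
    and bound: "\<And>t s. s \<in> space M \<Longrightarrow> \<bar>f' t s\<bar> \<le> g s"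
    and g: "integrable M g"
    and meas: "f' x \<in> borel_measurable M"
  shows "((\<lambda>t. \<integral>s. f t s \<partial>M) has_real_derivative (\<integral>s. f' x s \<partial>M)) (at x)"
proof -
  have [measurable]: "f t \<in> borel_measurable M" for t using int by auto
  have "((\<lambda>h. ((\<integral>s. f (x + h) s \<partial>M) - (\<integral>s. f x s \<partial>M)) / h) \<longlongrightarrow> (\<integral>s. f' x s \<partial>M)) (at 0)"
    unfolding tendsto_at_iff_sequentially
  proof (intro allI impI)
    fix X :: "nat \<Rightarrow> real" assume X: "\<forall>i. X i \<in> UNIV - {0}" "X \<longlonglongrightarrow> 0"
    have nz: "X i \<noteq> 0" for i using X by auto
    have lim0: "filterlim X (at 0) sequentially" using X by (auto simp: filterlim_at)
    have eq: "(\<lambda>h. ((\<integral>s. f (x + h) s \<partial>M) - (\<integral>s. f x s \<partial>M)) / h) \<circ> X =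
        (\<lambda>i. \<integral>s. (f (x + X i) s - f x s) / X i \<partial>M)"
      by (auto simp: fun_eq_iff int)
    show "((\<lambda>h. ((\<integral>s. f (x + h) s \<partial>M) - (\<integral>s. f x s \<partial>M)) / h) \<circ> X) \<longlonglongrightarrow> (\<integral>s. f' x s \<partial>M)"
      unfolding eq
    proof (rule integral_dominated_convergence[where w = g])
      show "AE s in M. (\<lambda>i. (f (x + X i) s - f x s) / X i) \<longlonglongrightarrow> f' x s"
      proof (rule AE_I2)
        fix s assume s: "s \<in> space M"
        have "((\<lambda>h. (f (x + h) s - f x s) / h) \<longlongrightarrow> f' x s) (at 0)"
          using der[OF s, of x] by (simp add: DERIV_def)
        thus "(\<lambda>i. (f (x + X i) s - f x s) / X i) \<longlonglongrightarrow> f' x s"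
          using filterlim_compose lim0 by blast
      qed
      show "AE s in M. norm ((f (x + X i) s - f x s) / X i) \<le> g s" for i
      proof (rule AE_I2)
        fix s assume s: "s \<in> space M"
        have "norm (f (x + X i) s - f x s) \<le> g s * norm (x + X i - x)"
          by (rule field_differentiable_bound[where S = UNIV and f' = "\<lambda>t. f' t s"])
             (use der[OF s] bound[OF s] in auto)
        thus "norm ((f (x + X i) s - f x s) / X i) \<le> g s"
          using nz[of i] by (simp add: field_simps)
      qed
    qed (use g meas in auto)
  qed
  thus ?thesis by (simp add: DERIV_def)
qed

text \<open>The Gamma integral for integer exponents, read off from the normalisation of the Erlang
  density.\<close>

lemma has_bochner_integral_power_exp:
  fixes a :: real
  assumes "a > 0"
  shows "has_bochner_integral lborel (\<lambda>s. indicator {0..} s *\<^sub>R (s ^ m * exp (- a * s))) (fact m / a ^ (m + 1))"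
proof -
  have "(\<integral>\<^sup>+s. ennreal (erlang_density m a s) \<partial>lborel) = 1"
    using prob_space.emeasure_space_1[OF prob_space_erlang_density[OF assms, of m]]
    by (simp add: emeasure_density)
  hence "has_bochner_integral lborel (erlang_density m a) 1"
    by (intro has_bochner_integral_nn_integral) (use assms in auto)
  hence "has_bochner_integral lborel (\<lambda>s. erlang_density m a s * (fact m / a ^ (m + 1))) (1 * (fact m / a ^ (m + 1)))"
    by (rule has_bochner_integral_mult_left)
  also have "(\<lambda>s. erlang_density m a s * (fact m / a ^ (m + 1))) = (\<lambda>s. indicator {0..} s *\<^sub>R (s ^ m * exp (- a * s)))"
    using assms by (auto simp: fun_eq_iff erlang_density_def indicator_def field_simps)
  finally show ?thesis by simp
qed

lemma integrable_even_extension: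
  fixes f :: "real \<Rightarrow> real"
  assumes "integrable lborel (\<lambda>s. indicator {0..} s *\<^sub>R f s)" "\<And>s. f (- s) = f s"
  shows "integrable lborel f" "(\<integral>s. f s \<partial>lborel) = 2 * (\<integral>s. indicator {0..} s *\<^sub>R f s \<partial>lborel)"
  using has_bochner_integral_even_function[OF has_bochner_integral_integrable[OF assms(1)] assms(2)]
  by (auto simp: has_bochner_integral_iff)

lemma integrable_poly_exp_abs:
  fixes a :: real
  assumes "a > 0"
  shows "integrable lborel (\<lambda>s. (1 + \<bar>s\<bar>) ^ m * exp (- a * \<bar>s\<bar>))"
proof -
  have "integrable lborel (\<lambda>s. \<bar>s\<bar> ^ j * exp (- a * \<bar>s\<bar>))" for j
  proof (rule integrable_even_extension(1))
    have "(\<lambda>s. indicator {0..} s *\<^sub>R (\<bar>s\<bar> ^ j * exp (- a * \<bar>s\<bar>))) =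
          (\<lambda>s. indicator {0..} s *\<^sub>R (s ^ j * exp (- a * s)))"
      by (auto simp: fun_eq_iff indicator_def)
    thus "integrable lborel (\<lambda>s. indicator {0..} s *\<^sub>R (\<bar>s\<bar> ^ j * exp (- a * \<bar>s\<bar>)))"
      using has_bochner_integral_power_exp[OF assms, of j] by (simp add: has_bochner_integral_iff)
  qed auto
  hence "integrable lborel (\<lambda>s. \<Sum>j\<le>m. real (m choose j) * (\<bar>s\<bar> ^ j * exp (- a * \<bar>s\<bar>)))"
    by (intro Bochner_Integration.integrable_sum integrable_mult_right) auto
  also have "(\<lambda>s. \<Sum>j\<le>m. real (m choose j) * (\<bar>s\<bar> ^ j * exp (- a * \<bar>s\<bar>))) =
      (\<lambda>s. (1 + \<bar>s\<bar>) ^ m * exp (- a * \<bar>s\<bar>))"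
    by (subst add.commute, subst binomial_ring) (simp add: sum_distrib_right sum_distrib_left mult_ac)
  finally show ?thesis .
qed

lemma has_bochner_integral_FTC_UNIV:
  fixes F f :: "real \<Rightarrow> real"
  assumes der: "\<And>x. (F has_real_derivative f x) (at x)"
    and cont: "continuous_on UNIV f"
    and nn: "\<And>x. f x \<ge> 0"
    and bot: "(F \<longlongrightarrow> A) at_bot" and top: "(F \<longlongrightarrow> B) at_top"
  shows "has_bochner_integral lborel f (B - A)"
proof -
  have A: "((F \<circ> real_of_ereal) \<longlongrightarrow> A) (at_right (- \<infinity>))"
    using bot by (simp add: ereal_tendsto_simps1)
  have B: "((F \<circ> real_of_ereal) \<longlongrightarrow> B) (at_left \<infinity>)"
    using top by (simp add: ereal_tendsto_simps1)
  have C: "isCont f x" for x using cont by (simp add: continuous_on_eq_continuous_at)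
  have "set_integrable lborel (einterval (-\<infinity>) \<infinity>) f" "(LBINT x=-\<infinity>..\<infinity>. f x) = B - A"
    using interval_integral_FTC_nonneg[of "-\<infinity>" "\<infinity>" F f A B] der C nn A B by auto
  thus ?thesis
    by (simp add: has_bochner_integral_iff interval_lebesgue_integral_def set_integrable_def set_lebesgue_integral_def einterval_def)
qed

section \<open>Decay estimates and the family of densities\<close>

lemma sech_le_exp: "1 / cosh (s::real) \<le> 2 * exp (- \<bar>s\<bar>)"
proof -
  have "exp \<bar>s\<bar> \<le> 2 * cosh s" by (auto simp: cosh_def abs_if)
  thus ?thesis by (auto simp: exp_minus field_simps)
qed

lemma csch_le_exp: "s / sinh (s::real) \<le> (1 + 2 * \<bar>s\<bar>) * exp (- \<bar>s\<bar>)"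
proof -
  have pos: "s / sinh s \<le> (1 + 2 * s) * exp (- s)" if "s > 0" for s :: real
  proof -
    \<comment> \<open>\<open>1 + 2 s <= e^(2 s)\<close> is the only estimate used; it gives
      \<open>2 s <= (1 + 2 s) (1 - e^(-2 s))\<close>, which is the claim multiplied by
      \<open>2 sinh s\<close>.\<close>
    have e: "exp (- 2 * s) * (1 + 2 * s) \<le> 1"
      using exp_ge_add_one_self[of "2 * s"] by (simp add: exp_minus field_simps)
    have "s \<le> (1 + 2 * s) * exp (- s) * sinh s"
    proof -
      have "s = ((1 + 2 * s) - 1) / 2" by simp
      also have "\<dots> \<le> ((1 + 2 * s) - exp (- 2 * s) * (1 + 2 * s)) / 2"
        by (intro divide_right_mono diff_left_mono e) auto
      also have "\<dots> = (1 + 2 * s) * exp (- s) * sinh s"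
        by (simp add: sinh_def field_simps flip: exp_add)
      finally show ?thesis .
    qed
    thus ?thesis using that by (simp add: pos_divide_le_eq)
  qed
  consider "s > 0" | "s = 0" | "s < 0" by linarith
  thus ?thesis
  proof cases
    case 1 thus ?thesis using pos[of s] by simp
  next
    case 3 thus ?thesis using pos[of "-s"] by simp
  qed auto
qed

text \<open>Index 0 is a dummy: zero steps give a point mass, which has no density. The two seeds
  are the law of one step and its self-convolution. At \<open>s = 0\<close> the second seed takes
  the value 0 instead of its limit, on a null set only.\<close>

fun sech_density :: "nat \<Rightarrow> real \<Rightarrow> real" where
  "sech_density 0 s = 0"
| "sech_density (Suc 0) s = 1 / (pi * cosh s)"
| "sech_density (Suc (Suc 0)) s = 2 / pi\<^sup>2 * (s / sinh s)"
| "sech_density (Suc (Suc (Suc k))) s =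
     (4 * s\<^sup>2 / pi\<^sup>2 + (real k + 1)\<^sup>2) / ((real k + 1) * (real k + 2)) * sech_density (Suc k) s"

lemma sech_density_step:
  "k \<ge> 1 \<Longrightarrow> sech_density (k + 2) s =
     (4 * s\<^sup>2 / pi\<^sup>2 + (real k)\<^sup>2) / (real k * (real k + 1)) * sech_density k s"
  by (cases k) (auto simp: add_ac)

lemma sech_density_measurable [measurable]: "sech_density k \<in> borel_measurable borel"
proof (induction k rule: less_induct)
  case (less k)
  consider "k = 0" | "k = 1" | "k = 2" | j where "k = Suc (Suc (Suc j))"
    by (metis One_nat_def Suc_1 not0_implies_Suc)
  thus ?case
  proof cases
    case 1
    have "sech_density k = (\<lambda>s. 0)" using 1 by (auto simp: fun_eq_iff)
    thus ?thesis by simp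
  next
    case 2
    have "sech_density k = (\<lambda>s. 1 / (pi * ((exp s + exp (-s)) / 2)))"
      using 2 by (auto simp: fun_eq_iff cosh_def)
    thus ?thesis by simp
  next
    case 3
    have "sech_density k = (\<lambda>s. 2 / pi\<^sup>2 * (s / ((exp s - exp (-s)) / 2)))"
      using 3 by (auto simp: fun_eq_iff sinh_def numeral_2_eq_2)
    thus ?thesis by simp
  next
    case (4 j)
    have [measurable]: "sech_density (Suc j) \<in> borel_measurable borel" using less[of "Suc j"] 4 by auto
    have "sech_density k = (\<lambda>s. (4 * s\<^sup>2 / pi\<^sup>2 + (real j + 1)\<^sup>2) / ((real j + 1) * (real j + 2)) * sech_density (Suc j) s)"
      using 4 by (auto simp: fun_eq_iff)
    thus ?thesis by simp
  qed
qed

lemma sech_density_nonneg: "sech_density k s \<ge> 0"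
proof (induction k s rule: sech_density.induct)
  case (3 s)
  have "s / sinh s \<ge> 0" by (cases "s \<ge> 0") (auto simp: divide_nonpos_nonpos)
  hence "2 / pi\<^sup>2 * (s / sinh s) \<ge> 0" by (intro mult_nonneg_nonneg) auto
  thus ?case by (simp only: sech_density.simps)
qed (auto intro!: divide_nonneg_nonneg mult_nonneg_nonneg)

lemma sech_density_even [simp]: "sech_density k (- s) = sech_density k s"
  by (induction k s rule: sech_density.induct) auto

text \<open>Each recursion step multiplies by a quadratic in \<open>s\<close>, so it costs two
  powers of \<open>1 + |s|\<close> and leaves the exponential decay untouched. All polynomial
  moments are finite as a consequence.\<close>

lemma sech_density_bound:
  "\<exists>C. \<forall>s. sech_density k s \<le> C * ((1 + \<bar>s\<bar>) ^ k * exp (- \<bar>s\<bar>))"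
proof (induction k rule: less_induct)
  case (less k)
  consider "k = 0" | "k = 1" | "k = 2" | j where "k = Suc (Suc (Suc j))"
    by (metis One_nat_def Suc_1 not0_implies_Suc)
  thus ?case
  proof cases
    case 1 thus ?thesis by (intro exI[of _ 0]) auto
  next
    case 2
    have "sech_density k s \<le> (2 / pi) * ((1 + \<bar>s\<bar>) ^ k * exp (- \<bar>s\<bar>))" for s
    proof -
      have "sech_density k s \<le> (2 / pi) * exp (- \<bar>s\<bar>)" using 2 sech_le_exp[of s] by (simp add: field_simps)
      also have "\<dots> \<le> (2 / pi) * ((1 + \<bar>s\<bar>) * exp (- \<bar>s\<bar>))"
        by (intro mult_left_mono) (auto intro: mult_right_mono)
      finally show ?thesis using 2 by simp
    qed
    thus ?thesis by blast
  next
    case 3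
    have "sech_density k s \<le> (4 / pi\<^sup>2) * ((1 + \<bar>s\<bar>) ^ k * exp (- \<bar>s\<bar>))" for s
    proof -
      have "sech_density k s \<le> (2 / pi\<^sup>2) * ((1 + 2 * \<bar>s\<bar>) * exp (- \<bar>s\<bar>))"
        unfolding 3 numeral_2_eq_2 sech_density.simps by (intro mult_left_mono csch_le_exp) auto
      also have "\<dots> \<le> (2 / pi\<^sup>2) * (2 * (1 + \<bar>s\<bar>) ^ 2 * exp (- \<bar>s\<bar>))"
        by (intro mult_left_mono mult_right_mono) (auto simp: power2_eq_square algebra_simps)
      finally show ?thesis using 3 by simp
    qed
    thus ?thesis by blast
  next
    case 4
    obtain C where C: "\<And>s. sech_density (Suc j) s \<le> C * ((1 + \<bar>s\<bar>) ^ (Suc j) * exp (- \<bar>s\<bar>))"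
      using less[of "Suc j"] 4 by auto
    have C0: "C \<ge> 0" using order_trans[OF sech_density_nonneg C[of 0]] by simp
    define D where "D = (4 / pi\<^sup>2 + (real j + 1)\<^sup>2) / ((real j + 1) * (real j + 2))"
    have "sech_density k s \<le> (D * C) * ((1 + \<bar>s\<bar>) ^ k * exp (- \<bar>s\<bar>))" for s
    proof -
      have "(4 * s\<^sup>2 / pi\<^sup>2 + (real j + 1)\<^sup>2) \<le> (4 / pi\<^sup>2 + (real j + 1)\<^sup>2) * (1 + \<bar>s\<bar>)\<^sup>2"
      proof -
        have "s\<^sup>2 \<le> (1 + \<bar>s\<bar>)\<^sup>2" "1 \<le> (1 + \<bar>s\<bar>)\<^sup>2" by (auto simp: power2_eq_square algebra_simps)
        hence "(4 / pi\<^sup>2) * s\<^sup>2 \<le> (4 / pi\<^sup>2) * (1 + \<bar>s\<bar>)\<^sup>2" "(real j + 1)\<^sup>2 * 1 \<le> (real j + 1)\<^sup>2 * (1 + \<bar>s\<bar>)\<^sup>2"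
          by (auto intro!: mult_left_mono divide_right_mono)
        hence "(4 / pi\<^sup>2) * s\<^sup>2 + (real j + 1)\<^sup>2 * 1 \<le> (4 / pi\<^sup>2) * (1 + \<bar>s\<bar>)\<^sup>2 + (real j + 1)\<^sup>2 * (1 + \<bar>s\<bar>)\<^sup>2"
          by (rule add_mono)
        thus ?thesis by (simp only: distrib_right mult_1_right times_divide_eq_left)
      qed
      hence f: "(4 * s\<^sup>2 / pi\<^sup>2 + (real j + 1)\<^sup>2) / ((real j + 1) * (real j + 2)) \<le> D * (1 + \<bar>s\<bar>)\<^sup>2"
        unfolding D_def by (simp add: divide_right_mono)
      have "sech_density k s \<le> (D * (1 + \<bar>s\<bar>)\<^sup>2) * (C * ((1 + \<bar>s\<bar>) ^ (Suc j) * exp (- \<bar>s\<bar>)))"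
        unfolding 4 sech_density.simps
        by (intro mult_mono f C sech_density_nonneg) (auto simp: D_def)
      also have "\<dots> = (D * C) * ((1 + \<bar>s\<bar>) ^ k * exp (- \<bar>s\<bar>))"
        unfolding 4 by (simp add: power2_eq_square mult_ac)
      finally show ?thesis .
    qed
    thus ?thesis by blast
  qed
qed

lemma integrable_poly_sech_density:
  "integrable lborel (\<lambda>s. (1 + \<bar>s\<bar>) ^ m * sech_density k s)"
proof -
  obtain C where C: "\<And>s. sech_density k s \<le> C * ((1 + \<bar>s\<bar>) ^ k * exp (- \<bar>s\<bar>))"
    using sech_density_bound by blast
  show ?thesis
  proof (rule Bochner_Integration.integrable_bound)
    show "integrable lborel (\<lambda>s. C * ((1 + \<bar>s\<bar>) ^ (m + k) * exp (- 1 * \<bar>s\<bar>)))"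
      by (intro integrable_mult_right integrable_poly_exp_abs) auto
    show "AE s in lborel. norm ((1 + \<bar>s\<bar>) ^ m * sech_density k s) \<le> norm (C * ((1 + \<bar>s\<bar>) ^ (m + k) * exp (- 1 * \<bar>s\<bar>)))"
    proof (intro AE_I2)
      fix s :: real
      have "(1 + \<bar>s\<bar>) ^ m * sech_density k s \<le> (1 + \<bar>s\<bar>) ^ m * (C * ((1 + \<bar>s\<bar>) ^ k * exp (- \<bar>s\<bar>)))"
        by (intro mult_left_mono C) auto
      also have "\<dots> = C * ((1 + \<bar>s\<bar>) ^ (m + k) * exp (- 1 * \<bar>s\<bar>))" by (simp add: power_add mult_ac)
      also have "\<dots> \<le> norm (C * ((1 + \<bar>s\<bar>) ^ (m + k) * exp (- 1 * \<bar>s\<bar>)))" by simp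
      finally show "norm ((1 + \<bar>s\<bar>) ^ m * sech_density k s) \<le> norm (C * ((1 + \<bar>s\<bar>) ^ (m + k) * exp (- 1 * \<bar>s\<bar>)))"
        using sech_density_nonneg[of k s] by (simp add: abs_mult del: mult_minus1 mult_minus1_right)
    qed
  qed auto
qed

text \<open>Since \<open>tanh u - tanh (u - s) = sinh s / (cosh u cosh (u - s))\<close>, the
  integrand has the primitive \<open>ln (cosh u / cosh (u - s)) / sinh s\<close>, whose limits at
  the two ends are \<open>s / sinh s\<close> and \<open>- s / sinh s\<close>. This one integral is
  the self-convolution of \<open>sech\<close>; it returns later under several substitutions.\<close>

lemma has_bochner_integral_sech_conv:
  assumes "s \<noteq> 0"
  shows "has_bochner_integral lborel (\<lambda>u. 1 / (cosh (s - u) * cosh u)) (2 * s / sinh (s::real))"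
proof -
  define F where "F = (\<lambda>u. (ln (cosh u) - ln (cosh (u - s))) / sinh s)"
  have sh: "sinh s \<noteq> 0" using assms by simp
  \<comment> \<open>Splits the linear growth of \<open>ln cosh\<close> from a part that vanishes at
    infinity, so that the two logarithms in \<open>F\<close> can be compared.\<close>
  have lc: "ln (cosh u) = u + ln (1 + exp (- 2 * u)) - ln 2" for u :: real
  proof -
    have "cosh u = exp u * (1 + exp (- 2 * u)) / 2"
      by (simp add: cosh_def algebra_simps flip: exp_add)
    hence "ln (cosh u) = ln (exp u * (1 + exp (- 2 * u)) / 2)" by (rule arg_cong)
    also have "\<dots> = u + ln (1 + exp (- 2 * u)) - ln 2"
      using add_pos_pos[OF zero_less_one exp_gt_zero, of "- 2 * u"] by (simp add: ln_div ln_mult)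
    finally show ?thesis .
  qed
  have F_top: "(F \<longlongrightarrow> s / sinh s) at_top"
  proof -
    have "F = (\<lambda>u. (s + ln (1 + exp (- 2 * u)) - ln (1 + exp (- 2 * (u - s)))) / sinh s)"
      unfolding F_def lc by auto
    moreover have "((\<lambda>u. s + ln (1 + exp (- 2 * u)) - ln (1 + exp (- 2 * (u - s)))) \<longlongrightarrow> s) at_top"
      by real_asymp
    ultimately show ?thesis using sh by (auto intro!: tendsto_intros)
  qed
  have F_bot: "(F \<longlongrightarrow> - s / sinh s) at_bot"
  proof -
    have "(\<lambda>u. F (- u)) = (\<lambda>u. (ln (cosh u) - ln (cosh (u + s))) / sinh s)"
      unfolding F_def by (auto simp: fun_eq_iff)
    also have "\<dots> = (\<lambda>u. (- s + ln (1 + exp (- 2 * u)) - ln (1 + exp (- 2 * (u + s)))) / sinh s)"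
      unfolding lc by auto
    finally have eq: "(\<lambda>u. F (- u)) = \<dots>" .
    have "((\<lambda>u. - s + ln (1 + exp (- 2 * u)) - ln (1 + exp (- 2 * (u + s)))) \<longlongrightarrow> - s) at_top"
      by real_asymp
    hence "((\<lambda>u. F (- u)) \<longlongrightarrow> - s / sinh s) at_top" unfolding eq using sh by (intro tendsto_intros) auto
    thus ?thesis by (simp add: filterlim_at_bot_mirror)
  qed
  have "has_bochner_integral lborel (\<lambda>u. 1 / (cosh (s - u) * cosh u)) (s / sinh s - (- s / sinh s))"
  proof (rule has_bochner_integral_FTC_UNIV[OF _ _ _ F_bot F_top])
    show "(F has_real_derivative 1 / (cosh (s - u) * cosh u)) (at u)" for u
    proof -
      have "(F has_real_derivative (sinh u / cosh u - sinh (u - s) / cosh (u - s)) / sinh s) (at u)"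
        unfolding F_def using sh by (auto intro!: derivative_eq_intros simp: field_simps)
      moreover have "(sinh u / cosh u - sinh (u - s) / cosh (u - s)) / sinh s = 1 / (cosh (s - u) * cosh u)"
      proof -
        have "sinh u * cosh (u - s) - sinh (u - s) * cosh u = sinh s"
          using sinh_diff[of u "u - s"] by (simp add: mult.commute)
        moreover have "cosh (s - u) = cosh (u - s)" by (metis cosh_minus minus_diff_eq)
        ultimately show ?thesis using sh by (simp add: field_simps)
      qed
      ultimately show ?thesis by simp
    qed
    show "continuous_on UNIV (\<lambda>u. 1 / (cosh (s - u) * cosh u))" by (intro continuous_intros) auto
  qed auto
  thus ?thesis by simp
qed

section \<open>The characteristic function\<close>

text \<open>Logarithmic differentiation of \<open>Gamma w Gamma (1 - w) = pi / sin (pi w)\<close> at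
  \<open>z\<close>.\<close>

lemma Digamma_reflection:
  fixes z :: complex
  assumes "z \<notin> \<int>"
  shows "Digamma (1 - z) - Digamma z = of_real pi * cot (of_real pi * z)"
proof -
  have z: "z \<notin> \<int>\<^sub>\<le>\<^sub>0" "1 - z \<notin> \<int>\<^sub>\<le>\<^sub>0"
    using assms nonpos_Ints_Int by (blast, metis Ints_1 Ints_diff diff_diff_eq2 add_diff_cancel_left' nonpos_Ints_Int add.commute diff_add_cancel)
  have s: "sin (of_real pi * z) \<noteq> 0"
    using assms by (metis (no_types, opaque_lifting) Ints_of_int mult.commute mult_cancel_left of_real_eq_0_iff of_real_of_int_eq pi_neq_zero sin_eq_0 of_real_mult)
  have G: "Gamma z \<noteq> 0" "Gamma (1 - z) \<noteq> 0" using z by (auto simp: Gamma_eq_zero_iff)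
  have d1: "((\<lambda>w. Gamma w * Gamma (1 - w)) has_field_derivative
      Gamma z * Gamma (1 - z) * (Digamma z - Digamma (1 - z))) (at z)"
    using z by (auto intro!: derivative_eq_intros simp: algebra_simps)
  have d2: "((\<lambda>w. of_real pi / sin (of_real pi * w)) has_field_derivative
      - (of_real pi * (of_real pi * cos (of_real pi * z))) / (sin (of_real pi * z))\<^sup>2) (at z)"
    using s by (auto intro!: derivative_eq_intros simp: power2_eq_square field_simps)
  have eq: "(\<lambda>w::complex. Gamma w * Gamma (1 - w)) = (\<lambda>w. of_real pi / sin (of_real pi * w))"
    using Gamma_reflection_complex by (intro ext) blast
  have "Gamma z * Gamma (1 - z) * (Digamma z - Digamma (1 - z)) =
      - (of_real pi * (of_real pi * cos (of_real pi * z))) / (sin (of_real pi * z))\<^sup>2"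
    using DERIV_unique[OF d1 d2[folded eq]] .
  moreover have "Gamma z * Gamma (1 - z) = of_real pi / sin (of_real pi * z)" by (rule Gamma_reflection_complex)
  ultimately have "of_real pi / sin (of_real pi * z) * (Digamma z - Digamma (1 - z)) =
      of_real pi / sin (of_real pi * z) * (- of_real pi * cot (of_real pi * z))"
    using s by (simp add: cot_def power2_eq_square)
  moreover have "of_real pi / sin (of_real pi * z) \<noteq> 0" using s by simp
  ultimately have "Digamma z - Digamma (1 - z) = - of_real pi * cot (of_real pi * z)"
    using mult_left_cancel by blast
  thus ?thesis by (simp add: algebra_simps)
qed

text \<open>The real part of \<open>Digamma (1 - z) - Digamma z = pi cot (pi z)\<close> at
  \<open>z = (1 + i t) / 4\<close>: the real parts of \<open>1 / (z + k)\<close> and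
  \<open>1 / (1 - z + k)\<close> have denominators proportional to \<open>(4 k + 1)^2 + t^2\<close>
  and \<open>(4 k + 3)^2 + t^2\<close>, so the odd numbers appear with alternating signs. The series
  converges only conditionally and the terms come in pairs, hence the even number of terms.\<close>

lemma sech_partial_fractions:
  fixes t :: real
  shows "(\<lambda>n. \<Sum>j<2*n. (-1) ^ j * (2 * real j + 1) / ((2 * real j + 1)\<^sup>2 + t\<^sup>2)) \<longlonglongrightarrow> pi / 4 / cosh (pi * t / 2)"
proof -
  define z :: complex where "z = (1 + \<i> * of_real t) / 4"
  have Re_z: "Re z = 1/4" and Im_z: "Im z = t / 4" by (auto simp: z_def)
  have nI: "z \<notin> \<int>"
  proof
    assume "z \<in> \<int>"
    then obtain k where "z = of_int k" by (auto elim: Ints_cases)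
    hence "1/4 = real_of_int k" using Re_z by simp
    hence "1 = 4 * real_of_int k" by simp
    hence "1 = 4 * k" by linarith
    thus False by presburger
  qed
  have lim: "(\<lambda>m. of_real (ln (real m)) - (\<Sum>k<m. inverse (w + of_nat k))) \<longlonglongrightarrow> Digamma w" if "w \<noteq> 0" for w :: complex
    using Digamma_LIMSEQ[OF that] by simp
  have z0: "z \<noteq> 0" "1 - z \<noteq> 0" using Re_z by (auto simp: complex_eq_iff)
  have "(\<lambda>m. (of_real (ln (real m)) - (\<Sum>k<m. inverse (1 - z + of_nat k))) - (of_real (ln (real m)) - (\<Sum>k<m. inverse (z + of_nat k))))
      \<longlonglongrightarrow> Digamma (1 - z) - Digamma z"
    by (intro tendsto_diff lim z0)
  hence "(\<lambda>m. \<Sum>k<m. (inverse (z + of_nat k) - inverse (1 - z + of_nat k))) \<longlonglongrightarrow> of_real pi * cot (of_real pi * z)"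
    by (simp add: Digamma_reflection[OF nI] sum_subtractf)
  hence "(\<lambda>m. Re (\<Sum>k<m. (inverse (z + of_nat k) - inverse (1 - z + of_nat k)))) \<longlonglongrightarrow> Re (of_real pi * cot (of_real pi * z))"
    by (rule tendsto_Re)
  hence "(\<lambda>m. (\<Sum>k<m. Re (inverse (z + of_nat k) - inverse (1 - z + of_nat k))) / 4) \<longlonglongrightarrow> Re (of_real pi * cot (of_real pi * z)) / 4"
    unfolding Re_sum by (intro tendsto_intros) auto
  also have "(\<lambda>m. (\<Sum>k<m. Re (inverse (z + of_nat k) - inverse (1 - z + of_nat k))) / 4) =
     (\<lambda>n. \<Sum>j<2*n. (-1) ^ j * (2 * real j + 1) / ((2 * real j + 1)\<^sup>2 + t\<^sup>2))"
  proof
    fix n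
    have *: "Re (inverse (z + of_nat k) - inverse (1 - z + of_nat k)) / 4 =
       (4 * real k + 1) / ((4 * real k + 1)\<^sup>2 + t\<^sup>2) - (4 * real k + 3) / ((4 * real k + 3)\<^sup>2 + t\<^sup>2)" for k
    proof -
      have a: "(1/4 + real k)\<^sup>2 + (t/4)\<^sup>2 = ((4 * real k + 1)\<^sup>2 + t\<^sup>2) / 16"
              "(3/4 + real k)\<^sup>2 + (t/4)\<^sup>2 = ((4 * real k + 3)\<^sup>2 + t\<^sup>2) / 16"
        by (simp_all add: power2_eq_square algebra_simps)
      have b: "x / (A / 16) / 4 = (4 * x) / A" for x A :: real by simp
      have "Re (inverse (z + of_nat k)) = (1/4 + real k) / ((1/4 + real k)\<^sup>2 + (t/4)\<^sup>2)"
        by (simp add: Re_z Im_z)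
      moreover have "Re (inverse (1 - z + of_nat k)) = (3/4 + real k) / ((3/4 + real k)\<^sup>2 + (t/4)\<^sup>2)"
        by (simp add: Re_z Im_z)
      ultimately have "Re (inverse (z + of_nat k) - inverse (1 - z + of_nat k)) / 4 =
          (4 * (1/4 + real k)) / ((4 * real k + 1)\<^sup>2 + t\<^sup>2) - (4 * (3/4 + real k)) / ((4 * real k + 3)\<^sup>2 + t\<^sup>2)"
        unfolding a by (simp only: minus_complex.sel diff_divide_distrib b)
      thus ?thesis by (simp add: algebra_simps)
    qed
    have "(\<Sum>k<n. Re (inverse (z + of_nat k) - inverse (1 - z + of_nat k))) / 4 =
       (\<Sum>k<n. (4 * real k + 1) / ((4 * real k + 1)\<^sup>2 + t\<^sup>2) - (4 * real k + 3) / ((4 * real k + 3)\<^sup>2 + t\<^sup>2))"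
      unfolding * [symmetric] by (simp only: sum_divide_distrib)
    also have "\<dots> = (\<Sum>j<2*n. (-1) ^ j * (2 * real j + 1) / ((2 * real j + 1)\<^sup>2 + t\<^sup>2))"
    proof (induction n)
      case (Suc n)
      have "(\<Sum>j<2 * Suc n. (-1) ^ j * (2 * real j + 1) / ((2 * real j + 1)\<^sup>2 + t\<^sup>2)) =
        (\<Sum>j<2 * n. (-1) ^ j * (2 * real j + 1) / ((2 * real j + 1)\<^sup>2 + t\<^sup>2))
        + (2 * real (2*n) + 1) / ((2 * real (2*n) + 1)\<^sup>2 + t\<^sup>2) - (2 * real (2*n+1) + 1) / ((2 * real (2*n+1) + 1)\<^sup>2 + t\<^sup>2)"
        by (simp add: diff_divide_distrib add_divide_distrib)
      also have "2 * real (2*n) + 1 = 4 * real n + 1" by simp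
      also have "2 * real (2*n+1) + 1 = 4 * real n + 3" by simp
      finally show ?case using Suc.IH by (simp only: sum.lessThan_Suc)
    qed simp
    finally show "(\<Sum>k<n. Re (inverse (z + of_nat k) - inverse (1 - z + of_nat k))) / 4 = \<dots>" .
  qed
  also have "Re (of_real pi * cot (of_real pi * z)) / 4 = pi / 4 / cosh (pi * t / 2)"
  proof -
    have "of_real pi * z = of_real (pi / 4) + \<i> * of_real (pi * t / 4)" by (simp add: z_def field_simps)
    hence c: "cot (of_real pi * z) = cos (of_real (pi / 4) + \<i> * of_real (pi * t / 4)) / sin (of_real (pi / 4) + \<i> * of_real (pi * t / 4))"
      by (simp add: cot_def)
    define y where "y = pi * t / 4"
    have q: "Re (Complex a (- b) / Complex a b) = (a\<^sup>2 - b\<^sup>2) / (a\<^sup>2 + b\<^sup>2)" for a b :: real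
      by (simp add: Re_divide power2_eq_square)
    \<comment> \<open>At \<open>pi / 4\<close> sine and cosine agree, so these two values are
      complex conjugates up to a common real factor, and their quotient has real part
      \<open>(cosh^2 - sinh^2) / (cosh^2 + sinh^2)\<close> at \<open>y\<close>.\<close>
    have cc: "cos (of_real (pi / 4) + \<i> * of_real y) = of_real (sqrt 2 / 2) * Complex (cosh y) (- sinh y)"
             "sin (of_real (pi / 4) + \<i> * of_real y) = of_real (sqrt 2 / 2) * Complex (cosh y) (sinh y)"
      by (simp_all add: complex_eq_iff Re_cos Im_cos Re_sin Im_sin cos_45 sin_45 cosh_def sinh_def diff_divide_distrib add_divide_distrib algebra_simps)
    have "cosh (2 * y) = (cosh y)\<^sup>2 + (sinh y)\<^sup>2" by (simp add: cosh_double)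
    hence "Re (cot (of_real pi * z)) = 1 / cosh (2 * y)"
      unfolding c y_def[symmetric] cc by (simp add: q cosh_square_eq)
    thus ?thesis by (simp add: y_def)
  qed
  finally show ?thesis .
qed

lemma borel_measurable_hyperbolic [measurable (raw)]:
  fixes f :: "'a \<Rightarrow> real"
  assumes [measurable]: "f \<in> borel_measurable M"
  shows "(\<lambda>x. cosh (f x)) \<in> borel_measurable M" "(\<lambda>x. sinh (f x)) \<in> borel_measurable M"
    "(\<lambda>x. tanh (f x)) \<in> borel_measurable M"
  unfolding tanh_def cosh_def sinh_def by measurable

lemma has_bochner_integral_cos_exp:
  fixes a t :: real
  assumes "a > 0"
  shows "has_bochner_integral lborel (\<lambda>s. indicator {0..} s *\<^sub>R (cos (t * s) * exp (- a * s))) (a / (a\<^sup>2 + t\<^sup>2))"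
proof -
  define F where "F = (\<lambda>s. exp (- a * s) * (t * sin (t * s) - a * cos (t * s)) / (a\<^sup>2 + t\<^sup>2))"
  have nz: "a\<^sup>2 + t\<^sup>2 \<noteq> 0" using assms by (simp add: sum_power2_eq_zero_iff)
  have int: "integrable lborel (\<lambda>s. indicator {0..} s *\<^sub>R (cos (t * s) * exp (- a * s)))"
  proof (rule Bochner_Integration.integrable_bound)
    show "integrable lborel (\<lambda>s. indicator {0..} s *\<^sub>R (s ^ 0 * exp (- a * s)))"
      using has_bochner_integral_power_exp[OF assms, of 0] by (simp add: has_bochner_integral_iff)
    show "AE s in lborel. norm (indicator {0..} s *\<^sub>R (cos (t * s) * exp (- a * s))) \<le> norm (indicator {0..} s *\<^sub>R (s ^ 0 * exp (- a * s)))"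
      by (intro AE_I2) (auto simp: indicator_def abs_mult mult_left_le_one_le)
  qed auto
  have int': "set_integrable lborel {0<..} (\<lambda>s. cos (t * s) * exp (- a * s))"
    unfolding set_integrable_def
    by (rule Bochner_Integration.integrable_bound[OF int]) (auto simp: indicator_def)
  have lim: "((F \<circ> real_of_ereal) \<longlongrightarrow> 0) (at_left \<infinity>)"
  proof -
    have "(F \<longlongrightarrow> 0) at_top"
    proof (rule Lim_null_comparison)
      show "((\<lambda>s. exp (- a * s) * ((\<bar>t\<bar> + \<bar>a\<bar>) / (a\<^sup>2 + t\<^sup>2))) \<longlongrightarrow> 0) at_top"
        using assms by real_asymp
      have "norm (F s) \<le> exp (- a * s) * ((\<bar>t\<bar> + \<bar>a\<bar>) / (a\<^sup>2 + t\<^sup>2))" for s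
      proof -
        have "\<bar>t * sin (t * s) - a * cos (t * s)\<bar> \<le> \<bar>t\<bar> * 1 + \<bar>a\<bar> * 1"
          by (rule order_trans[OF abs_triangle_ineq4]) (auto simp: abs_mult intro!: add_mono mult_left_le)
        hence "\<bar>t * sin (t * s) - a * cos (t * s)\<bar> / (a\<^sup>2 + t\<^sup>2) \<le> (\<bar>t\<bar> + \<bar>a\<bar>) / (a\<^sup>2 + t\<^sup>2)"
          by (intro divide_right_mono) auto
        hence "exp (- a * s) * (\<bar>t * sin (t * s) - a * cos (t * s)\<bar> / (a\<^sup>2 + t\<^sup>2)) \<le> exp (- a * s) * ((\<bar>t\<bar> + \<bar>a\<bar>) / (a\<^sup>2 + t\<^sup>2))"
          by (intro mult_left_mono) auto
        thus ?thesis by (simp add: F_def abs_mult)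
      qed
      thus "\<forall>\<^sub>F s in at_top. norm (F s) \<le> exp (- a * s) * ((\<bar>t\<bar> + \<bar>a\<bar>) / (a\<^sup>2 + t\<^sup>2))" by simp
    qed
    thus ?thesis by (simp add: ereal_tendsto_simps1)
  qed
  have d: "(F has_real_derivative (cos (t * s) * exp (- a * s))) (at s)" for s
  proof -
    have "((\<lambda>s. exp (- a * s) * (t * sin (t * s) - a * cos (t * s))) has_real_derivative (cos (t * s) * exp (- a * s)) * (a\<^sup>2 + t\<^sup>2)) (at s)"
      by (auto intro!: derivative_eq_intros simp: power2_eq_square algebra_simps)
    from DERIV_cdivide[OF this, of "a\<^sup>2 + t\<^sup>2"] show ?thesis
      unfolding F_def nonzero_mult_div_cancel_right[OF nz] .
  qed
  have c: "isCont F s" for s using d DERIV_isCont by blast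
  have lim0: "((F \<circ> real_of_ereal) \<longlongrightarrow> F 0) (at_right 0)"
  proof -
    have "(F \<longlongrightarrow> F 0) (at_right 0)" using c[of 0] by (simp add: isCont_def filterlim_at_split)
    thus ?thesis by (simp add: ereal_tendsto_simps1 zero_ereal_def)
  qed
  have "(LBINT s=0..\<infinity>. cos (t * s) * exp (- a * s)) = 0 - F 0"
  proof (rule interval_integral_FTC_integrable[of 0 "\<infinity>" F])
    show "(F has_vector_derivative cos (t * s) * exp (- a * s)) (at s)" for s
      using d[of s] by (simp add: has_real_derivative_iff_has_vector_derivative)
    show "isCont (\<lambda>s. cos (t * s) * exp (- a * s)) s" for s by (intro continuous_intros)
    show "set_integrable lborel (einterval 0 \<infinity>) (\<lambda>s. cos (t * s) * exp (- a * s))"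
      using int' by (simp add: zero_ereal_def)
  qed (use lim lim0 in auto)
  also have "(LBINT s=0..\<infinity>. cos (t * s) * exp (- a * s)) = (LBINT s:{0<..}. cos (t * s) * exp (- a * s))"
    by (simp add: interval_lebesgue_integral_def zero_ereal_def)
  also have "\<dots> = (\<integral>s. indicator {0..} s *\<^sub>R (cos (t * s) * exp (- a * s)) \<partial>lborel)"
    unfolding set_lebesgue_integral_def
    by (rule integral_cong_AE) (auto simp: indicator_def intro!: AE_I[where N="{0}"])
  finally show ?thesis using int by (simp add: has_bochner_integral_iff F_def)
qed

text \<open>The geometric series of \<open>1 / cosh s\<close> stopped after \<open>N\<close> terms,
  with its exact remainder. Keeping the remainder avoids the divergence at \<open>s = 0\<close> and
  allows estimates that are uniform down to that point.\<close>

lemma sech_geometric: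
  "1 / cosh (s::real) = 2 * (\<Sum>j<N. (-1) ^ j * exp (- (2 * real j + 1) * s)) + (-1) ^ N * (exp (- 2 * real N * s) / cosh s)"
proof (induction N)
  case (Suc N)
  have A: "exp (- 2 * real N * s) / cosh s = 2 * exp (- (2 * real N + 1) * s) - exp (- 2 * real (Suc N) * s) / cosh s"
  proof -
    have "2 * exp (- (2 * real N + 1) * s) * cosh s = exp (- 2 * real N * s) + exp (- 2 * real (Suc N) * s)"
      by (simp add: cosh_def algebra_simps flip: exp_add)
    hence "exp (- 2 * real N * s) / cosh s = (2 * exp (- (2 * real N + 1) * s) * cosh s - exp (- 2 * real (Suc N) * s)) / cosh s"
      by simp
    thus ?thesis by (simp only: diff_divide_distrib) simp
  qed
  have aux: "2 * S + p * (2 * e - B) = 2 * (S + p * e) + (- 1 * p) * B" for S p e B :: real by algebra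
  show ?case by (subst Suc.IH, subst A, simp only: sum.lessThan_Suc power_Suc aux)
qed simp

lemma integrable_sech_density: "integrable lborel (sech_density k)"
  using integrable_poly_sech_density[of 0 k] by (simp only: power_0 mult_1)

lemma integrable_sech: "integrable lborel (\<lambda>s::real. 1 / cosh s)"
proof -
  have "integrable lborel (\<lambda>s. pi * ((1 + \<bar>s\<bar>) ^ 0 * sech_density (Suc 0) s))"
    by (intro integrable_mult_right integrable_poly_sech_density)
  thus ?thesis by simp
qed

declare sech_density.simps [simp del]

lemma sech_density_1: "sech_density (Suc 0) s = 1 / (pi * cosh s)"
  by (simp add: sech_density.simps)

lemma integral_cos_sech: "(\<integral>s. cos (t * s) / cosh s \<partial>lborel) = pi / cosh (pi * t / 2)"
proof -
  define I where "I = (\<integral>s. indicator {0..} s *\<^sub>R (cos (t * s) / cosh s) \<partial>lborel)"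
  have int: "integrable lborel (\<lambda>s. cos (t * s) / cosh s)"
    by (rule Bochner_Integration.integrable_bound[OF integrable_sech])
       (auto simp: divide_right_mono)
  have int0: "integrable lborel (\<lambda>s. indicator {0..} s *\<^sub>R (cos (t * s) / cosh s))"
    by (rule Bochner_Integration.integrable_bound[OF int]) (auto simp: indicator_def)
  have "(\<integral>s. cos (t * s) / cosh s \<partial>lborel) = 2 * I"
    unfolding I_def by (rule integrable_even_extension(2)[OF int0]) simp
  moreover have "I = pi / 2 / cosh (pi * t / 2)"
  proof (rule LIMSEQ_unique)
    define S where "S = (\<lambda>n. \<Sum>j<2*n. (-1) ^ j * (2 * real j + 1) / ((2 * real j + 1)\<^sup>2 + t\<^sup>2))"
    have "(\<lambda>n. 2 * S n) \<longlonglongrightarrow> 2 * (pi / 4 / cosh (pi * t / 2))"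
      unfolding S_def by (intro tendsto_mult_left sech_partial_fractions)
    thus "(\<lambda>n. 2 * S n) \<longlonglongrightarrow> pi / 2 / cosh (pi * t / 2)" by (simp add: field_simps)
    \<comment> \<open>After \<open>2 n\<close> terms the remainder is at most
      \<open>e^(-4 n s)\<close> on the half line, and the integral of this bound is
      \<open>1 / (4 n)\<close>.\<close>
    have "\<bar>I - 2 * S n\<bar> \<le> 1 / (4 * real n)" if n: "n > 0" for n
    proof -
      define R where "R = (\<lambda>s. indicator {0..} s *\<^sub>R (cos (t * s) / cosh s * exp (- (4 * real n) * s)))"
      have bnd: "norm (R s) \<le> indicator {0..} s *\<^sub>R (s ^ 0 * exp (- (4 * real n) * s))" for s
      proof -
        have "\<bar>cos (t * s)\<bar> / cosh s \<le> 1"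
          using order_trans[OF abs_cos_le_one cosh_real_ge_1[of s]] by simp
        hence "\<bar>cos (t * s)\<bar> / cosh s * exp (- (4 * real n) * s) \<le> 1 * exp (- (4 * real n) * s)"
          by (intro mult_right_mono) auto
        thus ?thesis unfolding R_def by (auto simp: indicator_def abs_mult)
      qed
      have E: "has_bochner_integral lborel (\<lambda>s. indicator {0..} s *\<^sub>R (s ^ 0 * exp (- (4 * real n) * s))) (1 / (4 * real n))"
        using has_bochner_integral_power_exp[of "4 * real n" 0] n by simp
      have R: "integrable lborel R"
      proof (rule Bochner_Integration.integrable_bound)
        show "integrable lborel (\<lambda>s. indicator {0..} s *\<^sub>R (s ^ 0 * exp (- (4 * real n) * s)))"
          using E by (simp add: has_bochner_integral_iff)
        show "R \<in> borel_measurable lborel" unfolding R_def cosh_def by measurable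
        show "AE s in lborel. norm (R s) \<le> norm (indicator {0..} s *\<^sub>R (s ^ 0 * exp (- (4 * real n) * s)))"
          using bnd by (intro AE_I2) (auto intro: order_trans)
      qed
      define f where "f = (\<lambda>j s. indicator {0..} s *\<^sub>R (cos (t * s) * exp (- (2 * real j + 1) * s)))"
      have aux: "c * (2 * (\<Sum>j<m. p j * e j) + r) = 2 * (\<Sum>j<m. p j * (c * e j)) + c * r"
        for c r :: real and p e :: "nat \<Rightarrow> real" and m
        by (simp add: distrib_left sum_distrib_left mult_ac)
      have eq: "indicator {0..} s *\<^sub>R (cos (t * s) / cosh s) = 2 * (\<Sum>j<2*n. (-1) ^ j * f j s) + R s" for s
      proof (cases "s \<ge> 0")
        case True
        have "cos (t * s) * (1 / cosh s) = cos (t * s) * (2 * (\<Sum>j<2*n. (-1) ^ j * exp (- (2 * real j + 1) * s)) + (-1) ^ (2*n) * (exp (- 2 * real (2*n) * s) / cosh s))"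
          by (subst sech_geometric[of s "2*n"]) (rule refl)
        also have "\<dots> = 2 * (\<Sum>j<2*n. (-1) ^ j * (cos (t * s) * exp (- (2 * real j + 1) * s))) + cos (t * s) * ((-1) ^ (2*n) * (exp (- 2 * real (2*n) * s) / cosh s))"
          by (rule aux)
        finally show ?thesis using True by (simp add: f_def R_def)
      qed (auto simp: f_def R_def)
      have "has_bochner_integral lborel (\<lambda>s. 2 * (\<Sum>j<2*n. (-1) ^ j * f j s) + R s)
          (2 * (\<Sum>j<2*n. (-1) ^ j * ((2 * real j + 1) / ((2 * real j + 1)\<^sup>2 + t\<^sup>2))) + (\<integral>s. R s \<partial>lborel))"
        unfolding f_def
        by (intro has_bochner_integral_add has_bochner_integral_mult_right has_bochner_integral_sum
              has_bochner_integral_cos_exp has_bochner_integral_integrable R) auto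
      hence "I = 2 * (\<Sum>j<2*n. (-1) ^ j * ((2 * real j + 1) / ((2 * real j + 1)\<^sup>2 + t\<^sup>2))) + (\<integral>s. R s \<partial>lborel)"
        unfolding I_def eq by (simp add: has_bochner_integral_iff)
      hence "I - 2 * S n = (\<integral>s. R s \<partial>lborel)" by (simp add: S_def)
      also have "\<bar>\<dots>\<bar> \<le> (\<integral>s. norm (R s) \<partial>lborel)"
        using integral_norm_bound[of lborel R] by simp
      also have "\<dots> \<le> (\<integral>s. indicator {0..} s *\<^sub>R (s ^ 0 * exp (- (4 * real n) * s)) \<partial>lborel)"
        by (rule integral_mono) (use E R bnd in \<open>auto simp: has_bochner_integral_iff\<close>)
      finally show ?thesis using E by (simp add: has_bochner_integral_iff)
    qed
    moreover have "(\<lambda>n. 1 / (4 * real n)) \<longlonglongrightarrow> 0" by real_asymp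
    ultimately have "(\<lambda>n. I - 2 * S n) \<longlonglongrightarrow> 0"
      by (intro Lim_null_comparison[of "\<lambda>n. I - 2 * S n" "\<lambda>n. 1 / (4 * real n)"])
         (auto intro!: eventually_sequentiallyI[of 1])
    hence "(\<lambda>n. I - (I - 2 * S n)) \<longlonglongrightarrow> I - 0" by (intro tendsto_diff tendsto_const)
    thus "(\<lambda>n. 2 * S n) \<longlonglongrightarrow> I" by simp
  qed
  ultimately show ?thesis by simp
qed

section \<open>The law of a sum of independent steps\<close>

lemma char_even_density:
  assumes [measurable]: "g \<in> borel_measurable borel" and nn: "\<And>s. g s \<ge> 0" and even: "\<And>s. g (- s) = g s"
    and int: "integrable lborel g"
  shows "char (density lborel g) t = of_real (\<integral>s. cos (t * s) * g s \<partial>lborel)"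
proof -
  have i: "integrable lborel (\<lambda>s. g s *\<^sub>R iexp (t * s))"
    by (rule Bochner_Integration.integrable_bound[OF int]) auto
  have "char (density lborel g) t = (\<integral>s. g s *\<^sub>R iexp (t * s) \<partial>lborel)"
    unfolding char_def by (subst integral_density) (auto simp: nn)
  also have "\<dots> = of_real (\<integral>s. cos (t * s) * g s \<partial>lborel)"
  proof (rule complex_eqI)
    have re: "Re (g s *\<^sub>R iexp (t * s)) = cos (t * s) * g s" "Im (g s *\<^sub>R iexp (t * s)) = sin (t * s) * g s" for s
      by (simp_all add: Re_exp Im_exp)
    show "Re (\<integral>s. g s *\<^sub>R iexp (t * s) \<partial>lborel) = Re (of_real (\<integral>s. cos (t * s) * g s \<partial>lborel))"
      using integral_Re[OF i] by (simp only: re Re_complex_of_real)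
    have "Im (\<integral>s. g s *\<^sub>R iexp (t * s) \<partial>lborel) = (\<integral>s. sin (t * s) * g s \<partial>lborel)"
      using integral_Im[OF i] by (simp only: re)
    also have "\<dots> = 0"
      using lborel_integral_real_affine[of "-1" "\<lambda>s. sin (t * s) * g s" 0] by (simp add: even)
    finally show "Im (\<integral>s. g s *\<^sub>R iexp (t * s) \<partial>lborel) = Im (of_real (\<integral>s. cos (t * s) * g s \<partial>lborel))" by simp
  qed
  finally show ?thesis .
qed

text \<open>Defined by convolution and not by a density, so that zero steps make sense as a point
  mass and one step can be split off by definition. That \<open>sech_density\<close> is its density
  for \<open>k >= 1\<close> is proved afterwards.\<close>

primrec sech_law :: "nat \<Rightarrow> real measure" where
  "sech_law 0 = return borel 0"
| "sech_law (Suc k) = (sech_law k \<star> density lborel (sech_density 1))"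

abbreviation sech_step :: "real measure" where
  "sech_step \<equiv> density lborel (sech_density 1)"

lemma prob_space_sech_step: "prob_space sech_step"
proof
  have "(\<integral>s. sech_density 1 s \<partial>lborel) = 1"
  proof -
    have "(\<integral>s. sech_density 1 s \<partial>lborel) = (\<integral>s. 1 / pi * (cos (0 * s) / cosh s) \<partial>lborel)"
      by (simp add: sech_density_1)
    also have "\<dots> = 1" by (subst integral_mult_right_zero, subst integral_cos_sech) simp
    finally show ?thesis .
  qed
  moreover have "integrable lborel (sech_density 1)"
    by (rule integrable_sech_density)
  ultimately show "emeasure sech_step (space sech_step) = 1"
    by (simp add: emeasure_density nn_integral_eq_integral sech_density_nonneg del: sech_density.simps)
qed

lemma sets_sech_law [measurable_cong, simp]: "sets (sech_law k) = sets borel"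
  by (cases k) auto

lemma space_sech_law [simp]: "space (sech_law k) = UNIV"
  using sets_eq_imp_space_eq[OF sets_sech_law[of k]] by simp

lemma prob_space_sech_law: "prob_space (sech_law k)"
proof (induction k)
  case 0 show ?case by (simp add: prob_space_return)
next
  case (Suc k)
  interpret A: prob_space "sech_law k" by fact
  interpret B: prob_space sech_step by (rule prob_space_sech_step)
  interpret P: pair_prob_space "sech_law k" sech_step ..
  show ?case unfolding sech_law.simps convolution_def by (rule P.prob_space_distr) simp
qed

lemma real_distribution_sech_law: "real_distribution (sech_law k)"
  using prob_space_sech_law[of k]
  by (simp add: real_distribution_def real_distribution_axioms_def)

lemma char_convolution:
  assumes "real_distribution M" "real_distribution N"
  shows "char (M \<star> N) t = char M t * char N t"
proof -
  interpret M: real_distribution M by fact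
  interpret N: real_distribution N by fact
  interpret P: pair_prob_space M N ..
  have "char (M \<star> N) t = (\<integral>p. iexp (t * (fst p + snd p)) \<partial>(M \<Otimes>\<^sub>M N))"
    unfolding char_def convolution_def by (subst integral_distr) (auto simp: case_prod_beta)
  also have "\<dots> = (\<integral>x. \<integral>y. iexp (t * (x + y)) \<partial>N \<partial>M)"
  proof -
    have "integrable (M \<Otimes>\<^sub>M N) (\<lambda>p. iexp (t * (fst p + snd p)))"
      by (rule P.P.integrable_const_bound[of _ 1]) auto
    from P.integral_fst'[OF this] show ?thesis by simp
  qed
  also have "\<dots> = (\<integral>x. iexp (t * x) * char N t \<partial>M)"
    by (simp add: char_def distrib_left exp_add)
  also have "\<dots> = char M t * char N t" by (simp add: char_def)
  finally show ?thesis .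
qed

lemma char_sech_law: "char (sech_law k) t = of_real (1 / cosh (pi * t / 2) ^ k)"
proof (induction k)
  case 0
  show ?case by (simp add: char_def integral_return)
next
  case (Suc k)
  have rd: "real_distribution sech_step"
    using prob_space_sech_step by (simp add: real_distribution_def real_distribution_axioms_def)
  have "char sech_step t = of_real (\<integral>s. cos (t * s) * sech_density 1 s \<partial>lborel)"
    using integrable_sech_density[of 1]
    by (intro char_even_density sech_density_nonneg sech_density_even) auto
  also have "(\<integral>s. cos (t * s) * sech_density 1 s \<partial>lborel) = (\<integral>s. 1 / pi * (cos (t * s) / cosh s) \<partial>lborel)"
    by (simp add: sech_density_1)
  also have "\<dots> = 1 / cosh (pi * t / 2)"
    by (subst integral_mult_right_zero, subst integral_cos_sech) simp
  finally show ?case using Suc char_convolution[OF real_distribution_sech_law[of k] rd, of t] by simp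
qed

lemma sech_law_1: "sech_law 1 = sech_step"
proof -
  interpret prob_space sech_step by (rule prob_space_sech_step)
  have fin: "finite_measure (return borel (0::real))" "finite_measure sech_step"
    using prob_space_return[of 0 "borel :: real measure"] prob_space_sech_step
    by (auto simp: prob_space_def)
  show ?thesis
  proof (rule measure_eqI)
    fix A assume "A \<in> sets (sech_law 1)"
    hence [measurable]: "A \<in> sets borel" by (simp del: sech_law.simps)
    have "emeasure (sech_law 1) A = (\<integral>\<^sup>+x. indicator A x \<partial>(return borel 0 \<star> sech_step))"
      by simp
    also have "\<dots> = (\<integral>\<^sup>+x. \<integral>\<^sup>+y. indicator A (x + y) \<partial>sech_step \<partial>return borel 0)"
      by (rule nn_integral_convolution[OF fin]) auto
    also have "\<dots> = (\<integral>\<^sup>+y. indicator A (0 + y) \<partial>sech_step)"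
      by (rule nn_integral_return, simp, measurable)
    also have "\<dots> = (\<integral>\<^sup>+y. indicator A y \<partial>sech_step)" by (simp only: add_0)
    also have "\<dots> = emeasure sech_step A" by (rule nn_integral_indicator) simp
    finally show "emeasure (sech_law 1) A = emeasure sech_step A" .
  qed simp
qed

lemma sech_law_2: "sech_law 2 = density lborel (sech_density 2)"
proof -
  have fin: "finite_measure sech_step" using prob_space_sech_step by (simp add: prob_space_def)
  have "sech_law 2 = (sech_step \<star> sech_step)"
    unfolding numeral_2_eq_2 sech_law.simps using sech_law_1 by simp
  also have "\<dots> = density lborel (\<lambda>x. \<integral>\<^sup>+y. ennreal (sech_density 1 (x - y)) * ennreal (sech_density 1 y) \<partial>lborel)"
    by (rule convolution_density) (use fin in auto)
  also have "\<dots> = density lborel (sech_density 2)"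
  proof (rule density_cong)
    show "AE x in lborel. (\<integral>\<^sup>+y. ennreal (sech_density 1 (x - y)) * ennreal (sech_density 1 y) \<partial>lborel) = ennreal (sech_density 2 x)"
      using AE_lborel_singleton[of 0]
    proof eventually_elim
      case (elim x)
      have hb: "has_bochner_integral lborel (\<lambda>y. (1 / pi\<^sup>2) * (1 / (cosh (x - y) * cosh y))) ((1 / pi\<^sup>2) * (2 * x / sinh x))"
        by (intro has_bochner_integral_mult_right has_bochner_integral_sech_conv elim)
      have "(\<integral>\<^sup>+y. ennreal (sech_density 1 (x - y)) * ennreal (sech_density 1 y) \<partial>lborel) =
         (\<integral>\<^sup>+y. ennreal ((1 / pi\<^sup>2) * (1 / (cosh (x - y) * cosh y))) \<partial>lborel)"
        by (intro nn_integral_cong) (simp add: ennreal_mult[symmetric] power2_eq_square sech_density_1)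
      also have "\<dots> = ennreal ((1 / pi\<^sup>2) * (2 * x / sinh x))"
        using hb by (subst nn_integral_eq_integral) (auto simp: has_bochner_integral_iff)
      also have "(1 / pi\<^sup>2) * (2 * x / sinh x) = sech_density 2 x" by (simp add: numeral_2_eq_2 sech_density.simps)
      finally show ?case .
    qed
  qed auto
  finally show ?thesis .
qed

lemma integral_density_cauchy:
  fixes f :: "real \<Rightarrow> real"
  assumes [measurable]: "f \<in> borel_measurable borel"
  shows "(\<integral>s. f s \<partial>density lborel (sech_density k)) = (\<integral>s. f s * sech_density k s \<partial>lborel)"
  by (subst integral_density) (auto simp: sech_density_nonneg mult.commute)

lemma integrable_poly_growth_cauchy:
  fixes f :: "real \<Rightarrow> real"
  assumes [measurable]: "f \<in> borel_measurable borel" and "\<And>s. \<bar>f s\<bar> \<le> C * (1 + \<bar>s\<bar>) ^ m"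
  shows "integrable lborel (\<lambda>s. f s * sech_density k s)"
proof (rule Bochner_Integration.integrable_bound)
  show "integrable lborel (\<lambda>s. C * ((1 + \<bar>s\<bar>) ^ m * sech_density k s))"
    by (intro integrable_mult_right integrable_poly_sech_density)
  show "AE s in lborel. norm (f s * sech_density k s) \<le> norm (C * ((1 + \<bar>s\<bar>) ^ m * sech_density k s))"
  proof (intro AE_I2)
    fix s
    have "\<bar>f s\<bar> * sech_density k s \<le> (C * (1 + \<bar>s\<bar>) ^ m) * sech_density k s"
      by (intro mult_right_mono assms sech_density_nonneg)
    also have "\<dots> \<le> norm (C * ((1 + \<bar>s\<bar>) ^ m * sech_density k s))" by (simp add: mult.assoc)
    finally show "norm (f s * sech_density k s) \<le> norm (C * ((1 + \<bar>s\<bar>) ^ m * sech_density k s))"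
      using sech_density_nonneg[of k s] by (simp add: abs_mult)
  qed
qed auto

lemma sech_power_derivs:
  fixes t :: real
  shows "((\<lambda>t. 1 / cosh (pi * t / 2) ^ k) has_real_derivative - (real k * (pi / 2) * sinh (pi * t / 2) / cosh (pi * t / 2) ^ (k + 1))) (at t)"
    and "((\<lambda>t. - (real k * (pi / 2) * sinh (pi * t / 2) / cosh (pi * t / 2) ^ (k + 1))) has_real_derivative
      (pi / 2)\<^sup>2 * ((real k)\<^sup>2 / cosh (pi * t / 2) ^ k - real k * (real k + 1) / cosh (pi * t / 2) ^ (k + 2))) (at t)"
proof -
  have c: "cosh (pi * t / 2) \<noteq> 0" by simp
  have d: "((\<lambda>t. cosh (pi * t / 2) ^ Suc n) has_real_derivative (1 + real n) * (pi / 2 * sinh (pi * t / 2)) * cosh (pi * t / 2) ^ n) (at t)" for n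
  proof -
    have "((\<lambda>t. cosh (pi * t / 2)) has_real_derivative (pi / 2 * sinh (pi * t / 2))) (at t)"
      by (auto intro!: derivative_eq_intros)
    from DERIV_power_Suc[OF this, of n] show ?thesis by (simp only: mult.assoc)
  qed
  show "((\<lambda>t. 1 / cosh (pi * t / 2) ^ k) has_real_derivative - (real k * (pi / 2) * sinh (pi * t / 2) / cosh (pi * t / 2) ^ (k + 1))) (at t)"
  proof (cases k)
    case (Suc n)
    have "((\<lambda>t. inverse (cosh (pi * t / 2) ^ Suc n)) has_real_derivative - (real k * (pi / 2) * sinh (pi * t / 2) / cosh (pi * t / 2) ^ (k + 1))) (at t)"
      by (rule DERIV_cong[OF DERIV_inverse_fun[OF d]]) (simp_all add: Suc field_simps)
    thus ?thesis unfolding Suc inverse_eq_divide .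
  qed auto
  define x where "x = pi * t / 2"
  have "((\<lambda>t. - (real k * (pi / 2) * sinh (pi * t / 2) / cosh (pi * t / 2) ^ (k + 1))) has_real_derivative
     - (real k * (pi / 2) * ((pi / 2 * cosh x) * cosh x ^ (k + 1) - sinh x * (real (k + 1) * cosh x ^ k * (pi / 2 * sinh x))) / (cosh x ^ (k + 1) * cosh x ^ (k + 1)))) (at t)"
  proof -
    have "((\<lambda>t. sinh (pi * t / 2)) has_real_derivative (pi / 2 * cosh (pi * t / 2))) (at t)"
      by (auto intro!: derivative_eq_intros)
    from DERIV_cmult[OF DERIV_divide[OF this d[of k]], of "- (real k * (pi / 2))"] c show ?thesis
      by (simp add: x_def mult_ac add_ac)
  qed
  also have "- (real k * (pi / 2) * ((pi / 2 * cosh x) * cosh x ^ (k + 1) - sinh x * (real (k + 1) * cosh x ^ k * (pi / 2 * sinh x))) / (cosh x ^ (k + 1) * cosh x ^ (k + 1))) =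
      (pi / 2)\<^sup>2 * ((real k)\<^sup>2 / cosh x ^ k - real k * (real k + 1) / cosh x ^ (k + 2))"
  proof -
    define a where "a = cosh x ^ k"
    have a: "a \<noteq> 0" "cosh x \<noteq> 0" by (auto simp: a_def)
    have s2: "sinh x * sinh x = cosh x * cosh x - 1" using sinh_square_eq[of x] by (simp add: power2_eq_square)
    have num: "(pi / 2 * cosh x) * (cosh x * a) - sinh x * (real (k + 1) * a * (pi / 2 * sinh x)) = (pi / 2) * a * (real k + 1 - real k * (cosh x * cosh x))"
    proof -
      have "(pi / 2 * cosh x) * (cosh x * a) - sinh x * (real (k + 1) * a * (pi / 2 * sinh x)) = (pi / 2) * a * (cosh x * cosh x - (real k + 1) * (sinh x * sinh x))"
        by (simp add: algebra_simps)
      thus ?thesis unfolding s2 by (simp add: algebra_simps)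
    qed
    have p: "cosh x ^ (k + 1) = cosh x * a" "cosh x ^ (k + 2) = cosh x * cosh x * a" by (auto simp: a_def)
    show ?thesis unfolding p a_def[symmetric] num using a by (simp add: field_simps power2_eq_square)
  qed
  finally show "((\<lambda>t. - (real k * (pi / 2) * sinh (pi * t / 2) / cosh (pi * t / 2) ^ (k + 1))) has_real_derivative
      (pi / 2)\<^sup>2 * ((real k)\<^sup>2 / cosh (pi * t / 2) ^ k - real k * (real k + 1) / cosh (pi * t / 2) ^ (k + 2))) (at t)"
    by (simp add: x_def)
qed

text \<open>
  On the side of characteristic functions, multiplying a density by \<open>s\<^sup>2\<close> is minus the second
  derivative, and the second derivative of \<open>sech\<^sup>k\<close> is a combination of \<open>sech\<^sup>k\<close> and
  \<open>sech\<^bsup>k+2\<^esup>\<close>. This is where the quadratic factors of the densities come from.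
\<close>

lemma sech_law_density_step:
  assumes "k \<ge> 1" and IH: "sech_law k = density lborel (sech_density k)"
  shows "sech_law (k + 2) = density lborel (sech_density (k + 2))"
proof -
  have cosint: "(\<integral>s. cos (t * s) * sech_density k s \<partial>lborel) = 1 / cosh (pi * t / 2) ^ k" for t
  proof -
    have "complex_of_real (1 / cosh (pi * t / 2) ^ k) = of_real (\<integral>s. cos (t * s) * sech_density k s \<partial>lborel)"
      using char_sech_law[of k t] char_even_density[OF sech_density_measurable sech_density_nonneg sech_density_even integrable_sech_density, of k t]
      by (simp only: IH)
    thus ?thesis by (simp only: of_real_eq_iff)
  qed
  have int: "integrable lborel (\<lambda>s. f s * sech_density k s)"
    if "f \<in> borel_measurable borel" "\<And>s. \<bar>f s\<bar> \<le> (1 + \<bar>s\<bar>) ^ 2" for f :: "real \<Rightarrow> real"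
    using integrable_poly_growth_cauchy[of f 1 2 k] that by simp
  have b1: "\<bar>s * c\<bar> \<le> (1 + \<bar>s\<bar>) ^ 2" if "\<bar>c\<bar> \<le> 1" for s c :: real
  proof -
    have "\<bar>s * c\<bar> \<le> \<bar>s\<bar> * 1" unfolding abs_mult using that by (intro mult_left_mono) auto
    also have "\<dots> \<le> (1 + \<bar>s\<bar>) ^ 2" by (simp add: power2_eq_square algebra_simps)
    finally show ?thesis .
  qed
  have b2: "\<bar>s\<^sup>2 * c\<bar> \<le> (1 + \<bar>s\<bar>) ^ 2" if "\<bar>c\<bar> \<le> 1" for s c :: real
  proof -
    have "\<bar>s\<^sup>2 * c\<bar> \<le> \<bar>s\<^sup>2\<bar> * 1" unfolding abs_mult using that by (intro mult_left_mono) auto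
    also have "\<dots> \<le> (1 + \<bar>s\<bar>) ^ 2" by (simp add: power2_eq_square algebra_simps)
    finally show ?thesis .
  qed
  have b0: "\<bar>c\<bar> \<le> (1 + \<bar>s\<bar>) ^ 2" if "\<bar>c\<bar> \<le> 1" for s c :: real
    by (rule order_trans[OF that]) (simp add: power2_eq_square algebra_simps)
  have d1: "((\<lambda>t. \<integral>s. cos (t * s) * sech_density k s \<partial>lborel) has_real_derivative (\<integral>s. - (s * sin (t * s)) * sech_density k s \<partial>lborel)) (at t)" for t
  proof (rule has_real_derivative_integral[where g = "\<lambda>s. \<bar>s\<bar> * sech_density k s"])
    show "integrable lborel (\<lambda>s. cos (t * s) * sech_density k s)" for t
      by (rule int) (auto intro: b0)
    show "integrable lborel (\<lambda>s. \<bar>s\<bar> * sech_density k s)"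
      by (rule int) (auto simp: power2_eq_square algebra_simps)
    show "((\<lambda>t. cos (t * s) * sech_density k s) has_real_derivative - (s * sin (t * s)) * sech_density k s) (at t)" for s t
      by (auto intro!: derivative_eq_intros)
    show "\<bar>- (s * sin (t * s)) * sech_density k s\<bar> \<le> \<bar>s\<bar> * sech_density k s" for s t
      using sech_density_nonneg[of k s] by (auto simp: abs_mult intro!: mult_right_mono mult_left_le)
  qed auto
  have d2: "((\<lambda>t. \<integral>s. - (s * sin (t * s)) * sech_density k s \<partial>lborel) has_real_derivative (\<integral>s. - (s\<^sup>2 * cos (t * s)) * sech_density k s \<partial>lborel)) (at t)" for t
  proof (rule has_real_derivative_integral[where g = "\<lambda>s. s\<^sup>2 * sech_density k s"])
    show "integrable lborel (\<lambda>s. - (s * sin (t * s)) * sech_density k s)" for t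
      by (rule int) (auto simp only: abs_minus_cancel intro!: b1 abs_sin_le_one, simp)
    show "integrable lborel (\<lambda>s. s\<^sup>2 * sech_density k s)"
      by (rule int) (auto simp: power2_eq_square algebra_simps)
    show "((\<lambda>t. - (s * sin (t * s)) * sech_density k s) has_real_derivative - (s\<^sup>2 * cos (t * s)) * sech_density k s) (at t)" for s t
      by (auto intro!: derivative_eq_intros simp: power2_eq_square)
    show "\<bar>- (s\<^sup>2 * cos (t * s)) * sech_density k s\<bar> \<le> s\<^sup>2 * sech_density k s" for s t
      using sech_density_nonneg[of k s] by (auto simp: abs_mult intro!: mult_right_mono mult_left_le)
  qed auto
  have e1: "(\<integral>s. - (s * sin (t * s)) * sech_density k s \<partial>lborel) = - (real k * (pi / 2) * sinh (pi * t / 2) / cosh (pi * t / 2) ^ (k + 1))" for t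
    using DERIV_unique[OF d1[of t, unfolded cosint] sech_power_derivs(1)[of k t]] .
  have e2: "(\<integral>s. - (s\<^sup>2 * cos (t * s)) * sech_density k s \<partial>lborel) =
      (pi / 2)\<^sup>2 * ((real k)\<^sup>2 / cosh (pi * t / 2) ^ k - real k * (real k + 1) / cosh (pi * t / 2) ^ (k + 2))" for t
    using DERIV_unique[OF d2[of t, unfolded e1] sech_power_derivs(2)[of k t]] .
  \<comment> \<open>The identity \<open>e2\<close> is linear in \<open>sech^k\<close> and
    \<open>sech^(k+2)\<close>; it is solved for the latter, which requires
    \<open>k (k + 1) > 0\<close>. The resulting combination of densities is exactly the
    recursion.\<close>
  have main: "(\<integral>s. cos (t * s) * sech_density (k + 2) s \<partial>lborel) = 1 / cosh (pi * t / 2) ^ (k + 2)" for t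
  proof -
    define K where "K = real k * (real k + 1)"
    have K: "K > 0" using assms by (simp add: K_def)
    have h1: "has_bochner_integral lborel (\<lambda>s. - (s\<^sup>2 * cos (t * s)) * sech_density k s) ((pi / 2)\<^sup>2 * ((real k)\<^sup>2 / cosh (pi * t / 2) ^ k - K / cosh (pi * t / 2) ^ (k + 2)))"
      unfolding has_bochner_integral_iff e2 K_def
      by (intro conjI refl int) (auto simp only: abs_minus_cancel intro!: b2 abs_cos_le_one, simp)
    have h2: "has_bochner_integral lborel (\<lambda>s. cos (t * s) * sech_density k s) (1 / cosh (pi * t / 2) ^ k)"
      unfolding has_bochner_integral_iff cosint by (intro conjI refl int) (auto intro: b0)
    have "has_bochner_integral lborel (\<lambda>s. (- 4 / (pi\<^sup>2 * K)) * (- (s\<^sup>2 * cos (t * s)) * sech_density k s) + ((real k)\<^sup>2 / K) * (cos (t * s) * sech_density k s))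
      ((- 4 / (pi\<^sup>2 * K)) * ((pi / 2)\<^sup>2 * ((real k)\<^sup>2 / cosh (pi * t / 2) ^ k - K / cosh (pi * t / 2) ^ (k + 2))) + ((real k)\<^sup>2 / K) * (1 / cosh (pi * t / 2) ^ k))"
      by (intro has_bochner_integral_add has_bochner_integral_mult_right h1 h2)
    also have "(\<lambda>s. (- 4 / (pi\<^sup>2 * K)) * (- (s\<^sup>2 * cos (t * s)) * sech_density k s) + ((real k)\<^sup>2 / K) * (cos (t * s) * sech_density k s)) =
        (\<lambda>s. cos (t * s) * sech_density (k + 2) s)"
      unfolding sech_density_step[OF assms(1)] K_def[symmetric] using K by (auto simp: fun_eq_iff field_simps)
    also have "(- 4 / (pi\<^sup>2 * K)) * ((pi / 2)\<^sup>2 * (A - K / B)) + A' = A' - A / K + 1 / B" if "B \<noteq> 0" for A A' B :: real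
      using K that by (simp add: field_simps power2_eq_square)
    hence "(- 4 / (pi\<^sup>2 * K)) * ((pi / 2)\<^sup>2 * ((real k)\<^sup>2 / cosh (pi * t / 2) ^ k - K / cosh (pi * t / 2) ^ (k + 2))) + ((real k)\<^sup>2 / K) * (1 / cosh (pi * t / 2) ^ k) = 1 / cosh (pi * t / 2) ^ (k + 2)"
      by simp
    finally show ?thesis by (simp add: has_bochner_integral_iff)
  qed
  show ?thesis
  proof (rule Levy_uniqueness)
    show "real_distribution (sech_law (k + 2))" by (rule real_distribution_sech_law)
    have "prob_space (density lborel (sech_density (k + 2)))"
    proof
      \<comment> \<open>The total mass is the cosine transform at \<open>t = 0\<close>.\<close>
      have "(\<integral>s. sech_density (k + 2) s \<partial>lborel) = 1" using main[of 0] by simp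
      thus "emeasure (density lborel (sech_density (k + 2))) (space (density lborel (sech_density (k + 2)))) = 1"
        using integrable_sech_density[of "k + 2"]
        by (simp add: emeasure_density nn_integral_eq_integral sech_density_nonneg)
    qed
    thus "real_distribution (density lborel (sech_density (k + 2)))"
      by (simp add: real_distribution_def real_distribution_axioms_def)
    show "char (sech_law (k + 2)) = char (density lborel (sech_density (k + 2)))"
    proof
      fix t
      have "char (density lborel (sech_density (k + 2))) t = of_real (1 / cosh (pi * t / 2) ^ (k + 2))"
        by (subst char_even_density) (simp_all only: main sech_density_nonneg sech_density_even sech_density_measurable integrable_sech_density)
      thus "char (sech_law (k + 2)) t = char (density lborel (sech_density (k + 2))) t"
        by (simp only: char_sech_law)
    qed
  qed
qed

theorem sech_law_density:
  assumes "k \<ge> 1"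
  shows "sech_law k = density lborel (sech_density k)"
  using assms
proof (induction k rule: less_induct)
  case (less k)
  consider "k = 1" | "k = 2" | "k - 2 \<ge> 1" "k = (k - 2) + 2" using less.prems by linarith
  thus ?case
  proof cases
    case 1 thus ?thesis using sech_law_1 by simp
  next
    case 2 thus ?thesis using sech_law_2 by simp
  next
    case 3
    show ?thesis by (subst 3(2), subst (2) 3(2), rule sech_law_density_step[OF 3(1) less.IH[OF _ 3(1)]]) (use 3 in linarith)
  qed
qed

declare sech_law.simps [simp del]

section \<open>The torus\<close>

definition angle_unif :: "real measure" where
  "angle_unif = density lborel (\<lambda>\<theta>. ennreal (indicator {0..2*pi} \<theta> / (2 * pi)))"

lemma sets_angle_unif [measurable_cong, simp]: "sets angle_unif = sets borel"
  by (simp add: angle_unif_def)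

lemma space_angle_unif [simp]: "space angle_unif = UNIV"
  by (simp add: angle_unif_def)

lemma nn_integral_angle_unif:
  assumes [measurable]: "f \<in> borel_measurable borel"
  shows "(\<integral>\<^sup>+\<theta>. f \<theta> \<partial>angle_unif) = (\<integral>\<^sup>+\<theta>. ennreal (1 / (2 * pi)) * (f \<theta> * indicator {0..2*pi} \<theta>) \<partial>lborel)"
  unfolding angle_unif_def
  by (subst nn_integral_density) (auto intro!: nn_integral_cong simp: indicator_def)

lemma integral_angle_unif:
  fixes f :: "real \<Rightarrow> real"
  assumes [measurable]: "f \<in> borel_measurable borel"
  shows "(\<integral>\<theta>. f \<theta> \<partial>angle_unif) = (\<integral>\<theta>. indicator {0..2*pi} \<theta> *\<^sub>R f \<theta> \<partial>lborel) / (2 * pi)"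
proof -
  have "(\<integral>\<theta>. f \<theta> \<partial>angle_unif) = (\<integral>\<theta>. (indicator {0..2*pi} \<theta> / (2 * pi)) *\<^sub>R f \<theta> \<partial>lborel)"
    unfolding angle_unif_def by (subst integral_density) auto
  also have "\<dots> = (\<integral>\<theta>. (indicator {0..2*pi} \<theta> *\<^sub>R f \<theta>) / (2 * pi) \<partial>lborel)"
    by (intro Bochner_Integration.integral_cong) auto
  finally show ?thesis by simp
qed

lemma prob_space_angle_unif: "prob_space angle_unif"
proof
  have "emeasure angle_unif UNIV = (\<integral>\<^sup>+\<theta>. 1 \<partial>angle_unif)" by simp
  also have "\<dots> = ennreal (1 / (2 * pi)) * ennreal (2 * pi)"
    by (subst nn_integral_angle_unif) (auto simp: nn_integral_cmult)
  also have "\<dots> = 1" by (subst ennreal_mult[symmetric]) auto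
  finally show "emeasure angle_unif (space angle_unif) = 1" by simp
qed

lemma finite_measure_sech_law [simp]: "finite_measure (sech_law k)"
  using prob_space_sech_law[of k] by (simp add: prob_space_def)

interpretation angle: prob_space angle_unif
  by (rule prob_space_angle_unif)

interpretation torus: product_prob_space "\<lambda>_ :: nat. angle_unif" "UNIV :: nat set"
  by unfold_locales

abbreviation torus :: "nat set \<Rightarrow> (nat \<Rightarrow> real) measure" where
  "torus I \<equiv> PiM I (\<lambda>_. angle_unif)"

lemma prob_space_torus: "prob_space (torus I)"
  by (intro prob_space_PiM angle.prob_space_axioms)

text \<open>Boxes determine a finite product measure, so the two measures are compared on boxes.
  This is the bridge from the set integral in \<open>mahler_measure\<close> to a product of
  probability measures, where independence is available.\<close>

lemma torus_eq_density:
  assumes [simp]: "finite I"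
  shows "torus I = density (PiM I (\<lambda>_. lborel)) (\<lambda>\<theta>. ennreal (indicator (PiE I (\<lambda>_. {0..2*pi})) \<theta> / (2 * pi) ^ card I))"
    (is "_ = ?D")
proof (rule sym, rule torus.PiM_eqI)
  interpret L: product_sigma_finite "\<lambda>_ :: nat. lborel :: real measure" by unfold_locales
  have box [measurable]: "PiE I (\<lambda>_. {0..2*pi}) \<in> sets (PiM I (\<lambda>_. lborel :: real measure))"
    by (intro sets_PiM_I_finite) auto
  show "finite I" by simp
  show "sets ?D = sets (torus I)" by (simp, rule sets_PiM_cong) auto
  fix A :: "nat \<Rightarrow> real set" assume A: "\<And>i. i \<in> I \<Longrightarrow> A i \<in> sets angle_unif"
  have A' [measurable]: "PiE I A \<in> sets (PiM I (\<lambda>_. lborel))" using A by (intro sets_PiM_I_finite) auto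
  have "emeasure ?D (PiE I A) =
     (\<integral>\<^sup>+\<theta>. ennreal (indicator (PiE I (\<lambda>_. {0..2*pi})) \<theta> / (2 * pi) ^ card I) * indicator (PiE I A) \<theta> \<partial>PiM I (\<lambda>_. lborel))"
    by (intro emeasure_density) auto
  also have "\<dots> = (\<integral>\<^sup>+\<theta>. (\<Prod>i\<in>I. ennreal (indicator {0..2*pi} (\<theta> i) / (2 * pi)) * indicator (A i) (\<theta> i)) \<partial>PiM I (\<lambda>_. lborel))"
  proof (rule nn_integral_cong)
    fix \<theta> :: "nat \<Rightarrow> real" assume "\<theta> \<in> space (PiM I (\<lambda>_. lborel))"
    \<comment> \<open>Membership in \<open>PiE\<close> also demands the value
      \<open>undefined\<close> outside \<open>I\<close>. Points of the product space satisfy this,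
      so membership can be tested on the coordinates in \<open>I\<close>.\<close>
    hence e: "\<theta> \<in> extensional I" by (auto simp: space_PiM PiE_def)
    show "ennreal (indicator (PiE I (\<lambda>_. {0..2*pi})) \<theta> / (2 * pi) ^ card I) * indicator (PiE I A) \<theta> =
        (\<Prod>i\<in>I. ennreal (indicator {0..2*pi} (\<theta> i) / (2 * pi)) * indicator (A i) (\<theta> i))"
    proof (cases "\<forall>i\<in>I. \<theta> i \<in> {0..2*pi} \<inter> A i")
      case True
      hence "\<theta> \<in> PiE I (\<lambda>_. {0..2*pi})" "\<theta> \<in> PiE I A" using e by (auto simp: PiE_def)
      moreover have "(\<Prod>i\<in>I. ennreal (indicator {0..2*pi} (\<theta> i) / (2 * pi)) * indicator (A i) (\<theta> i)) = (\<Prod>i\<in>I. ennreal (1 / (2 * pi)))"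
        using True by (intro prod.cong) (auto simp: indicator_def)
      moreover have "\<dots> = ennreal (1 / (2 * pi) ^ card I)"
        by (simp add: ennreal_power power_one_over)
      ultimately show ?thesis by simp
    next
      case False
      then obtain i where i: "i \<in> I" "\<theta> i \<notin> {0..2*pi} \<inter> A i" by blast
      hence out: "\<theta> \<notin> PiE I (\<lambda>_. {0..2*pi}) \<or> \<theta> \<notin> PiE I A" by (auto simp: PiE_def Pi_def)
      have "(\<Prod>i\<in>I. ennreal (indicator {0..2*pi} (\<theta> i) / (2 * pi)) * indicator (A i) (\<theta> i)) = 0"
        using i by (intro prod_zero bexI[of _ i]) (auto simp: indicator_def)
      moreover have "ennreal (indicator (PiE I (\<lambda>_. {0..2*pi})) \<theta> / (2 * pi) ^ card I) * indicator (PiE I A) \<theta> = 0"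
        using out by (elim disjE) (simp_all only: indicator_simps not_False_eq_True div_0 ennreal_0 mult_zero_left mult_zero_right)
      ultimately show ?thesis by (simp only:)
    qed
  qed
  also have "\<dots> = (\<Prod>i\<in>I. \<integral>\<^sup>+\<theta>. ennreal (indicator {0..2*pi} \<theta> / (2 * pi)) * indicator (A i) \<theta> \<partial>lborel)"
    using A by (intro L.product_nn_integral_prod) auto
  also have "\<dots> = (\<Prod>i\<in>I. emeasure angle_unif (A i))"
    unfolding angle_unif_def using A by (intro prod.cong refl) (subst emeasure_density, auto)
  finally show "emeasure ?D (PiE I A) = (\<Prod>i\<in>I. emeasure angle_unif (A i))" .
qed

lemma mahler_measure_torus:
  assumes [measurable]: "(\<lambda>\<theta>. ln (cmod (P (\<lambda>j. cis (\<theta> j))))) \<in> borel_measurable (torus {1..N})"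
  shows "mahler_measure N P = (\<integral>\<theta>. ln (cmod (P (\<lambda>j. cis (\<theta> j)))) \<partial>torus {1..N})"
proof -
  let ?L = "PiM {1..N} (\<lambda>_. lborel :: real measure)"
  have box [measurable]: "PiE {1..N} (\<lambda>_. {0..2*pi}) \<in> sets ?L"
    by (intro sets_PiM_I_finite) auto
  have "sets (torus {1..N}) = sets ?L" by (rule sets_PiM_cong) auto
  hence m [measurable]: "(\<lambda>\<theta>. ln (cmod (P (\<lambda>j. cis (\<theta> j))))) \<in> borel_measurable ?L"
    using assms measurable_cong_sets by blast
  have "(\<integral>\<theta>. ln (cmod (P (\<lambda>j. cis (\<theta> j)))) \<partial>torus {1..N}) =
    (\<integral>\<theta>. (indicator (PiE {1..N} (\<lambda>_. {0..2*pi})) \<theta> / (2 * pi) ^ N) *\<^sub>R ln (cmod (P (\<lambda>j. cis (\<theta> j)))) \<partial>?L)"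
    by (subst torus_eq_density, simp, subst integral_density) (use box m in \<open>auto simp del: One_nat_def\<close>)
  also have "\<dots> = (\<integral>\<theta>. 1 / (2 * pi) ^ N * (indicator (PiE {1..N} (\<lambda>_. {0..2*pi})) \<theta> *\<^sub>R ln (cmod (P (\<lambda>j. cis (\<theta> j))))) \<partial>?L)"
    by (intro Bochner_Integration.integral_cong) auto
  finally show ?thesis
    unfolding mahler_measure_def set_lebesgue_integral_def by simp
qed

section \<open>The half-angle substitution and the law of the tangent product\<close>

lemma nn_integral_incseq_UN:
  assumes [measurable]: "F \<in> borel_measurable M" "\<And>n. A n \<in> sets M" and "incseq A"
  shows "(\<integral>\<^sup>+x. F x * indicator (\<Union>n. A n) x \<partial>M) = (SUP n :: nat. \<integral>\<^sup>+x. F x * indicator (A n) x \<partial>M)"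
proof -
  have "(SUP n. emeasure (density M F) (A n)) = emeasure (density M F) (\<Union>n. A n)"
    by (rule SUP_emeasure_incseq) (use assms in auto)
  thus ?thesis by (simp add: emeasure_density)
qed

lemma nn_integral_substitution_UNIV:
  fixes F :: "real \<Rightarrow> ennreal"
  assumes [measurable]: "F \<in> borel_measurable borel"
    and dg: "\<And>s. (g has_real_derivative g' s) (at s)"
    and cont: "continuous_on UNIV g'" and nn: "\<And>s. g' s \<ge> 0"
  shows "(\<integral>\<^sup>+\<theta>. F \<theta> * indicator (range g) \<theta> \<partial>lborel) = (\<integral>\<^sup>+s. F (g s) * ennreal (g' s) \<partial>lborel)"
proof -
  have mono: "g x \<le> g y" if "x \<le> y" for x y
    by (rule DERIV_nonneg_imp_nondecreasing[OF that]) (use dg nn in blast)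
  have gc: "continuous_on A g" for A
    by (intro continuous_at_imp_continuous_on ballI DERIV_isCont[OF dg])
  have [measurable]: "g \<in> borel_measurable borel" "g' \<in> borel_measurable borel"
    using gc cont by (auto intro: borel_measurable_continuous_onI)
  \<comment> \<open>Exhaustion of the line by \<open>[-(n + 1), n + 1]\<close>; starting at 1 keeps
    the intervals nondegenerate.\<close>
  define A where "A = (\<lambda>n. {g (- real (Suc n))..g (real (Suc n))})"
  define B where "B = (\<lambda>n. {- real (Suc n)..real (Suc n)})"
  have I: "(\<integral>\<^sup>+\<theta>. F \<theta> * indicator (A n) \<theta> \<partial>lborel) = (\<integral>\<^sup>+s. F (g s) * ennreal (g' s) * indicator (B n) s \<partial>lborel)" for n
    unfolding A_def B_def
    by (rule nn_integral_substitution_aux) (auto intro!: dg nn continuous_on_subset[OF cont])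
  have incA: "incseq A"
  proof (rule incseq_SucI)
    fix n show "A n \<subseteq> A (Suc n)"
      using mono[of "- real (Suc (Suc n))" "- real (Suc n)"] mono[of "real (Suc n)" "real (Suc (Suc n))"] by (auto simp: A_def)
  qed
  have UA: "(\<Union>n. A n) = range g"
  proof (intro set_eqI iffI)
    fix \<theta> assume "\<theta> \<in> (\<Union>n. A n)"
    then obtain n where n: "g (- real (Suc n)) \<le> \<theta>" "\<theta> \<le> g (real (Suc n))" by (auto simp: A_def)
    have "\<exists>x. - real (Suc n) \<le> x \<and> x \<le> real (Suc n) \<and> g x = \<theta>"
      by (rule IVT'[OF n _ gc]) simp
    thus "\<theta> \<in> range g" by blast
  next
    fix \<theta> assume "\<theta> \<in> range g"
    then obtain s where s: "\<theta> = g s" by blast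
    obtain n where n: "\<bar>s\<bar> \<le> real n" using real_arch_simple by blast
    hence "\<theta> \<in> A n" using mono[of "- real (Suc n)" s] mono[of s "real (Suc n)"] by (auto simp: A_def s)
    thus "\<theta> \<in> (\<Union>n. A n)" by blast
  qed
  have UB: "(\<Union>n. B n) = UNIV"
  proof (intro equalityI subsetI UNIV_I)
    fix s :: real
    obtain n where "\<bar>s\<bar> \<le> real n" using real_arch_simple by blast
    hence "s \<in> B n" by (auto simp: B_def)
    thus "s \<in> (\<Union>n. B n)" by (rule UN_I[OF UNIV_I])
  qed
  have "(\<integral>\<^sup>+\<theta>. F \<theta> * indicator (range g) \<theta> \<partial>lborel) = (SUP n. \<integral>\<^sup>+\<theta>. F \<theta> * indicator (A n) \<theta> \<partial>lborel)"
    unfolding UA[symmetric] by (rule nn_integral_incseq_UN[OF _ _ incA]) (auto simp: A_def)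
  also have "\<dots> = (SUP n. \<integral>\<^sup>+s. F (g s) * ennreal (g' s) * indicator (B n) s \<partial>lborel)"
    unfolding I ..
  also have "\<dots> = (\<integral>\<^sup>+s. F (g s) * ennreal (g' s) * indicator (\<Union>n. B n) s \<partial>lborel)"
  proof (rule nn_integral_incseq_UN[symmetric])
    show "incseq B" unfolding B_def by (rule incseq_SucI) auto
  qed (auto simp: B_def)
  finally show ?thesis unfolding UB by simp
qed

text \<open>The substitution \<open>theta = 2 arctan (e^s)\<close>, that is
  \<open>tan (theta / 2) = e^s\<close>, has \<open>d theta = ds / cosh s\<close>. It is the origin
  of the density \<open>1 / (pi cosh s)\<close>.\<close>

lemma nn_integral_half_angle:
  assumes [measurable]: "F \<in> borel_measurable borel"
  shows "(\<integral>\<^sup>+\<theta>. F \<theta> * indicator {0<..<pi} \<theta> \<partial>lborel) = (\<integral>\<^sup>+s. F (2 * arctan (exp s)) * ennreal (1 / cosh s) \<partial>lborel)"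
proof -
  define g where "g = (\<lambda>s::real. 2 * arctan (exp s))"
  have dg: "(g has_real_derivative 1 / cosh s) (at s)" for s
  proof -
    have "(g has_real_derivative 2 * (exp s * inverse (1 + (exp s)\<^sup>2))) (at s)"
      unfolding g_def by (auto intro!: derivative_eq_intros)
    moreover have "2 * (exp s * inverse (1 + (exp s)\<^sup>2)) = 1 / cosh s"
      by (simp add: cosh_def exp_minus field_simps power2_eq_square)
    ultimately show ?thesis by simp
  qed
  have "range g = {0<..<pi}"
  proof (intro equalityI subsetI)
    fix \<theta> assume "\<theta> \<in> range g"
    then obtain s where "\<theta> = g s" by blast
    thus "\<theta> \<in> {0<..<pi}" using arctan_ubound[of "exp s"] by (simp add: g_def)
  next
    fix \<theta> assume th: "\<theta> \<in> {0<..<pi}"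
    hence "tan (\<theta> / 2) > 0" by (intro tan_gt_zero) auto
    hence "\<theta> = g (ln (tan (\<theta> / 2)))" using th by (simp add: g_def arctan_tan)
    thus "\<theta> \<in> range g" by blast
  qed
  thus ?thesis
    using nn_integral_substitution_UNIV[OF assms dg] by (simp add: g_def continuous_intros)
qed

lemma ennreal_double_half [simp]: "2 * x / 2 = (x :: ennreal)"
  by (subst mult.commute, rule mult_divide_eq_ennreal) auto

text \<open>Reflection of \<open>theta\<close> to \<open>2 pi - theta\<close> changes only the sign
  of the tangent, so this sign is a fair coin independent of the modulus \<open>e^s\<close>. The
  average over the two signs is kept in the formula because in (iii) the integrand depends on the
  sign.\<close>

lemma nn_integral_angle_tan:
  fixes f :: "real \<Rightarrow> ennreal"
  assumes [measurable]: "f \<in> borel_measurable borel"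
  shows "(\<integral>\<^sup>+\<theta>. f (tan (\<theta> / 2)) \<partial>angle_unif) = (\<integral>\<^sup>+s. (f (exp s) + f (- exp s)) / 2 \<partial>sech_law 1)"
proof -
  have tm [measurable]: "(\<lambda>\<theta>::real. tan (\<theta> / 2)) \<in> borel_measurable borel"
    unfolding tan_def by measurable
  define F where "F = (\<lambda>\<theta>. f (tan (\<theta> / 2)))"
  have Fm [measurable]: "F \<in> borel_measurable borel" unfolding F_def by measurable
  have t: "tan (arctan (exp s)) = exp s" for s :: real by (simp add: tan_arctan)
  have A: "(\<integral>\<^sup>+\<theta>. F \<theta> * indicator {0<..<pi} \<theta> \<partial>lborel) = (\<integral>\<^sup>+s. f (exp s) * ennreal (1 / cosh s) \<partial>lborel)"
    by (subst nn_integral_half_angle) (auto simp: F_def t)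
  have "(\<integral>\<^sup>+\<theta>. F \<theta> * indicator {pi<..<2*pi} \<theta> \<partial>lborel) = (\<integral>\<^sup>+\<theta>. F (2 * pi + (-1) * \<theta>) * indicator {pi<..<2*pi} (2 * pi + (-1) * \<theta>) \<partial>lborel)"
    by (subst nn_integral_real_affine[where c = "-1" and t = "2 * pi"]) auto
  also have "\<dots> = (\<integral>\<^sup>+\<theta>. F (2 * pi - \<theta>) * indicator {0<..<pi} \<theta> \<partial>lborel)"
    by (intro nn_integral_cong) (auto simp: indicator_def)
  also have "\<dots> = (\<integral>\<^sup>+s. F (2 * pi - 2 * arctan (exp s)) * ennreal (1 / cosh s) \<partial>lborel)"
    by (rule nn_integral_half_angle) measurable
  also have "\<dots> = (\<integral>\<^sup>+s. f (- exp s) * ennreal (1 / cosh s) \<partial>lborel)"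
  proof (intro nn_integral_cong)
    fix s :: real
    have "(2 * pi - 2 * arctan (exp s)) / 2 = pi - arctan (exp s)" by (simp add: field_simps)
    moreover have "tan (pi - arctan (exp s)) = - exp s"
      using t[of s] by (simp add: tan_def sin_diff cos_diff)
    ultimately have "tan ((2 * pi - 2 * arctan (exp s)) / 2) = - exp s" by (simp only:)
    thus "F (2 * pi - 2 * arctan (exp s)) * ennreal (1 / cosh s) = f (- exp s) * ennreal (1 / cosh s)"
      by (simp only: F_def)
  qed
  finally have B: "(\<integral>\<^sup>+\<theta>. F \<theta> * indicator {pi<..<2*pi} \<theta> \<partial>lborel) = \<dots>" .
  have "(\<integral>\<^sup>+\<theta>. f (tan (\<theta> / 2)) \<partial>angle_unif) = (\<integral>\<^sup>+\<theta>. ennreal (1 / (2 * pi)) * (F \<theta> * indicator {0..2*pi} \<theta>) \<partial>lborel)"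
    unfolding F_def by (rule nn_integral_angle_unif) measurable
  also have "\<dots> = ennreal (1 / (2 * pi)) * (\<integral>\<^sup>+\<theta>. F \<theta> * indicator {0..2*pi} \<theta> \<partial>lborel)"
    by (rule nn_integral_cmult) measurable
  also have "(\<integral>\<^sup>+\<theta>. F \<theta> * indicator {0..2*pi} \<theta> \<partial>lborel) = (\<integral>\<^sup>+\<theta>. F \<theta> * indicator {0<..<pi} \<theta> + F \<theta> * indicator {pi<..<2*pi} \<theta> \<partial>lborel)"
  proof (rule nn_integral_cong_AE)
    show "AE \<theta> in lborel. F \<theta> * indicator {0..2*pi} \<theta> = F \<theta> * indicator {0<..<pi} \<theta> + F \<theta> * indicator {pi<..<2*pi} \<theta>"
      using AE_lborel_singleton[of 0] AE_lborel_singleton[of pi] AE_lborel_singleton[of "2 * pi"]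
      by eventually_elim (auto simp: indicator_def)
  qed
  also have "\<dots> = (\<integral>\<^sup>+s. f (exp s) * ennreal (1 / cosh s) \<partial>lborel) + (\<integral>\<^sup>+s. f (- exp s) * ennreal (1 / cosh s) \<partial>lborel)"
    by (subst nn_integral_add) (auto simp: A B)
  also have "\<dots> = (\<integral>\<^sup>+s. f (exp s) * ennreal (1 / cosh s) + f (- exp s) * ennreal (1 / cosh s) \<partial>lborel)"
    by (rule nn_integral_add[symmetric]) measurable
  also have "ennreal (1 / (2 * pi)) * \<dots> = (\<integral>\<^sup>+s. ennreal (1 / (2 * pi)) * (f (exp s) * ennreal (1 / cosh s) + f (- exp s) * ennreal (1 / cosh s)) \<partial>lborel)"
    by (rule nn_integral_cmult[symmetric]) measurable
  also have "\<dots> = (\<integral>\<^sup>+s. ennreal (sech_density 1 s) * ((f (exp s) + f (- exp s)) / 2) \<partial>lborel)"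
  proof (intro nn_integral_cong)
    fix s :: real
    have "ennreal (sech_density 1 s) = ennreal (1 / (2 * pi)) * ennreal (1 / cosh s) * 2"
      by (simp add: sech_density_1 ennreal_mult[symmetric] ennreal_numeral[symmetric] del: ennreal_numeral)
    hence "ennreal (sech_density 1 s) * ((f (exp s) + f (- exp s)) / 2) = ennreal (1 / (2 * pi)) * ennreal (1 / cosh s) * (f (exp s) + f (- exp s)) * (2 / 2)"
      by (simp add: ennreal_times_divide mult_ac)
    thus "ennreal (1 / (2 * pi)) * (f (exp s) * ennreal (1 / cosh s) + f (- exp s) * ennreal (1 / cosh s)) = ennreal (sech_density 1 s) * ((f (exp s) + f (- exp s)) / 2)"
      by (simp add: distrib_left distrib_right mult_ac)
  qed
  also have "\<dots> = (\<integral>\<^sup>+s. (f (exp s) + f (- exp s)) / 2 \<partial>sech_law 1)"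
    unfolding sech_law_1 by (rule nn_integral_density[symmetric]) measurable
  finally show ?thesis .
qed

text \<open>The signs of the factors combine into a single fair sign: once the sign of the product
  of the other factors is averaged, the function \<open>h\<close> of the new factor is even, so the
  new sign disappears. What remains is the addition of independent logarithms, which is
  convolution.\<close>

lemma nn_integral_torus_tan_prod:
  fixes f :: "real \<Rightarrow> ennreal"
  assumes "finite I" "I \<noteq> {}" "f \<in> borel_measurable borel"
  shows "(\<integral>\<^sup>+\<theta>. f (\<Prod>i\<in>I. tan (\<theta> i / 2)) \<partial>torus I) = (\<integral>\<^sup>+s. (f (exp s) + f (- exp s)) / 2 \<partial>sech_law (card I))"
  using assms
proof (induction I arbitrary: f rule: finite_ne_induct)
  case (singleton i)
  note [measurable] = singleton
  have tm [measurable]: "(\<lambda>\<theta>::real. tan (\<theta> / 2)) \<in> borel_measurable borel"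
    unfolding tan_def by measurable
  have "(\<integral>\<^sup>+\<theta>. f (tan (\<theta> i / 2)) \<partial>torus {i}) = (\<integral>\<^sup>+\<theta>. f (tan (\<theta> / 2)) \<partial>angle_unif)"
    by (rule torus.product_nn_integral_singleton) measurable
  thus ?case using nn_integral_angle_tan[OF singleton] by simp
next
  case (insert i I)
  note [measurable] = insert.prems
  have tm [measurable]: "(\<lambda>\<theta>::real. tan (\<theta> / 2)) \<in> borel_measurable borel"
    unfolding tan_def by measurable
  let ?k = "card I"
  interpret A: prob_space "sech_law ?k" by (rule prob_space_sech_law)
  interpret B: prob_space "sech_law 1" by (rule prob_space_sech_law)
  interpret P: pair_sigma_finite "sech_law ?k" "sech_law 1" ..
  define h where "h = (\<lambda>\<tau>. \<integral>\<^sup>+s. (f (\<tau> * exp s) + f (- \<tau> * exp s)) / 2 \<partial>sech_law ?k)"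
  have hm [measurable]: "h \<in> borel_measurable borel" unfolding h_def by measurable
  have "(\<integral>\<^sup>+\<theta>. f (\<Prod>j\<in>insert i I. tan (\<theta> j / 2)) \<partial>torus (insert i I)) =
    (\<integral>\<^sup>+y. (\<integral>\<^sup>+x. f (\<Prod>j\<in>insert i I. tan ((x(i := y)) j / 2)) \<partial>torus I) \<partial>angle_unif)"
    by (rule torus.product_nn_integral_insert_rev) (use insert.hyps in measurable)
  also have "\<dots> = (\<integral>\<^sup>+y. (\<integral>\<^sup>+x. f (tan (y / 2) * (\<Prod>j\<in>I. tan (x j / 2))) \<partial>torus I) \<partial>angle_unif)"
  proof -
    have "(\<Prod>j\<in>insert i I. tan ((x(i := y)) j / 2)) = tan (y / 2) * (\<Prod>j\<in>I. tan (x j / 2))" for x and y :: real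
      using insert.hyps by (subst prod.insert) (auto intro!: arg_cong2[where f = "(*)"] prod.cong simp: fun_upd_def split: if_splits)
    thus ?thesis by simp
  qed
  also have "\<dots> = (\<integral>\<^sup>+y. h (tan (y / 2)) \<partial>angle_unif)"
  proof (rule nn_integral_cong)
    fix y
    show "(\<integral>\<^sup>+x. f (tan (y / 2) * (\<Prod>j\<in>I. tan (x j / 2))) \<partial>torus I) = h (tan (y / 2))"
      using insert.IH[of "\<lambda>p. f (tan (y / 2) * p)"] by (simp add: h_def)
  qed
  also have "\<dots> = (\<integral>\<^sup>+r. (h (exp r) + h (- exp r)) / 2 \<partial>sech_law 1)"
    by (rule nn_integral_angle_tan) measurable
  also have "\<dots> = (\<integral>\<^sup>+r. h (exp r) \<partial>sech_law 1)"
  proof (rule nn_integral_cong)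
    fix r
    have "h (- exp r) = h (exp r)" by (simp add: h_def add.commute)
    thus "(h (exp r) + h (- exp r)) / 2 = h (exp r)"
      by (simp add: mult_2[symmetric])
  qed
  also have "\<dots> = (\<integral>\<^sup>+s. \<integral>\<^sup>+r. (f (exp (s + r)) + f (- exp (s + r))) / 2 \<partial>sech_law 1 \<partial>sech_law ?k)"
  proof -
    have "(\<integral>\<^sup>+r. h (exp r) \<partial>sech_law 1) = (\<integral>\<^sup>+r. \<integral>\<^sup>+s. (\<lambda>(s, r). (f (exp (s + r)) + f (- exp (s + r))) / 2) (s, r) \<partial>sech_law ?k \<partial>sech_law 1)"
      unfolding h_def by (intro nn_integral_cong) (simp add: exp_add mult.commute)
    also have "\<dots> = (\<integral>\<^sup>+s. \<integral>\<^sup>+r. (\<lambda>(s, r). (f (exp (s + r)) + f (- exp (s + r))) / 2) (s, r) \<partial>sech_law 1 \<partial>sech_law ?k)"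
      by (rule P.Fubini) measurable
    finally show ?thesis by simp
  qed
  also have "\<dots> = (\<integral>\<^sup>+x. (f (exp x) + f (- exp x)) / 2 \<partial>(sech_law ?k \<star> sech_law 1))"
    by (rule nn_integral_convolution[symmetric]) auto
  also have "(sech_law ?k \<star> sech_law 1) = sech_law (card (insert i I))"
  proof -
    have c: "card (insert i I) = Suc ?k" using insert.hyps by simp
    show ?thesis by (simp only: c sech_law_1 sech_law.simps)
  qed
  finally show ?case .
qed

section \<open>Jensen's formula\<close>

lemma borel_measurable_cis [measurable]: "cis \<in> borel_measurable borel"
  by (intro borel_measurable_continuous_onI continuous_intros)

lemma AE_angle_unifI: "(AE \<theta> in lborel. P \<theta>) \<Longrightarrow> AE \<theta> in angle_unif. P \<theta>"
  unfolding angle_unif_def by (subst AE_density) auto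

lemma AE_angle_cis_neq: "AE \<theta> in angle_unif. cis \<theta> \<noteq> w"
proof (rule AE_angle_unifI)
  have "countable {\<theta>. cis \<theta> = w}"
  proof (cases "\<exists>\<theta>0. cis \<theta>0 = w")
    case True
    then obtain \<theta>0 where w: "cis \<theta>0 = w" by blast
    have "{\<theta>. cis \<theta> = w} \<subseteq> range (\<lambda>n::int. \<theta>0 + 2 * pi * of_int n)"
    proof
      fix \<theta> assume "\<theta> \<in> {\<theta>. cis \<theta> = w}"
      hence "sin \<theta> = sin \<theta>0 \<and> cos \<theta> = cos \<theta>0" using w by (auto simp: complex_eq_iff)
      then obtain n :: int where "\<theta> = \<theta>0 + 2 * pi * of_int n" using sin_cos_eq_iff by blast
      thus "\<theta> \<in> range (\<lambda>n::int. \<theta>0 + 2 * pi * of_int n)" by blast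
    qed
    thus ?thesis by (rule countable_subset) auto
  qed auto
  hence "{\<theta>. cis \<theta> = w} \<in> null_sets lborel" by (rule countable_imp_null_set_lborel)
  thus "AE \<theta> in lborel. cis \<theta> \<noteq> w" using AE_not_in by fastforce
qed

lemma integral_angle_cis_power:
  assumes "n \<ge> 1"
  shows "(\<integral>\<theta>. Re (c * cis \<theta> ^ n) \<partial>angle_unif) = 0"
proof -
  define F where "F = (\<lambda>\<theta>. (Re c * sin (real n * \<theta>) + Im c * cos (real n * \<theta>)) / real n)"
  have eq: "Re (c * cis \<theta> ^ n) = Re c * cos (real n * \<theta>) - Im c * sin (real n * \<theta>)" for \<theta>
    by (simp add: Complex.DeMoivre)
  have d: "(F has_real_derivative Re (c * cis \<theta> ^ n)) (at \<theta>)" for \<theta>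
    unfolding F_def eq using assms
    by (auto intro!: derivative_eq_intros simp: field_simps)
  have "(\<integral>\<theta>. Re (c * cis \<theta> ^ n) * indicator {0..2*pi} \<theta> \<partial>lborel) = F (2 * pi) - F 0"
  proof (rule integral_FTC_Icc_real)
    show "isCont (\<lambda>\<theta>. Re (c * cis \<theta> ^ n)) \<theta>" for \<theta> unfolding eq by (intro continuous_intros)
  qed (use d in auto)
  also have "\<dots> = 0"
    using sin_2npi[of n] cos_2npi[of n] by (simp add: F_def mult_ac)
  finally show ?thesis
    by (subst integral_angle_unif) (simp_all add: mult.commute)
qed

text \<open>Inside the disc \<open>ln (1 + a e^(i theta))\<close> is an absolutely convergent power
  series without constant term, and each of its monomials has mean zero.\<close>

lemma jensen_unit_disc:
  fixes a :: complex
  assumes "cmod a < 1"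
  shows "integrable angle_unif (\<lambda>\<theta>. ln (cmod (1 + a * cis \<theta>)))"
    and "(\<integral>\<theta>. ln (cmod (1 + a * cis \<theta>)) \<partial>angle_unif) = 0"
proof -
  \<comment> \<open>The term \<open>n = 0\<close> is 0 because of the division by zero, in agreement
    with the missing constant term.\<close>
  define f where "f = (\<lambda>n \<theta>. Re ((-1) ^ Suc n / of_nat n * (a * cis \<theta>) ^ n))"
  have nb: "norm (f n \<theta>) \<le> cmod a ^ n" for n \<theta>
  proof -
    have "norm (f n \<theta>) \<le> norm ((-1) ^ Suc n / of_nat n * (a * cis \<theta>) ^ n)" unfolding f_def real_norm_def by (rule abs_Re_le_cmod)
    also have "\<dots> = 1 / real n * cmod a ^ n" by (simp add: norm_mult norm_power norm_divide)
    also have "\<dots> \<le> 1 * cmod a ^ n" by (intro mult_right_mono) (cases n; auto simp: field_simps)+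
    finally show ?thesis by simp
  qed
  have fm [measurable]: "f n \<in> borel_measurable borel" for n unfolding f_def by measurable
  have int: "integrable angle_unif (f n)" for n
    by (rule angle.integrable_const_bound[of _ "cmod a ^ n"]) (use nb in auto)
  have sums: "(\<lambda>n. f n \<theta>) sums ln (cmod (1 + a * cis \<theta>))" for \<theta>
  proof -
    have n1: "cmod (a * cis \<theta>) < 1" using assms by (simp add: norm_mult)
    hence nz: "1 + a * cis \<theta> \<noteq> 0" by (metis add_eq_0_iff2 norm_minus_cancel norm_one order_less_irrefl add.commute)
    have "(\<lambda>n. (-1) ^ Suc n / of_nat n * (a * cis \<theta>) ^ n) sums ln (1 + a * cis \<theta>)" by (rule Ln_series[OF n1])
    from sums_Re[OF this] show ?thesis using nz by (simp add: f_def Re_Ln)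
  qed
  have summ: "summable (\<lambda>n. norm (f n \<theta>))" for \<theta>
    by (rule summable_comparison_test'[of "\<lambda>n. cmod a ^ n" 0]) (use assms nb in \<open>auto intro: summable_geometric\<close>)
  have nz2: "cmod (1 + a * cis \<theta>) \<ge> 1 - cmod a" for \<theta>
    using norm_triangle_ineq2[of 1 "- (a * cis \<theta>)"] by (simp add: norm_mult)
  have up: "cmod (1 + a * cis \<theta>) \<le> 2" for \<theta>
    using norm_triangle_ineq[of 1 "a * cis \<theta>"] assms by (simp add: norm_mult)
  show int': "integrable angle_unif (\<lambda>\<theta>. ln (cmod (1 + a * cis \<theta>)))"
  proof (rule angle.integrable_const_bound[of _ "ln 2 + \<bar>ln (1 - cmod a)\<bar>"])
    show "AE \<theta> in angle_unif. norm (ln (cmod (1 + a * cis \<theta>))) \<le> ln 2 + \<bar>ln (1 - cmod a)\<bar>"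
    proof (rule AE_I2)
      fix \<theta>
      have "cmod (1 + a * cis \<theta>) > 0" using nz2[of \<theta>] assms by linarith
      hence "ln (cmod (1 + a * cis \<theta>)) \<le> ln 2" "ln (1 - cmod a) \<le> ln (cmod (1 + a * cis \<theta>))"
        using up[of \<theta>] nz2[of \<theta>] assms by (subst ln_le_cancel_iff; simp)+
      thus "norm (ln (cmod (1 + a * cis \<theta>))) \<le> ln 2 + \<bar>ln (1 - cmod a)\<bar>"
        using ln_ge_zero[of "2::real"] unfolding real_norm_def by linarith
    qed
  qed measurable
  have "(\<lambda>n. \<integral>\<theta>. f n \<theta> \<partial>angle_unif) sums (\<integral>\<theta>. (\<Sum>n. f n \<theta>) \<partial>angle_unif)"
  proof (rule sums_integral[OF int])
    show "AE \<theta> in angle_unif. summable (\<lambda>n. norm (f n \<theta>))" using summ by auto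
    show "summable (\<lambda>n. \<integral>\<theta>. norm (f n \<theta>) \<partial>angle_unif)"
    proof (rule summable_comparison_test'[of "\<lambda>n. cmod a ^ n" 0])
      fix n
      have "(\<integral>\<theta>. norm (f n \<theta>) \<partial>angle_unif) \<le> (\<integral>\<theta>. cmod a ^ n \<partial>angle_unif)"
        by (rule integral_mono) (use int nb in auto)
      thus "norm (\<integral>\<theta>. norm (f n \<theta>) \<partial>angle_unif) \<le> cmod a ^ n"
        by (simp add: angle.prob_space[simplified])
    qed (use assms in \<open>auto intro: summable_geometric\<close>)
  qed
  moreover have "(\<integral>\<theta>. f n \<theta> \<partial>angle_unif) = 0" for n
  proof (cases "n = 0")
    case False
    have "f n = (\<lambda>\<theta>. Re ((-1) ^ Suc n / of_nat n * a ^ n * cis \<theta> ^ n))"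
      unfolding f_def power_mult_distrib by (simp only: mult.assoc)
    thus ?thesis using False by (simp only:) (rule integral_angle_cis_power, simp)
  qed (simp add: f_def)
  moreover have "(\<Sum>n. f n \<theta>) = ln (cmod (1 + a * cis \<theta>))" for \<theta> using sums by (simp add: sums_iff)
  ultimately show "(\<integral>\<theta>. ln (cmod (1 + a * cis \<theta>)) \<partial>angle_unif) = 0"
    by (simp add: sums_iff)
qed

text \<open>The logarithmic singularity possible at \<open>|a| = 1\<close> is approached through
  \<open>r a\<close> with \<open>r < 1\<close>: Fatou for \<open>ln 2 - f >= 0\<close> gives
  integrability, and then dominated convergence transports the value 0. The bound
  \<open>2 ln 2\<close> on the absolute mean does not depend on \<open>a\<close>; it is what later
  permits Fubini in the remaining variables.\<close>

lemma jensen_closed_disc: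
  fixes a :: complex
  assumes "cmod a \<le> 1"
  shows "integrable angle_unif (\<lambda>\<theta>. ln (cmod (1 + a * cis \<theta>)))"
    and "(\<integral>\<theta>. ln (cmod (1 + a * cis \<theta>)) \<partial>angle_unif) = 0"
    and "(\<integral>\<theta>. \<bar>ln (cmod (1 + a * cis \<theta>))\<bar> \<partial>angle_unif) \<le> 2 * ln 2"
proof -
  define f where "f = (\<lambda>\<theta>. ln (cmod (1 + a * cis \<theta>)))"
  define r where "r = (\<lambda>n. 1 - 1 / (real n + 2))"
  have r: "0 \<le> r n" "r n < 1" for n by (auto simp: r_def field_simps)
  have rl: "r \<longlonglongrightarrow> 1" unfolding r_def by real_asymp
  define fn where "fn = (\<lambda>n \<theta>. ln (cmod (1 + of_real (r n) * a * cis \<theta>)))"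
  have ra: "cmod (of_real (r n) * a) < 1" for n
  proof -
    have "cmod (of_real (r n) * a) \<le> r n * 1" using r[of n] assms unfolding norm_mult by (intro mult_mono) auto
    thus ?thesis using r[of n] by linarith
  qed
  have fni: "integrable angle_unif (fn n)" "(\<integral>\<theta>. fn n \<theta> \<partial>angle_unif) = 0" for n
    using jensen_unit_disc[OF ra[of n]] by (simp_all add: fn_def)
  have [measurable]: "f \<in> borel_measurable borel" "fn n \<in> borel_measurable borel" for n
    unfolding f_def fn_def by measurable
  have ae: "AE \<theta> in angle_unif. 1 + a * cis \<theta> \<noteq> 0"
  proof (cases "a = 0")
    case False
    show ?thesis using AE_angle_cis_neq[of "- 1 / a"]
      by eventually_elim (use False in \<open>auto simp: field_simps add_eq_0_iff\<close>)
  qed auto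
  have le2: "cmod (1 + b * cis \<theta>) \<le> 2" if "cmod b \<le> 1" for b \<theta>
    using norm_triangle_ineq[of 1 "b * cis \<theta>"] that by (simp add: norm_mult)
  have lnle: "ln x \<le> ln 2" if "0 \<le> x" "x \<le> 2" for x :: real
    using that by (cases "x = 0") auto
  have f_le: "f \<theta> \<le> ln 2" for \<theta> unfolding f_def by (rule lnle) (use le2[OF assms] in auto)
  have fn_le: "fn n \<theta> \<le> ln 2" for n \<theta>
    unfolding fn_def by (rule lnle) (use le2[of "of_real (r n) * a"] ra[of n] in auto)
  have conv: "AE \<theta> in angle_unif. (\<lambda>n. fn n \<theta>) \<longlonglongrightarrow> f \<theta>"
    using ae
  proof eventually_elim
    case (elim \<theta>)
    have "(\<lambda>n. cmod (1 + of_real (r n) * a * cis \<theta>)) \<longlonglongrightarrow> cmod (1 + of_real 1 * a * cis \<theta>)"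
      by (intro tendsto_intros rl)
    thus ?case unfolding f_def fn_def using elim by (intro tendsto_ln) auto
  qed
  have "(\<integral>\<^sup>+\<theta>. ennreal (ln 2 - f \<theta>) \<partial>angle_unif) = (\<integral>\<^sup>+\<theta>. liminf (\<lambda>n. ennreal (ln 2 - fn n \<theta>)) \<partial>angle_unif)"
  proof (rule nn_integral_cong_AE)
    show "AE \<theta> in angle_unif. ennreal (ln 2 - f \<theta>) = liminf (\<lambda>n. ennreal (ln 2 - fn n \<theta>))"
      using conv
    proof eventually_elim
      case (elim \<theta>)
      have "(\<lambda>n. ennreal (ln 2 - fn n \<theta>)) \<longlonglongrightarrow> ennreal (ln 2 - f \<theta>)"
        by (intro tendsto_ennrealI tendsto_intros elim)
      thus ?case using lim_imp_Liminf trivial_limit_sequentially by metis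
    qed
  qed
  also have "\<dots> \<le> liminf (\<lambda>n. \<integral>\<^sup>+\<theta>. ennreal (ln 2 - fn n \<theta>) \<partial>angle_unif)"
    by (rule nn_integral_liminf) measurable
  also have "(\<lambda>n. \<integral>\<^sup>+\<theta>. ennreal (ln 2 - fn n \<theta>) \<partial>angle_unif) = (\<lambda>n. ennreal (ln 2))"
  proof
    fix n
    have "(\<integral>\<^sup>+\<theta>. ennreal (ln 2 - fn n \<theta>) \<partial>angle_unif) = ennreal (\<integral>\<theta>. ln 2 - fn n \<theta> \<partial>angle_unif)"
      using fni[of n] fn_le by (intro nn_integral_eq_integral) auto
    thus "(\<integral>\<^sup>+\<theta>. ennreal (ln 2 - fn n \<theta>) \<partial>angle_unif) = ennreal (ln 2)"
      using fni[of n] angle.prob_space by simp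
  qed
  finally have fin: "(\<integral>\<^sup>+\<theta>. ennreal (ln 2 - f \<theta>) \<partial>angle_unif) \<le> ennreal (ln 2)" by (simp add: Liminf_const)
  have "integrable angle_unif (\<lambda>\<theta>. ln 2 - f \<theta>)"
  proof (rule integrableI_bounded)
    have "(\<integral>\<^sup>+\<theta>. ennreal (norm (ln 2 - f \<theta>)) \<partial>angle_unif) = (\<integral>\<^sup>+\<theta>. ennreal (ln 2 - f \<theta>) \<partial>angle_unif)"
      using f_le by (intro nn_integral_cong) simp
    also have "\<dots> < \<infinity>" using fin by (simp add: order_le_less_trans[OF fin])
    finally show "(\<integral>\<^sup>+\<theta>. ennreal (norm (ln 2 - f \<theta>)) \<partial>angle_unif) < \<infinity>" .
  qed measurable
  hence "integrable angle_unif (\<lambda>\<theta>. ln 2 - (ln 2 - f \<theta>))" by (rule Bochner_Integration.integrable_diff[OF angle.integrable_const])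
  hence fi: "integrable angle_unif f" by simp
  have "(\<lambda>n. \<integral>\<theta>. fn n \<theta> \<partial>angle_unif) \<longlonglongrightarrow> (\<integral>\<theta>. f \<theta> \<partial>angle_unif)"
  proof (rule integral_dominated_convergence[where w = "\<lambda>\<theta>. \<bar>f \<theta>\<bar> + ln 2"])
    show "AE \<theta> in angle_unif. norm (fn n \<theta>) \<le> \<bar>f \<theta>\<bar> + ln 2" for n
      using ae
    proof eventually_elim
      case (elim \<theta>)
      let ?z = "a * cis \<theta>"
      \<comment> \<open>Both summands are at most \<open>|1 + r z|\<close>, because
        \<open>|1 + r z| >= 1 - r\<close> for \<open>|z| <= 1\<close>. Shrinking the radius
        therefore loses at most a factor 2, and \<open>|f| + ln 2\<close> dominates.\<close>
      have "cmod (1 + ?z) \<le> cmod (1 + of_real (r n) * ?z) + cmod (of_real (1 - r n) * ?z)"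
        using norm_triangle_ineq[of "1 + of_real (r n) * ?z" "of_real (1 - r n) * ?z"] by (simp add: algebra_simps)
      also have "cmod (of_real (1 - r n) * ?z) \<le> (1 - r n) * 1"
        using r[of n] assms unfolding norm_mult by (intro mult_mono) (auto simp del: of_real_diff)
      also have "(1 - r n) * 1 \<le> cmod (1 + of_real (r n) * ?z)"
      proof -
        have "cmod (of_real (r n) * ?z) \<le> r n * 1" using r[of n] assms unfolding norm_mult by (intro mult_mono) auto
        thus ?thesis using norm_triangle_ineq2[of 1 "- (of_real (r n) * ?z)"] by simp
      qed
      finally have "cmod (1 + ?z) / 2 \<le> cmod (1 + of_real (r n) * a * cis \<theta>)" by (simp add: mult.assoc)
      moreover have p: "cmod (1 + ?z) > 0" using elim by simp
      ultimately have "ln (cmod (1 + ?z) / 2) \<le> fn n \<theta>" unfolding fn_def by (subst ln_le_cancel_iff) auto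
      hence "f \<theta> - ln 2 \<le> fn n \<theta>" using ln_div[of "cmod (1 + ?z)" 2] p by (simp add: f_def)
      thus ?case using fn_le[of n \<theta>] by auto
    qed
  qed (use conv fi in auto)
  hence f0: "(\<integral>\<theta>. f \<theta> \<partial>angle_unif) = 0" unfolding fni using LIMSEQ_unique tendsto_const by blast
  \<comment> \<open>From \<open>f <= ln 2\<close> follows \<open>|f| <= 2 ln 2 - f\<close>
    pointwise, and the mean of \<open>f\<close> is 0.\<close>
  have "(\<integral>\<theta>. \<bar>f \<theta>\<bar> \<partial>angle_unif) \<le> (\<integral>\<theta>. 2 * ln 2 - f \<theta> \<partial>angle_unif)"
  proof (rule integral_mono)
    fix \<theta>
    show "\<bar>f \<theta>\<bar> \<le> 2 * ln 2 - f \<theta>" using f_le[of \<theta>] ln_ge_zero[of "2::real"] by linarith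
  qed (use fi in auto)
  also have "\<dots> = 2 * ln 2" using fi f0 angle.prob_space by simp
  finally show "(\<integral>\<theta>. \<bar>ln (cmod (1 + a * cis \<theta>))\<bar> \<partial>angle_unif) \<le> 2 * ln 2" by (simp add: f_def)
  show "integrable angle_unif (\<lambda>\<theta>. ln (cmod (1 + a * cis \<theta>)))"
    "(\<integral>\<theta>. ln (cmod (1 + a * cis \<theta>)) \<partial>angle_unif) = 0"
    using fi f0 by (simp_all add: f_def)
qed

text \<open>Factoring out the larger of the two coefficients leaves \<open>1 + a e^(i theta)\<close>
  with \<open>|a| <= 1\<close>, the case of the closed disc.\<close>

lemma jensen_linear:
  fixes p q :: complex
  assumes "p \<noteq> 0 \<or> q \<noteq> 0"
  shows "integrable angle_unif (\<lambda>\<theta>. ln (cmod (p + q * cis \<theta>)))"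
    and "(\<integral>\<theta>. ln (cmod (p + q * cis \<theta>)) \<partial>angle_unif) = ln (max (cmod p) (cmod q))"
    and "(\<integral>\<theta>. \<bar>ln (cmod (p + q * cis \<theta>))\<bar> \<partial>angle_unif) \<le> \<bar>ln (max (cmod p) (cmod q))\<bar> + 2 * ln 2"
proof -
  define m where "m = max (cmod p) (cmod q)"
  obtain a where a: "cmod a \<le> 1" "\<And>\<theta>. cmod (p + q * cis \<theta>) = m * cmod (1 + a * cis \<theta>)"
  proof (cases "cmod p \<ge> cmod q")
    case True
    hence p: "p \<noteq> 0" using assms by auto
    have "cmod (p + q * cis \<theta>) = m * cmod (1 + (q / p) * cis \<theta>)" for \<theta>
    proof -
      have "p + q * cis \<theta> = p * (1 + (q / p) * cis \<theta>)" using p by (simp add: field_simps)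
      thus ?thesis using True by (simp add: m_def norm_mult)
    qed
    thus ?thesis using that[of "q / p"] True p by (simp add: norm_divide)
  next
    case False
    hence q: "q \<noteq> 0" by auto
    \<comment> \<open>Factoring out \<open>q e^(i theta)\<close> leaves \<open>e^(-i theta)\<close>
      in the other term; conjugation keeps the modulus and restores
      \<open>e^(i theta)\<close>.\<close>
    have "cmod (p + q * cis \<theta>) = m * cmod (1 + cnj (p / q) * cis \<theta>)" for \<theta>
    proof -
      have "cis (- \<theta>) * cis \<theta> = 1" by (simp add: cis_mult)
      hence "p + q * cis \<theta> = q * cis \<theta> * (1 + (p / q) * cis (- \<theta>))" using q by (simp add: field_simps)
      also have "cmod \<dots> = cmod q * cmod (1 + (p / q) * cis (- \<theta>))" by (simp add: norm_mult)
      also have "cmod (1 + (p / q) * cis (- \<theta>)) = cmod (cnj (1 + (p / q) * cis (- \<theta>)))" by (simp only: complex_mod_cnj)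
      also have "cnj (1 + (p / q) * cis (- \<theta>)) = 1 + cnj (p / q) * cis \<theta>" by (simp add: cis_cnj)
      finally show ?thesis using False by (simp add: m_def max_def)
    qed
    moreover have "cmod (cnj (p / q)) \<le> 1" using False q by (simp add: norm_divide)
    ultimately show ?thesis using that by blast
  qed
  have m: "m > 0" using assms by (auto simp: m_def max_def)
  have ae: "AE \<theta> in angle_unif. 1 + a * cis \<theta> \<noteq> 0"
  proof (cases "a = 0")
    case False
    show ?thesis using AE_angle_cis_neq[of "- 1 / a"]
      by eventually_elim (use False in \<open>auto simp: field_simps add_eq_0_iff\<close>)
  qed auto
  note J = jensen_closed_disc[OF a(1)]
  have eq: "AE \<theta> in angle_unif. ln (cmod (p + q * cis \<theta>)) = ln m + ln (cmod (1 + a * cis \<theta>))"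
    using ae
  proof eventually_elim
    case (elim \<theta>)
    show ?case unfolding a(2) using m elim by (subst ln_mult) auto
  qed
  have int: "integrable angle_unif (\<lambda>\<theta>. ln m + ln (cmod (1 + a * cis \<theta>)))"
    using J(1) by auto
  show int': "integrable angle_unif (\<lambda>\<theta>. ln (cmod (p + q * cis \<theta>)))"
    by (rule integrable_cong_AE_imp[OF int]) (use eq in \<open>auto elim: eventually_mono\<close>)
  have "(\<integral>\<theta>. ln (cmod (p + q * cis \<theta>)) \<partial>angle_unif) = (\<integral>\<theta>. ln m + ln (cmod (1 + a * cis \<theta>)) \<partial>angle_unif)"
    by (rule integral_cong_AE) (use eq in auto)
  also have "\<dots> = ln m" using J(1,2) angle.prob_space by simp
  finally show "(\<integral>\<theta>. ln (cmod (p + q * cis \<theta>)) \<partial>angle_unif) = ln (max (cmod p) (cmod q))" by (simp add: m_def)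
  have "(\<integral>\<theta>. \<bar>ln (cmod (p + q * cis \<theta>))\<bar> \<partial>angle_unif) \<le> (\<integral>\<theta>. \<bar>ln m\<bar> + \<bar>ln (cmod (1 + a * cis \<theta>))\<bar> \<partial>angle_unif)"
    by (rule integral_mono_AE) (use eq int' J(1) in \<open>auto elim: eventually_mono\<close>)
  also have "\<dots> \<le> \<bar>ln m\<bar> + 2 * ln 2" using J(1,3) angle.prob_space by simp
  finally show "(\<integral>\<theta>. \<bar>ln (cmod (p + q * cis \<theta>))\<bar> \<partial>angle_unif) \<le> \<bar>ln (max (cmod p) (cmod q))\<bar> + 2 * ln 2" by (simp add: m_def)
qed

text \<open>Fubini in one variable, with integrability on the larger torus deduced from an
  integrable bound \<open>b\<close> for the \<open>L1\<close> norms of the sections. The values of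
  the inner integrals alone would not give it, since logarithms change sign.\<close>

lemma torus_insert_integral:
  fixes f g b :: "(nat \<Rightarrow> real) \<Rightarrow> real"
  assumes I: "finite I" "i \<notin> I"
    and f [measurable]: "f \<in> borel_measurable (torus (insert i I))"
    and g [measurable]: "g \<in> borel_measurable (torus I)"
    and b: "integrable (torus I) b"
    and ae: "AE x in torus I. integrable angle_unif (\<lambda>t. f (x(i := t))) \<and>
       (\<integral>t. f (x(i := t)) \<partial>angle_unif) = g x \<and> (\<integral>t. \<bar>f (x(i := t))\<bar> \<partial>angle_unif) \<le> b x"
  shows "integrable (torus (insert i I)) f" "(\<integral>x. f x \<partial>torus (insert i I)) = (\<integral>x. g x \<partial>torus I)"
proof -
  have "(\<integral>\<^sup>+x. ennreal (norm (f x)) \<partial>torus (insert i I)) = (\<integral>\<^sup>+x. (\<integral>\<^sup>+t. ennreal (norm (f (x(i := t)))) \<partial>angle_unif) \<partial>torus I)"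
    by (rule torus.product_nn_integral_insert[OF I]) measurable
  also have "\<dots> \<le> (\<integral>\<^sup>+x. ennreal (norm (b x)) \<partial>torus I)"
  proof (rule nn_integral_mono_AE)
    show "AE x in torus I. (\<integral>\<^sup>+t. ennreal (norm (f (x(i := t)))) \<partial>angle_unif) \<le> ennreal (norm (b x))"
      using ae
    proof eventually_elim
      case (elim x)
      have "(\<integral>\<^sup>+t. ennreal (norm (f (x(i := t)))) \<partial>angle_unif) = ennreal (\<integral>t. norm (f (x(i := t))) \<partial>angle_unif)"
        using elim by (intro nn_integral_eq_integral) auto
      also have "\<dots> \<le> ennreal (norm (b x))" using elim by (intro ennreal_leI) auto
      finally show ?case .
    qed
  qed
  also have "\<dots> < \<infinity>" using b by (simp add: integrable_iff_bounded)
  finally show fi: "integrable (torus (insert i I)) f" by (simp add: integrable_iff_bounded)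
  have "(\<integral>x. f x \<partial>torus (insert i I)) = (\<integral>x. (\<integral>t. f (x(i := t)) \<partial>angle_unif) \<partial>torus I)"
    by (rule torus.product_integral_insert[OF I fi])
  also have "\<dots> = (\<integral>x. g x \<partial>torus I)"
  proof (rule integral_cong_AE)
    show "(\<lambda>x. \<integral>t. f (x(i := t)) \<partial>angle_unif) \<in> borel_measurable (torus I)"
      by (rule angle.borel_measurable_lebesgue_integral) (simp add: case_prod_beta, measurable)
    show "AE x in torus I. (\<integral>t. f (x(i := t)) \<partial>angle_unif) = g x" using ae by eventually_elim auto
  qed measurable
  finally show "(\<integral>x. f x \<partial>torus (insert i I)) = (\<integral>x. g x \<partial>torus I)" .
qed

section \<open>Exchangeability\<close>

lemma integral_sech_law:
  fixes f :: "real \<Rightarrow> real"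
  assumes "k \<ge> 1" "f \<in> borel_measurable borel"
  shows "(\<integral>s. f s \<partial>sech_law k) = (\<integral>s. f s * sech_density k s \<partial>lborel)"
  using assms by (simp add: sech_law_density integral_density_cauchy)

lemma integrable_sech_law:
  fixes f :: "real \<Rightarrow> real"
  assumes [measurable]: "f \<in> borel_measurable borel" and bound: "\<And>s. \<bar>f s\<bar> \<le> C * (1 + \<bar>s\<bar>) ^ m"
  shows "integrable (sech_law k) f"
proof (cases "k = 0")
  case True
  show ?thesis unfolding True sech_law.simps
    by (intro integrableI_bounded) (auto simp: nn_integral_return)
next
  case False
  have "integrable lborel (\<lambda>s. f s * sech_density k s)"
    by (rule integrable_poly_growth_cauchy[OF assms])
  thus ?thesis using False
    by (subst sech_law_density) (auto simp: integrable_density sech_density_nonneg mult.commute)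
qed

interpretation step: prob_space sech_step
  by (rule prob_space_sech_step)

interpretation steps: product_prob_space "\<lambda>_ :: nat. sech_step" "UNIV :: nat set"
  by unfold_locales

abbreviation steps :: "nat set \<Rightarrow> (nat \<Rightarrow> real) measure" where
  "steps I \<equiv> PiM I (\<lambda>_. sech_step)"

lemma nn_integral_steps_sum:
  assumes "finite I" "f \<in> borel_measurable borel"
  shows "(\<integral>\<^sup>+x. f (\<Sum>i\<in>I. x i) \<partial>steps I) = (\<integral>\<^sup>+s. f s \<partial>sech_law (card I))"
  using assms
proof (induction I arbitrary: f rule: finite_induct)
  case empty
  note [measurable] = empty
  have "(\<integral>\<^sup>+x. f (\<Sum>i\<in>{}. x i) \<partial>steps {}) = f (\<Sum>i\<in>({}::nat set). (\<lambda>k. undefined) i)"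
    by (rule steps.nn_integral_empty) simp
  thus ?case by (simp add: sech_law.simps nn_integral_return)
next
  case (insert i I)
  note [measurable] = insert.prems
  have c: "card (insert i I) = Suc (card I)" using insert.hyps by simp
  interpret A: prob_space "sech_law (card I)" by (rule prob_space_sech_law)
  interpret P: pair_sigma_finite "sech_law (card I)" sech_step ..
  have "(\<integral>\<^sup>+x. f (\<Sum>j\<in>insert i I. x j) \<partial>steps (insert i I)) =
    (\<integral>\<^sup>+y. (\<integral>\<^sup>+x. f (\<Sum>j\<in>insert i I. (x(i := y)) j) \<partial>steps I) \<partial>sech_step)"
    by (rule steps.product_nn_integral_insert_rev) (use insert.hyps in measurable)
  also have "\<dots> = (\<integral>\<^sup>+y. (\<integral>\<^sup>+x. f (y + (\<Sum>j\<in>I. x j)) \<partial>steps I) \<partial>sech_step)"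
  proof -
    have "(\<Sum>j\<in>insert i I. (x(i := y)) j) = y + (\<Sum>j\<in>I. x j)" for x and y :: real
      using insert.hyps by (subst sum.insert) (auto intro!: arg_cong2[where f = "(+)"] sum.cong simp: fun_upd_def split: if_splits)
    thus ?thesis by simp
  qed
  also have "\<dots> = (\<integral>\<^sup>+y. \<integral>\<^sup>+s. (\<lambda>(s, y). f (s + y)) (s, y) \<partial>sech_law (card I) \<partial>sech_step)"
  proof (rule nn_integral_cong)
    fix y
    show "(\<integral>\<^sup>+x. f (y + (\<Sum>j\<in>I. x j)) \<partial>steps I) = (\<integral>\<^sup>+s. (\<lambda>(s, y). f (s + y)) (s, y) \<partial>sech_law (card I))"
      using insert.IH[of "\<lambda>p. f (y + p)"] by (simp add: add.commute)
  qed
  also have "\<dots> = (\<integral>\<^sup>+s. \<integral>\<^sup>+y. (\<lambda>(s, y). f (s + y)) (s, y) \<partial>sech_step \<partial>sech_law (card I))"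
    by (rule P.Fubini) measurable
  also have "\<dots> = (\<integral>\<^sup>+x. f x \<partial>(sech_law (card I) \<star> sech_step))"
    using step.finite_measure_axioms by (subst nn_integral_convolution) auto
  finally show ?case by (simp only: c sech_law.simps)
qed

text \<open>This is the independence of one coordinate and the sum of the others. The right-hand
  side depends on \<open>I\<close> only through its size and does not mention \<open>i\<close>,
  which is the exchangeability used below.\<close>

lemma distr_steps_pair:
  assumes "finite I" "i \<notin> I"
  shows "distr (steps (insert i I)) (borel \<Otimes>\<^sub>M borel) (\<lambda>x. (x i, \<Sum>j\<in>I. x j)) = sech_step \<Otimes>\<^sub>M sech_law (card I)"
proof (rule measure_eqI)
  interpret A: prob_space "sech_law (card I)" by (rule prob_space_sech_law)
  show "sets (distr (steps (insert i I)) (borel \<Otimes>\<^sub>M borel) (\<lambda>x. (x i, \<Sum>j\<in>I. x j))) = sets (sech_step \<Otimes>\<^sub>M sech_law (card I))"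
    by (subst sets_distr, rule sets_pair_measure_cong) simp_all
  fix X assume "X \<in> sets (distr (steps (insert i I)) (borel \<Otimes>\<^sub>M borel) (\<lambda>x. (x i, \<Sum>j\<in>I. x j)))"
  hence X [measurable]: "X \<in> sets (borel \<Otimes>\<^sub>M borel)" by simp
  have X' [measurable]: "X \<in> sets (sech_step \<Otimes>\<^sub>M sech_law (card I))"
  proof -
    have "sets (borel \<Otimes>\<^sub>M borel) = sets (sech_step \<Otimes>\<^sub>M sech_law (card I))"
      by (rule sets_pair_measure_cong) simp_all
    thus ?thesis using X by (simp only:)
  qed
  have m: "(\<lambda>x. (x i, \<Sum>j\<in>I. x j)) \<in> measurable (steps (insert i I)) (borel \<Otimes>\<^sub>M borel)"
    by measurable
  have "emeasure (distr (steps (insert i I)) (borel \<Otimes>\<^sub>M borel) (\<lambda>x. (x i, \<Sum>j\<in>I. x j))) X =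
      (\<integral>\<^sup>+p. indicator X p \<partial>distr (steps (insert i I)) (borel \<Otimes>\<^sub>M borel) (\<lambda>x. (x i, \<Sum>j\<in>I. x j)))"
    by simp
  also have "\<dots> = (\<integral>\<^sup>+x. indicator X (x i, \<Sum>j\<in>I. x j) \<partial>steps (insert i I))"
    by (rule nn_integral_distr[OF m]) measurable
  also have "\<dots> = (\<integral>\<^sup>+y. (\<integral>\<^sup>+x. indicator X ((x(i := y)) i, \<Sum>j\<in>I. (x(i := y)) j) \<partial>steps I) \<partial>sech_step)"
    by (rule steps.product_nn_integral_insert_rev[OF assms]) measurable
  also have "\<dots> = (\<integral>\<^sup>+y. (\<integral>\<^sup>+x. indicator X (y, \<Sum>j\<in>I. x j) \<partial>steps I) \<partial>sech_step)"
  proof -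
    have "(\<Sum>j\<in>I. (x(i := y)) j) = (\<Sum>j\<in>I. x j)" for x and y :: real
      using assms by (auto intro!: sum.cong)
    thus ?thesis by (simp only: fun_upd_same)
  qed
  also have "\<dots> = (\<integral>\<^sup>+y. (\<integral>\<^sup>+s. indicator X (y, s) \<partial>sech_law (card I)) \<partial>sech_step)"
    by (intro nn_integral_cong nn_integral_steps_sum[OF assms(1)]) measurable
  also have "\<dots> = (\<integral>\<^sup>+p. indicator X p \<partial>(sech_step \<Otimes>\<^sub>M sech_law (card I)))"
    by (rule A.nn_integral_fst) measurable
  finally show "emeasure (distr (steps (insert i I)) (borel \<Otimes>\<^sub>M borel) (\<lambda>x. (x i, \<Sum>j\<in>I. x j))) X = emeasure (sech_step \<Otimes>\<^sub>M sech_law (card I)) X"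
    by simp
qed

text \<open>Expanding the first factor as the sum of all coordinates writes the left side as
  \<open>k + 1\<close> integrals over the pair formed by one coordinate and the sum of the others;
  all of them have the same value \<open>J\<close>. The second conclusion makes it possible to add
  such inner means under a further integral.\<close>

lemma sech_law_exchange:
  fixes f :: "real \<Rightarrow> real"
  assumes [measurable]: "f \<in> borel_measurable borel" and bound: "\<And>s. \<bar>f s\<bar> \<le> C * (1 + \<bar>s\<bar>) ^ m"
  shows "(\<integral>s. s * f s \<partial>sech_law (Suc k)) =
     real (Suc k) * (\<integral>s. \<integral>t. t * f (s + t) \<partial>sech_step \<partial>sech_law k)"
    and "integrable (sech_law k) (\<lambda>s. \<integral>t. t * f (s + t) \<partial>sech_step)"
proof -
  interpret A: prob_space "sech_law k" by (rule prob_space_sech_law)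
  interpret P: pair_prob_space sech_step "sech_law k" ..
  define I where "I = {..k}"
  have fI: "finite I" "card I = Suc k" by (auto simp: I_def)
  define g where "g = (\<lambda>p::real\<times>real. fst p * f (snd p + fst p))"
  have gm [measurable]: "g \<in> borel_measurable (borel \<Otimes>\<^sub>M borel)" unfolding g_def by measurable
  have C0: "C \<ge> 0" using bound[of 0] by (simp add: order_trans[OF abs_ge_zero])
  have pairint: "integrable (sech_step \<Otimes>\<^sub>M sech_law k) g"
  proof (rule Bochner_Integration.integrable_bound)
    define h1 h2 where "h1 = (\<lambda>t::real. C * (1 + \<bar>t\<bar>) ^ Suc m)" and "h2 = (\<lambda>s::real. (1 + \<bar>s\<bar>) ^ m)"
    have i1: "integrable sech_step h1"
      using integrable_sech_law[of h1 C "Suc m" 1] C0 unfolding sech_law_1 h1_def by (simp add: abs_mult)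
    have i2: "integrable (sech_law k) h2"
      by (rule integrable_sech_law[of _ 1 m]) (auto simp: h2_def)
    show "integrable (sech_step \<Otimes>\<^sub>M sech_law k) (\<lambda>p. h1 (fst p) * h2 (snd p))"
    proof (rule P.Fubini_integrable)
      show "(\<lambda>p. h1 (fst p) * h2 (snd p)) \<in> borel_measurable (sech_step \<Otimes>\<^sub>M sech_law k)"
        unfolding h1_def h2_def by measurable
      show "integrable sech_step (\<lambda>x. \<integral>y. norm (h1 (fst (x, y)) * h2 (snd (x, y))) \<partial>sech_law k)"
        using i1 by (simp add: abs_mult)
      show "AE x in sech_step. integrable (sech_law k) (\<lambda>y. h1 (fst (x, y)) * h2 (snd (x, y)))"
        using i2 by simp
    qed
    show "AE p in sech_step \<Otimes>\<^sub>M sech_law k. norm (g p) \<le> norm (h1 (fst p) * h2 (snd p))"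
    proof (rule AE_I2)
      fix p :: "real \<times> real"
      obtain t s where p: "p = (t, s)" by (cases p)
      \<comment> \<open>Makes the growth bound split into a function of \<open>t\<close> times a
        function of \<open>s\<close>, so that integrability on the product reduces to two
        one-dimensional statements.\<close>
      have "1 + \<bar>s + t\<bar> \<le> (1 + \<bar>t\<bar>) * (1 + \<bar>s\<bar>)" by (simp add: algebra_simps abs_mult[symmetric] add_increasing2 order_trans[OF abs_triangle_ineq])
      hence "(1 + \<bar>s + t\<bar>) ^ m \<le> ((1 + \<bar>t\<bar>) * (1 + \<bar>s\<bar>)) ^ m" by (intro power_mono) auto
      hence "\<bar>f (s + t)\<bar> \<le> C * ((1 + \<bar>t\<bar>) * (1 + \<bar>s\<bar>)) ^ m"
        using order_trans[OF bound mult_left_mono[OF _ C0]] by blast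
      hence "\<bar>t\<bar> * \<bar>f (s + t)\<bar> \<le> (1 + \<bar>t\<bar>) * (C * ((1 + \<bar>t\<bar>) * (1 + \<bar>s\<bar>)) ^ m)"
        by (intro mult_mono) auto
      also have "\<dots> = h1 t * h2 s" by (simp add: h1_def h2_def power_mult_distrib)
      also have "\<dots> \<le> norm (h1 t * h2 s)" by simp
      finally show "norm (g p) \<le> norm (h1 (fst p) * h2 (snd p))" by (simp add: g_def p abs_mult)
    qed
  qed measurable
  have cp: "(\<lambda>(t, s). g (t, s)) = g" by auto
  define J where "J = (\<integral>p. g p \<partial>(sech_step \<Otimes>\<^sub>M sech_law k))"
  have each: "integrable (steps I) (\<lambda>x. x i * f (\<Sum>j\<in>I. x j)) \<and> (\<integral>x. x i * f (\<Sum>j\<in>I. x j) \<partial>steps I) = J" if i: "i \<in> I" for i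
  proof -
    define I' where "I' = I - {i}"
    have I': "finite I'" "i \<notin> I'" "card I' = k" "I = insert i I'" using fI i by (auto simp: I'_def)
    have m: "(\<lambda>x. (x i, \<Sum>j\<in>I'. x j)) \<in> measurable (steps (insert i I')) (borel \<Otimes>\<^sub>M borel)"
      by measurable
    have D: "sech_step \<Otimes>\<^sub>M sech_law k = distr (steps I) (borel \<Otimes>\<^sub>M borel) (\<lambda>x. (x i, \<Sum>j\<in>I'. x j))"
      using distr_steps_pair[OF I'(1,2)] I' by simp
    have eq: "g (x i, \<Sum>j\<in>I'. x j) = x i * f (\<Sum>j\<in>I. x j)" for x
      unfolding I'(4) using I'(1,2) by (simp add: g_def add.commute)
    have "integrable (steps I) (\<lambda>x. g (x i, \<Sum>j\<in>I'. x j))"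
      using pairint m unfolding D by (subst (asm) integrable_distr_eq) (auto simp: I'(4))
    moreover have "J = (\<integral>x. g (x i, \<Sum>j\<in>I'. x j) \<partial>steps I)"
      unfolding J_def D by (rule integral_distr) (use m I'(4) in auto)
    ultimately show ?thesis by (simp add: eq)
  qed
  have sumI: "(\<lambda>x. (\<Sum>i\<in>I. x i) * f (\<Sum>j\<in>I. x j)) = (\<lambda>x. \<Sum>i\<in>I. x i * f (\<Sum>j\<in>I. x j))"
    by (simp add: sum_distrib_right)
  have DS: "distr (steps I) borel (\<lambda>x. \<Sum>i\<in>I. x i) = sech_law (Suc k)"
  proof (rule measure_eqI)
    fix X assume "X \<in> sets (distr (steps I) borel (\<lambda>x. \<Sum>i\<in>I. x i))"
    hence [measurable]: "X \<in> sets borel" by simp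
    have "emeasure (distr (steps I) borel (\<lambda>x. \<Sum>i\<in>I. x i)) X = (\<integral>\<^sup>+p. indicator X p \<partial>distr (steps I) borel (\<lambda>x. \<Sum>i\<in>I. x i))"
      by simp
    also have "\<dots> = (\<integral>\<^sup>+x. indicator X (\<Sum>i\<in>I. x i) \<partial>steps I)"
      by (rule nn_integral_distr) measurable
    also have "\<dots> = (\<integral>\<^sup>+s. indicator X s \<partial>sech_law (Suc k))"
      unfolding fI(2)[symmetric] by (rule nn_integral_steps_sum[OF fI(1)]) simp
    finally show "emeasure (distr (steps I) borel (\<lambda>x. \<Sum>i\<in>I. x i)) X = emeasure (sech_law (Suc k)) X" by simp
  qed simp
  have "(\<integral>s. s * f s \<partial>sech_law (Suc k)) = (\<integral>x. (\<Sum>i\<in>I. x i) * f (\<Sum>j\<in>I. x j) \<partial>steps I)"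
    unfolding DS[symmetric] by (rule integral_distr) measurable
  also have "\<dots> = (\<Sum>i\<in>I. \<integral>x. x i * f (\<Sum>j\<in>I. x j) \<partial>steps I)"
    unfolding sumI by (rule Bochner_Integration.integral_sum) (use each in auto)
  also have "\<dots> = real (Suc k) * J" using each fI by simp
  also have "J = (\<integral>s. \<integral>t. g (t, s) \<partial>sech_step \<partial>sech_law k)"
    unfolding J_def by (rule P.integral_snd[of "\<lambda>t s. g (t, s)", unfolded cp, OF pairint, symmetric])
  finally show "(\<integral>s. s * f s \<partial>sech_law (Suc k)) =
     real (Suc k) * (\<integral>s. \<integral>t. t * f (s + t) \<partial>sech_step \<partial>sech_law k)"
    by (simp add: g_def)
  have "integrable (sech_law k) (\<lambda>s. \<integral>t. g (t, s) \<partial>sech_step)"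
    by (rule P.integrable_snd[of "\<lambda>t s. g (t, s)", unfolded cp, OF pairint])
  thus "integrable (sech_law k) (\<lambda>s. \<integral>t. t * f (s + t) \<partial>sech_step)"
    by (simp add: g_def)
qed

lemma sech_law_Suc_integral:
  fixes f :: "real \<Rightarrow> real"
  assumes [measurable]: "f \<in> borel_measurable borel" and bound: "\<And>s. \<bar>f s\<bar> \<le> C * (1 + \<bar>s\<bar>) ^ m"
  shows "(\<integral>s. f s \<partial>sech_law (Suc k)) = (\<integral>s. \<integral>t. f (s + t) \<partial>sech_step \<partial>sech_law k)"
    and "integrable (sech_law k) (\<lambda>s. \<integral>t. f (s + t) \<partial>sech_step)"
proof -
  interpret A: prob_space "sech_law k" by (rule prob_space_sech_law)
  interpret P: pair_prob_space "sech_law k" sech_step ..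
  have m: "(\<lambda>(x, y). x + y) \<in> measurable (sech_law k \<Otimes>\<^sub>M sech_step) borel" by measurable
  have D: "sech_law (Suc k) = distr (sech_law k \<Otimes>\<^sub>M sech_step) borel (\<lambda>(x, y). x + y)"
    by (simp only: sech_law.simps convolution_def)
  have "integrable (sech_law (Suc k)) f" by (rule integrable_sech_law[OF assms])
  hence i: "integrable (sech_law k \<Otimes>\<^sub>M sech_step) (\<lambda>p. f (fst p + snd p))"
    unfolding D using m by (subst (asm) integrable_distr_eq) (auto simp: case_prod_beta)
  have "(\<integral>s. f s \<partial>sech_law (Suc k)) = (\<integral>p. f (fst p + snd p) \<partial>(sech_law k \<Otimes>\<^sub>M sech_step))"
    unfolding D by (subst integral_distr[OF m]) (auto simp: case_prod_beta)
  also have "\<dots> = (\<integral>s. \<integral>t. f (s + t) \<partial>sech_step \<partial>sech_law k)"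
    using P.integral_fst'[OF i] by simp
  finally show "(\<integral>s. f s \<partial>sech_law (Suc k)) = (\<integral>s. \<integral>t. f (s + t) \<partial>sech_step \<partial>sech_law k)" .
  show "integrable (sech_law k) (\<lambda>s. \<integral>t. f (s + t) \<partial>sech_step)"
    using P.integrable_fst'[OF i] by simp
qed

text \<open>The signed form of \<open>nn_integral_torus_tan_prod\<close>, obtained from the positive
  and the negative part separately.\<close>

lemma integral_torus_tan_prod:
  fixes f :: "real \<Rightarrow> real"
  assumes I: "finite I" "I \<noteq> {}" and f [measurable]: "f \<in> borel_measurable borel"
    and i1: "integrable (sech_law (card I)) (\<lambda>s. f (exp s))"
    and i2: "integrable (sech_law (card I)) (\<lambda>s. f (- exp s))"
  shows "integrable (torus I) (\<lambda>\<theta>. f (\<Prod>i\<in>I. tan (\<theta> i / 2)))"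
    and "(\<integral>\<theta>. f (\<Prod>i\<in>I. tan (\<theta> i / 2)) \<partial>torus I) =
      ((\<integral>s. f (exp s) \<partial>sech_law (card I)) + (\<integral>s. f (- exp s) \<partial>sech_law (card I))) / 2"
proof -
  let ?M = "sech_law (card I)"
  have tm [measurable]: "(\<lambda>\<theta>::real. tan (\<theta> / 2)) \<in> borel_measurable borel"
    unfolding tan_def by measurable
  have half': "ennreal x / 2 = ennreal (x / 2)" if "x \<ge> 0" for x
    using divide_ennreal[of x 2] that by simp
  have half: "(\<integral>\<^sup>+\<theta>. ennreal (h (\<Prod>i\<in>I. tan (\<theta> i / 2))) \<partial>torus I) = ennreal (((\<integral>s. h (exp s) \<partial>?M) + (\<integral>s. h (- exp s) \<partial>?M)) / 2)"
    if [measurable]: "h \<in> borel_measurable borel" and nn: "\<And>x. h x \<ge> 0"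
      and h1: "integrable ?M (\<lambda>s. h (exp s))" and h2: "integrable ?M (\<lambda>s. h (- exp s))" for h :: "real \<Rightarrow> real"
  proof -
    have "(\<integral>\<^sup>+\<theta>. ennreal (h (\<Prod>i\<in>I. tan (\<theta> i / 2))) \<partial>torus I) = (\<integral>\<^sup>+s. (ennreal (h (exp s)) + ennreal (h (- exp s))) / 2 \<partial>?M)"
      by (rule nn_integral_torus_tan_prod[OF I, of "\<lambda>x. ennreal (h x)"]) measurable
    also have "\<dots> = (\<integral>\<^sup>+s. ennreal (h (exp s)) + ennreal (h (- exp s)) \<partial>?M) / 2"
      by (rule nn_integral_divide) measurable
    also have "(\<integral>\<^sup>+s. ennreal (h (exp s)) + ennreal (h (- exp s)) \<partial>?M) = (\<integral>\<^sup>+s. ennreal (h (exp s)) \<partial>?M) + (\<integral>\<^sup>+s. ennreal (h (- exp s)) \<partial>?M)"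
      by (rule nn_integral_add) measurable
    also have "\<dots> = ennreal (\<integral>s. h (exp s) \<partial>?M) + ennreal (\<integral>s. h (- exp s) \<partial>?M)"
      using h1 h2 nn by (subst (1 2) nn_integral_eq_integral) auto
    also have "\<dots> = ennreal ((\<integral>s. h (exp s) \<partial>?M) + (\<integral>s. h (- exp s) \<partial>?M))"
      by (rule ennreal_plus[symmetric]) (intro Bochner_Integration.integral_nonneg nn)+
    also have "\<dots> / 2 = ennreal (((\<integral>s. h (exp s) \<partial>?M) + (\<integral>s. h (- exp s) \<partial>?M)) / 2)"
      by (rule half') (intro add_nonneg_nonneg Bochner_Integration.integral_nonneg nn)
    finally show ?thesis .
  qed
  have "(\<integral>\<^sup>+\<theta>. ennreal \<bar>f (\<Prod>i\<in>I. tan (\<theta> i / 2))\<bar> \<partial>torus I) = ennreal (((\<integral>s. \<bar>f (exp s)\<bar> \<partial>?M) + (\<integral>s. \<bar>f (- exp s)\<bar> \<partial>?M)) / 2)"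
    by (rule half[of "\<lambda>x. \<bar>f x\<bar>"]) (use i1 i2 in auto)
  thus int: "integrable (torus I) (\<lambda>\<theta>. f (\<Prod>i\<in>I. tan (\<theta> i / 2)))"
    by (intro integrableI_bounded) auto
  have P: "(\<integral>\<^sup>+\<theta>. ennreal (max 0 (f (\<Prod>i\<in>I. tan (\<theta> i / 2)))) \<partial>torus I) = ennreal (((\<integral>s. max 0 (f (exp s)) \<partial>?M) + (\<integral>s. max 0 (f (- exp s)) \<partial>?M)) / 2)"
    by (rule half[of "\<lambda>x. max 0 (f x)"]) (use i1 i2 in auto)
  have N: "(\<integral>\<^sup>+\<theta>. ennreal (max 0 (- f (\<Prod>i\<in>I. tan (\<theta> i / 2)))) \<partial>torus I) = ennreal (((\<integral>s. max 0 (- f (exp s)) \<partial>?M) + (\<integral>s. max 0 (- f (- exp s)) \<partial>?M)) / 2)"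
    by (rule half[of "\<lambda>x. max 0 (- f x)"]) (use i1 i2 in auto)
  have mx: "ennreal (max 0 x) = ennreal x" for x by (simp add: max_def ennreal_neg)
  have pm: "(\<integral>s. max 0 (h s) \<partial>?M) - (\<integral>s. max 0 (- h s) \<partial>?M) = (\<integral>s. h s \<partial>?M)" if "integrable ?M h" for h :: "real \<Rightarrow> real"
  proof -
    have "(\<integral>s. max 0 (h s) - max 0 (- h s) \<partial>?M) = (\<integral>s. max 0 (h s) \<partial>?M) - (\<integral>s. max 0 (- h s) \<partial>?M)"
      using that by (intro Bochner_Integration.integral_diff) auto
    moreover have "max 0 (h s) - max 0 (- h s) = h s" for s by auto
    ultimately show ?thesis by simp
  qed
  have "(\<integral>\<theta>. f (\<Prod>i\<in>I. tan (\<theta> i / 2)) \<partial>torus I) =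
     enn2real (\<integral>\<^sup>+\<theta>. ennreal (f (\<Prod>i\<in>I. tan (\<theta> i / 2))) \<partial>torus I) - enn2real (\<integral>\<^sup>+\<theta>. ennreal (- f (\<Prod>i\<in>I. tan (\<theta> i / 2))) \<partial>torus I)"
    by (rule real_lebesgue_integral_def[OF int])
  also have "\<dots> = ((\<integral>s. max 0 (f (exp s)) \<partial>?M) + (\<integral>s. max 0 (f (- exp s)) \<partial>?M)) / 2 - ((\<integral>s. max 0 (- f (exp s)) \<partial>?M) + (\<integral>s. max 0 (- f (- exp s)) \<partial>?M)) / 2"
    unfolding P[unfolded mx] N[unfolded mx]
    by (intro arg_cong2[where f = "(-)"] enn2real_ennreal divide_nonneg_nonneg add_nonneg_nonneg Bochner_Integration.integral_nonneg) simp_all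
  also have "\<dots> = ((\<integral>s. f (exp s) \<partial>?M) + (\<integral>s. f (- exp s) \<partial>?M)) / 2"
    using pm[OF i1] pm[OF i2] by (simp add: field_simps)
  finally show "(\<integral>\<theta>. f (\<Prod>i\<in>I. tan (\<theta> i / 2)) \<partial>torus I) = ((\<integral>s. f (exp s) \<partial>?M) + (\<integral>s. f (- exp s) \<partial>?M)) / 2" .
qed

lemma integral_sech_law_reflect:
  fixes f :: "real \<Rightarrow> real"
  assumes "k \<ge> 1" and [measurable]: "f \<in> borel_measurable borel"
  shows "(\<integral>s. f (- s) \<partial>sech_law k) = (\<integral>s. f s \<partial>sech_law k)"
  using lborel_integral_real_affine[of "-1" "\<lambda>s. f s * sech_density k s" 0]
  by (simp add: integral_sech_law[OF assms(1)])

lemma integral_sech_law_id: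
  assumes "k \<ge> 1" shows "(\<integral>s. s \<partial>sech_law k) = 0"
  using integral_sech_law_reflect[OF assms, of "\<lambda>s. s"] by simp

section \<open>The mean of ln (2 cosh) after one more step\<close>

lemma ln_two_cosh: "ln (2 * cosh x) = 2 * (ln (1 + (exp x)\<^sup>2) / 2) - (x :: real)"
proof -
  have "2 * cosh x = (1 + (exp x)\<^sup>2) / exp x" by (simp add: cosh_def exp_minus field_simps power2_eq_square)
  moreover have "1 + (exp x)\<^sup>2 > 0" by (simp add: add_pos_nonneg)
  ultimately show ?thesis by (simp add: ln_div)
qed

lemma ln_two_cosh_half: "2 * ln (2 * cosh (x / 2)) = 2 * ln (1 + exp x) - (x :: real)"
proof -
  have "(exp (x / 2))\<^sup>2 = exp x" by (simp add: power2_eq_square flip: exp_add)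
  thus ?thesis by (simp add: ln_two_cosh[of "x / 2"])
qed

lemma ln_two_cosh_bound: "0 \<le> ln (2 * cosh (x :: real))" "ln (2 * cosh x) \<le> 1 + \<bar>x\<bar>"
proof -
  have c: "1 \<le> cosh x" by (rule cosh_real_ge_1)
  thus "0 \<le> ln (2 * cosh x)" by (intro ln_ge_zero) simp
  have "cosh x \<le> exp \<bar>x\<bar>" by (auto simp: cosh_def abs_if)
  hence "ln (2 * cosh x) \<le> ln (2 * exp \<bar>x\<bar>)" using c by (subst ln_le_cancel_iff) auto
  also have "\<dots> = ln 2 + \<bar>x\<bar>" by (simp add: ln_mult)
  also have "ln 2 \<le> (1::real)" using ln_2_less_1 by simp
  finally show "ln (2 * cosh x) \<le> 1 + \<bar>x\<bar>" by simp
qed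

text \<open>With \<open>a = e^c\<close> and \<open>tau = tan (theta / 2)\<close>, the function
  \<open>ln (1 + a^2 tau^2) / 2\<close> equals
  \<open>ln |(1 - a) + (1 + a) e^(i theta)| - ln |1 + e^(i theta)|\<close>, whose mean is
  \<open>ln (1 + a)\<close> by Jensen because \<open>|1 - a| <= 1 + a\<close>. Removing the linear
  parts on both sides turns this into the symmetric statement in \<open>cosh\<close>.\<close>

lemma integral_ln_cosh_shift:
  "(\<integral>t. ln (2 * cosh (c + t)) \<partial>sech_step) = 2 * ln (2 * cosh (c / 2))"
proof -
  define a where "a = exp c"
  have a: "a > 0" by (simp add: a_def)
  define f where "f = (\<lambda>x::real. ln (1 + (a * x)\<^sup>2) / 2)"
  have [measurable]: "f \<in> borel_measurable borel" unfolding f_def by measurable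
  have fe: "f (exp t) = (ln (2 * cosh (c + t)) + (c + t)) / 2" "f (- exp t) = f (exp t)" for t
    by (simp_all add: f_def a_def ln_two_cosh exp_add)
  have lc: "integrable (sech_law 1) (\<lambda>t. ln (2 * cosh (c + t)))"
  proof (rule integrable_sech_law[of _ "1 + \<bar>c\<bar>" 1])
    fix s
    have "\<bar>ln (2 * cosh (c + s))\<bar> \<le> 1 + (\<bar>c\<bar> + \<bar>s\<bar>)" using ln_two_cosh_bound[of "c + s"] by auto
    also have "\<dots> \<le> (1 + \<bar>c\<bar>) * (1 + \<bar>s\<bar>) ^ 1" by (simp add: algebra_simps)
    finally show "\<bar>ln (2 * cosh (c + s))\<bar> \<le> (1 + \<bar>c\<bar>) * (1 + \<bar>s\<bar>) ^ 1" .
  qed measurable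
  have idi: "integrable (sech_law 1) (\<lambda>t. t)"
    by (rule integrable_sech_law[of _ 1 1]) auto
  interpret L: prob_space "sech_law 1" by (rule prob_space_sech_law)
  have fi: "integrable (sech_law 1) (\<lambda>t. f (exp t))"
    unfolding fe by (intro integrable_divide Bochner_Integration.integrable_add lc idi L.integrable_const)
  have E: "(\<integral>t. f (exp t) \<partial>sech_law 1) = ((\<integral>t. ln (2 * cosh (c + t)) \<partial>sech_law 1) + c) / 2"
  proof -
    have "(\<integral>t. f (exp t) \<partial>sech_law 1) = ((\<integral>t. ln (2 * cosh (c + t)) \<partial>sech_law 1) + ((\<integral>t. c \<partial>sech_law 1) + (\<integral>t. t \<partial>sech_law 1))) / 2"
      unfolding fe
      by (subst integral_divide_zero, subst Bochner_Integration.integral_add[OF lc], intro Bochner_Integration.integrable_add idi L.integrable_const,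
          subst Bochner_Integration.integral_add[OF L.integrable_const idi], rule refl)
    thus ?thesis using integral_sech_law_id[of 1] L.prob_space by (simp del: One_nat_def)
  qed
  have cd: "sech_law (card {0::nat}) = sech_law 1" by simp
  have A: "(\<integral>\<theta>. f (tan (\<theta> 0 / 2)) \<partial>torus {0}) = (\<integral>t. f (exp t) \<partial>sech_law 1)"
    using integral_torus_tan_prod(2)[of "{0}" f, unfolded cd] fi by (simp add: fe(2) del: One_nat_def)
  have tm [measurable]: "(\<lambda>\<theta>::real. tan (\<theta> / 2)) \<in> borel_measurable borel"
    unfolding tan_def by measurable
  have "(\<integral>\<theta>. f (tan (\<theta> 0 / 2)) \<partial>torus {0}) = (\<integral>\<theta>. f (tan (\<theta> / 2)) \<partial>angle_unif)"
    by (rule torus.product_integral_singleton) measurable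
  also have "\<dots> = (\<integral>\<theta>. ln (cmod ((1 - of_real a) + (1 + of_real a) * cis \<theta>)) - ln (cmod (1 + 1 * cis \<theta>)) \<partial>angle_unif)"
  proof (rule integral_cong_AE)
    show "AE \<theta> in angle_unif. f (tan (\<theta> / 2)) = ln (cmod ((1 - of_real a) + (1 + of_real a) * cis \<theta>)) - ln (cmod (1 + 1 * cis \<theta>))"
      using AE_angle_cis_neq[of "-1"]
    proof eventually_elim
      case (elim \<theta>)
      define x where "x = \<theta> / 2"
      have cis2: "cis \<theta> = cis x * cis x" by (simp add: x_def cis_mult)
      have cx: "cos x \<noteq> 0"
      proof
        assume "cos x = 0"
        hence "cis x * cis x = -1" using sin_cos_squared_add[of x] by (simp add: complex_eq_iff power2_eq_square)
        thus False using elim cis2 by simp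
      qed
      have e1: "1 + cis \<theta> = cis x * of_real (2 * cos x)"
        unfolding cis2 using sin_cos_squared_add[of x] by (simp add: complex_eq_iff power2_eq_square algebra_simps)
      have sc: "a * (cos x * cos x) + a * (sin x * sin x) = a"
        using sin_cos_squared_add2[of x] by (simp add: distrib_left[symmetric] power2_eq_square)
      \<comment> \<open>With \<open>x = theta / 2\<close>, factoring \<open>e^(i x)\<close> out of
        \<open>(1 + e^(2 i x)) + a (e^(2 i x) - 1)\<close> leaves
        \<open>2 cos x + 2 i a sin x\<close>.\<close>
      have e2: "(1 - of_real a) + (1 + of_real a) * cis \<theta> = cis x * Complex (2 * cos x) (2 * a * sin x)"
        unfolding cis2 using sin_cos_squared_add[of x] sc by (simp add: complex_eq_iff power2_eq_square algebra_simps)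
      have "cmod ((1 - of_real a) + (1 + of_real a) * cis \<theta>) = sqrt ((2 * cos x)\<^sup>2 + (2 * a * sin x)\<^sup>2)"
        unfolding e2 by (simp add: norm_mult complex_norm)
      also have "(2 * cos x)\<^sup>2 + (2 * a * sin x)\<^sup>2 = (2 * cos x)\<^sup>2 * (1 + (a * tan x)\<^sup>2)"
        using cx by (simp add: tan_def field_simps power2_eq_square)
      finally have n2: "cmod ((1 - of_real a) + (1 + of_real a) * cis \<theta>) = 2 * \<bar>cos x\<bar> * sqrt (1 + (a * tan x)\<^sup>2)"
        by (simp add: real_sqrt_mult)
      have n1: "cmod (1 + 1 * cis \<theta>) = 2 * \<bar>cos x\<bar>" using e1 by (simp add: norm_mult)
      have "sqrt (1 + (a * tan x)\<^sup>2) > 0" by (simp add: add_pos_nonneg)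
      hence "ln (2 * \<bar>cos x\<bar> * sqrt (1 + (a * tan x)\<^sup>2)) - ln (2 * \<bar>cos x\<bar>) = ln (sqrt (1 + (a * tan x)\<^sup>2))"
        using cx by (subst ln_mult) auto
      also have "\<dots> = f (tan x)" by (simp add: f_def ln_sqrt add_pos_nonneg)
      finally show ?case unfolding n1 n2 by (simp add: x_def)
    qed
  qed measurable
  also have "\<dots> = ln (1 + a)"
    using jensen_linear[of "1 - of_real a" "1 + of_real a"] jensen_linear[of 1 1] a
  proof -
    have nz: "1 - of_real a \<noteq> (0::complex) \<or> 1 + of_real a \<noteq> (0::complex)"
      using a by (metis of_real_1 of_real_add of_real_eq_0_iff add_pos_pos zero_less_one less_irrefl)
    have c1: "cmod (1 + of_real a) = 1 + a" using a by (metis norm_of_real of_real_1 of_real_add abs_of_pos add_pos_pos zero_less_one)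
    have c2: "cmod (1 - of_real a) \<le> 1 + a" using a norm_triangle_ineq4[of 1 "of_real a :: complex"] by simp
    have "(\<integral>\<theta>. ln (cmod ((1 - of_real a) + (1 + of_real a) * cis \<theta>)) \<partial>angle_unif) = ln (1 + a)"
      using jensen_linear(2)[OF nz] c1 c2 by (simp add: max_absorb2)
    moreover have "(\<integral>\<theta>. ln (cmod (1 + 1 * cis \<theta>)) \<partial>angle_unif) = 0"
      using jensen_linear(2)[of 1 1] by simp
    ultimately show ?thesis
      using jensen_linear(1)[OF nz] jensen_linear(1)[of 1 1] by (subst Bochner_Integration.integral_diff) auto
  qed
  finally have "((\<integral>t. ln (2 * cosh (c + t)) \<partial>sech_law 1) + c) / 2 = ln (1 + exp c)"
    unfolding A E by (simp only: a_def)
  hence "(\<integral>t. ln (2 * cosh (c + t)) \<partial>sech_law 1) = 2 * ln (1 + exp c) - c"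
    by (simp add: field_simps del: One_nat_def)
  thus ?thesis unfolding ln_two_cosh_half sech_law_1 .
qed

text \<open>By symmetry of the law the part \<open>|t| < c\<close> cancels and the part
  \<open>|t| >= c\<close> contributes \<open>|t|\<close>, so the mean is the tail integral of
  \<open>2 t / (pi cosh t)\<close> from \<open>c\<close> on. This tail has no convenient closed
  form; \<open>E\<close> stands for any function with the right derivative and with limit 0 at
  infinity.\<close>

lemma nn_integral_cauchy_tail:
  fixes E :: "real \<Rightarrow> real"
  assumes c: "c \<ge> 0"
    and der: "\<And>x. (E has_real_derivative - (2 / pi * (x / cosh x))) (at x)"
    and lim: "(E \<longlongrightarrow> 0) at_top"
  shows "(\<integral>t. t * sgn (c + t) \<partial>sech_law 1) = E c"
proof -
  have "(\<integral>\<^sup>+x. ennreal (2 / pi * (x / cosh x)) * indicator {c..} x \<partial>lborel) = ennreal (0 - (- E c))"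
  proof (rule nn_integral_FTC_atLeast)
    show "(\<lambda>x. 2 / pi * (x / cosh x)) \<in> borel_measurable borel" by measurable
    show "DERIV (\<lambda>x. - E x) x :> 2 / pi * (x / cosh x)" for x
      using DERIV_minus[OF der[of x]] by simp
    show "0 \<le> 2 / pi * (x / cosh x)" if "c \<le> x" for x using that c by simp
    show "((\<lambda>x. - E x) \<longlongrightarrow> 0) at_top" using tendsto_minus[OF lim] by simp
  qed
  hence I1: "(\<integral>\<^sup>+x. ennreal (2 / pi * (x / cosh x) * indicator {c..} x) \<partial>lborel) = ennreal (E c)"
    by (simp add: nn_integral_set_ennreal)
  have Ec: "E c \<ge> 0"
  proof -
    have "E c \<ge> E y" if "c \<le> y" for y
      using that c by (intro DERIV_nonpos_imp_nonincreasing[of c y E]) (auto intro!: exI[of _ "- (2 / pi * (_ / cosh _))"] der)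
    thus ?thesis using lim by (intro tendsto_upperbound[OF lim]) (auto intro: eventually_at_top_linorderI[of c])
  qed
  have hb: "has_bochner_integral lborel (\<lambda>x. 2 / pi * (x / cosh x) * indicator {c..} x) (E c)"
    by (rule has_bochner_integral_nn_integral) (use I1 Ec c in \<open>auto simp: indicator_def\<close>)
  define h where "h = (\<lambda>t. \<bar>t\<bar> / (pi * cosh t) * indicator {c..} \<bar>t\<bar>)"
  have "has_bochner_integral lborel h (2 *\<^sub>R (E c / 2))"
  proof (rule has_bochner_integral_even_function)
    have "has_bochner_integral lborel (\<lambda>x. (2 / pi * (x / cosh x) * indicator {c..} x) / 2) (E c / 2)"
      by (intro has_bochner_integral_divide_zero hb)
    also have "(\<lambda>x. (2 / pi * (x / cosh x) * indicator {c..} x) / 2) = (\<lambda>x. indicator {0..} x *\<^sub>R h x)"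
      using c by (auto simp: fun_eq_iff h_def indicator_def)
    finally show "has_bochner_integral lborel (\<lambda>x. indicator {0..} x *\<^sub>R h x) (E c / 2)" .
  qed (simp add: h_def)
  hence H: "(\<integral>t. h t \<partial>lborel) = E c" by (simp add: has_bochner_integral_iff)
  define g where "g = (\<lambda>t. t * sgn (c + t) * sech_density 1 t)"
  have gi: "integrable lborel g"
    unfolding g_def by (rule integrable_poly_growth_cauchy[of _ 1 1]) (auto simp: sgn_if abs_mult)
  have "(\<integral>t. g (- t) \<partial>lborel) = (\<integral>t. g t \<partial>lborel)"
    using lborel_integral_real_affine[of "-1" g 0] by simp
  moreover have gi': "integrable lborel (\<lambda>t. g (- t))"
    using lborel_integrable_real_affine[OF gi, of "-1" 0] by simp
  ultimately have "(\<integral>t. g t \<partial>lborel) = (\<integral>t. (g t + g (- t)) / 2 \<partial>lborel)"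
    using gi by simp
  also have "\<dots> = (\<integral>t. h t \<partial>lborel)"
  proof (rule integral_cong_AE)
    show "AE t in lborel. (g t + g (- t)) / 2 = h t"
      using AE_lborel_singleton[of c] AE_lborel_singleton[of "- c"]
    proof eventually_elim
      case (elim t)
      have "(g t + g (- t)) / 2 = t * (sgn (c + t) - sgn (c - t)) / 2 * sech_density 1 t"
        by (simp add: g_def algebra_simps)
      also have "t * (sgn (c + t) - sgn (c - t)) / 2 = \<bar>t\<bar> * indicator {c..} \<bar>t\<bar>"
        using elim c by (auto simp: sgn_if indicator_def abs_if)
      finally show ?case by (simp add: h_def sech_density_1)
    qed
    show "(\<lambda>t. (g t + g (- t)) / 2) \<in> borel_measurable lborel" using gi gi' by auto
  qed (simp add: h_def)
  finally have "(\<integral>t. g t \<partial>lborel) = E c" using H by simp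
  thus ?thesis by (subst integral_sech_law) (auto simp: g_def)
qed

text \<open>From \<open>2 cosh ((c - t) / 2) cosh ((c + t) / 2) = cosh c + cosh t\<close> and the
  self-convolution of \<open>sech\<close>, with \<open>u = (c + t) / 2\<close>.\<close>

lemma integral_inverse_cosh_plus_cosh:
  assumes "c \<noteq> 0"
  shows "has_bochner_integral lborel (\<lambda>t. 1 / (cosh c + cosh t)) (2 * c / sinh (c::real))"
proof -
  have "has_bochner_integral lborel (\<lambda>u. 1 / (cosh (c - u) * cosh u)) (2 * c / sinh c)"
    by (rule has_bochner_integral_sech_conv[OF assms])
  from lborel_has_bochner_integral_real_affine_iff[of "1/2" "\<lambda>u. 1 / (cosh (c - u) * cosh u)" "2 * c / sinh c" "c / 2"] this
  have "has_bochner_integral lborel (\<lambda>t. 1 / (cosh (c - (c / 2 + t / 2)) * cosh (c / 2 + t / 2))) (2 * (2 * c / sinh c))"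
    by (simp add: mult.commute)
  also have "(\<lambda>t. 1 / (cosh (c - (c / 2 + t / 2)) * cosh (c / 2 + t / 2))) = (\<lambda>t. 2 * (1 / (cosh c + cosh t)))"
  proof
    fix t
    have "cosh (c - (c / 2 + t / 2)) * cosh (c / 2 + t / 2) = (cosh c + cosh t) / 2"
    proof -
      define a b where "a = c / 2" and "b = t / 2"
      have ct: "c = a + a" "t = b + b" by (auto simp: a_def b_def)
      have "c - (a + b) = a - b" using ct by simp
      hence "cosh (c - (a + b)) * cosh (a + b) = (cosh a)\<^sup>2 * (cosh b)\<^sup>2 - (sinh a)\<^sup>2 * (sinh b)\<^sup>2"
        by (simp add: cosh_add cosh_diff power2_eq_square algebra_simps)
      also have "\<dots> = (cosh c + cosh t) / 2"
        unfolding ct cosh_add using hyperbolic_pythagoras[of a] hyperbolic_pythagoras[of b]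
        by (simp add: sinh_square_eq power2_eq_square[symmetric] algebra_simps)
      finally show ?thesis by (simp add: a_def b_def)
    qed
    thus "1 / (cosh (c - (c / 2 + t / 2)) * cosh (c / 2 + t / 2)) = 2 * (1 / (cosh c + cosh t))" by (simp only:) simp
  qed
  finally have "has_bochner_integral lborel (\<lambda>t. (1 / 2) * (2 * (1 / (cosh c + cosh t)))) ((1 / 2) * (2 * (2 * c / sinh c)))"
    by (rule has_bochner_integral_mult_right)
  thus ?thesis by simp
qed

text \<open>Averaging over \<open>t\<close> and \<open>-t\<close> replaces the integrand by
  \<open>sinh c / (cosh c + cosh t)\<close>, and against the density \<open>1 / (pi cosh t)\<close>
  this decomposes into partial fractions in \<open>cosh t\<close>.\<close>

lemma integral_tanh_half_shift:
  "(\<integral>t. tanh ((c + t) / 2) \<partial>sech_law 1) = tanh c - 2 / pi * (c / cosh c)"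
proof (cases "c = 0")
  case True
  have "(\<integral>t. tanh ((- t) / 2) \<partial>sech_law 1) = (\<integral>t. tanh (t / 2) \<partial>sech_law 1)"
    by (rule integral_sech_law_reflect) auto
  thus ?thesis using True by simp
next
  case False
  have ti: "integrable (sech_law 1) (\<lambda>t. tanh ((c + s * t) / 2))" for s
    by (rule integrable_sech_law[of _ 1 0]) (use tanh_real_bounds in \<open>auto simp: abs_le_iff intro: less_imp_le\<close>)
  have "(\<integral>t. tanh ((c - t) / 2) \<partial>sech_law 1) = (\<integral>t. tanh ((c + t) / 2) \<partial>sech_law 1)"
    using integral_sech_law_reflect[of 1 "\<lambda>t. tanh ((c + t) / 2)"] by simp
  hence "(\<integral>t. tanh ((c + t) / 2) \<partial>sech_law 1) = (\<integral>t. (tanh ((c + t) / 2) + tanh ((c - t) / 2)) / 2 \<partial>sech_law 1)"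
    using ti[of 1] ti[of "-1"] by simp
  also have "\<dots> = (\<integral>t. sinh c / (cosh c + cosh t) \<partial>sech_law 1)"
  proof (rule Bochner_Integration.integral_cong[OF refl])
    fix t :: real
    define a b where "a = c / 2" and "b = t / 2"
    have ct: "c = a + a" "t = b + b" by (auto simp: a_def b_def)
    have p: "cosh (a + b) * cosh (a - b) = (cosh c + cosh t) / 2"
    proof -
      have "cosh (a + b) * cosh (a - b) = (cosh a)\<^sup>2 * (cosh b)\<^sup>2 - (sinh a)\<^sup>2 * (sinh b)\<^sup>2"
        by (simp add: cosh_add cosh_diff power2_eq_square algebra_simps)
      also have "\<dots> = (cosh c + cosh t) / 2"
        unfolding ct cosh_add by (simp add: sinh_square_eq power2_eq_square[symmetric] algebra_simps)
      finally show ?thesis .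
    qed
    have "tanh (a + b) + tanh (a - b) = (sinh (a + b) * cosh (a - b) + sinh (a - b) * cosh (a + b)) / (cosh (a + b) * cosh (a - b))"
      by (simp add: tanh_def field_simps)
    also have "sinh (a + b) * cosh (a - b) + sinh (a - b) * cosh (a + b) = sinh c"
      using sinh_add[of "a + b" "a - b"] by (simp add: ct mult.commute)
    finally have "tanh (a + b) + tanh (a - b) = sinh c / ((cosh c + cosh t) / 2)" by (simp only: p)
    moreover have "(c + t) / 2 = a + b" "(c - t) / 2 = a - b" by (auto simp: a_def b_def field_simps)
    ultimately show "(tanh ((c + t) / 2) + tanh ((c - t) / 2)) / 2 = sinh c / (cosh c + cosh t)"
      using cosh_real_pos[of c] cosh_real_pos[of t] add_pos_pos[of "cosh c" "cosh t"]
      by (simp only:) (simp add: field_simps)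
  qed
  also have "\<dots> = (\<integral>t. sinh c / (cosh c + cosh t) * sech_density 1 t \<partial>lborel)"
    by (rule integral_sech_law) auto
  also have "\<dots> = (\<integral>t. (tanh c / pi) * (1 / cosh t - 1 / (cosh c + cosh t)) \<partial>lborel)"
  proof (rule Bochner_Integration.integral_cong[OF refl])
    fix t :: real
    have p: "cosh c + cosh t > 0" "cosh t > 0" "cosh c > 0" by (auto intro: add_pos_pos)
    have "1 / cosh t - 1 / (cosh c + cosh t) = cosh c / (cosh t * (cosh c + cosh t))"
      using p diff_frac_eq[of "cosh t" "cosh c + cosh t" 1 1] less_imp_neq[OF p(1)] by simp
    thus "sinh c / (cosh c + cosh t) * sech_density 1 t = (tanh c / pi) * (1 / cosh t - 1 / (cosh c + cosh t))"
      using p by (simp add: sech_density_1 tanh_def)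
  qed
  also have "\<dots> = (tanh c / pi) * (pi - 2 * c / sinh c)"
    using integral_inverse_cosh_plus_cosh[OF False] integrable_sech integral_cos_sech[of 0]
    by (simp add: has_bochner_integral_iff)
  also have "\<dots> = tanh c - 2 / pi * (c / cosh c)"
    using False by (simp add: tanh_def field_simps)
  finally show ?thesis .
qed

text \<open>The difference between the left side and \<open>ln (2 cosh c)\<close> has derivative
  \<open>-(2 / pi) c / cosh c\<close>, by the mean of \<open>tanh\<close>, and tends to 0 at
  infinity. That is exactly the description of the tail in \<open>nn_integral_cauchy_tail\<close>;
  negative \<open>c\<close> follow by reflection.\<close>

lemma integral_ln_cosh_half_shift:
  "(\<integral>t. 2 * ln (2 * cosh ((c + t) / 2)) \<partial>sech_law 1) = ln (2 * cosh c) + (\<integral>t. t * sgn (c + t) \<partial>sech_law 1)"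
proof -
  interpret L: prob_space "sech_law 1" by (rule prob_space_sech_law)
  define F where "F = (\<lambda>c. \<integral>t. 2 * ln (2 * cosh ((c + t) / 2)) \<partial>sech_law 1)"
  define E where "E = (\<lambda>c. F c - ln (2 * cosh c))"
  have int: "integrable (sech_law 1) (\<lambda>t. 2 * ln (2 * cosh ((c + t) / 2)))" for c
  proof (rule integrable_sech_law[of _ "2 + \<bar>c\<bar>" 1])
    fix s
    have "\<bar>2 * ln (2 * cosh ((c + s) / 2))\<bar> \<le> 2 + (\<bar>c\<bar> + \<bar>s\<bar>)" using ln_two_cosh_bound[of "(c + s) / 2"] abs_triangle_ineq[of c s] by auto
    also have "\<dots> \<le> (2 + \<bar>c\<bar>) * (1 + \<bar>s\<bar>) ^ 1" by (simp add: algebra_simps)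
    finally show "\<bar>2 * ln (2 * cosh ((c + s) / 2))\<bar> \<le> (2 + \<bar>c\<bar>) * (1 + \<bar>s\<bar>) ^ 1" .
  qed measurable
  have dF: "(F has_real_derivative (\<integral>t. tanh ((c + t) / 2) \<partial>sech_law 1)) (at c)" for c
    unfolding F_def
  proof (rule has_real_derivative_integral[where g = "\<lambda>_. 1"])
    show "((\<lambda>c. 2 * ln (2 * cosh ((c + t) / 2))) has_real_derivative tanh ((c + t) / 2)) (at c)" for c t
      by (auto intro!: derivative_eq_intros simp: tanh_def field_simps)
    show "\<bar>tanh ((c + t) / 2)\<bar> \<le> 1" for c t :: real
      using tanh_real_bounds[of "(c + t) / 2"] by (auto simp: abs_le_iff)
    show "integrable (sech_law 1) (\<lambda>_. 1 :: real)" by (rule L.integrable_const)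
    show "integrable (sech_law 1) (\<lambda>t. 2 * ln (2 * cosh ((c + t) / 2)))" for c by (rule int)
    show "(\<lambda>t. tanh ((c + t) / 2)) \<in> borel_measurable (sech_law 1)" by measurable
  qed
  have dE: "(E has_real_derivative - (2 / pi * (x / cosh x))) (at x)" for x
  proof -
    have "((\<lambda>c. ln (2 * cosh c)) has_real_derivative tanh x) (at x)"
      by (auto intro!: derivative_eq_intros simp: tanh_def field_simps)
    from DERIV_diff[OF dF this] show ?thesis unfolding E_def integral_tanh_half_shift by simp
  qed
  \<comment> \<open>Both terms of \<open>E\<close> are compared with \<open>c\<close>: the first
    leaves the mean of \<open>2 ln (1 + e^(-(c + t)))\<close>, dominated by \<open>2 + 2 |t|\<close>
    for \<open>c >= 0\<close>, and the second leaves \<open>ln (1 + e^(-2 c))\<close>.\<close>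
  have lim: "(E \<longlongrightarrow> 0) at_top"
  proof -
    have E_eq: "E c = (\<integral>t. 2 * ln (1 + exp (- (c + t))) \<partial>sech_law 1) - (ln (2 * cosh c) - c)" for c
    proof -
      have i: "integrable (sech_law 1) (\<lambda>t. t)" by (rule integrable_sech_law[of _ 1 1]) auto
      have eq: "2 * ln (1 + exp (- (c + t))) = 2 * ln (2 * cosh ((c + t) / 2)) - (c + t)" for t
        using ln_two_cosh_half[of "- (c + t)"] unfolding minus_divide_left[symmetric] cosh_minus by linarith
      have "(\<integral>t. 2 * ln (1 + exp (- (c + t))) \<partial>sech_law 1) = F c - (\<integral>t. c + t \<partial>sech_law 1)"
        unfolding eq F_def by (rule Bochner_Integration.integral_diff[OF int]) (intro Bochner_Integration.integrable_add i L.integrable_const)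
      also have "(\<integral>t. c + t \<partial>sech_law 1) = c"
        using Bochner_Integration.integral_add[OF L.integrable_const[of c] i] integral_sech_law_id[of 1] L.prob_space by (simp del: One_nat_def)
      finally show ?thesis by (simp add: E_def)
    qed
    have "((\<lambda>c. \<integral>t. 2 * ln (1 + exp (- (c + t))) \<partial>sech_law 1) \<longlongrightarrow> (\<integral>t. 0 \<partial>sech_law 1)) at_top"
    proof (rule integral_dominated_convergence_at_top[where w = "\<lambda>t. 2 + 2 * \<bar>t\<bar>"])
      show "integrable (sech_law 1) (\<lambda>t. 2 + 2 * \<bar>t\<bar>)"
        by (rule integrable_sech_law[of _ 2 1]) auto
      show "\<forall>\<^sub>F c in at_top. AE t in sech_law 1. norm (2 * ln (1 + exp (- (c + t)))) \<le> 2 + 2 * \<bar>t\<bar>"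
        using eventually_ge_at_top[of 0]
      proof eventually_elim
        case (elim c)
        show ?case
        proof (rule AE_I2)
          fix t
          have "exp (- (c + t)) \<le> exp \<bar>t\<bar>" using elim by simp
          moreover have "1 \<le> exp \<bar>t\<bar>" by simp
          ultimately have "1 + exp (- (c + t)) \<le> 2 * exp \<bar>t\<bar>" by linarith
          hence "ln (1 + exp (- (c + t))) \<le> ln (2 * exp \<bar>t\<bar>)"
            by (subst ln_le_cancel_iff) (auto intro: add_pos_pos)
          also have "\<dots> = ln 2 + \<bar>t\<bar>" by (simp add: ln_mult)
          also have "\<dots> \<le> 1 + \<bar>t\<bar>" using ln_2_less_1 by simp
          finally have "ln (1 + exp (- (c + t))) \<le> 1 + \<bar>t\<bar>" .
          moreover have "ln (1 + exp (- (c + t))) \<ge> 0" by (intro ln_ge_zero) simp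
          ultimately show "norm (2 * ln (1 + exp (- (c + t)))) \<le> 2 + 2 * \<bar>t\<bar>" by simp
        qed
      qed
      show "AE t in sech_law 1. ((\<lambda>c. 2 * ln (1 + exp (- (c + t)))) \<longlongrightarrow> 0) at_top"
        by (rule AE_I2) real_asymp
    qed measurable
    moreover have "((\<lambda>c. ln (2 * cosh c) - c) \<longlongrightarrow> (0::real)) at_top"
    proof -
      have "ln (2 * cosh c) - c = ln (1 + exp (- 2 * c))" for c :: real
        using ln_two_cosh_half[of "- (2 * c)"] by simp
      moreover have "((\<lambda>c::real. ln (1 + exp (- 2 * c))) \<longlongrightarrow> 0) at_top" by real_asymp
      ultimately show ?thesis by simp
    qed
    ultimately show ?thesis unfolding E_eq using tendsto_diff by fastforce
  qed
  have pos: "(\<integral>t. t * sgn (c + t) \<partial>sech_law 1) = F c - ln (2 * cosh c)" if "c \<ge> 0" for c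
    using nn_integral_cauchy_tail[OF that dE lim] by (simp add: E_def)
  show ?thesis
  proof (cases "c \<ge> 0")
    case True thus ?thesis using pos[OF True] by (simp add: F_def)
  next
    case False
    have "(\<integral>t. t * sgn (c + t) \<partial>sech_law 1) = (\<integral>t. (- t) * sgn (c + (- t)) \<partial>sech_law 1)"
      by (rule integral_sech_law_reflect[symmetric]) auto
    also have "(\<lambda>t. (- t) * sgn (c + (- t))) = (\<lambda>t. t * sgn (- c + t))"
      by (auto simp: fun_eq_iff sgn_if)
    also have "(\<integral>t. t * sgn (- c + t) \<partial>sech_law 1) = F (- c) - ln (2 * cosh (- c))"
      by (rule pos) (use False in simp)
    also have "F (- c) = (\<integral>t. 2 * ln (2 * cosh ((- c + (- t)) / 2)) \<partial>sech_law 1)"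
      unfolding F_def by (rule integral_sech_law_reflect[symmetric]) auto
    also have "\<dots> = F c"
    proof -
      have "cosh ((- c + (- t)) / 2) = cosh ((c + t) / 2)" for t :: real
        using cosh_minus[of "(c + t) / 2"] by (simp add: field_simps)
      thus ?thesis by (simp only: F_def)
    qed
    finally show ?thesis by (simp add: F_def)
  qed
qed

text \<open>
  Adding one more step turns \<open>ln (2 cosh)\<close> into \<open>2 ln (2 cosh (\<sqdot>/2))\<close>, and adding another one returns
  it to \<open>ln (2 cosh)\<close> up to an explicit error, which by exchangeability is an absolute first moment.
\<close>

lemma integral_ln_cosh_sech_law:
  "(\<integral>s. ln (2 * cosh s) \<partial>sech_law (2 * n + 1)) = 2 * ln 2 + (\<Sum>j=1..n. (\<integral>s. \<bar>s\<bar> \<partial>sech_law (2 * j)) / real (2 * j))"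
  and integral_ln_cosh_half_sech_law:
  "(\<integral>s. 2 * ln (2 * cosh (s / 2)) \<partial>sech_law (2 * n)) = 2 * ln 2 + (\<Sum>j=1..n. (\<integral>s. \<bar>s\<bar> \<partial>sech_law (2 * j)) / real (2 * j))"
proof -
  have b1: "\<bar>ln (2 * cosh s)\<bar> \<le> 1 * (1 + \<bar>s\<bar>) ^ 1" for s :: real
    using ln_two_cosh_bound[of s] by auto
  have b2: "\<bar>2 * ln (2 * cosh (s / 2))\<bar> \<le> 2 * (1 + \<bar>s\<bar>) ^ 1" for s :: real
    using ln_two_cosh_bound[of "s / 2"] by auto
  have b3: "\<bar>sgn s\<bar> \<le> 1 * (1 + \<bar>s\<bar>) ^ 0" for s :: real by (simp add: sgn_if)
  have m: "(\<lambda>s::real. ln (2 * cosh s)) \<in> borel_measurable borel" "(\<lambda>s::real. 2 * ln (2 * cosh (s / 2))) \<in> borel_measurable borel"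
    "(sgn :: real \<Rightarrow> real) \<in> borel_measurable borel" by measurable
  have A: "(\<integral>s. ln (2 * cosh s) \<partial>sech_law (Suc k)) = (\<integral>s. 2 * ln (2 * cosh (s / 2)) \<partial>sech_law k)" for k
    unfolding sech_law_Suc_integral(1)[OF m(1) b1] integral_ln_cosh_shift ..
  have B: "(\<integral>s. 2 * ln (2 * cosh (s / 2)) \<partial>sech_law (Suc k)) = (\<integral>s. ln (2 * cosh s) \<partial>sech_law k) + (\<integral>s. \<bar>s\<bar> \<partial>sech_law (Suc k)) / real (Suc k)" for k
  proof -
    have "(\<integral>s. 2 * ln (2 * cosh (s / 2)) \<partial>sech_law (Suc k)) = (\<integral>s. (ln (2 * cosh s) + (\<integral>t. t * sgn (s + t) \<partial>sech_step)) \<partial>sech_law k)"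
      unfolding sech_law_Suc_integral(1)[OF m(2) b2] integral_ln_cosh_half_shift[unfolded sech_law_1] ..
    also have "\<dots> = (\<integral>s. ln (2 * cosh s) \<partial>sech_law k) + (\<integral>s. \<integral>t. t * sgn (s + t) \<partial>sech_step \<partial>sech_law k)"
      by (rule Bochner_Integration.integral_add[OF integrable_sech_law[OF m(1) b1] sech_law_exchange(2)[OF m(3) b3]])
    also have "(\<integral>s. \<integral>t. t * sgn (s + t) \<partial>sech_step \<partial>sech_law k) = (\<integral>s. s * sgn s \<partial>sech_law (Suc k)) / real (Suc k)"
      using sech_law_exchange(1)[OF m(3) b3, of k] by simp
    also have "(\<lambda>s::real. s * sgn s) = (\<lambda>s. \<bar>s\<bar>)" by (simp add: fun_eq_iff abs_sgn)
    finally show ?thesis .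
  qed
  have C: "(\<integral>s. 2 * ln (2 * cosh (s / 2)) \<partial>sech_law (2 * n)) = 2 * ln 2 + (\<Sum>j=1..n. (\<integral>s. \<bar>s\<bar> \<partial>sech_law (2 * j)) / real (2 * j))" for n
  proof (induction n)
    \<comment> \<open>With no step the sum is 0, and \<open>2 ln (2 cosh 0) = 2 ln 2\<close>. This
      start value is the source of the \<open>log 2\<close> term in (iii).\<close>
    case 0
    have "(\<integral>s. 2 * ln (2 * cosh (s / 2)) \<partial>return borel 0) = 2 * ln (2 * cosh (0 / 2 :: real))"
      by (rule integral_return) auto
    thus ?case by (simp add: sech_law.simps)
  next
    case (Suc n)
    have e: "2 * Suc n = Suc (Suc (2 * n))" by simp
    show ?case using B[of "Suc (2 * n)"] A[of "2 * n"] Suc.IH unfolding e by (simp only: sum.cl_ivl_Suc) (simp add: e)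
  qed
  show "(\<integral>s. 2 * ln (2 * cosh (s / 2)) \<partial>sech_law (2 * n)) = 2 * ln 2 + (\<Sum>j=1..n. (\<integral>s. \<bar>s\<bar> \<partial>sech_law (2 * j)) / real (2 * j))"
    by (rule C)
  show "(\<integral>s. ln (2 * cosh s) \<partial>sech_law (2 * n + 1)) = 2 * ln 2 + (\<Sum>j=1..n. (\<integral>s. \<bar>s\<bar> \<partial>sech_law (2 * j)) / real (2 * j))"
    using A[of "2 * n"] C by simp
qed

section \<open>The ratio of two linear factors\<close>

text \<open>With \<open>\<tau> = tan (\<theta> / 2)\<close> one has \<open>ln |1 + x| = ln 2 - ln (1 + \<tau>\<^sup>2) / 2\<close>; this is the density of the last term.\<close>

definition half_log_density :: "real \<Rightarrow> real" where
  "half_log_density z = (if z > 0 then 2 / (pi * sqrt (exp (2 * z) - 1)) else 0)"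

lemma half_log_density_nonneg: "half_log_density z \<ge> 0"
  by (simp add: half_log_density_def)

lemma half_log_density_measurable [measurable]: "half_log_density \<in> borel_measurable borel"
  unfolding half_log_density_def by measurable

lemma nn_integral_half_log:
  fixes f :: "real \<Rightarrow> ennreal"
  assumes [measurable]: "f \<in> borel_measurable borel"
  shows "(\<integral>\<^sup>+t. f (ln (1 + (exp t)\<^sup>2) / 2) \<partial>sech_step) = (\<integral>\<^sup>+z. f z * ennreal (half_log_density z) \<partial>lborel)"
proof -
  define g where "g = (\<lambda>t::real. ln (1 + (exp t)\<^sup>2) / 2)"
  define g' where "g' = (\<lambda>t::real. (exp t)\<^sup>2 / (1 + (exp t)\<^sup>2))"
  have p: "1 + (exp t)\<^sup>2 > (0::real)" for t by (simp add: add_pos_nonneg)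
  have dg: "(g has_real_derivative g' t) (at t)" for t
    unfolding g_def g'_def using p[of t] by (auto intro!: derivative_eq_intros simp: power2_eq_square field_simps)
  have eg: "exp (2 * g t) = 1 + (exp t)\<^sup>2" for t using p[of t] by (simp add: g_def)
  have gpos: "g t > 0" for t using ln_gt_zero[of "1 + (exp t)\<^sup>2"] by (simp add: g_def)
  have rg: "range g = {0<..}"
  proof (intro equalityI subsetI)
    fix z :: real assume z: "z \<in> {0<..}"
    define t where "t = ln (sqrt (exp (2 * z) - 1))"
    have "exp (2 * z) - 1 > 0" using z by simp
    hence "(exp t)\<^sup>2 = exp (2 * z) - 1" by (simp add: t_def)
    hence "g t = z" by (simp add: g_def)
    thus "z \<in> range g" by blast
  qed (use gpos in auto)
  have [measurable]: "g \<in> borel_measurable borel" unfolding g_def by measurable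
  have "(\<integral>\<^sup>+t. f (g t) \<partial>sech_step) = (\<integral>\<^sup>+t. ennreal (sech_density 1 t) * f (g t) \<partial>lborel)"
    by (rule nn_integral_density) measurable
  also have "\<dots> = (\<integral>\<^sup>+t. (f (g t) * ennreal (half_log_density (g t))) * ennreal (g' t) \<partial>lborel)"
  proof (rule nn_integral_cong)
    fix t
    have "half_log_density (g t) * g' t = 2 / (pi * exp t) * ((exp t)\<^sup>2 / (1 + (exp t)\<^sup>2))"
      using gpos[of t] by (simp add: half_log_density_def eg g'_def)
    also have "\<dots> = sech_density 1 t"
      using p[of t] by (simp add: sech_density_1 cosh_def exp_minus field_simps power2_eq_square)
    finally have "ennreal (sech_density 1 t) = ennreal (half_log_density (g t)) * ennreal (g' t)"
      by (subst ennreal_mult[symmetric]) (auto simp: half_log_density_nonneg g'_def)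
    thus "ennreal (sech_density 1 t) * f (g t) = (f (g t) * ennreal (half_log_density (g t))) * ennreal (g' t)"
      by (simp add: mult_ac)
  qed
  also have "\<dots> = (\<integral>\<^sup>+z. (f z * ennreal (half_log_density z)) * indicator (range g) z \<partial>lborel)"
  proof (rule nn_integral_substitution_UNIV[symmetric])
    show "continuous_on UNIV g'" unfolding g'_def
      using p by (intro continuous_intros) (metis less_irrefl)
    show "g' s \<ge> 0" for s by (simp add: g'_def)
  qed (use dg in auto)
  also have "\<dots> = (\<integral>\<^sup>+z. f z * ennreal (half_log_density z) \<partial>lborel)"
    unfolding rg by (intro nn_integral_cong) (auto simp: indicator_def half_log_density_def)
  finally show ?thesis by (simp add: g_def)
qed

text \<open>With \<open>a = e^(-r)\<close> and \<open>E = e^(-2 z)\<close> the integrand is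
  \<open>4 / pi^2\<close> times \<open>a E / sqrt ((1 - E) (1 - a^2 E))\<close>, the derivative of
  \<open>artanh (a sqrt Q)\<close> for \<open>Q = (1 - E) / (1 - a^2 E)\<close>. As \<open>z\<close>
  runs from 0 to infinity, \<open>Q\<close> runs from 0 to 1. The integrand is unbounded near
  \<open>z = 0\<close>, so the fundamental theorem is applied on the open half line.\<close>

lemma nn_integral_half_log_autocorrelation:
  assumes r: "r > 0"
  shows "(\<integral>\<^sup>+z. ennreal (half_log_density (z + r)) * ennreal (half_log_density z) \<partial>lborel) = ennreal (4 / pi\<^sup>2 * artanh (exp (- r)))"
proof -
  define a where "a = exp (- r)"
  have a: "0 < a" "a < 1" using r by (auto simp: a_def)
  define Q where "Q = (\<lambda>z. (1 - exp (- 2 * z)) / (1 - a\<^sup>2 * exp (- 2 * z)))"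
  define F where "F = (\<lambda>z. artanh (a * sqrt (Q z)))"
  define f where "f = (\<lambda>z. a * exp (- 2 * z) / sqrt ((1 - exp (- 2 * z)) * (1 - a\<^sup>2 * exp (- 2 * z))))"
  have a2: "a\<^sup>2 < 1" "0 < a\<^sup>2" using a by (auto simp: power_less_one_iff abs_square_less_1)
  have y: "0 < exp (- 2 * z)" "exp (- 2 * z) < 1" "0 < 1 - a\<^sup>2 * exp (- 2 * z)" if "z > 0" for z
  proof -
    show "0 < exp (- 2 * z)" "exp (- 2 * z) < 1" using that by auto
    have "a\<^sup>2 * exp (- 2 * z) < 1 * 1" using a2 that by (intro mult_strict_mono) auto
    thus "0 < 1 - a\<^sup>2 * exp (- 2 * z)" by simp
  qed
  have Qp: "Q z > 0" "a\<^sup>2 * Q z < 1" if "z > 0" for z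
  proof -
    show "Q z > 0" using y[OF that] by (simp add: Q_def)
    have "a\<^sup>2 * (1 - exp (- 2 * z)) < 1 - a\<^sup>2 * exp (- 2 * z)" using a2 by (simp add: algebra_simps)
    thus "a\<^sup>2 * Q z < 1" using y[OF that] by (simp add: Q_def field_simps)
  qed
  have aq: "\<bar>a * sqrt (Q z)\<bar> < 1" if "z > 0" for z
  proof -
    have "(a * sqrt (Q z))\<^sup>2 < 1" using Qp[OF that] by (simp add: power_mult_distrib)
    thus ?thesis by (simp add: abs_square_less_1)
  qed
  have dF: "(F has_real_derivative f z) (at z)" if z: "z > 0" for z
  proof -
    define E where "E = exp (- 2 * z)"
    note yy = y[OF z, folded E_def]
    have QE: "Q z = (1 - E) / (1 - a\<^sup>2 * E)" by (simp only: Q_def E_def)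
    have dQ: "(Q has_real_derivative 2 * E * (1 - a\<^sup>2) / (1 - a\<^sup>2 * E)\<^sup>2) (at z)"
      unfolding Q_def E_def using y(3)[OF z]
      by (auto intro!: derivative_eq_intros simp: power2_eq_square) (simp add: algebra_simps)?
    have "(F has_real_derivative (a * ((2 * E * (1 - a\<^sup>2) / (1 - a\<^sup>2 * E)\<^sup>2) * (inverse (sqrt (Q z)) / 2))) / (1 - (a * sqrt (Q z))\<^sup>2)) (at z)"
    proof -
      have "((\<lambda>z. a * sqrt (Q z)) has_real_derivative a * ((2 * E * (1 - a\<^sup>2) / (1 - a\<^sup>2 * E)\<^sup>2) * (inverse (sqrt (Q z)) / 2))) (at z)"
        using DERIV_cmult[OF DERIV_chain2[OF DERIV_real_sqrt[OF Qp(1)[OF z]] dQ], of a] by (simp add: mult_ac)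
      from DERIV_chain2[OF artanh_real_has_field_derivative[OF aq[OF z]] this]
      show ?thesis unfolding F_def by (simp add: mult_ac)
    qed
    also have "(a * ((2 * E * (1 - a\<^sup>2) / (1 - a\<^sup>2 * E)\<^sup>2) * (inverse (sqrt (Q z)) / 2))) / (1 - (a * sqrt (Q z))\<^sup>2) = f z"
    proof -
      have "1 - (a * sqrt (Q z))\<^sup>2 = 1 - a\<^sup>2 * Q z" using Qp[OF z] by (simp add: power_mult_distrib)
      also have "\<dots> = (1 - a\<^sup>2) / (1 - a\<^sup>2 * E)" using yy by (simp add: QE field_simps)
      finally have e1: "1 - (a * sqrt (Q z))\<^sup>2 = (1 - a\<^sup>2) / (1 - a\<^sup>2 * E)" .
      have e2: "sqrt (Q z) * (1 - a\<^sup>2 * E) = sqrt ((1 - E) * (1 - a\<^sup>2 * E))"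
      proof -
        have "sqrt (Q z) = sqrt (1 - E) / sqrt (1 - a\<^sup>2 * E)" by (simp add: QE real_sqrt_divide)
        hence "sqrt (Q z) * (sqrt (1 - a\<^sup>2 * E) * sqrt (1 - a\<^sup>2 * E)) = sqrt (1 - E) * sqrt (1 - a\<^sup>2 * E)"
        proof -
          have "(x / w) * (w * w) = x * w" if "w \<noteq> 0" for x w :: real using that by simp
          moreover have "sqrt (1 - a\<^sup>2 * E) \<noteq> 0" using yy(3) by simp
          ultimately show ?thesis unfolding \<open>sqrt (Q z) = sqrt (1 - E) / sqrt (1 - a\<^sup>2 * E)\<close> by blast
        qed
        moreover have "sqrt (1 - a\<^sup>2 * E) * sqrt (1 - a\<^sup>2 * E) = 1 - a\<^sup>2 * E"
          by (simp only: real_sqrt_mult_self abs_of_pos[OF yy(3)])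
        ultimately show ?thesis by (simp only: real_sqrt_mult)
      qed
      have n: "1 - a\<^sup>2 \<noteq> 0" "1 - a\<^sup>2 * E \<noteq> 0" "sqrt (Q z) \<noteq> 0" using a2 yy Qp(1)[OF z] by auto
      have "(a * ((2 * E * (1 - a\<^sup>2) / (1 - a\<^sup>2 * E)\<^sup>2) * (inverse (sqrt (Q z)) / 2))) / ((1 - a\<^sup>2) / (1 - a\<^sup>2 * E)) = a * E / (sqrt (Q z) * (1 - a\<^sup>2 * E))"
      proof -
        have "(a * ((2 * E * p / D\<^sup>2) * (inverse w / 2))) / (p / D) = a * E / (w * D)"
          if "p \<noteq> 0" "D \<noteq> 0" "w \<noteq> 0" for p D w :: real
          using that by (simp add: power2_eq_square inverse_eq_divide)
        from this[OF n] show ?thesis .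
      qed
      thus ?thesis unfolding e1 e2 by (simp add: f_def E_def)
    qed
    finally show ?thesis .
  qed
  have fp: "f z \<ge> 0" if "z > 0" for z using a y[OF that] by (simp add: f_def)
  have Q0: "(Q \<longlongrightarrow> 0) (at_right 0)"
  proof -
    have "isCont Q 0" unfolding Q_def using a2 by (intro continuous_intros) auto
    hence "(Q \<longlongrightarrow> Q 0) (at_right 0)" by (simp add: isCont_def filterlim_at_split)
    thus ?thesis by (simp add: Q_def)
  qed
  have Q1: "(Q \<longlongrightarrow> 1) at_top"
  proof -
    have "((\<lambda>z::real. exp (- 2 * z)) \<longlongrightarrow> 0) at_top" by real_asymp
    hence "(Q \<longlongrightarrow> (1 - 0) / (1 - a\<^sup>2 * 0)) at_top" unfolding Q_def by (intro tendsto_intros) auto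
    thus ?thesis by simp
  qed
  have l0: "((F \<circ> real_of_ereal) \<longlongrightarrow> 0) (at_right 0)"
  proof -
    have "(F \<longlongrightarrow> artanh (a * sqrt 0)) (at_right 0)"
      unfolding F_def by (intro tendsto_artanh tendsto_intros Q0) auto
    thus ?thesis by (simp add: ereal_tendsto_simps1 zero_ereal_def)
  qed
  have l1: "((F \<circ> real_of_ereal) \<longlongrightarrow> artanh a) (at_left \<infinity>)"
  proof -
    have "(F \<longlongrightarrow> artanh (a * sqrt 1)) at_top"
      unfolding F_def using a by (intro tendsto_artanh tendsto_intros Q1) auto
    thus ?thesis by (simp add: ereal_tendsto_simps1)
  qed
  have cf: "isCont f z" if "z > 0" for z
    unfolding f_def using y[OF that] by (intro continuous_intros) auto
  have "set_integrable lborel (einterval 0 \<infinity>) f" "(LBINT z=0..\<infinity>. f z) = artanh a - 0"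
    using interval_integral_FTC_nonneg[of 0 "\<infinity>" F f 0 "artanh a"] dF cf fp l0 l1 by (auto simp: zero_ereal_def)
  hence hb: "has_bochner_integral lborel (\<lambda>z. indicator {0<..} z *\<^sub>R f z) (artanh a)"
    by (simp add: has_bochner_integral_iff interval_lebesgue_integral_def set_integrable_def set_lebesgue_integral_def zero_ereal_def)
  have "(\<integral>\<^sup>+z. ennreal (half_log_density (z + r)) * ennreal (half_log_density z) \<partial>lborel) = (\<integral>\<^sup>+z. ennreal (4 / pi\<^sup>2 * (indicator {0<..} z *\<^sub>R f z)) \<partial>lborel)"
  proof (rule nn_integral_cong)
    fix z
    have "half_log_density (z + r) * half_log_density z = 4 / pi\<^sup>2 * (indicator {0<..} z *\<^sub>R f z)"
    proof (cases "z > 0")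
      case True
      define E where "E = exp (- 2 * z)"
      note yy = y[OF True, folded E_def]
      have e1: "exp (2 * z) - 1 = (1 - E) / E" by (simp add: E_def exp_minus field_simps)
      have e2: "exp (2 * (z + r)) - 1 = (1 - a\<^sup>2 * E) / (a\<^sup>2 * E)"
      proof -
        have "exp (2 * (z + r)) = 1 / (a\<^sup>2 * E)"
          by (simp add: a_def E_def power2_eq_square exp_minus field_simps flip: exp_add) (simp add: exp_add algebra_simps)?
        thus ?thesis using a yy by (simp add: field_simps)
      qed
      have "sqrt (exp (2 * (z + r)) - 1) * sqrt (exp (2 * z) - 1) = sqrt ((1 - E) * (1 - a\<^sup>2 * E) / (a * E)\<^sup>2)"
        unfolding e1 e2 by (simp add: real_sqrt_mult[symmetric] power2_eq_square mult_ac)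
      also have "\<dots> = sqrt ((1 - E) * (1 - a\<^sup>2 * E)) / (a * E)" using a yy by (simp add: real_sqrt_divide)
      finally have s: "sqrt (exp (2 * (z + r)) - 1) * sqrt (exp (2 * z) - 1) = sqrt ((1 - E) * (1 - a\<^sup>2 * E)) / (a * E)" .
      have "half_log_density (z + r) * half_log_density z = 4 / (pi\<^sup>2 * (sqrt (exp (2 * (z + r)) - 1) * sqrt (exp (2 * z) - 1)))"
        using True r by (simp add: half_log_density_def power2_eq_square)
      also have "\<dots> = 4 / pi\<^sup>2 * f z" unfolding s by (simp add: f_def E_def)
      finally show ?thesis using True by simp
    qed (simp add: half_log_density_def)
    thus "ennreal (half_log_density (z + r)) * ennreal (half_log_density z) = ennreal (4 / pi\<^sup>2 * (indicator {0<..} z *\<^sub>R f z))"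
      by (simp add: ennreal_mult[symmetric] half_log_density_nonneg)
  qed
  also have "\<dots> = ennreal (4 / pi\<^sup>2 * artanh a)"
    using has_bochner_integral_mult_right[OF hb, of "4 / pi\<^sup>2"] fp
    by (subst nn_integral_eq_integral) (auto simp: has_bochner_integral_iff indicator_def)
  finally show ?thesis by (simp add: a_def)
qed

text \<open>The density of \<open>ln |1 + y| - ln |1 + x|\<close> for two independent uniform points
  of the circle. The name refers to \<open>artanh (e^(-r))\<close> being half the integral of
  \<open>1 / sinh v\<close> over \<open>v >= r\<close>. At \<open>r = 0\<close> the logarithmic
  singularity is replaced by a default value, on a null set.\<close>

definition csch_tail_density :: "real \<Rightarrow> real" where
  "csch_tail_density r = 4 / pi\<^sup>2 * artanh (exp (- \<bar>r\<bar>))"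

lemma csch_tail_density_measurable [measurable]: "csch_tail_density \<in> borel_measurable borel"
  unfolding csch_tail_density_def artanh_def by measurable

lemma csch_tail_density_even [simp]: "csch_tail_density (- r) = csch_tail_density r"
  by (simp add: csch_tail_density_def)

lemma nn_integral_half_log_difference:
  fixes f :: "real \<Rightarrow> ennreal"
  assumes [measurable]: "f \<in> borel_measurable borel"
  shows "(\<integral>\<^sup>+t. \<integral>\<^sup>+s. f (ln (1 + (exp s)\<^sup>2) / 2 - ln (1 + (exp t)\<^sup>2) / 2) \<partial>sech_step \<partial>sech_step) =
    (\<integral>\<^sup>+r. f r * ennreal (csch_tail_density r) \<partial>lborel)"
proof -
  let ?h = half_log_density
  have "(\<integral>\<^sup>+t. \<integral>\<^sup>+s. f (ln (1 + (exp s)\<^sup>2) / 2 - ln (1 + (exp t)\<^sup>2) / 2) \<partial>sech_step \<partial>sech_step) =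
     (\<integral>\<^sup>+t. (\<lambda>w. \<integral>\<^sup>+z. f (z - w) * ennreal (?h z) \<partial>lborel) (ln (1 + (exp t)\<^sup>2) / 2) \<partial>sech_step)"
    by (intro nn_integral_cong nn_integral_half_log) measurable
  also have "\<dots> = (\<integral>\<^sup>+w. (\<integral>\<^sup>+z. f (z - w) * ennreal (?h z) \<partial>lborel) * ennreal (?h w) \<partial>lborel)"
    by (rule nn_integral_half_log) measurable
  also have "\<dots> = (\<integral>\<^sup>+w. (\<integral>\<^sup>+r. f r * ennreal (?h (w + r)) \<partial>lborel) * ennreal (?h w) \<partial>lborel)"
  proof (rule nn_integral_cong)
    fix w :: real
    have "(\<integral>\<^sup>+z. f (z - w) * ennreal (?h z) \<partial>lborel) = (\<integral>\<^sup>+r. f (w + r - w) * ennreal (?h (w + r)) \<partial>lborel)"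
      using nn_integral_real_affine[of "\<lambda>z. f (z - w) * ennreal (?h z)" 1 w] by simp
    thus "(\<integral>\<^sup>+z. f (z - w) * ennreal (?h z) \<partial>lborel) * ennreal (?h w) = (\<integral>\<^sup>+r. f r * ennreal (?h (w + r)) \<partial>lborel) * ennreal (?h w)" by simp
  qed
  also have "\<dots> = (\<integral>\<^sup>+w. \<integral>\<^sup>+r. (\<lambda>(w, r). f r * ennreal (?h (w + r)) * ennreal (?h w)) (w, r) \<partial>lborel \<partial>lborel)"
    by (intro nn_integral_cong) (simp add: nn_integral_multc)
  also have "\<dots> = (\<integral>\<^sup>+r. \<integral>\<^sup>+w. (\<lambda>(w, r). f r * ennreal (?h (w + r)) * ennreal (?h w)) (w, r) \<partial>lborel \<partial>lborel)"
    by (rule lborel_pair.Fubini'[symmetric]) measurable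
  also have "\<dots> = (\<integral>\<^sup>+r. f r * (\<integral>\<^sup>+w. ennreal (?h (w + r)) * ennreal (?h w) \<partial>lborel) \<partial>lborel)"
    by (intro nn_integral_cong) (simp add: nn_integral_cmult[symmetric] mult.assoc)
  also have "\<dots> = (\<integral>\<^sup>+r. f r * ennreal (csch_tail_density r) \<partial>lborel)"
  proof (rule nn_integral_cong_AE)
    show "AE r in lborel. f r * (\<integral>\<^sup>+w. ennreal (?h (w + r)) * ennreal (?h w) \<partial>lborel) = f r * ennreal (csch_tail_density r)"
      using AE_lborel_singleton[of 0]
    proof eventually_elim
      case (elim r)
      have "(\<integral>\<^sup>+w. ennreal (?h (w + r)) * ennreal (?h w) \<partial>lborel) = ennreal (csch_tail_density r)"
      proof (cases "r > 0")
        case True thus ?thesis using nn_integral_half_log_autocorrelation[OF True] by (simp add: csch_tail_density_def)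
      next
        case False
        hence r: "- r > 0" using elim by simp
        have "(\<integral>\<^sup>+w. ennreal (?h (w + r)) * ennreal (?h w) \<partial>lborel) = (\<integral>\<^sup>+z. ennreal (?h (- r + z + r)) * ennreal (?h (- r + z)) \<partial>lborel)"
          using nn_integral_real_affine[of "\<lambda>w. ennreal (?h (w + r)) * ennreal (?h w)" 1 "- r"] by simp
        also have "\<dots> = (\<integral>\<^sup>+z. ennreal (?h (z + (- r))) * ennreal (?h z) \<partial>lborel)"
          by (intro nn_integral_cong) (simp add: mult.commute)
        also have "\<dots> = ennreal (csch_tail_density r)"
          using nn_integral_half_log_autocorrelation[OF r] r by (simp add: csch_tail_density_def)
        finally show ?thesis .
      qed
      thus ?case by simp
    qed
  qed
  finally show ?thesis .
qed

lemma has_real_derivative_artanh_exp: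
  fixes r :: real
  assumes "r > 0"
  shows "((\<lambda>r. - artanh (exp (- r))) has_real_derivative (1 / sinh r) / 2) (at r)"
proof -
  have e: "\<bar>exp (- r)\<bar> < 1" using assms by simp
  have "((\<lambda>r. - artanh (exp (- r))) has_real_derivative - (1 / (1 - (exp (- r))\<^sup>2) * (exp (- r) * (- 1)))) (at r)"
    by (rule DERIV_minus, rule DERIV_chain2[where f = artanh and g = "\<lambda>r. exp (- r)"], rule artanh_real_has_field_derivative[OF e])
       (auto intro!: derivative_eq_intros)
  also have "- (1 / (1 - (exp (- r))\<^sup>2) * (exp (- r) * (- 1))) = (1 / sinh r) / 2"
  proof -
    define X where "X = 1 - (exp (- r))\<^sup>2"
    have "X \<noteq> 0" using e abs_square_less_1[of "exp (- r)"] by (simp add: X_def)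
    moreover have "sinh r = X / (2 * exp (- r))"
      by (simp add: X_def sinh_def exp_minus field_simps power2_eq_square)
    ultimately show ?thesis unfolding X_def[symmetric] by simp
  qed
  finally show ?thesis .
qed

lemma nn_integral_csch_tail:
  assumes r: "r > 0"
  shows "(\<integral>\<^sup>+v. ennreal (1 / sinh v) * indicator {r..} v \<partial>lborel) = ennreal (2 * artanh (exp (- r)))"
proof -
  have "(\<integral>\<^sup>+v. ennreal (1 / sinh v) * indicator {r..} v \<partial>lborel) = ennreal (0 - (- (2 * artanh (exp (- r)))))"
  proof (rule nn_integral_FTC_atLeast)
    show "(\<lambda>v::real. 1 / sinh v) \<in> borel_measurable borel" by measurable
    show "DERIV (\<lambda>v. - (2 * artanh (exp (- v)))) v :> 1 / sinh v" if "r \<le> v" for v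
      using DERIV_cmult[OF has_real_derivative_artanh_exp, of v 2] that r by simp
    show "0 \<le> 1 / sinh v" if "r \<le> v" for v using that r by simp
    have "((\<lambda>v::real. exp (- v)) \<longlongrightarrow> 0) at_top" by real_asymp
    hence "((\<lambda>v::real. - (2 * artanh (exp (- v)))) \<longlongrightarrow> - (2 * artanh 0)) at_top" by (intro tendsto_intros tendsto_artanh) auto
    thus "((\<lambda>v::real. - (2 * artanh (exp (- v)))) \<longlongrightarrow> 0) at_top" by simp
  qed
  thus ?thesis by simp
qed

lemma has_bochner_integral_abs_power_exp_shift:
  "(\<integral>\<^sup>+r. ennreal (exp (- a * r)) * indicator {b..} r \<partial>lborel) = ennreal (exp (- a * b) / a)" if "a > 0"
proof -
  have "(\<integral>\<^sup>+r. ennreal (exp (- a * r)) * indicator {b..} r \<partial>lborel) = ennreal (0 - (- (exp (- a * b) / a)))"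
  proof (rule nn_integral_FTC_atLeast)
    show "DERIV (\<lambda>r. - (exp (- a * r) / a)) r :> exp (- a * r)" for r
      using that by (auto intro!: derivative_eq_intros)
    show "((\<lambda>r. - (exp (- a * r) / a)) \<longlongrightarrow> 0) at_top" using that by real_asymp
  qed auto
  thus ?thesis by simp
qed

lemma csch_geometric:
  assumes "v > 0"
  shows "ennreal (1 / sinh v) = (\<Sum>k. ennreal (2 * exp (- (2 * real k + 1) * v)))"
proof -
  have q: "norm (exp (- 2 * v)) < 1" using assms by simp
  have "(\<lambda>k. exp (- 2 * v) ^ k) sums (1 / (1 - exp (- 2 * v)))" by (rule geometric_sums[OF q])
  hence "(\<lambda>k. 2 * exp (- v) * exp (- 2 * v) ^ k) sums (2 * exp (- v) * (1 / (1 - exp (- 2 * v))))" by (rule sums_mult)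
  also have "(\<lambda>k. 2 * exp (- v) * exp (- 2 * v) ^ k) = (\<lambda>k. 2 * exp (- (2 * real k + 1) * v))"
    by (simp add: fun_eq_iff exp_of_nat_mult[symmetric] mult_exp_exp algebra_simps)
  also have "2 * exp (- v) * (1 / (1 - exp (- 2 * v))) = 1 / sinh v"
  proof -
    have "exp (- 2 * v) < 1" using assms by simp
    moreover have "sinh v = (1 - exp (- 2 * v)) / (2 * exp (- v))"
      by (simp add: sinh_def field_simps flip: exp_add)
    ultimately show ?thesis by simp
  qed
  finally have s: "(\<lambda>k. 2 * exp (- (2 * real k + 1) * v)) sums (1 / sinh v)" .
  have "(\<Sum>k. ennreal (2 * exp (- (2 * real k + 1) * v))) = ennreal (\<Sum>k. 2 * exp (- (2 * real k + 1) * v))"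
    by (rule suminf_ennreal2) (use s in \<open>auto simp: sums_iff\<close>)
  thus ?thesis using s by (simp add: sums_iff)
qed

text \<open>The geometric series of \<open>1 / sinh v\<close> has positive terms, so it may be
  exchanged with the tail integral; each exponential then picks up one factor
  \<open>1 / (2 k + 1)\<close>.\<close>

lemma csch_tail_density_series:
  assumes r: "r \<noteq> 0"
  shows "ennreal (csch_tail_density r) = (\<Sum>k. ennreal (4 / pi\<^sup>2 * (exp (- (2 * real k + 1) * \<bar>r\<bar>) / (2 * real k + 1))))"
proof -
  let ?r = "\<bar>r\<bar>"
  have rp: "?r > 0" using r by simp
  have "ennreal (2 * artanh (exp (- ?r))) = (\<integral>\<^sup>+v. ennreal (1 / sinh v) * indicator {?r..} v \<partial>lborel)"
    by (rule nn_integral_csch_tail[OF rp, symmetric])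
  also have "\<dots> = (\<integral>\<^sup>+v. (\<Sum>k. ennreal (2 * exp (- (2 * real k + 1) * v)) * indicator {?r..} v) \<partial>lborel)"
  proof (rule nn_integral_cong)
    fix v :: real
    show "ennreal (1 / sinh v) * indicator {?r..} v = (\<Sum>k. ennreal (2 * exp (- (2 * real k + 1) * v)) * indicator {?r..} v)"
    proof (cases "v \<ge> ?r")
      case True
      hence v: "v > 0" "v \<in> {?r..}" using rp by auto
      show ?thesis by (simp only: indicator_simps(1)[OF v(2)] mult_1_right csch_geometric[OF v(1)])
    qed simp
  qed
  also have "\<dots> = (\<Sum>k. \<integral>\<^sup>+v. ennreal (2 * exp (- (2 * real k + 1) * v)) * indicator {?r..} v \<partial>lborel)"
    by (rule nn_integral_suminf) measurable
  also have "\<dots> = (\<Sum>k. ennreal (2 * (exp (- (2 * real k + 1) * ?r) / (2 * real k + 1))))"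
  proof (rule suminf_cong)
    fix k
    have "(\<integral>\<^sup>+v. ennreal (2 * exp (- (2 * real k + 1) * v)) * indicator {?r..} v \<partial>lborel) =
        (\<integral>\<^sup>+v. ennreal 2 * (ennreal (exp (- (2 * real k + 1) * v)) * indicator {?r..} v) \<partial>lborel)"
      by (intro nn_integral_cong) (simp only: ennreal_mult'[symmetric] mult.assoc[symmetric] zero_le_numeral)
    also have "\<dots> = ennreal 2 * ennreal (exp (- (2 * real k + 1) * ?r) / (2 * real k + 1))"
      by (subst nn_integral_cmult, measurable, subst has_bochner_integral_abs_power_exp_shift) auto
    finally show "(\<integral>\<^sup>+v. ennreal (2 * exp (- (2 * real k + 1) * v)) * indicator {?r..} v \<partial>lborel) = ennreal (2 * (exp (- (2 * real k + 1) * ?r) / (2 * real k + 1)))"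
      by (simp only: ennreal_mult'[symmetric] zero_le_numeral)
  qed
  finally have E: "ennreal (2 * artanh (exp (- ?r))) = (\<Sum>k. ennreal (2 * (exp (- (2 * real k + 1) * ?r) / (2 * real k + 1))))" .
  have "ennreal (csch_tail_density r) = ennreal (2 / pi\<^sup>2) * ennreal (2 * artanh (exp (- ?r)))"
    by (subst ennreal_mult'[symmetric]) (auto simp: csch_tail_density_def)
  also have "\<dots> = (\<Sum>k. ennreal (2 / pi\<^sup>2) * ennreal (2 * (exp (- (2 * real k + 1) * ?r) / (2 * real k + 1))))"
    unfolding E by (rule ennreal_suminf_cmult[symmetric])
  also have "\<dots> = (\<Sum>k. ennreal (4 / pi\<^sup>2 * (exp (- (2 * real k + 1) * \<bar>r\<bar>) / (2 * real k + 1))))"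
    by (intro suminf_cong) (subst ennreal_mult'[symmetric], auto)
  finally show ?thesis .
qed

text \<open>Both sides are \<open>A (x + v) - A (x - v)\<close> for a primitive \<open>A\<close> of
  the density of one step, since \<open>A (b - v) - A (b + v)\<close> tends to 0 for large
  \<open>b\<close>. The purpose is to trade a window around \<open>x\<close> for an integral over
  \<open>b >= x\<close>, in which \<open>x\<close> occurs only as an endpoint.\<close>

lemma nn_integral_sech_density_window:
  assumes x: "x > 0" and v: "v > 0"
  shows "(\<integral>\<^sup>+t. ennreal (sech_density 1 t) * indicator {x - v..x + v} t \<partial>lborel) =
    (\<integral>\<^sup>+b. ennreal (sech_density 1 (b - v) - sech_density 1 (b + v)) * indicator {x..} b \<partial>lborel)"
proof -
  let ?g = "sech_density 1"
  define A where "A = (\<lambda>t::real. 2 / pi * arctan (exp t))"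
  have dA: "(A has_real_derivative ?g t) (at t)" for t
  proof -
    have "(A has_real_derivative 2 / pi * (exp t * inverse (1 + (exp t)\<^sup>2))) (at t)"
      unfolding A_def by (auto intro!: derivative_eq_intros)
    also have "2 / pi * (exp t * inverse (1 + (exp t)\<^sup>2)) = ?g t"
      by (simp add: sech_density_1 cosh_def exp_minus field_simps power2_eq_square)
    finally show ?thesis .
  qed
  have gnn: "?g t \<ge> 0" for t by (rule sech_density_nonneg)
  have "(\<integral>\<^sup>+t. ennreal (?g t) * indicator {x - v..x + v} t \<partial>lborel) = ennreal (A (x + v) - A (x - v))"
    by (rule nn_integral_FTC_Icc) (use v in \<open>auto intro!: DERIV_subset[OF dA] gnn simp del: One_nat_def\<close>)
  moreover have "(\<integral>\<^sup>+b. ennreal (?g (b - v) - ?g (b + v)) * indicator {x..} b \<partial>lborel) = ennreal (0 - (A (x - v) - A (x + v)))"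
  proof (rule nn_integral_FTC_atLeast)
    show "(\<lambda>b. ?g (b - v) - ?g (b + v)) \<in> borel_measurable borel" by measurable
    show "DERIV (\<lambda>b. A (b - v) - A (b + v)) b :> ?g (b - v) - ?g (b + v)" for b
    proof (rule DERIV_diff)
      show "((\<lambda>b. A (b - v)) has_real_derivative ?g (b - v)) (at b)"
        using DERIV_shift[of A "?g (b - v)" b "- v"] dA by simp
      show "((\<lambda>b. A (b + v)) has_real_derivative ?g (b + v)) (at b)"
        using DERIV_shift[of A "?g (b + v)" b v] dA by simp
    qed
    show "0 \<le> ?g (b - v) - ?g (b + v)" if b: "x \<le> b" for b
    proof -
      have "\<bar>b - v\<bar> \<le> b + v" using b x v by linarith
      hence "cosh (b - v) \<le> cosh (b + v)" using cosh_real_nonneg_le_iff[of "\<bar>b - v\<bar>" "b + v"] by simp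
      thus ?thesis by (simp add: sech_density_1 frac_le)
    qed
    have "((\<lambda>b. arctan (exp (b - v))) \<longlongrightarrow> pi / 2) at_top" "((\<lambda>b. arctan (exp (b + v))) \<longlongrightarrow> pi / 2) at_top"
      by (rule filterlim_compose[OF tendsto_arctan_at_top], real_asymp)+
    hence "((\<lambda>b. A (b - v) - A (b + v)) \<longlongrightarrow> 2 / pi * (pi / 2) - 2 / pi * (pi / 2)) at_top"
      unfolding A_def by (intro tendsto_intros)
    thus "((\<lambda>b. A (b - v) - A (b + v)) \<longlongrightarrow> 0) at_top" by simp
  qed
  ultimately show ?thesis by simp
qed

text \<open>\<open>1 / cosh (b - v) - 1 / cosh (b + v)\<close> has numerator
  \<open>2 sinh b sinh v\<close>, so the factor \<open>1 / sinh v\<close> cancels and an even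
  function of \<open>v\<close> is left, whose integral is the self-convolution of
  \<open>sech\<close> at the point \<open>2 b\<close>.\<close>

lemma nn_integral_csch_window:
  assumes b: "b > 0"
  shows "(\<integral>\<^sup>+v. ennreal (1 / sinh v) * ennreal (sech_density 1 (b - v) - sech_density 1 (b + v)) * indicator {0<..} v \<partial>lborel) =
    ennreal (2 * b * sech_density 1 b)"
proof -
  let ?g = "sech_density 1"
  define k where "k = (\<lambda>v. sinh b / pi * (1 / (cosh (b - v) * cosh (b + v))))"
  have "has_bochner_integral lborel (\<lambda>u. 1 / (cosh (2 * b - u) * cosh u)) (2 * (2 * b) / sinh (2 * b))"
    by (rule has_bochner_integral_sech_conv) (use b in simp)
  hence "has_bochner_integral lborel (\<lambda>v. 1 / (cosh (2 * b - (b + v)) * cosh (b + v))) (2 * (2 * b) / sinh (2 * b))"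
    using lborel_has_bochner_integral_real_affine_iff[of 1 "\<lambda>u. 1 / (cosh (2 * b - u) * cosh u)" "2 * (2 * b) / sinh (2 * b)" b] by simp
  hence "has_bochner_integral lborel k (sinh b / pi * (2 * (2 * b) / sinh (2 * b)))"
    unfolding k_def by (intro has_bochner_integral_mult_right) (simp add: algebra_simps)
  also have "sinh b / pi * (2 * (2 * b) / sinh (2 * b)) = 2 * b * ?g b"
  proof -
    have s2: "sinh (2 * b) = 2 * sinh b * cosh b" by (simp add: sinh_double)
    show ?thesis unfolding s2 using b by (simp add: sech_density_1 field_simps)
  qed
  finally have hb: "has_bochner_integral lborel k (2 * b * ?g b)" .
  have kint: "integrable lborel k" using hb by (simp add: has_bochner_integral_iff del: One_nat_def)
  have keven: "k (- v) = k v" for v by (simp add: k_def mult.commute)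
  have kpos: "k v \<ge> 0" for v using b by (simp add: k_def)
  have ki: "integrable lborel (\<lambda>v. indicator {0..} v *\<^sub>R k v)"
    by (rule integrable_mult_indicator[OF _ kint]) simp
  have half: "(\<integral>v. indicator {0..} v *\<^sub>R k v \<partial>lborel) = b * ?g b"
    using integrable_even_extension(2)[OF ki keven] hb by (simp add: has_bochner_integral_iff del: One_nat_def)
  have "(\<integral>\<^sup>+v. ennreal (1 / sinh v) * ennreal (?g (b - v) - ?g (b + v)) * indicator {0<..} v \<partial>lborel) = (\<integral>\<^sup>+v. ennreal (2 * (indicator {0..} v *\<^sub>R k v)) \<partial>lborel)"
  proof (rule nn_integral_cong_AE)
    show "AE v in lborel. ennreal (1 / sinh v) * ennreal (?g (b - v) - ?g (b + v)) * indicator {0<..} v = ennreal (2 * (indicator {0..} v *\<^sub>R k v))"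
      using AE_lborel_singleton[of 0]
    proof eventually_elim
      case (elim v)
      show ?case
      proof (cases "v > 0")
        case True
        have "?g (b - v) - ?g (b + v) = (cosh (b + v) - cosh (b - v)) / (pi * (cosh (b - v) * cosh (b + v)))"
          by (simp add: sech_density_1 diff_frac_eq field_simps)
        also have "cosh (b + v) - cosh (b - v) = 2 * sinh b * sinh v" by (simp add: cosh_add cosh_diff)
        finally have "1 / sinh v * (?g (b - v) - ?g (b + v)) = 2 * k v" using True by (simp add: k_def)
        thus ?thesis using True by (simp add: ennreal_mult'[symmetric] del: One_nat_def)
      qed (use elim in simp)
    qed
  qed
  also have "\<dots> = ennreal (2 * (b * ?g b))"
    using ki half kpos by (subst nn_integral_eq_integral) (auto simp: indicator_def)
  finally show ?thesis by (simp add: mult.assoc)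
qed

text \<open>With \<open>g\<close> the density of one step, the convolution of \<open>g\<close> with
  \<open>csch_tail_density\<close> has at \<open>x\<close> the value of the integral of
  \<open>(4 / pi^2) b g(b)\<close> over \<open>b >= |x|\<close>; it is thus a mixture of indicators
  of \<open>[-b, b]\<close>. For this the tail density is written as an integral over
  \<open>v\<close>, the window around \<open>x\<close> is converted into \<open>b >= x\<close>, and
  the integral over \<open>v\<close> is evaluated last.\<close>

lemma nn_integral_csch_tail_convolution:
  fixes f :: "real \<Rightarrow> ennreal"
  assumes [measurable]: "f \<in> borel_measurable borel"
  shows "(\<integral>\<^sup>+t. \<integral>\<^sup>+r. f (t + r) * ennreal (csch_tail_density r) \<partial>lborel \<partial>sech_step) =
    (\<integral>\<^sup>+b. ennreal (4 / pi\<^sup>2 * (b * sech_density 1 b)) * (\<integral>\<^sup>+x. f x * indicator {- b..b} x \<partial>lborel) * indicator {0<..} b \<partial>lborel)"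
proof -
  let ?g = "sech_density 1" and ?w = csch_tail_density
  let ?H = "\<lambda>(t, x). f x * (ennreal (?g t) * ennreal (?w (x - t)))"
  let ?K = "\<lambda>(x, b). f x * (ennreal (4 / pi\<^sup>2 * (b * ?g b)) * indicator {- b..b} x * indicator {0<..} b)"
  have q: "(\<integral>\<^sup>+t. ennreal (?g t) * ennreal (?w (x - t)) \<partial>lborel) = (\<integral>\<^sup>+b. ennreal (4 / pi\<^sup>2 * (b * ?g b)) * indicator {\<bar>x\<bar>..} b \<partial>lborel)"
    if x0: "x \<noteq> 0" for x
  proof -
    have pos: "(\<integral>\<^sup>+t. ennreal (?g t) * ennreal (?w (x - t)) \<partial>lborel) = (\<integral>\<^sup>+b. ennreal (4 / pi\<^sup>2 * (b * ?g b)) * indicator {x..} b \<partial>lborel)"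
      if x: "x > 0" for x
    proof -
      let ?F = "\<lambda>(t, v). ennreal (2 / pi\<^sup>2) * (ennreal (1 / sinh v) * (ennreal (?g t) * indicator {x - v..x + v} t)) * indicator {0<..} v"
      let ?G = "\<lambda>(b, v). ennreal (2 / pi\<^sup>2) * (ennreal (1 / sinh v) * (ennreal (?g (b - v) - ?g (b + v)) * indicator {x..} b)) * indicator {0<..} v"
      \<comment> \<open>\<open>v >= |x - t|\<close> is read as \<open>t\<close> lying in
        \<open>[x - v, x + v]\<close>. The point \<open>t = x\<close> is excluded because the tail
        integral diverges there.\<close>
      have w: "AE t in lborel. ennreal (?w (x - t)) = ennreal (2 / pi\<^sup>2) * (\<integral>\<^sup>+v. ennreal (1 / sinh v) * indicator {x - v..x + v} t * indicator {0<..} v \<partial>lborel)"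
        using AE_lborel_singleton[of x]
      proof eventually_elim
        case (elim t)
        have "(\<integral>\<^sup>+v. ennreal (1 / sinh v) * indicator {x - v..x + v} t * indicator {0<..} v \<partial>lborel) =
          (\<integral>\<^sup>+v. ennreal (1 / sinh v) * indicator {\<bar>x - t\<bar>..} v \<partial>lborel)"
          by (intro nn_integral_cong) (use elim in \<open>auto simp: indicator_def\<close>)
        also have "\<dots> = ennreal (2 * artanh (exp (- \<bar>x - t\<bar>)))"
          by (rule nn_integral_csch_tail) (use elim in simp)
        finally show ?case by (simp add: csch_tail_density_def ennreal_mult'[symmetric])
      qed
      have "(\<integral>\<^sup>+t. ennreal (?g t) * ennreal (?w (x - t)) \<partial>lborel) =
        (\<integral>\<^sup>+t. \<integral>\<^sup>+v. ?F (t, v) \<partial>lborel \<partial>lborel)"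
      proof (rule nn_integral_cong_AE)
        show "AE t in lborel. ennreal (?g t) * ennreal (?w (x - t)) = (\<integral>\<^sup>+v. ?F (t, v) \<partial>lborel)"
          using w
        proof eventually_elim
          case (elim t)
          have "ennreal (?g t) * ennreal (?w (x - t)) = (ennreal (?g t) * ennreal (2 / pi\<^sup>2)) * (\<integral>\<^sup>+v. ennreal (1 / sinh v) * indicator {x - v..x + v} t * indicator {0<..} v \<partial>lborel)"
            unfolding elim by (simp add: mult.assoc)
          also have "\<dots> = (\<integral>\<^sup>+v. (ennreal (?g t) * ennreal (2 / pi\<^sup>2)) * (ennreal (1 / sinh v) * indicator {x - v..x + v} t * indicator {0<..} v) \<partial>lborel)"
            by (rule nn_integral_cmult[symmetric]) (simp add: indicator_def, measurable)
          finally show ?case by (simp add: mult_ac)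
        qed
      qed
      also have "\<dots> = (\<integral>\<^sup>+v. \<integral>\<^sup>+t. ?F (t, v) \<partial>lborel \<partial>lborel)"
        by (rule lborel_pair.Fubini'[symmetric]) (simp add: indicator_def case_prod_beta, measurable)
      also have "\<dots> = (\<integral>\<^sup>+v. \<integral>\<^sup>+b. ?G (b, v) \<partial>lborel \<partial>lborel)"
      proof (rule nn_integral_cong)
        fix v :: real
        show "(\<integral>\<^sup>+t. ?F (t, v) \<partial>lborel) =
          (\<integral>\<^sup>+b. ?G (b, v) \<partial>lborel)"
        proof (cases "v > 0")
          case True
          thus ?thesis using nn_integral_sech_density_window[OF x True]
            by (simp add: nn_integral_cmult del: One_nat_def)
        qed simp
      qed
      also have "\<dots> = (\<integral>\<^sup>+b. \<integral>\<^sup>+v. ?G (b, v) \<partial>lborel \<partial>lborel)"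
        by (rule lborel_pair.Fubini') measurable
      also have "\<dots> = (\<integral>\<^sup>+b. ennreal (4 / pi\<^sup>2 * (b * ?g b)) * indicator {x..} b \<partial>lborel)"
      proof (rule nn_integral_cong)
        fix b :: real
        show "(\<integral>\<^sup>+v. ?G (b, v) \<partial>lborel) =
          ennreal (4 / pi\<^sup>2 * (b * ?g b)) * indicator {x..} b"
        proof (cases "b \<ge> x")
          case True
          hence "b > 0" using x by simp
          have "(\<integral>\<^sup>+v. ennreal (2 / pi\<^sup>2) * (ennreal (1 / sinh v) * ennreal (?g (b - v) - ?g (b + v)) * indicator {0<..} v) \<partial>lborel) = ennreal (2 / pi\<^sup>2) * ennreal (2 * b * ?g b)"
            by (subst nn_integral_cmult, measurable, subst nn_integral_csch_window[OF \<open>b > 0\<close>], rule refl)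
          also have "\<dots> = ennreal (4 / pi\<^sup>2 * (b * ?g b))" by (subst ennreal_mult'[symmetric]) (auto simp: mult.assoc)
          finally show ?thesis using True by (simp add: mult_ac del: One_nat_def)
        qed simp
      qed
      finally show ?thesis .
    qed
    show ?thesis
    proof (cases "x > 0")
      case True thus ?thesis using pos[OF True] by simp
    next
      case False
      hence x: "- x > 0" using x0 by simp
      have "(\<integral>\<^sup>+t. ennreal (?g t) * ennreal (?w (x - t)) \<partial>lborel) = (\<integral>\<^sup>+t. ennreal (?g (- t)) * ennreal (?w (x - (- t))) \<partial>lborel)"
        using nn_integral_real_affine[of "\<lambda>t. ennreal (?g t) * ennreal (?w (x - t))" "-1" 0] by simp
      also have "\<dots> = (\<integral>\<^sup>+t. ennreal (?g t) * ennreal (?w (- x - t)) \<partial>lborel)"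
        using csch_tail_density_even[of "- x - _"] by (simp add: algebra_simps del: csch_tail_density_even)
      finally show ?thesis using pos[OF x] x by simp
    qed
  qed
  have "(\<integral>\<^sup>+t. \<integral>\<^sup>+r. f (t + r) * ennreal (?w r) \<partial>lborel \<partial>sech_step) = (\<integral>\<^sup>+t. ennreal (?g t) * (\<integral>\<^sup>+r. f (t + r) * ennreal (?w r) \<partial>lborel) \<partial>lborel)"
    by (rule nn_integral_density) measurable
  also have "\<dots> = (\<integral>\<^sup>+t. \<integral>\<^sup>+x. ?H (t, x) \<partial>lborel \<partial>lborel)"
  proof (rule nn_integral_cong)
    fix t
    have "(\<integral>\<^sup>+x. f x * ennreal (?w (x - t)) \<partial>lborel) = (\<integral>\<^sup>+r. f (t + r) * ennreal (?w r) \<partial>lborel)"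
      using nn_integral_real_affine[of "\<lambda>x. f x * ennreal (?w (x - t))" 1 t] by simp
    hence "ennreal (?g t) * (\<integral>\<^sup>+r. f (t + r) * ennreal (?w r) \<partial>lborel) = ennreal (?g t) * (\<integral>\<^sup>+x. f x * ennreal (?w (x - t)) \<partial>lborel)"
      by simp
    also have "\<dots> = (\<integral>\<^sup>+x. ennreal (?g t) * (f x * ennreal (?w (x - t))) \<partial>lborel)"
      by (rule nn_integral_cmult[symmetric]) measurable
    finally show "ennreal (?g t) * (\<integral>\<^sup>+r. f (t + r) * ennreal (?w r) \<partial>lborel) = (\<integral>\<^sup>+x. ?H (t, x) \<partial>lborel)"
      by (simp add: mult_ac)
  qed
  also have "\<dots> = (\<integral>\<^sup>+x. \<integral>\<^sup>+t. ?H (t, x) \<partial>lborel \<partial>lborel)"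
    by (rule lborel_pair.Fubini'[symmetric]) measurable
  also have "\<dots> = (\<integral>\<^sup>+x. \<integral>\<^sup>+b. ?K (x, b) \<partial>lborel \<partial>lborel)"
  proof (rule nn_integral_cong_AE)
    show "AE x in lborel. (\<integral>\<^sup>+t. ?H (t, x) \<partial>lborel) =
        (\<integral>\<^sup>+b. ?K (x, b) \<partial>lborel)"
      using AE_lborel_singleton[of 0]
    proof eventually_elim
      case (elim x)
      have "(\<integral>\<^sup>+t. f x * (ennreal (?g t) * ennreal (?w (x - t))) \<partial>lborel) = f x * (\<integral>\<^sup>+t. ennreal (?g t) * ennreal (?w (x - t)) \<partial>lborel)"
        by (rule nn_integral_cmult) measurable
      also have "\<dots> = (\<integral>\<^sup>+b. f x * (ennreal (4 / pi\<^sup>2 * (b * ?g b)) * indicator {\<bar>x\<bar>..} b) \<partial>lborel)"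
        unfolding q[OF elim] by (rule nn_integral_cmult[symmetric]) measurable
      also have "\<dots> = (\<integral>\<^sup>+b. f x * (ennreal (4 / pi\<^sup>2 * (b * ?g b)) * indicator {- b..b} x * indicator {0<..} b) \<partial>lborel)"
        by (intro nn_integral_cong) (use elim in \<open>auto simp: indicator_def\<close>)
      finally show ?case by simp
    qed
  qed
  also have "\<dots> = (\<integral>\<^sup>+b. \<integral>\<^sup>+x. ?K (x, b) \<partial>lborel \<partial>lborel)"
    by (rule lborel_pair.Fubini'[symmetric]) (simp add: indicator_def case_prod_beta, measurable)
  also have "\<dots> = (\<integral>\<^sup>+b. ennreal (4 / pi\<^sup>2 * (b * ?g b)) * (\<integral>\<^sup>+x. f x * indicator {- b..b} x \<partial>lborel) * indicator {0<..} b \<partial>lborel)"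
  proof (rule nn_integral_cong)
    fix b :: real
    have "(\<integral>\<^sup>+x. f x * (ennreal (4 / pi\<^sup>2 * (b * ?g b)) * indicator {- b..b} x * indicator {0<..} b) \<partial>lborel) =
       (\<integral>\<^sup>+x. (ennreal (4 / pi\<^sup>2 * (b * ?g b)) * indicator {0<..} b) * (f x * indicator {- b..b} x) \<partial>lborel)"
      by (intro nn_integral_cong) (simp only: mult_ac)
    also have "\<dots> = (ennreal (4 / pi\<^sup>2 * (b * ?g b)) * indicator {0<..} b) * (\<integral>\<^sup>+x. f x * indicator {- b..b} x \<partial>lborel)"
      by (rule nn_integral_cmult) measurable
    finally show "(\<integral>\<^sup>+x. ?K (x, b) \<partial>lborel) =
      ennreal (4 / pi\<^sup>2 * (b * ?g b)) * (\<integral>\<^sup>+x. f x * indicator {- b..b} x \<partial>lborel) * indicator {0<..} b"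
      by (simp add: mult_ac)
  qed
  finally show ?thesis .
qed

section \<open>The ramp averaged against ln |1 + y| - ln |1 + x|\<close>

lemma nn_integral_ln_one_plus_cis:
  fixes F :: "real \<Rightarrow> ennreal"
  assumes [measurable]: "F \<in> borel_measurable borel"
  shows "(\<integral>\<^sup>+\<theta>. F (ln (cmod (1 + cis \<theta>))) \<partial>angle_unif) = (\<integral>\<^sup>+t. F (ln 2 - ln (1 + (exp t)\<^sup>2) / 2) \<partial>sech_step)"
proof -
  have "(\<integral>\<^sup>+\<theta>. F (ln (cmod (1 + cis \<theta>))) \<partial>angle_unif) = (\<integral>\<^sup>+\<theta>. F (ln 2 - ln (1 + (tan (\<theta> / 2))\<^sup>2) / 2) \<partial>angle_unif)"
  proof (rule nn_integral_cong_AE)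
    show "AE \<theta> in angle_unif. F (ln (cmod (1 + cis \<theta>))) = F (ln 2 - ln (1 + (tan (\<theta> / 2))\<^sup>2) / 2)"
      using AE_angle_cis_neq[of "-1"]
    proof eventually_elim
      case (elim \<theta>)
      define x where "x = \<theta> / 2"
      have cis2: "cis \<theta> = cis x * cis x" by (simp add: x_def cis_mult)
      have e1: "1 + cis \<theta> = cis x * of_real (2 * cos x)"
        unfolding cis2 using sin_cos_squared_add[of x] by (simp add: complex_eq_iff power2_eq_square algebra_simps)
      have cx: "cos x \<noteq> 0" using e1 elim by (auto simp: add_eq_0_iff)
      have n1: "cmod (1 + cis \<theta>) = 2 * \<bar>cos x\<bar>" using e1 by (simp add: norm_mult)
      have "1 + (tan x)\<^sup>2 = 1 / \<bar>cos x\<bar>\<^sup>2"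
        using cx sin_cos_squared_add[of x] by (simp add: tan_def field_simps)
      moreover have "ln (1 / \<bar>cos x\<bar>\<^sup>2) = - 2 * ln \<bar>cos x\<bar>"
        using ln_div[of 1 "\<bar>cos x\<bar>\<^sup>2"] ln_realpow[of "\<bar>cos x\<bar>" 2] cx by (simp del: power2_abs)
      ultimately have "ln (1 + (tan x)\<^sup>2) = - 2 * ln \<bar>cos x\<bar>" by (simp only:)
      hence "ln (cmod (1 + cis \<theta>)) = ln 2 - ln (1 + (tan x)\<^sup>2) / 2" unfolding n1 using cx by (simp add: ln_mult)
      thus ?case by (simp add: x_def)
    qed
  qed
  also have "\<dots> = (\<integral>\<^sup>+t. (F (ln 2 - ln (1 + (exp t)\<^sup>2) / 2) + F (ln 2 - ln (1 + (- exp t)\<^sup>2) / 2)) / 2 \<partial>sech_law 1)"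
    by (rule nn_integral_angle_tan) measurable
  also have "\<dots> = (\<integral>\<^sup>+t. F (ln 2 - ln (1 + (exp t)\<^sup>2) / 2) \<partial>sech_step)"
    unfolding sech_law_1 by (simp add: mult_2[symmetric])
  finally show ?thesis .
qed

lemma nn_integral_csch_tail_reflect:
  fixes f :: "real \<Rightarrow> ennreal"
  assumes [measurable]: "f \<in> borel_measurable borel"
  shows "(\<integral>\<^sup>+r. f (- r) * ennreal (csch_tail_density r) \<partial>lborel) = (\<integral>\<^sup>+r. f r * ennreal (csch_tail_density r) \<partial>lborel)"
  using nn_integral_real_affine[of "\<lambda>r. f r * ennreal (csch_tail_density r)" "-1" 0] by simp

text \<open>The constants \<open>ln 2\<close> cancel in the difference, and its reversed sign is
  absorbed by the symmetry of the density.\<close>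

lemma nn_integral_ln_one_plus_cis_difference:
  fixes f :: "real \<Rightarrow> ennreal"
  assumes [measurable]: "f \<in> borel_measurable borel"
  shows "(\<integral>\<^sup>+x. \<integral>\<^sup>+y. f (ln (cmod (1 + cis y)) - ln (cmod (1 + cis x))) \<partial>angle_unif \<partial>angle_unif) =
    (\<integral>\<^sup>+r. f r * ennreal (csch_tail_density r) \<partial>lborel)"
proof -
  have "(\<integral>\<^sup>+x. \<integral>\<^sup>+y. f (ln (cmod (1 + cis y)) - ln (cmod (1 + cis x))) \<partial>angle_unif \<partial>angle_unif) =
    (\<integral>\<^sup>+x. (\<lambda>w. \<integral>\<^sup>+t. f ((ln 2 - ln (1 + (exp t)\<^sup>2) / 2) - w) \<partial>sech_step) (ln (cmod (1 + cis x))) \<partial>angle_unif)"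
    by (intro nn_integral_cong nn_integral_ln_one_plus_cis) measurable
  also have "\<dots> = (\<integral>\<^sup>+s. \<integral>\<^sup>+t. f ((ln 2 - ln (1 + (exp t)\<^sup>2) / 2) - (ln 2 - ln (1 + (exp s)\<^sup>2) / 2)) \<partial>sech_step \<partial>sech_step)"
    by (rule nn_integral_ln_one_plus_cis) measurable
  also have "\<dots> = (\<integral>\<^sup>+s. \<integral>\<^sup>+t. (\<lambda>r. f (- r)) (ln (1 + (exp t)\<^sup>2) / 2 - ln (1 + (exp s)\<^sup>2) / 2) \<partial>sech_step \<partial>sech_step)"
    by simp
  also have "\<dots> = (\<integral>\<^sup>+r. f (- r) * ennreal (csch_tail_density r) \<partial>lborel)"
    by (rule nn_integral_half_log_difference) measurable
  also have "\<dots> = (\<integral>\<^sup>+r. f r * ennreal (csch_tail_density r) \<partial>lborel)"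
    by (rule nn_integral_csch_tail_reflect) measurable
  finally show ?thesis .
qed

text \<open>\<open>4 / pi^2\<close> times the Legendre chi function of order 3 at
  \<open>e^(-|s|)\<close>. It is \<open>csch_tail_density\<close> with each exponential of its
  series integrated twice more, which is what the mean of a ramp amounts to.\<close>

definition odd_trilog :: "real \<Rightarrow> real" where
  "odd_trilog s = (\<Sum>k. 4 / pi\<^sup>2 * (exp (- (2 * real k + 1) * \<bar>s\<bar>) / (2 * real k + 1) ^ 3))"

lemma summable_odd_cubes: "summable (\<lambda>k. 1 / (2 * real k + 1) ^ 3)"
proof (rule summable_comparison_test')
  show "summable (\<lambda>k. inverse (real k ^ 3))" by (rule inverse_power_summable) simp
  show "norm (1 / (2 * real k + 1) ^ 3) \<le> inverse (real k ^ 3)" if "k \<ge> 1" for k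
  proof -
    have "real k ^ 3 \<le> (2 * real k + 1) ^ 3" by (intro power_mono) auto
    thus ?thesis using that by (simp add: inverse_eq_divide frac_le)
  qed
qed

lemma exp_odd_le_one: "exp (- (2 * real k + 1) * \<bar>s\<bar>) \<le> 1"
proof -
  have "0 \<le> (2 * real k + 1) * \<bar>s\<bar>" by simp
  thus ?thesis by (simp only: exp_le_one_iff mult_minus_left neg_le_0_iff_le)
qed

lemma summable_odd_trilog: "summable (\<lambda>k. 4 / pi\<^sup>2 * (exp (- (2 * real k + 1) * \<bar>s\<bar>) / (2 * real k + 1) ^ 3))"
proof (rule summable_mult, rule summable_comparison_test'[OF summable_odd_cubes])
  fix k :: nat
  show "norm (exp (- (2 * real k + 1) * \<bar>s\<bar>) / (2 * real k + 1) ^ 3) \<le> 1 / (2 * real k + 1) ^ 3"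
    unfolding real_norm_def abs_divide abs_exp_cancel
    by (rule frac_le) (use exp_odd_le_one in auto)
qed

lemma odd_trilog_nonneg: "odd_trilog s \<ge> 0"
  unfolding odd_trilog_def by (rule suminf_nonneg[OF summable_odd_trilog]) simp

lemma odd_trilog_bound: "odd_trilog s \<le> odd_trilog 0"
  unfolding odd_trilog_def
proof (rule suminf_le[OF _ summable_odd_trilog summable_odd_trilog])
  fix k :: nat
  show "4 / pi\<^sup>2 * (exp (- (2 * real k + 1) * \<bar>s\<bar>) / (2 * real k + 1) ^ 3) \<le> 4 / pi\<^sup>2 * (exp (- (2 * real k + 1) * \<bar>0\<bar>) / (2 * real k + 1) ^ 3)"
    by (intro mult_left_mono divide_right_mono) (use exp_odd_le_one[of k s] in auto)
qed

lemma odd_trilog_measurable [measurable]: "odd_trilog \<in> borel_measurable borel"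
  unfolding odd_trilog_def by measurable

lemma nn_integral_ramp_exp:
  fixes a c :: real
  assumes a: "a > 0"
  shows "(\<integral>\<^sup>+r. ennreal (max 0 (r - c) * exp (- a * r)) \<partial>lborel) = ennreal (exp (- a * c) / a\<^sup>2)"
proof -
  have "(\<integral>\<^sup>+r. ennreal (max 0 (r - c) * exp (- a * r)) \<partial>lborel) = (\<integral>\<^sup>+r. ennreal ((r - c) * exp (- a * r)) * indicator {c..} r \<partial>lborel)"
    by (intro nn_integral_cong) (auto simp: indicator_def max_def)
  also have "\<dots> = ennreal (0 - (- exp (- a * c) * ((c - c) / a + 1 / a\<^sup>2)))"
  proof (rule nn_integral_FTC_atLeast[where F = "\<lambda>r. - exp (- a * r) * ((r - c) / a + 1 / a\<^sup>2)"])
    show "DERIV (\<lambda>r. - exp (- a * r) * ((r - c) / a + 1 / a\<^sup>2)) r :> (r - c) * exp (- a * r)" for r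
      using a by (auto intro!: derivative_eq_intros simp: field_simps power2_eq_square)
    show "((\<lambda>r. - exp (- a * r) * ((r - c) / a + 1 / a\<^sup>2)) \<longlongrightarrow> 0) at_top" using a by real_asymp
  qed auto
  finally show ?thesis by simp
qed

text \<open>For \<open>s <= 0\<close> the ramp is supported on \<open>r >= -s\<close>, inside the
  half line where the density is a series of the exponentials \<open>e^(-(2 k + 1) r)\<close>;
  integrated against the ramp, each of them gains \<open>1 / (2 k + 1)^2\<close>.\<close>

lemma nn_integral_ramp_csch_tail_nonpos:
  assumes s: "s \<le> 0"
  shows "(\<integral>\<^sup>+r. ennreal (max 0 (s + r)) * ennreal (csch_tail_density r) \<partial>lborel) = ennreal (odd_trilog s)"
proof -
  have "(\<integral>\<^sup>+r. ennreal (max 0 (s + r)) * ennreal (csch_tail_density r) \<partial>lborel) =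
    (\<integral>\<^sup>+r. (\<Sum>k. ennreal (4 / pi\<^sup>2 / (2 * real k + 1) * (max 0 (r - (- s)) * exp (- (2 * real k + 1) * r)))) \<partial>lborel)"
  proof (rule nn_integral_cong_AE)
    show "AE r in lborel. ennreal (max 0 (s + r)) * ennreal (csch_tail_density r) = (\<Sum>k. ennreal (4 / pi\<^sup>2 / (2 * real k + 1) * (max 0 (r - (- s)) * exp (- (2 * real k + 1) * r))))"
      using AE_lborel_singleton[of 0]
    proof eventually_elim
      case (elim r)
      show ?case
      proof (cases "r > 0")
        case True
        have "ennreal (max 0 (s + r)) * ennreal (csch_tail_density r) = (\<Sum>k. ennreal (max 0 (s + r)) * ennreal (4 / pi\<^sup>2 * (exp (- (2 * real k + 1) * \<bar>r\<bar>) / (2 * real k + 1))))"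
          unfolding csch_tail_density_series[OF elim] by (rule ennreal_suminf_cmult[symmetric])
        also have "\<dots> = (\<Sum>k. ennreal (4 / pi\<^sup>2 / (2 * real k + 1) * (max 0 (r - (- s)) * exp (- (2 * real k + 1) * r))))"
        proof (rule suminf_cong)
          fix k
          have "ennreal (max 0 (s + r)) * ennreal (4 / pi\<^sup>2 * (exp (- (2 * real k + 1) * \<bar>r\<bar>) / (2 * real k + 1))) =
            ennreal (max 0 (s + r) * (4 / pi\<^sup>2 * (exp (- (2 * real k + 1) * \<bar>r\<bar>) / (2 * real k + 1))))"
            by (rule ennreal_mult'[symmetric]) simp
          also have "max 0 (s + r) * (4 / pi\<^sup>2 * (exp (- (2 * real k + 1) * \<bar>r\<bar>) / (2 * real k + 1))) =
            4 / pi\<^sup>2 / (2 * real k + 1) * (max 0 (r - (- s)) * exp (- (2 * real k + 1) * r))"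
            using True by (simp add: add.commute mult_ac)
          finally show "ennreal (max 0 (s + r)) * ennreal (4 / pi\<^sup>2 * (exp (- (2 * real k + 1) * \<bar>r\<bar>) / (2 * real k + 1))) =
            ennreal (4 / pi\<^sup>2 / (2 * real k + 1) * (max 0 (r - (- s)) * exp (- (2 * real k + 1) * r)))" .
        qed
        finally show ?thesis .
      next
        case False
        hence "max 0 (s + r) = 0" "max 0 (r - (- s)) = 0" using s elim by auto
        thus ?thesis by simp
      qed
    qed
  qed
  also have "\<dots> = (\<Sum>k. \<integral>\<^sup>+r. ennreal (4 / pi\<^sup>2 / (2 * real k + 1) * (max 0 (r - (- s)) * exp (- (2 * real k + 1) * r))) \<partial>lborel)"
    by (rule nn_integral_suminf) measurable
  also have "\<dots> = (\<Sum>k. ennreal (4 / pi\<^sup>2 * (exp (- (2 * real k + 1) * \<bar>s\<bar>) / (2 * real k + 1) ^ 3)))"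
  proof (rule suminf_cong)
    fix k
    let ?a = "2 * real k + 1"
    have "(\<integral>\<^sup>+r. ennreal (4 / pi\<^sup>2 / ?a * (max 0 (r - (- s)) * exp (- ?a * r))) \<partial>lborel) =
      (\<integral>\<^sup>+r. ennreal (4 / pi\<^sup>2 / ?a) * ennreal (max 0 (r - (- s)) * exp (- ?a * r)) \<partial>lborel)"
      by (intro nn_integral_cong ennreal_mult') simp
    also have "\<dots> = ennreal (4 / pi\<^sup>2 / ?a) * ennreal (exp (- ?a * (- s)) / ?a\<^sup>2)"
      by (subst nn_integral_cmult, measurable, subst nn_integral_ramp_exp) auto
    also have "\<dots> = ennreal (4 / pi\<^sup>2 / ?a * (exp (- ?a * (- s)) / ?a\<^sup>2))" by (rule ennreal_mult'[symmetric]) simp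
    also have "4 / pi\<^sup>2 / ?a * (exp (- ?a * (- s)) / ?a\<^sup>2) = 4 / pi\<^sup>2 * (exp (- ?a * \<bar>s\<bar>) / ?a ^ 3)"
      using s by (simp add: power2_eq_square power3_eq_cube)
    finally show "(\<integral>\<^sup>+r. ennreal (4 / pi\<^sup>2 / ?a * (max 0 (r - (- s)) * exp (- ?a * r))) \<partial>lborel) = ennreal (4 / pi\<^sup>2 * (exp (- ?a * \<bar>s\<bar>) / ?a ^ 3))" .
  qed
  also have "\<dots> = ennreal (odd_trilog s)"
    unfolding odd_trilog_def by (rule suminf_ennreal2[OF _ summable_odd_trilog]) simp
  finally show ?thesis .
qed

lemma csch_tail_density_nonneg: "csch_tail_density r \<ge> 0"
proof (cases "r = 0")
  case True thus ?thesis by (simp add: csch_tail_density_def artanh_def)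
next
  case False
  have "artanh (exp (- \<bar>r\<bar>)) \<ge> 0"
    using False by (simp add: artanh_def)
  thus ?thesis by (simp add: csch_tail_density_def)
qed

text \<open>For \<open>s > 0\<close> one has \<open>max 0 (s + r) = s + r + max 0 (-s - r)\<close>.
  The density has mass 1 and mean 0 and is even, so the last term reduces to the case
  \<open>-s <= 0\<close> and yields \<open>odd_trilog (-s) = odd_trilog s\<close>.\<close>

lemma nn_integral_ramp_csch_tail:
  "(\<integral>\<^sup>+r. ennreal (max 0 (s + r)) * ennreal (csch_tail_density r) \<partial>lborel) = ennreal (max 0 s + odd_trilog s)"
proof (cases "s \<le> 0")
  case True thus ?thesis using nn_integral_ramp_csch_tail_nonpos[OF True] by simp
next
  case False
  let ?w = csch_tail_density
  have mass: "(\<integral>\<^sup>+r. 1 * ennreal (?w r) \<partial>lborel) = 1"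
    using nn_integral_ln_one_plus_cis_difference[of "\<lambda>_. 1"] angle.emeasure_space_1 by simp
  have w: "integrable lborel ?w" "(\<integral>r. ?w r \<partial>lborel) = 1"
    using mass csch_tail_density_nonneg by (auto simp: integrable_iff_bounded integral_eq_nn_integral)
  have ramp: "integrable lborel (\<lambda>r. max 0 (c + r) * ?w r)" "(\<integral>r. max 0 (c + r) * ?w r \<partial>lborel) = odd_trilog c" if "c \<le> 0" for c
  proof -
    have "(\<integral>\<^sup>+r. ennreal (max 0 (c + r) * ?w r) \<partial>lborel) = ennreal (odd_trilog c)"
      using nn_integral_ramp_csch_tail_nonpos[OF that] csch_tail_density_nonneg by (simp add: ennreal_mult')
    thus "integrable lborel (\<lambda>r. max 0 (c + r) * ?w r)" "(\<integral>r. max 0 (c + r) * ?w r \<partial>lborel) = odd_trilog c"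
      using csch_tail_density_nonneg odd_trilog_nonneg by (auto simp: integrable_iff_bounded integral_eq_nn_integral abs_mult)
  qed
  have refl: "integrable lborel (\<lambda>r. max 0 (c - r) * ?w r)" "(\<integral>r. max 0 (c - r) * ?w r \<partial>lborel) = odd_trilog c" if "c \<le> 0" for c
    using lborel_integrable_real_affine[OF ramp(1)[OF that], of "-1" 0] ramp(2)[OF that]
      lborel_integral_real_affine[of "-1" "\<lambda>r. max 0 (c + r) * ?w r" 0] by simp_all
  have id_eq: "r * ?w r = max 0 (0 + r) * ?w r - max 0 (0 - r) * ?w r" for r by (simp add: max_def algebra_simps)
  have idi: "integrable lborel (\<lambda>r. r * ?w r)" "(\<integral>r. r * ?w r \<partial>lborel) = 0"
    unfolding id_eq using ramp[of 0] refl[of 0] by (auto intro: Bochner_Integration.integrable_diff)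
  have eq: "max 0 (s + r) * ?w r = s * ?w r + r * ?w r + max 0 (- s - r) * ?w r" for r
    by (simp add: max_def algebra_simps)
  have ns: "- s \<le> 0" using False by simp
  have "integrable lborel (\<lambda>r. max 0 (s + r) * ?w r)" "(\<integral>r. max 0 (s + r) * ?w r \<partial>lborel) = s + odd_trilog s"
  proof -
    have hb: "has_bochner_integral lborel (\<lambda>r. s * ?w r + r * ?w r + max 0 (- s - r) * ?w r) (s * 1 + 0 + odd_trilog (- s))"
      using w idi refl[OF ns] by (intro has_bochner_integral_add has_bochner_integral_mult_right) (auto simp: has_bochner_integral_iff)
    moreover have "odd_trilog (- s) = odd_trilog s" by (simp add: odd_trilog_def)
    ultimately show "integrable lborel (\<lambda>r. max 0 (s + r) * ?w r)" "(\<integral>r. max 0 (s + r) * ?w r \<partial>lborel) = s + odd_trilog s"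
      unfolding eq by (auto simp: has_bochner_integral_iff)
  qed
  hence "(\<integral>\<^sup>+r. ennreal (max 0 (s + r) * ?w r) \<partial>lborel) = ennreal (s + odd_trilog s)"
    using csch_tail_density_nonneg by (subst nn_integral_eq_integral) auto
  moreover have "ennreal (max 0 (s + r)) * ennreal (?w r) = ennreal (max 0 (s + r) * ?w r)" for r
    by (rule ennreal_mult'[symmetric]) simp
  ultimately show ?thesis using False by (simp add: max_absorb2)
qed

lemma has_real_derivative_ramp_square: "((\<lambda>x::real. (max 0 x)\<^sup>2 / 2) has_real_derivative max 0 x) (at x)"
proof -
  consider "x > 0" | "x < 0" | "x = 0" by linarith
  thus ?thesis
  proof cases
    case 1
    have "((\<lambda>x::real. x\<^sup>2 / 2) has_real_derivative x) (at x)" by (auto intro!: derivative_eq_intros)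
    moreover have "eventually (\<lambda>y. y\<^sup>2 / 2 = (max 0 y)\<^sup>2 / 2) (nhds x)"
      using eventually_nhds_in_open[of "{0<..}" x] 1 by (auto elim!: eventually_mono simp: max_def)
    ultimately show ?thesis using 1 by (subst (asm) DERIV_cong_ev) auto
  next
    case 2
    have "((\<lambda>x::real. 0) has_real_derivative 0) (at x)" by simp
    moreover have "eventually (\<lambda>y. 0 = (max 0 y)\<^sup>2 / 2) (nhds x)"
      using eventually_nhds_in_open[of "{..<0}" x] 2 by (auto elim!: eventually_mono simp: max_def)
    ultimately show ?thesis using 2 by (subst (asm) DERIV_cong_ev) auto
  next
    case 3
    have "((\<lambda>h::real. (max 0 h)\<^sup>2 / 2 / h) \<longlongrightarrow> 0) (at 0)"
    proof (rule Lim_null_comparison)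
      show "\<forall>\<^sub>F h in at 0. norm ((max 0 h)\<^sup>2 / 2 / h) \<le> \<bar>h :: real\<bar>"
        by (intro always_eventually allI) (auto simp: max_def power2_eq_square)
      show "((\<lambda>h::real. \<bar>h\<bar>) \<longlongrightarrow> 0) (at 0)" by (rule tendsto_rabs_zero) simp
    qed
    thus ?thesis using 3 by (simp add: DERIV_def)
  qed
qed

text \<open>The mixture of intervals turns the ramp into its primitive,
  \<open>Th (c + b) - Th (c - b)\<close> with \<open>Th x = (max 0 x)^2 / 2\<close>; evenness in
  \<open>b\<close> then extends the half line to the whole line. The result is a mean of the form
  \<open>b f (c + b)\<close>, with the step \<open>b\<close> itself as a factor, which is the form
  that exchangeability can absorb.\<close>

lemma nn_integral_ramp_csch_tail_convolution:
  "(\<integral>\<^sup>+t. ennreal (max 0 (c + t) + odd_trilog (c + t)) \<partial>sech_step) =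
    ennreal (4 / pi\<^sup>2 * (\<integral>b. b * ((max 0 (c + b))\<^sup>2 / 2) \<partial>sech_step))"
proof -
  let ?g = "sech_density 1"
  define Th where "Th = (\<lambda>x::real. (max 0 x)\<^sup>2 / 2)"
  have [measurable]: "Th \<in> borel_measurable borel" unfolding Th_def by measurable
  have Thmono: "Th x \<le> Th y" if "x \<le> y" for x y
    using that unfolding Th_def by (intro divide_right_mono power_mono) auto
  have tb: "integrable lborel (\<lambda>b. b * Th (c + \<sigma> * b) * ?g b)" if "\<bar>\<sigma>\<bar> = 1" for \<sigma>
  proof (rule integrable_poly_growth_cauchy[of _ "(1 + \<bar>c\<bar>)\<^sup>2" 3])
    fix b
    have "(max 0 (c + \<sigma> * b))\<^sup>2 \<le> ((1 + \<bar>c\<bar>) * (1 + \<bar>b\<bar>))\<^sup>2"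
    proof (intro power_mono)
      have "c + \<sigma> * b \<le> \<bar>c\<bar> + \<bar>\<sigma>\<bar> * \<bar>b\<bar>" by (simp add: abs_mult[symmetric])
      also have "\<dots> \<le> (1 + \<bar>c\<bar>) * (1 + \<bar>b\<bar>)" using that by (simp add: algebra_simps)
      finally show "max 0 (c + \<sigma> * b) \<le> (1 + \<bar>c\<bar>) * (1 + \<bar>b\<bar>)" by simp
    qed simp
    hence "Th (c + \<sigma> * b) \<le> (1 + \<bar>c\<bar>)\<^sup>2 * (1 + \<bar>b\<bar>)\<^sup>2"
      using zero_le_power2[of "max 0 (c + \<sigma> * b)"] unfolding Th_def power_mult_distrib by linarith
    moreover have Tn: "Th (c + \<sigma> * b) \<ge> 0" by (simp add: Th_def)
    ultimately have "\<bar>b\<bar> * Th (c + \<sigma> * b) \<le> (1 + \<bar>b\<bar>) * ((1 + \<bar>c\<bar>)\<^sup>2 * (1 + \<bar>b\<bar>)\<^sup>2)"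
      by (intro mult_mono) auto
    thus "\<bar>b * Th (c + \<sigma> * b)\<bar> \<le> (1 + \<bar>c\<bar>)\<^sup>2 * (1 + \<bar>b\<bar>) ^ 3"
      using Tn by (simp add: abs_mult power3_eq_cube power2_eq_square mult_ac)
  qed measurable
  have i1: "integrable lborel (\<lambda>b. b * Th (c + b) * ?g b)" and i2: "integrable lborel (\<lambda>b. b * Th (c - b) * ?g b)"
    using tb[of 1] tb[of "-1"] by simp_all
  have i: "integrable lborel (\<lambda>b. b * (Th (c + b) - Th (c - b)) * ?g b)"
    using Bochner_Integration.integrable_diff[OF i1 i2] by (simp add: algebra_simps)
  have "(\<integral>\<^sup>+t. ennreal (max 0 (c + t) + odd_trilog (c + t)) \<partial>sech_step) =
    (\<integral>\<^sup>+t. \<integral>\<^sup>+r. (\<lambda>x. ennreal (max 0 (c + x))) (t + r) * ennreal (csch_tail_density r) \<partial>lborel \<partial>sech_step)"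
    unfolding nn_integral_ramp_csch_tail[symmetric] by (simp add: add.assoc)
  also have "\<dots> = (\<integral>\<^sup>+b. ennreal (4 / pi\<^sup>2 * (b * ?g b)) * (\<integral>\<^sup>+x. ennreal (max 0 (c + x)) * indicator {- b..b} x \<partial>lborel) * indicator {0<..} b \<partial>lborel)"
    by (rule nn_integral_csch_tail_convolution) measurable
  also have "\<dots> = (\<integral>\<^sup>+b. ennreal (4 / pi\<^sup>2 * (indicator {0..} b *\<^sub>R (b * (Th (c + b) - Th (c - b)) * ?g b))) \<partial>lborel)"
  proof (rule nn_integral_cong)
    fix b :: real
    show "ennreal (4 / pi\<^sup>2 * (b * ?g b)) * (\<integral>\<^sup>+x. ennreal (max 0 (c + x)) * indicator {- b..b} x \<partial>lborel) * indicator {0<..} b =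
      ennreal (4 / pi\<^sup>2 * (indicator {0..} b *\<^sub>R (b * (Th (c + b) - Th (c - b)) * ?g b)))"
    proof (cases "b > 0")
      case True
      have "(\<integral>\<^sup>+x. ennreal (max 0 (c + x)) * indicator {- b..b} x \<partial>lborel) = ennreal (Th (c + b) - Th (c + (- b)))"
      proof (rule nn_integral_FTC_Icc[where F = "\<lambda>x. Th (c + x)"])
        show "((\<lambda>x. Th (c + x)) has_real_derivative max 0 (c + x)) (at x)" for x
          using DERIV_shift[of Th "max 0 (c + x)" x c] has_real_derivative_ramp_square[of "c + x"]
          by (simp add: Th_def add.commute)
      qed (use True in auto)
      thus ?thesis using True Thmono[of "c - b" "c + b"] sech_density_nonneg[of 1 b]
        by (simp add: ennreal_mult'[symmetric] mult_ac del: One_nat_def)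
    qed (auto simp: indicator_def)
  qed
  also have "\<dots> = ennreal (4 / pi\<^sup>2 * (\<integral>b. indicator {0..} b *\<^sub>R (b * (Th (c + b) - Th (c - b)) * ?g b) \<partial>lborel))"
  proof -
    have i0: "integrable lborel (\<lambda>b. indicator {0..} b *\<^sub>R (b * (Th (c + b) - Th (c - b)) * ?g b))"
      by (rule integrable_mult_indicator[OF _ i]) simp
    have nn: "0 \<le> 4 / pi\<^sup>2 * (indicator {0..} b *\<^sub>R (b * (Th (c + b) - Th (c - b)) * ?g b))" for b
      using Thmono[of "c - b" "c + b"] sech_density_nonneg[of 1 b] by (auto simp: indicator_def)
    show ?thesis
      using nn i0 by (subst nn_integral_eq_integral) (auto simp del: One_nat_def)
  qed
  also have "(\<integral>b. indicator {0..} b *\<^sub>R (b * (Th (c + b) - Th (c - b)) * ?g b) \<partial>lborel) = (\<integral>b. b * Th (c + b) \<partial>sech_law 1)"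
  proof -
    have i0: "integrable lborel (\<lambda>b. indicator {0..} b *\<^sub>R (b * (Th (c + b) - Th (c - b)) * ?g b))"
      by (rule integrable_mult_indicator[OF _ i]) simp
    have "2 * (\<integral>b. indicator {0..} b *\<^sub>R (b * (Th (c + b) - Th (c - b)) * ?g b) \<partial>lborel) = (\<integral>b. b * (Th (c + b) - Th (c - b)) * ?g b \<partial>lborel)"
      by (rule integrable_even_extension(2)[OF i0, symmetric]) (simp add: algebra_simps)
    also have "\<dots> = (\<integral>b. b * Th (c + b) * ?g b - b * Th (c - b) * ?g b \<partial>lborel)"
      by (simp add: algebra_simps)
    also have "\<dots> = (\<integral>b. b * Th (c + b) * ?g b \<partial>lborel) - (\<integral>b. b * Th (c - b) * ?g b \<partial>lborel)"
      using i1 i2 by (rule Bochner_Integration.integral_diff)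
    also have "(\<integral>b. b * Th (c - b) * ?g b \<partial>lborel) = - (\<integral>b. b * Th (c + b) * ?g b \<partial>lborel)"
      using lborel_integral_real_affine[of "-1" "\<lambda>b. b * Th (c - b) * ?g b" 0] by (simp del: One_nat_def)
    also have "(\<integral>b. b * Th (c + b) * ?g b \<partial>lborel) = (\<integral>b. b * Th (c + b) \<partial>sech_law 1)"
      by (rule integral_sech_law[symmetric]) auto
    finally show ?thesis by (simp del: One_nat_def)
  qed
  finally show ?thesis by (simp only: Th_def sech_law_1)
qed

text \<open>\<open>max 0 s + odd_trilog s\<close> is the mean of \<open>max 0 (s + ln |1 + y| - ln |1 + x|)\<close> over the torus.\<close>

lemma nn_integral_ramp_odd_trilog_law:
  assumes k: "k \<ge> 1"
  shows "(\<integral>\<^sup>+s. ennreal (max 0 s + odd_trilog s) \<partial>sech_law k) = ennreal ((\<integral>s. \<bar>s\<bar> ^ 3 \<partial>sech_law k) / (real k * pi\<^sup>2))"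
proof -
  obtain j where kj: "k = Suc j" using k by (cases k) auto
  define Th where "Th = (\<lambda>x::real. (max 0 x)\<^sup>2 / 2)"
  have [measurable]: "Th \<in> borel_measurable borel" unfolding Th_def by measurable
  have Tb: "\<bar>Th s\<bar> \<le> 1 * (1 + \<bar>s\<bar>) ^ 2" for s
  proof -
    have "(max 0 s)\<^sup>2 \<le> (1 + \<bar>s\<bar>)\<^sup>2" by (intro power_mono) auto
    thus ?thesis using zero_le_power2[of "max 0 s"] unfolding Th_def abs_divide abs_power2 by linarith
  qed
  interpret A: prob_space "sech_law j" by (rule prob_space_sech_law)
  have fin: "finite_measure sech_step" by (rule step.finite_measure_axioms)
  \<comment> \<open>One of the \<open>k\<close> steps is set aside for the convolution with the tail
    density. \<open>K s\<close> is the mean over this step when the other \<open>k - 1\<close> steps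
    add up to \<open>s\<close>.\<close>
  define K where "K = (\<lambda>s. 4 / pi\<^sup>2 * (\<integral>b. b * Th (s + b) \<partial>sech_step))"
  have "(\<integral>\<^sup>+s. ennreal (max 0 s + odd_trilog s) \<partial>sech_law k) = (\<integral>\<^sup>+s. \<integral>\<^sup>+t. ennreal (max 0 (s + t) + odd_trilog (s + t)) \<partial>sech_step \<partial>sech_law j)"
    unfolding kj sech_law.simps by (rule nn_integral_convolution) (use fin in auto)
  also have "\<dots> = (\<integral>\<^sup>+s. ennreal (K s) \<partial>sech_law j)"
    unfolding nn_integral_ramp_csch_tail_convolution by (simp only: K_def Th_def)
  also have "\<dots> = ennreal (\<integral>s. K s \<partial>sech_law j)"
  proof (rule nn_integral_eq_integral)
    show "integrable (sech_law j) K"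
      unfolding K_def by (rule integrable_mult_right) (rule sech_law_exchange(2)[OF _ Tb], measurable)
    \<comment> \<open>Needed to pass from the extended to the ordinary integral. After
      symmetrisation the integrand is \<open>b (Th (s + b) - Th (s - b))\<close>, and
      \<open>Th\<close> is nondecreasing.\<close>
    have "K s \<ge> 0" for s
    proof -
      have "(\<integral>b. b * Th (s + b) \<partial>sech_step) = (\<integral>b. (- b) * Th (s + (- b)) \<partial>sech_step)"
        using integral_sech_law_reflect[of 1 "\<lambda>b. b * Th (s + b)"] unfolding sech_law_1 by simp
      moreover have "integrable (sech_law 1) (\<lambda>b. b * Th (s + \<sigma> * b))" if "\<bar>\<sigma>\<bar> = 1" for \<sigma>
      proof (rule integrable_sech_law[of _ "(1 + \<bar>s\<bar>)\<^sup>2" 3])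
        fix b
        have "(max 0 (s + \<sigma> * b))\<^sup>2 \<le> ((1 + \<bar>s\<bar>) * (1 + \<bar>b\<bar>))\<^sup>2"
        proof (intro power_mono)
          have "s + \<sigma> * b \<le> \<bar>s\<bar> + \<bar>\<sigma>\<bar> * \<bar>b\<bar>" by (simp add: abs_mult[symmetric])
          also have "\<dots> \<le> (1 + \<bar>s\<bar>) * (1 + \<bar>b\<bar>)" using that by (simp add: algebra_simps)
          finally show "max 0 (s + \<sigma> * b) \<le> (1 + \<bar>s\<bar>) * (1 + \<bar>b\<bar>)" by simp
        qed simp
        hence "Th (s + \<sigma> * b) \<le> (1 + \<bar>s\<bar>)\<^sup>2 * (1 + \<bar>b\<bar>)\<^sup>2"
      using zero_le_power2[of "max 0 (s + \<sigma> * b)"] unfolding Th_def power_mult_distrib by linarith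
        moreover have "Th (s + \<sigma> * b) \<ge> 0" by (simp add: Th_def)
        ultimately have "\<bar>b\<bar> * Th (s + \<sigma> * b) \<le> (1 + \<bar>b\<bar>) * ((1 + \<bar>s\<bar>)\<^sup>2 * (1 + \<bar>b\<bar>)\<^sup>2)"
          by (intro mult_mono) auto
        thus "\<bar>b * Th (s + \<sigma> * b)\<bar> \<le> (1 + \<bar>s\<bar>)\<^sup>2 * (1 + \<bar>b\<bar>) ^ 3"
          using \<open>Th (s + \<sigma> * b) \<ge> 0\<close> by (simp add: abs_mult power3_eq_cube power2_eq_square mult_ac)
      qed measurable
      from this[of 1] this[of "-1"] have "integrable sech_step (\<lambda>b. b * Th (s + b))" "integrable sech_step (\<lambda>b. b * Th (s - b))"
        unfolding sech_law_1 by simp_all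
      hence "(\<integral>b. b * Th (s + b) \<partial>sech_step) + (\<integral>b. (- b) * Th (s + (- b)) \<partial>sech_step) = (\<integral>b. b * (Th (s + b) - Th (s - b)) \<partial>sech_step)"
        by (subst Bochner_Integration.integral_add[symmetric]) (simp_all add: algebra_simps)
      moreover have "\<dots> \<ge> 0"
      proof (rule Bochner_Integration.integral_nonneg)
        fix b
        have mono: "Th x \<le> Th y" if "x \<le> y" for x y
          using that unfolding Th_def by (intro divide_right_mono power_mono) auto
        show "0 \<le> b * (Th (s + b) - Th (s - b))"
          using mono[of "s - b" "s + b"] mono[of "s + b" "s - b"] by (cases "b \<ge> 0") (auto intro: mult_nonpos_nonpos)
      qed
      ultimately have "(\<integral>b. b * Th (s + b) \<partial>sech_step) \<ge> 0" by linarith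
      thus ?thesis by (simp add: K_def)
    qed
    thus "AE s in sech_law j. 0 \<le> K s" by simp
  qed
  also have "(\<integral>s. K s \<partial>sech_law j) = 4 / pi\<^sup>2 * ((\<integral>s. s * Th s \<partial>sech_law k) / real k)"
    unfolding K_def kj using sech_law_exchange(1)[OF _ Tb, of j] by simp
  also have "(\<integral>s. s * Th s \<partial>sech_law k) = (\<integral>s. \<bar>s\<bar> ^ 3 \<partial>sech_law k) / 4"
  proof -
    have i: "integrable (sech_law k) (\<lambda>s. s * Th s)" "integrable (sech_law k) (\<lambda>s. (- s) * Th (- s))"
    proof -
      have b: "\<bar>s * Th s\<bar> \<le> 1 * (1 + \<bar>s\<bar>) ^ 3" for s
        unfolding abs_mult power3_eq_cube using Tb[of s]
        by (simp add: power2_eq_square mult.assoc mult_mono)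
      show "integrable (sech_law k) (\<lambda>s. s * Th s)" by (rule integrable_sech_law[OF _ b]) measurable
      show "integrable (sech_law k) (\<lambda>s. (- s) * Th (- s))"
        by (rule integrable_sech_law[of _ 1 3]) (use b[of "- _"] in auto)
    qed
    have "2 * (\<integral>s. s * Th s \<partial>sech_law k) = (\<integral>s. s * Th s \<partial>sech_law k) + (\<integral>s. (- s) * Th (- s) \<partial>sech_law k)"
      using integral_sech_law_reflect[OF k, of "\<lambda>s. s * Th s"] by simp
    also have "\<dots> = (\<integral>s. s * Th s + (- s) * Th (- s) \<partial>sech_law k)"
      by (rule Bochner_Integration.integral_add[OF i, symmetric])
    \<comment> \<open>\<open>s Th s\<close> is \<open>s^3 / 2\<close> for \<open>s > 0\<close> and 0
      otherwise, so adding the reflected function gives \<open>|s|^3 / 2\<close>. The mean of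
      \<open>s Th s\<close> is half of that, hence the quarter.\<close>
    also have "(\<lambda>s. s * Th s + (- s) * Th (- s)) = (\<lambda>s. \<bar>s\<bar> ^ 3 / 2)"
      by (auto simp: fun_eq_iff Th_def max_def abs_if power2_eq_square power3_eq_cube)
    finally show ?thesis by simp
  qed
  finally show ?thesis by (simp add: field_simps)
qed

section \<open>Reduction of the Mahler measures to moments\<close>

text \<open>Valid at the pole \<open>e^(i theta) = -1\<close> as well: both sides are 0 there, by
  division by zero on the left and inside the tangent.\<close>

lemma cayley_factor_cis: "(1 - cis \<theta>) / (1 + cis \<theta>) = - \<i> * of_real (tan (\<theta> / 2))"
proof -
  define x where "x = \<theta> / 2"
  have cis2: "cis \<theta> = cis x * cis x" by (simp add: x_def cis_mult)
  have e1: "1 + cis \<theta> = cis x * of_real (2 * cos x)"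
    unfolding cis2 using sin_cos_squared_add[of x] by (simp add: complex_eq_iff power2_eq_square algebra_simps)
  have e2: "1 - cis \<theta> = cis x * (- \<i> * of_real (2 * sin x))"
    unfolding cis2 using sin_cos_squared_add[of x] by (simp add: complex_eq_iff power2_eq_square algebra_simps)
  have "(1 - cis \<theta>) / (1 + cis \<theta>) = (- \<i> * of_real (2 * sin x)) / of_real (2 * cos x)"
    unfolding e1 e2 by (rule mult_divide_mult_cancel_left) simp
  thus ?thesis by (simp add: tan_def x_def)
qed

lemma cayley_prod_cis:
  "cayley_prod k (\<lambda>j. cis (\<theta> j)) = (- \<i>) ^ k * of_real (\<Prod>j=1..k. tan (\<theta> j / 2))"
  by (simp only: cayley_prod_def cayley_factor_cis prod.distrib prod_constant of_real_prod card_atLeastAtMost diff_Suc_1 add_diff_cancel_right')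

lemma cmod_cayley_prod_cis: "cmod (cayley_prod k (\<lambda>j. cis (\<theta> j))) = \<bar>\<Prod>j=1..k. tan (\<theta> j / 2)\<bar>"
  unfolding cayley_prod_cis by (simp add: norm_mult norm_power del: of_real_prod)

lemma cayley_prod_fun_upd:
  "i > k \<Longrightarrow> cayley_prod k (\<lambda>j. cis ((x(i := t)) j)) = cayley_prod k (\<lambda>j. cis (x j))"
  unfolding cayley_prod_def by (intro prod.cong) auto

lemma borel_measurable_cmod:
  fixes f :: "'a \<Rightarrow> complex"
  shows "f \<in> borel_measurable M \<Longrightarrow> (\<lambda>x. cmod (f x)) \<in> borel_measurable M"
  by measurable

lemma measurable_torus_cis: "i \<in> I \<Longrightarrow> (\<lambda>\<theta>. cis (\<theta> i)) \<in> borel_measurable (torus I)"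
  by (rule measurable_compose[OF _ borel_measurable_cis]) (simp add: measurable_component_singleton measurable_cong_sets[OF refl sets_angle_unif, symmetric])

lemma measurable_torus_tan: "i \<in> I \<Longrightarrow> (\<lambda>\<theta>. tan (\<theta> i / 2)) \<in> borel_measurable (torus I)"
proof -
  assume i: "i \<in> I"
  have "(\<lambda>\<theta>::real. tan (\<theta> / 2)) \<in> borel_measurable angle_unif"
    unfolding tan_def by measurable
  thus ?thesis by (rule measurable_compose[OF measurable_component_singleton[OF i]])
qed

lemma measurable_cayley_prod:
  assumes "{1..k} \<subseteq> I"
  shows "(\<lambda>\<theta>. cayley_prod k (\<lambda>j. cis (\<theta> j))) \<in> borel_measurable (torus I)"
  unfolding cayley_prod_def
  by (intro borel_measurable_prod borel_measurable_divide borel_measurable_add borel_measurable_diff borel_measurable_const measurable_torus_cis)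
     (use assms in auto)

lemma measurable_tan_prod:
  assumes "{1..k} \<subseteq> I"
  shows "(\<lambda>\<theta>. \<Prod>j=1..k. tan (\<theta> j / 2)) \<in> borel_measurable (torus I)"
  by (intro borel_measurable_prod measurable_torus_tan) (use assms in auto)

lemma integrable_torus_component:
  fixes h :: "real \<Rightarrow> real"
  assumes "i \<in> I" "integrable angle_unif h"
  shows "integrable (torus I) (\<lambda>\<theta>. h (\<theta> i))" "(\<integral>\<theta>. h (\<theta> i) \<partial>torus I) = (\<integral>t. h t \<partial>angle_unif)"
proof -
  have D: "angle_unif = distr (torus I) angle_unif (\<lambda>\<theta>. \<theta> i)"
    using distr_PiM_component[of I "\<lambda>_. angle_unif" i] assms(1) prob_space_angle_unif by simp
  have m: "(\<lambda>\<theta>. \<theta> i) \<in> measurable (torus I) angle_unif" using assms(1) by (rule measurable_component_singleton)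
  have hm: "h \<in> borel_measurable angle_unif" using assms(2) by auto
  show "integrable (torus I) (\<lambda>\<theta>. h (\<theta> i))"
    using assms(2) integrable_distr_eq[OF m hm] D by simp
  show "(\<integral>\<theta>. h (\<theta> i) \<partial>torus I) = (\<integral>t. h t \<partial>angle_unif)"
    using integral_distr[OF m hm] D by simp
qed

lemma AE_torus_cis_neq: "i \<in> I \<Longrightarrow> AE \<theta> in torus I. cis (\<theta> i) \<noteq> w"
  by (rule AE_PiM_component) (auto simp: prob_space_angle_unif AE_angle_cis_neq)

lemma AE_torus_tan_prod_neq:
  assumes "{1..k} \<subseteq> I"
  shows "AE \<theta> in torus I. (\<Prod>j=1..k. tan (\<theta> j / 2)) \<noteq> 0"
proof -
  \<comment> \<open>\<open>-1\<close> is excluded together with \<open>1\<close>, since the tangent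
    takes its default value 0 at its pole.\<close>
  have "AE \<theta> in torus I. \<forall>j\<in>{1..k}. cis (\<theta> j) \<noteq> 1 \<and> cis (\<theta> j) \<noteq> -1"
    by (intro AE_finite_allI AE_conjI AE_torus_cis_neq) (use assms in auto)
  thus ?thesis
  proof eventually_elim
    case (elim \<theta>)
    have "tan (\<theta> j / 2) \<noteq> 0" if "j \<in> {1..k}" for j
    proof
      assume "tan (\<theta> j / 2) = 0"
      hence "- \<i> * of_real (tan (\<theta> j / 2)) = 0" by simp
      hence "(1 - cis (\<theta> j)) / (1 + cis (\<theta> j)) = 0" by (simp only: cayley_factor_cis)
      thus False using elim that by (auto simp: add_eq_0_iff)
    qed
    thus ?case by auto
  qed
qed

lemma integrable_sech_law_ln_exp:
  "integrable (sech_law k) (\<lambda>s. ln (1 + exp s))" "integrable (sech_law k) (\<lambda>s. max 0 s)"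
  "integrable (sech_law k) (\<lambda>s. ln (1 + (exp s)\<^sup>2) / 2)" "integrable (sech_law k) (\<lambda>s. s)"
proof -
  have 1: "ln (1 + exp s) = (2 * ln (2 * cosh (s / 2)) + s) / 2" for s :: real using ln_two_cosh_half[of s] by simp
  show "integrable (sech_law k) (\<lambda>s. ln (1 + exp s))"
  proof (rule integrable_sech_law[of _ 2 1])
    fix s :: real
    define X where "X = ln (2 * cosh (s / 2))"
    have "0 \<le> X" "X \<le> 1 + \<bar>s\<bar> / 2" using ln_two_cosh_bound[of "s / 2"] by (auto simp: X_def)
    thus "\<bar>ln (1 + exp s)\<bar> \<le> 2 * (1 + \<bar>s\<bar>) ^ 1"
      unfolding 1 X_def[symmetric] abs_if by (auto simp: field_simps)
  qed measurable
  show "integrable (sech_law k) (\<lambda>s. max 0 s)"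
    by (rule integrable_sech_law[of _ 1 1]) auto
  have 2: "ln (1 + (exp s)\<^sup>2) / 2 = (ln (2 * cosh s) + s) / 2" for s :: real using ln_two_cosh[of s] by simp
  show "integrable (sech_law k) (\<lambda>s. ln (1 + (exp s)\<^sup>2) / 2)"
  proof (rule integrable_sech_law[of _ 1 1])
    fix s :: real
    define X where "X = ln (2 * cosh s)"
    have "0 \<le> X" "X \<le> 1 + \<bar>s\<bar>" using ln_two_cosh_bound[of s] by (auto simp: X_def)
    thus "\<bar>ln (1 + (exp s)\<^sup>2) / 2\<bar> \<le> 1 * (1 + \<bar>s\<bar>) ^ 1"
      unfolding 2 X_def[symmetric] abs_if by (auto simp: field_simps)
  qed measurable
  show "integrable (sech_law k) (\<lambda>s. s)"
    by (rule integrable_sech_law[of _ 1 1]) auto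
qed

lemma ln_max_one_exp: "ln (max 1 \<bar>exp s\<bar>) = max 0 (s :: real)"
  by (auto simp: max_def)

text \<open>Jensen in the last variable. The hypotheses \<open>upd\<close> express that
  \<open>P\<close> and \<open>Q\<close> do not read that variable; the constant
  \<open>2 ln 2\<close> of \<open>jensen_linear\<close> provides the integrable bound for
  Fubini.\<close>

lemma mahler_measure_linear_last:
  assumes m: "(\<lambda>\<theta>. P (\<lambda>j. cis (\<theta> j))) \<in> borel_measurable (torus {1..N + 1})" "(\<lambda>\<theta>. Q (\<lambda>j. cis (\<theta> j))) \<in> borel_measurable (torus {1..N + 1})"
    and upd: "\<And>\<theta> t. P (\<lambda>j. cis ((\<theta>(N + 1 := t)) j)) = P (\<lambda>j. cis (\<theta> j))" "\<And>\<theta> t. Q (\<lambda>j. cis ((\<theta>(N + 1 := t)) j)) = Q (\<lambda>j. cis (\<theta> j))"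
    and ae: "AE \<theta> in torus {1..N}. P (\<lambda>j. cis (\<theta> j)) \<noteq> 0 \<or> Q (\<lambda>j. cis (\<theta> j)) \<noteq> 0"
    and gi: "integrable (torus {1..N}) (\<lambda>\<theta>. ln (max (cmod (P (\<lambda>j. cis (\<theta> j)))) (cmod (Q (\<lambda>j. cis (\<theta> j))))))"
  shows "mahler_measure (N + 1) (\<lambda>u. P u + Q u * u (N + 1)) =
    (\<integral>\<theta>. ln (max (cmod (P (\<lambda>j. cis (\<theta> j)))) (cmod (Q (\<lambda>j. cis (\<theta> j))))) \<partial>torus {1..N})"
proof -
  let ?P = "\<lambda>\<theta>::nat\<Rightarrow>real. P (\<lambda>j. cis (\<theta> j))"
  let ?Q = "\<lambda>\<theta>::nat\<Rightarrow>real. Q (\<lambda>j. cis (\<theta> j))"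
  let ?f = "\<lambda>\<theta>::nat\<Rightarrow>real. ln (cmod (?P \<theta> + ?Q \<theta> * cis (\<theta> (N + 1))))"
  let ?g = "\<lambda>\<theta>. ln (max (cmod (?P \<theta>)) (cmod (?Q \<theta>)))"
  have I: "{1..N + 1} = insert (N + 1) {1..N}" by auto
  have fm: "?f \<in> borel_measurable (torus {1..N + 1})"
    by (intro borel_measurable_ln borel_measurable_cmod borel_measurable_add borel_measurable_times m measurable_torus_cis) auto
  have "(\<integral>\<theta>. ?f \<theta> \<partial>torus {1..N + 1}) = (\<integral>\<theta>. ?g \<theta> \<partial>torus {1..N})"
    unfolding I
  proof (rule torus_insert_integral(2)[where b = "\<lambda>\<theta>. \<bar>?g \<theta>\<bar> + 2 * ln 2"])
    show "?f \<in> borel_measurable (torus (insert (N + 1) {1..N}))" using fm unfolding I .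
    interpret T: prob_space "torus {1..N}" by (rule prob_space_torus)
    show "integrable (torus {1..N}) (\<lambda>\<theta>. \<bar>?g \<theta>\<bar> + 2 * ln 2)"
      by (intro Bochner_Integration.integrable_add integrable_abs gi T.integrable_const)
    show "AE x in torus {1..N}. integrable angle_unif (\<lambda>t. ?f (x(N + 1 := t))) \<and>
       (\<integral>t. ?f (x(N + 1 := t)) \<partial>angle_unif) = ?g x \<and> (\<integral>t. \<bar>?f (x(N + 1 := t))\<bar> \<partial>angle_unif) \<le> \<bar>?g x\<bar> + 2 * ln 2"
      using ae
    proof eventually_elim
      case (elim x)
      show ?case unfolding upd fun_upd_same using jensen_linear[OF elim] by blast
    qed
  qed (use gi in auto)
  thus ?thesis using mahler_measure_torus[OF fm] by simp
qed

theorem mahler_one_plus_cayley_prod: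
  assumes k: "k \<ge> 1"
  shows "mahler_measure (k + 1) (\<lambda>u. 1 + cayley_prod k u * u (k + 1)) = (\<integral>s. max 0 s \<partial>sech_law k)"
proof -
  have ne: "finite {1..k}" "{1..k} \<noteq> {}" "card {1..k} = k" using k by auto
  have gi: "integrable (torus {1..k}) (\<lambda>\<theta>. ln (max 1 \<bar>\<Prod>j=1..k. tan (\<theta> j / 2)\<bar>))"
    "(\<integral>\<theta>. ln (max 1 \<bar>\<Prod>j=1..k. tan (\<theta> j / 2)\<bar>) \<partial>torus {1..k}) = (\<integral>s. max 0 s \<partial>sech_law k)"
    using integral_torus_tan_prod[OF ne(1,2), of "\<lambda>\<tau>. ln (max 1 \<bar>\<tau>\<bar>)"] integrable_sech_law_ln_exp(2)[of k]
    unfolding ne(3) abs_minus_cancel ln_max_one_exp by auto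
  have "mahler_measure (k + 1) (\<lambda>u. 1 + cayley_prod k u * u (k + 1)) =
    (\<integral>\<theta>. ln (max (cmod 1) (cmod (cayley_prod k (\<lambda>j. cis (\<theta> j))))) \<partial>torus {1..k})"
  proof (rule mahler_measure_linear_last)
    show "(\<lambda>\<theta>. cayley_prod k (\<lambda>j. cis (\<theta> j))) \<in> borel_measurable (torus {1..k + 1})"
      by (rule measurable_cayley_prod) auto
  qed (use gi(1) in \<open>simp_all only: cmod_cayley_prod_cis norm_one cayley_prod_fun_upd borel_measurable_const, simp_all\<close>)
  thus ?thesis using gi(2) by (simp only: cmod_cayley_prod_cis norm_one)
qed

lemma nn_integral_torus_ramp:
  assumes k: "k \<ge> 1"
  shows "(\<integral>\<^sup>+\<theta>. ennreal (max 0 (ln \<bar>\<Prod>j=1..k. tan (\<theta> j / 2)\<bar> + (ln (cmod (1 + cis (\<theta> (k + 2)))) - ln (cmod (1 + cis (\<theta> (k + 1))))))) \<partial>torus {1..k + 2}) =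
    (\<integral>\<^sup>+s. ennreal (max 0 s + odd_trilog s) \<partial>sech_law k)"
proof -
  let ?Q = "\<lambda>\<theta>::nat\<Rightarrow>real. \<Prod>j=1..k. tan (\<theta> j / 2)"
  let ?H = "\<lambda>\<theta>::nat\<Rightarrow>real. ennreal (max 0 (ln \<bar>?Q \<theta>\<bar> + (ln (cmod (1 + cis (\<theta> (k + 2)))) - ln (cmod (1 + cis (\<theta> (k + 1)))))))"
  have I: "{1..k + 1} = insert (k + 1) {1..k}" "{1..k + 2} = insert (k + 2) {1..k + 1}" by auto
  have Hm [measurable]: "?H \<in> borel_measurable (torus {1..k + 2})"
    by (intro measurable_compose[OF _ measurable_ennreal] borel_measurable_ln borel_measurable_cmod borel_measurable_add borel_measurable_diff borel_measurable_max
      borel_measurable_const borel_measurable_abs measurable_tan_prod measurable_torus_cis) auto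
  have "(\<integral>\<^sup>+\<theta>. ?H \<theta> \<partial>torus {1..k + 2}) = (\<integral>\<^sup>+\<theta>. (\<integral>\<^sup>+y. ?H (\<theta>(k + 2 := y)) \<partial>angle_unif) \<partial>torus {1..k + 1})"
    unfolding I(2)
  proof (rule torus.product_nn_integral_insert)
    show "?H \<in> borel_measurable (torus (insert (k + 2) {1..k + 1}))" using Hm unfolding I(2) .
  qed auto
  also have "\<dots> = (\<integral>\<^sup>+\<theta>. (\<integral>\<^sup>+x. (\<integral>\<^sup>+y. ?H (\<theta>(k + 1 := x, k + 2 := y)) \<partial>angle_unif) \<partial>angle_unif) \<partial>torus {1..k})"
    unfolding I(1)
  proof (rule torus.product_nn_integral_insert)
    have "?H \<in> borel_measurable (torus (insert (k + 2) {1..k + 1}))" using Hm I(2) by simp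
    hence "(\<lambda>\<theta>. \<integral>\<^sup>+y. ?H (\<theta>(k + 2 := y)) \<partial>angle_unif) \<in> borel_measurable (torus {1..k + 1})"
      by measurable
    thus "(\<lambda>\<theta>. \<integral>\<^sup>+y. ?H (\<theta>(k + 2 := y)) \<partial>angle_unif) \<in> borel_measurable (torus (insert (k + 1) {1..k}))"
      by (simp only: I(1))
  qed auto
  also have "\<dots> = (\<integral>\<^sup>+\<theta>. ennreal (max 0 (ln \<bar>?Q \<theta>\<bar>) + odd_trilog (ln \<bar>?Q \<theta>\<bar>)) \<partial>torus {1..k})"
  proof (rule nn_integral_cong)
    fix \<theta> :: "nat \<Rightarrow> real"
    have q: "?Q (\<theta>(k + 1 := x, k + 2 := y)) = ?Q \<theta>" for x y
      by (intro prod.cong) auto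
    have "(\<integral>\<^sup>+x. (\<integral>\<^sup>+y. ?H (\<theta>(k + 1 := x, k + 2 := y)) \<partial>angle_unif) \<partial>angle_unif) =
      (\<integral>\<^sup>+x. (\<integral>\<^sup>+y. (\<lambda>r. ennreal (max 0 (ln \<bar>?Q \<theta>\<bar> + r))) (ln (cmod (1 + cis y)) - ln (cmod (1 + cis x))) \<partial>angle_unif) \<partial>angle_unif)"
      unfolding q by simp
    also have "\<dots> = ennreal (max 0 (ln \<bar>?Q \<theta>\<bar>) + odd_trilog (ln \<bar>?Q \<theta>\<bar>))"
      by (subst nn_integral_ln_one_plus_cis_difference, measurable) (rule nn_integral_ramp_csch_tail)
    finally show "(\<integral>\<^sup>+x. (\<integral>\<^sup>+y. ?H (\<theta>(k + 1 := x, k + 2 := y)) \<partial>angle_unif) \<partial>angle_unif) = ennreal (max 0 (ln \<bar>?Q \<theta>\<bar>) + odd_trilog (ln \<bar>?Q \<theta>\<bar>))" .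
  qed
  also have "\<dots> = (\<integral>\<^sup>+s. (ennreal (max 0 (ln \<bar>exp s\<bar>) + odd_trilog (ln \<bar>exp s\<bar>)) + ennreal (max 0 (ln \<bar>- exp s\<bar>) + odd_trilog (ln \<bar>- exp s\<bar>))) / 2 \<partial>sech_law (card {1..k}))"
    by (rule nn_integral_torus_tan_prod[of "{1..k}" "\<lambda>\<tau>. ennreal (max 0 (ln \<bar>\<tau>\<bar>) + odd_trilog (ln \<bar>\<tau>\<bar>))"]) (use k in auto)
  also have "\<dots> = (\<integral>\<^sup>+s. ennreal (max 0 s + odd_trilog s) \<partial>sech_law k)"
    by (simp add: mult_2[symmetric])
  finally show ?thesis .
qed

text \<open>Removing \<open>z\<close> leaves \<open>ln max (|1 + x|, |A| |1 + y|)\<close>, which is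
  \<open>ln |1 + x|\<close>, of mean 0, plus the ramp of
  \<open>ln |A| + ln |1 + y| - ln |1 + x|\<close>.\<close>

theorem mahler_two_linear_cayley_prod:
  assumes k: "k \<ge> 1"
  shows "mahler_measure (k + 3) (\<lambda>u. 1 + u (k + 1) + cayley_prod k u * (1 + u (k + 2)) * u (k + 3)) =
    (\<integral>s. \<bar>s\<bar> ^ 3 \<partial>sech_law k) / (real k * pi\<^sup>2)"
proof -
  let ?Q = "\<lambda>\<theta>::nat\<Rightarrow>real. \<Prod>j=1..k. tan (\<theta> j / 2)"
  let ?p = "\<lambda>\<theta>::nat\<Rightarrow>real. 1 + cis (\<theta> (k + 1))"
  let ?q = "\<lambda>\<theta>::nat\<Rightarrow>real. cayley_prod k (\<lambda>j. cis (\<theta> j)) * (1 + cis (\<theta> (k + 2)))"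
  let ?g = "\<lambda>\<theta>. ln (max (cmod (?p \<theta>)) (cmod (?q \<theta>)))"
  let ?I = "{1..k + 2}"
  define H where "H = (\<lambda>\<theta>::nat\<Rightarrow>real. max 0 (ln \<bar>?Q \<theta>\<bar> + (ln (cmod (1 + cis (\<theta> (k + 2)))) - ln (cmod (1 + cis (\<theta> (k + 1)))))))"
  define V where "V = (\<integral>s. \<bar>s\<bar> ^ 3 \<partial>sech_law k) / (real k * pi\<^sup>2)"
  have V0: "V \<ge> 0" unfolding V_def by (intro divide_nonneg_nonneg Bochner_Integration.integral_nonneg) auto
  have gm: "?g \<in> borel_measurable (torus ?I)"
    by (intro borel_measurable_ln borel_measurable_max borel_measurable_cmod borel_measurable_add borel_measurable_times borel_measurable_const measurable_cayley_prod measurable_torus_cis) auto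
  have Hm: "H \<in> borel_measurable (torus ?I)" unfolding H_def
    by (intro borel_measurable_ln borel_measurable_cmod borel_measurable_add borel_measurable_diff borel_measurable_max
      borel_measurable_const borel_measurable_abs measurable_tan_prod measurable_torus_cis) auto
  have HV: "(\<integral>\<^sup>+\<theta>. ennreal (H \<theta>) \<partial>torus ?I) = ennreal V"
    unfolding H_def nn_integral_torus_ramp[OF k] V_def by (rule nn_integral_ramp_odd_trilog_law[OF k])
  have H: "has_bochner_integral (torus ?I) H V"
    by (rule has_bochner_integral_nn_integral[OF Hm _ V0 HV]) (simp add: H_def)
  have J: "integrable angle_unif (\<lambda>t. ln (cmod (1 + cis t)))" "(\<integral>t. ln (cmod (1 + cis t)) \<partial>angle_unif) = 0"
    using jensen_linear[of 1 1] by simp_all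
  have L: "has_bochner_integral (torus ?I) (\<lambda>\<theta>. ln (cmod (?p \<theta>))) 0"
    using integrable_torus_component[of "k + 1" ?I, OF _ J(1)] J(2) by (simp add: has_bochner_integral_iff)
  \<comment> \<open>Off the zeros of \<open>1 + x\<close>, \<open>1 + y\<close> and the tangent
    product all logarithms have positive arguments, so the logarithm of the maximum splits.\<close>
  have ae: "AE \<theta> in torus ?I. ?p \<theta> \<noteq> 0 \<and> ?g \<theta> = ln (cmod (?p \<theta>)) + H \<theta>"
  proof -
    have "AE \<theta> in torus ?I. cis (\<theta> (k + 1)) \<noteq> -1" "AE \<theta> in torus ?I. cis (\<theta> (k + 2)) \<noteq> -1" "AE \<theta> in torus ?I. ?Q \<theta> \<noteq> 0"
      by (intro AE_torus_cis_neq AE_torus_tan_prod_neq; simp)+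
    thus ?thesis
    proof eventually_elim
      case (elim \<theta>)
      define P where "P = cmod (?p \<theta>)"
      define R where "R = cmod (1 + cis (\<theta> (k + 2)))"
      have p: "P > 0" "R > 0" using elim by (auto simp: P_def R_def add_eq_0_iff)
      have q: "cmod (?q \<theta>) = \<bar>?Q \<theta>\<bar> * R" by (simp only: norm_mult cmod_cayley_prod_cis R_def)
      have Qp: "\<bar>?Q \<theta>\<bar> > 0" using elim by simp
      have lm: "ln (a * b) = ln a + ln b" if "a > 0" "b > 0" for a b :: real using that by (simp add: ln_mult)
      have "ln (max P (\<bar>?Q \<theta>\<bar> * R)) = max (ln P) (ln (\<bar>?Q \<theta>\<bar> * R))"
        using p Qp by (auto simp: max_def)
      also have "ln (\<bar>?Q \<theta>\<bar> * R) = ln \<bar>?Q \<theta>\<bar> + ln R" by (rule lm[OF Qp p(2)])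
      also have "max (ln P) (ln \<bar>?Q \<theta>\<bar> + ln R) = ln P + max 0 (ln \<bar>?Q \<theta>\<bar> + (ln R - ln P))" by auto
      finally have "?g \<theta> = ln P + H \<theta>" unfolding q P_def[symmetric] by (simp only: H_def R_def P_def)
      thus ?case using p by (auto simp: P_def)
    qed
  qed
  have hb: "has_bochner_integral (torus ?I) (\<lambda>\<theta>. ln (cmod (?p \<theta>)) + H \<theta>) (0 + V)"
    by (rule has_bochner_integral_add[OF L H])
  have gi: "integrable (torus ?I) ?g"
    by (rule integrable_cong_AE_imp[of _ "\<lambda>\<theta>. ln (cmod (?p \<theta>)) + H \<theta>"])
       (use hb gm ae in \<open>auto simp: has_bochner_integral_iff elim: eventually_mono\<close>)
  have gV: "(\<integral>\<theta>. ?g \<theta> \<partial>torus ?I) = V"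
  proof -
    have "(\<integral>\<theta>. ?g \<theta> \<partial>torus ?I) = (\<integral>\<theta>. ln (cmod (?p \<theta>)) + H \<theta> \<partial>torus ?I)"
      by (rule integral_cong_AE) (use hb gm ae in \<open>auto simp: has_bochner_integral_iff elim: eventually_mono\<close>)
    thus ?thesis using hb by (simp add: has_bochner_integral_iff)
  qed
  have "mahler_measure (k + 2 + 1) (\<lambda>u. (1 + u (k + 1)) + cayley_prod k u * (1 + u (k + 2)) * u (k + 2 + 1)) = (\<integral>\<theta>. ?g \<theta> \<partial>torus ?I)"
  proof (rule mahler_measure_linear_last)
    show "(\<lambda>\<theta>. 1 + cis (\<theta> (k + 1))) \<in> borel_measurable (torus {1..k + 2 + 1})" "?q \<in> borel_measurable (torus {1..k + 2 + 1})"
      by (intro borel_measurable_add borel_measurable_times borel_measurable_const measurable_cayley_prod measurable_torus_cis; auto)+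
    show "AE \<theta> in torus ?I. ?p \<theta> \<noteq> 0 \<or> ?q \<theta> \<noteq> 0" using ae by eventually_elim blast
  qed (use gi in \<open>auto simp: cayley_prod_fun_upd fun_upd_other simp del: fun_upd_apply\<close>)
  moreover have "k + 2 + 1 = k + 3" by simp
  ultimately show ?thesis using gV by (simp only: V_def)
qed

text \<open>In this family the modulus of \<open>A\<close> alone does not determine the integrand:
  \<open>|1 - A|\<close> depends on the phase of \<open>A = (-i)^k q\<close>, with \<open>q\<close>
  the real product of tangents. The average over \<open>x\<close> is therefore left abstract as a
  function \<open>\<phi>\<close> of the signed \<open>q\<close>, and the two signs are averaged at
  the end.\<close>

lemma mahler_triangle_reduction:
  fixes \<phi> :: "real \<Rightarrow> real"
  assumes k: "k \<ge> 1" and \<phi>m: "\<phi> \<in> borel_measurable borel"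
    and i: "integrable (sech_law k) (\<lambda>s. \<phi> (exp s))" "integrable (sech_law k) (\<lambda>s. \<phi> (- exp s))"
    and inner: "\<And>q. q \<noteq> 0 \<Longrightarrow> integrable angle_unif (\<lambda>t. ln (max (cmod (1 + (- \<i>) ^ k * of_real q * cis t)) (cmod (1 - (- \<i>) ^ k * of_real q)))) \<and>
      (\<integral>t. ln (max (cmod (1 + (- \<i>) ^ k * of_real q * cis t)) (cmod (1 - (- \<i>) ^ k * of_real q))) \<partial>angle_unif) = \<phi> q \<and>
      (\<integral>t. \<bar>ln (max (cmod (1 + (- \<i>) ^ k * of_real q * cis t)) (cmod (1 - (- \<i>) ^ k * of_real q)))\<bar> \<partial>angle_unif) \<le> \<bar>\<phi> q\<bar> + 2 * ln 2"
  shows "mahler_measure (k + 2) (\<lambda>u. 1 + cayley_prod k u * u (k + 1) + (1 - cayley_prod k u) * u (k + 2)) =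
    ((\<integral>s. \<phi> (exp s) \<partial>sech_law k) + (\<integral>s. \<phi> (- exp s) \<partial>sech_law k)) / 2"
proof -
  let ?A = "\<lambda>\<theta>::nat\<Rightarrow>real. cayley_prod k (\<lambda>j. cis (\<theta> j))"
  let ?Q = "\<lambda>\<theta>::nat\<Rightarrow>real. \<Prod>j=1..k. tan (\<theta> j / 2)"
  let ?g = "\<lambda>\<theta>. ln (max (cmod (1 + ?A \<theta> * cis (\<theta> (k + 1)))) (cmod (1 - ?A \<theta>)))"
  have I: "{1..k + 1} = insert (k + 1) {1..k}" by auto
  have gm: "?g \<in> borel_measurable (torus (insert (k + 1) {1..k}))"
    unfolding I[symmetric]
    by (intro borel_measurable_ln borel_measurable_max borel_measurable_cmod borel_measurable_add borel_measurable_diff borel_measurable_times borel_measurable_const measurable_cayley_prod measurable_torus_cis) auto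
  have \<phi>Qm: "(\<lambda>\<theta>. \<phi> (?Q \<theta>)) \<in> borel_measurable (torus {1..k})"
    by (rule measurable_compose[OF measurable_tan_prod \<phi>m]) simp
  have ne: "finite {1..k}" "{1..k} \<noteq> {}" "card {1..k} = k" using k by auto
  note Q = integral_torus_tan_prod[OF ne(1,2) \<phi>m, unfolded ne(3), OF i]
  interpret T: prob_space "torus {1..k}" by (rule prob_space_torus)
  have bi: "integrable (torus {1..k}) (\<lambda>\<theta>. \<bar>\<phi> (?Q \<theta>)\<bar> + 2 * ln 2)"
    by (intro Bochner_Integration.integrable_add integrable_abs Q T.integrable_const)
  have "AE x in torus {1..k}. ?Q x \<noteq> 0" by (rule AE_torus_tan_prod_neq) simp
  hence ae: "AE x in torus {1..k}. integrable angle_unif (\<lambda>t. ?g (x(k + 1 := t))) \<and>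
     (\<integral>t. ?g (x(k + 1 := t)) \<partial>angle_unif) = \<phi> (?Q x) \<and> (\<integral>t. \<bar>?g (x(k + 1 := t))\<bar> \<partial>angle_unif) \<le> \<bar>\<phi> (?Q x)\<bar> + 2 * ln 2"
  proof eventually_elim
    case (elim x)
    have e: "?g (x(k + 1 := t)) = ln (max (cmod (1 + (- \<i>) ^ k * of_real (?Q x) * cis t)) (cmod (1 - (- \<i>) ^ k * of_real (?Q x))))" for t
      by (simp only: cayley_prod_fun_upd[OF less_add_one] cayley_prod_cis fun_upd_same)
    show ?case unfolding e by (rule inner[OF elim])
  qed
  have "mahler_measure (k + 1 + 1) (\<lambda>u. (1 + cayley_prod k u * u (k + 1)) + (1 - cayley_prod k u) * u (k + 1 + 1)) = (\<integral>\<theta>. ?g \<theta> \<partial>torus {1..k + 1})"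
  proof (rule mahler_measure_linear_last)
    show "(\<lambda>\<theta>. 1 + ?A \<theta> * cis (\<theta> (k + 1))) \<in> borel_measurable (torus {1..k + 1 + 1})" "(\<lambda>\<theta>. 1 - ?A \<theta>) \<in> borel_measurable (torus {1..k + 1 + 1})"
      by (intro borel_measurable_add borel_measurable_diff borel_measurable_times borel_measurable_const measurable_cayley_prod measurable_torus_cis; auto)+
    have "AE \<theta> in torus {1..k + 1}. cis (\<theta> (k + 1)) \<noteq> -1" by (rule AE_torus_cis_neq) simp
    \<comment> \<open>If the second coefficient vanishes then \<open>A = 1\<close>, and the first is
      \<open>1 + x\<close>, which is nonzero off \<open>x = -1\<close>.\<close>
    thus "AE \<theta> in torus {1..k + 1}. 1 + ?A \<theta> * cis (\<theta> (k + 1)) \<noteq> 0 \<or> 1 - ?A \<theta> \<noteq> 0"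
      by eventually_elim (auto simp: add_eq_0_iff)
    show "integrable (torus {1..k + 1}) ?g"
      unfolding I by (rule torus_insert_integral(1)[OF ne(1) _ gm \<phi>Qm bi ae]) simp
  qed (auto simp: cayley_prod_fun_upd fun_upd_other simp del: fun_upd_apply)
  also have "\<dots> = (\<integral>\<theta>. \<phi> (?Q \<theta>) \<partial>torus {1..k})"
    unfolding I by (rule torus_insert_integral(2)[OF ne(1) _ gm \<phi>Qm bi ae]) simp
  also have "k + 1 + 1 = k + 2" by simp
  finally show ?thesis unfolding Q(2) .
qed

text \<open>For even \<open>k\<close> the product \<open>A\<close> is real. If \<open>A < 0\<close>,
  then \<open>|1 + A x| <= 1 - A\<close> on the whole circle and the inner mean is the constant
  \<open>ln (1 - A)\<close>; if \<open>A >= 0\<close>, then \<open>|1 + A x| >= |1 - A|\<close> and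
  Jensen gives \<open>ln max (1, A)\<close>. With \<open>|A| = e^s\<close> the two equally likely
  signs give the two integrals.\<close>

theorem mahler_real_cayley_prod:
  assumes k: "k \<ge> 1" "even k"
  shows "mahler_measure (k + 2) (\<lambda>u. 1 + cayley_prod k u * u (k + 1) + (1 - cayley_prod k u) * u (k + 2)) =
    ((\<integral>s. ln (1 + exp s) \<partial>sech_law k) + (\<integral>s. max 0 s \<partial>sech_law k)) / 2"
proof -
  define \<sigma> :: real where "\<sigma> = (-1) ^ (k div 2)"
  have \<sigma>: "\<sigma> = 1 \<or> \<sigma> = -1" by (cases "even (k div 2)") (auto simp: \<sigma>_def)
  have A: "(- \<i>) ^ k * of_real q = of_real (\<sigma> * q)" for q
  proof -
    have "(- \<i>) ^ k = (- \<i>) ^ (2 * (k div 2))" using k(2) by simp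
    also have "\<dots> = of_real \<sigma>" unfolding power_mult \<sigma>_def by simp
    finally show ?thesis by (simp only: of_real_mult)
  qed
  define \<phi> where "\<phi> = (\<lambda>\<tau>::real. if \<sigma> * \<tau> < 0 then ln (1 - \<sigma> * \<tau>) else ln (max 1 (\<sigma> * \<tau>)))"
  have \<phi>e: "(\<lambda>s. \<phi> (\<sigma> * exp s)) = (\<lambda>s. max 0 s)" "(\<lambda>s. \<phi> (- (\<sigma> * exp s))) = (\<lambda>s. ln (1 + exp s))"
    using \<sigma> ln_max_one_exp by (auto simp: \<phi>_def fun_eq_iff)
  have "mahler_measure (k + 2) (\<lambda>u. 1 + cayley_prod k u * u (k + 1) + (1 - cayley_prod k u) * u (k + 2)) =
    ((\<integral>s. \<phi> (exp s) \<partial>sech_law k) + (\<integral>s. \<phi> (- exp s) \<partial>sech_law k)) / 2"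
  proof (rule mahler_triangle_reduction[OF k(1)])
    show "\<phi> \<in> borel_measurable borel" unfolding \<phi>_def by measurable
    show "integrable (sech_law k) (\<lambda>s. \<phi> (exp s))" "integrable (sech_law k) (\<lambda>s. \<phi> (- exp s))"
      using \<sigma> \<phi>e integrable_sech_law_ln_exp(1,2)[of k] by (elim disjE; simp)+
    fix q :: real
    define a where "a = \<sigma> * q"
    define g where "g = (\<lambda>t. ln (max (cmod (1 + of_real a * cis t)) (cmod (1 - of_real a))))"
    have \<phi>a: "\<phi> q = (if a < 0 then ln (1 - a) else ln (max 1 a))" by (simp only: \<phi>_def a_def)
    have c1: "cmod (1 - of_real a) = \<bar>1 - a\<bar>" by (metis norm_of_real of_real_1 of_real_diff)
    have "integrable angle_unif g \<and> (\<integral>t. g t \<partial>angle_unif) = \<phi> q \<and> (\<integral>t. \<bar>g t\<bar> \<partial>angle_unif) \<le> \<bar>\<phi> q\<bar> + 2 * ln 2"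
    proof (cases "a < 0")
      case True
      have "cmod (1 + of_real a * cis t) \<le> 1 - a" for t
        using norm_triangle_ineq[of 1 "of_real a * cis t"] True by (simp add: norm_mult)
      hence g: "g = (\<lambda>t. ln (1 - a))" unfolding g_def c1 using True by (simp add: max_absorb2)
      show ?thesis unfolding g \<phi>a using True angle.prob_space by simp
    next
      case False
      have "\<bar>1 - a\<bar> \<le> cmod (1 + of_real a * cis t)" for t
        using norm_triangle_ineq3[of 1 "- (of_real a * cis t)"] False by (simp add: norm_mult)
      hence g: "g = (\<lambda>t. ln (cmod (1 + of_real a * cis t)))" unfolding g_def c1 by (simp add: max_absorb1)
      have m: "\<phi> q = ln (max (cmod 1) (cmod (of_real a)))" unfolding \<phi>a using False by simp
      show ?thesis unfolding g m using jensen_linear[of 1 "of_real a"] by simp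
    qed
    thus "integrable angle_unif (\<lambda>t. ln (max (cmod (1 + (- \<i>) ^ k * of_real q * cis t)) (cmod (1 - (- \<i>) ^ k * of_real q)))) \<and>
      (\<integral>t. ln (max (cmod (1 + (- \<i>) ^ k * of_real q * cis t)) (cmod (1 - (- \<i>) ^ k * of_real q))) \<partial>angle_unif) = \<phi> q \<and>
      (\<integral>t. \<bar>ln (max (cmod (1 + (- \<i>) ^ k * of_real q * cis t)) (cmod (1 - (- \<i>) ^ k * of_real q)))\<bar> \<partial>angle_unif) \<le> \<bar>\<phi> q\<bar> + 2 * ln 2"
      unfolding A g_def a_def .
  qed
  also have "\<dots> = ((\<integral>s. ln (1 + exp s) \<partial>sech_law k) + (\<integral>s. max 0 s \<partial>sech_law k)) / 2"
    using \<sigma> \<phi>e by (elim disjE) simp_all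
  finally show ?thesis .
qed

section \<open>Moments as zeta and L-values\<close>

lemma suminf_pairs:
  fixes f :: "nat \<Rightarrow> real"
  assumes "summable f"
  shows "suminf f = (\<Sum>j. f (2 * j) + f (2 * j + 1))" "summable (\<lambda>j. f (2 * j) + f (2 * j + 1))"
proof -
  have "(\<lambda>n. sum f {n * 2..<n * 2 + 2}) sums suminf f" using sums_group[OF summable_sums[OF assms], of 2] by simp
  also have "(\<lambda>n. sum f {n * 2..<n * 2 + 2}) = (\<lambda>j. f (2 * j) + f (2 * j + 1))"
    by (auto simp: fun_eq_iff numeral_2_eq_2 mult.commute)
  finally show "suminf f = (\<Sum>j. f (2 * j) + f (2 * j + 1))" "summable (\<lambda>j. f (2 * j) + f (2 * j + 1))"
    by (simp_all add: sums_iff)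
qed

lemma summable_inverse_Suc_power: "q \<ge> 2 \<Longrightarrow> summable (\<lambda>n. 1 / real (Suc n) ^ q)"
  using inverse_power_summable[of q, where 'a = real] summable_Suc_iff[of "\<lambda>n. inverse (real n ^ q)"]
  by (simp add: inverse_eq_divide)

lemma summable_odd_powers:
  assumes "q \<ge> 2" shows "summable (\<lambda>j. 1 / (2 * real j + 1) ^ q)"
proof (rule summable_comparison_test'[OF summable_inverse_Suc_power[OF assms], of 0])
  show "norm (1 / (2 * real j + 1) ^ q) \<le> 1 / real (Suc j) ^ q" for j
    by (auto intro!: divide_left_mono power_mono mult_pos_pos)
qed

lemma suminf_odd_powers:
  assumes q: "q \<ge> 2" shows "(\<Sum>j. 1 / (2 * real j + 1) ^ q) = (1 - 1 / 2 ^ q) * zeta_nat q"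
proof -
  have z: "summable (\<lambda>n. 1 / real (Suc n) ^ q)" by (rule summable_inverse_Suc_power[OF q])
  have "zeta_nat q = (\<Sum>j. 1 / real (Suc (2 * j)) ^ q + 1 / real (Suc (2 * j + 1)) ^ q)"
    unfolding zeta_nat_def by (rule suminf_pairs(1)[OF z])
  also have "\<dots> = (\<Sum>j. 1 / (2 * real j + 1) ^ q + 1 / 2 ^ q * (1 / real (Suc j) ^ q))"
  proof (rule suminf_cong)
    fix j
    have "real (Suc (2 * j + 1)) = 2 * real (Suc j)" "real (Suc (2 * j)) = 2 * real j + 1" by auto
    thus "1 / real (Suc (2 * j)) ^ q + 1 / real (Suc (2 * j + 1)) ^ q = 1 / (2 * real j + 1) ^ q + 1 / 2 ^ q * (1 / real (Suc j) ^ q)"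
      by (simp only: power_mult_distrib) simp
  qed
  also have "\<dots> = (\<Sum>j. 1 / (2 * real j + 1) ^ q) + 1 / 2 ^ q * zeta_nat q"
    unfolding zeta_nat_def suminf_mult[OF z, symmetric]
    by (rule suminf_add[OF summable_odd_powers[OF q] summable_mult[OF z], symmetric])
  finally show ?thesis by (simp add: algebra_simps)
qed

lemma suminf_alternating_odd_powers:
  assumes q: "q \<ge> 2" shows "(\<Sum>j. (-1) ^ j / (2 * real j + 1) ^ q) = L_chi_minus4 q"
proof -
  have z: "summable (\<lambda>n. chi_minus4 (Suc n) / real (Suc n) ^ q)"
    by (rule summable_comparison_test'[OF summable_inverse_Suc_power[OF q], of 0]) (auto simp: chi_minus4_def)
  have "L_chi_minus4 q = (\<Sum>j. chi_minus4 (Suc (2 * j)) / real (Suc (2 * j)) ^ q + chi_minus4 (Suc (2 * j + 1)) / real (Suc (2 * j + 1)) ^ q)"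
    unfolding L_chi_minus4_def by (rule suminf_pairs(1)[OF z])
  also have "\<dots> = (\<Sum>j. (-1) ^ j / (2 * real j + 1) ^ q)"
    by (intro suminf_cong) (simp add: chi_minus4_def add.commute)
  finally show ?thesis by simp
qed

lemma sums_odd_exponentials:
  assumes "s > 0"
  shows "(\<lambda>j. exp (- (2 * real j + 1) * s)) sums (1 / (2 * sinh s))"
    and "(\<lambda>j. (-1) ^ j * exp (- (2 * real j + 1) * s)) sums (1 / (2 * cosh s))"
proof -
  have q: "norm (exp (- 2 * s)) < 1" "norm (- exp (- 2 * s)) < 1" using assms by auto
  have e: "exp (- (2 * real j + 1) * s) = exp (- s) * exp (- 2 * s) ^ j" for j
    by (simp add: exp_of_nat_mult[symmetric] exp_add[symmetric] algebra_simps)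
  have e2: "exp (- 2 * s) = exp (- s) * exp (- s)" "exp s * exp (- s) = 1" by (simp_all flip: exp_add)
  have "(\<lambda>j. exp (- s) * exp (- 2 * s) ^ j) sums (exp (- s) * (1 / (1 - exp (- 2 * s))))"
    by (intro sums_mult geometric_sums q)
  moreover have "exp (- s) * (1 / (1 - exp (- 2 * s))) = 1 / (2 * sinh s)"
  proof -
    have "1 - exp (- 2 * s) = exp (- s) * (2 * sinh s)" unfolding e2(1) sinh_def using e2(2) by (simp add: algebra_simps)
    thus ?thesis by simp
  qed
  ultimately show "(\<lambda>j. exp (- (2 * real j + 1) * s)) sums (1 / (2 * sinh s))" unfolding e by (simp only:)
  have "(\<lambda>j. exp (- s) * (- exp (- 2 * s)) ^ j) sums (exp (- s) * (1 / (1 - (- exp (- 2 * s)))))"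
    by (intro sums_mult geometric_sums q)
  moreover have "exp (- s) * (1 / (1 - (- exp (- 2 * s)))) = 1 / (2 * cosh s)"
  proof -
    have "1 - (- exp (- 2 * s)) = exp (- s) * (2 * cosh s)" unfolding e2(1) cosh_def using e2(2) by (simp add: algebra_simps)
    thus ?thesis by simp
  qed
  moreover have "exp (- s) * (- exp (- 2 * s)) ^ j = (-1) ^ j * exp (- (2 * real j + 1) * s)" for j
    unfolding e power_minus[of "exp (- 2 * s)"] by simp
  ultimately show "(\<lambda>j. (-1) ^ j * exp (- (2 * real j + 1) * s)) sums (1 / (2 * cosh s))" by (simp only:)
qed

text \<open>Common termwise integration for \<open>1 / sinh\<close> and \<open>1 / cosh\<close>. The
  condition \<open>m >= 1\<close> serves twice: it suppresses the point \<open>s = 0\<close>, where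
  nothing is known about the series, and it makes the exponent \<open>m + 1\<close> at least 2, so
  that the integrals of the terms are absolutely summable.\<close>

lemma has_bochner_integral_odd_exponentials:
  fixes c :: "nat \<Rightarrow> real"
  assumes c: "\<And>j. \<bar>c j\<bar> \<le> 1" and m: "m \<ge> 1" and g: "\<And>s. s > 0 \<Longrightarrow> (\<lambda>j. c j * exp (- (2 * real j + 1) * s)) sums g s"
  shows "has_bochner_integral lborel (\<lambda>s. indicator {0..} s *\<^sub>R (s ^ m * g s)) (\<Sum>j. fact m * (c j / (2 * real j + 1) ^ (m + 1)))"
proof -
  define f where "f = (\<lambda>j s. c j * (indicator {0..} s *\<^sub>R (s ^ m * exp (- (2 * real j + 1) * s))))"
  have hb: "has_bochner_integral lborel (\<lambda>s. indicator {0..} s *\<^sub>R (s ^ m * exp (- (2 * real j + 1) * s))) (fact m / (2 * real j + 1) ^ (m + 1))" for j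
    by (rule has_bochner_integral_power_exp) (simp add: add_nonneg_pos)
  have fi: "has_bochner_integral lborel (f j) (c j * (fact m / (2 * real j + 1) ^ (m + 1)))" for j
    unfolding f_def by (rule has_bochner_integral_mult_right[OF hb])
  have i1: "integrable lborel (f j)" for j using fi by (auto simp: has_bochner_integral_iff)
  have gs: "(\<lambda>j. f j s) sums (indicator {0..} s *\<^sub>R (s ^ m * g s))" for s
  proof (cases "s > 0")
    case True
    have "(\<lambda>j. s ^ m * (c j * exp (- (2 * real j + 1) * s))) sums (s ^ m * g s)" by (rule sums_mult[OF g[OF True]])
    thus ?thesis using True by (simp add: f_def mult.left_commute)
  next
    case False
    hence "indicator {0..} s * s ^ m = 0" using m by (cases "s = 0") auto
    hence "f j s = 0" for j by (simp add: f_def mult.assoc[symmetric])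
    moreover have "indicator {0..} s *\<^sub>R (s ^ m * g s) = 0" using \<open>indicator {0..} s * s ^ m = 0\<close> by (simp add: mult.assoc[symmetric])
    ultimately show ?thesis by (simp only: sums_zero)
  qed
  have ae: "AE s in lborel. summable (\<lambda>j. norm (f j s))"
  proof (rule AE_I2)
    fix s :: real
    show "summable (\<lambda>j. norm (f j s))"
    proof (cases "s > 0")
      case True
      have "summable (\<lambda>j. s ^ m * exp (- (2 * real j + 1) * s))"
        using sums_odd_exponentials(1)[OF True] by (intro summable_mult) (simp add: sums_iff)
      thus ?thesis
      proof (rule summable_comparison_test'[of _ 0])
        fix j
        show "norm (norm (f j s)) \<le> s ^ m * exp (- (2 * real j + 1) * s)"
          using True c[of j] by (simp add: f_def abs_mult mult_le_cancel_right1)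
      qed
    next
      case False
      hence "indicator {0..} s * s ^ m = 0" using m by (cases "s = 0") auto
      hence "f j s = 0" for j by (simp add: f_def mult.assoc[symmetric])
      thus ?thesis by simp
    qed
  qed
  have sm: "summable (\<lambda>j. \<integral>s. norm (f j s) \<partial>lborel)"
  proof (rule summable_comparison_test'[of "\<lambda>j. fact m * (1 / (2 * real j + 1) ^ (m + 1))" 0])
    show "summable (\<lambda>j. fact m * (1 / (2 * real j + 1) ^ (m + 1)))"
      using m by (intro summable_mult summable_odd_powers) simp
    fix j :: nat
    have "(\<integral>s. norm (f j s) \<partial>lborel) = \<bar>c j\<bar> * (fact m / (2 * real j + 1) ^ (m + 1))"
    proof -
      have "(\<lambda>s. norm (f j s)) = (\<lambda>s. \<bar>c j\<bar> * (indicator {0..} s *\<^sub>R (s ^ m * exp (- (2 * real j + 1) * s))))"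
        by (auto simp: f_def fun_eq_iff abs_mult indicator_def)
      thus ?thesis using has_bochner_integral_mult_right[OF hb[of j], of "\<bar>c j\<bar>"] by (simp only: has_bochner_integral_iff)
    qed
    also have "\<dots> \<le> 1 * (fact m / (2 * real j + 1) ^ (m + 1))" using c by (intro mult_right_mono) auto
    finally show "norm (\<integral>s. norm (f j s) \<partial>lborel) \<le> fact m * (1 / (2 * real j + 1) ^ (m + 1))" by simp
  qed
  have eq: "(\<lambda>s. indicator {0..} s *\<^sub>R (s ^ m * g s)) = (\<lambda>s. \<Sum>j. f j s)"
    using gs by (simp add: sums_iff fun_eq_iff)
  have v: "(\<integral>s. f j s \<partial>lborel) = fact m * (c j / (2 * real j + 1) ^ (m + 1))" for j
    using fi[of j] by (simp add: has_bochner_integral_iff)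
  show ?thesis unfolding eq has_bochner_integral_iff
    using integrable_suminf[OF i1 ae sm] integral_suminf[OF i1 ae sm] by (simp only: v)
qed

lemma has_bochner_integral_power_csch:
  assumes "m \<ge> 1"
  shows "has_bochner_integral lborel (\<lambda>s. indicator {0..} s *\<^sub>R (s ^ m / sinh s)) (2 * fact m * (1 - 1 / 2 ^ (m + 1)) * zeta_nat (m + 1))"
proof -
  have "has_bochner_integral lborel (\<lambda>s. indicator {0..} s *\<^sub>R (s ^ m * (1 / (2 * sinh s)))) (\<Sum>j. fact m * (1 / (2 * real j + 1) ^ (m + 1)))"
    by (rule has_bochner_integral_odd_exponentials[OF _ assms]) (use sums_odd_exponentials(1) in auto)
  also have "(\<Sum>j. fact m * (1 / (2 * real j + 1) ^ (m + 1))) = fact m * ((1 - 1 / 2 ^ (m + 1)) * zeta_nat (m + 1))"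
    using assms by (subst suminf_mult[OF summable_odd_powers], simp, subst suminf_odd_powers) auto
  finally have "has_bochner_integral lborel (\<lambda>s. 2 * (indicator {0..} s *\<^sub>R (s ^ m * (1 / (2 * sinh s))))) (2 * (fact m * ((1 - 1 / 2 ^ (m + 1)) * zeta_nat (m + 1))))"
    by (rule has_bochner_integral_mult_right)
  thus ?thesis by (simp add: mult.assoc)
qed

lemma has_bochner_integral_power_sech:
  assumes "m \<ge> 1"
  shows "has_bochner_integral lborel (\<lambda>s. indicator {0..} s *\<^sub>R (s ^ m / cosh s)) (2 * fact m * L_chi_minus4 (m + 1))"
proof -
  have "has_bochner_integral lborel (\<lambda>s. indicator {0..} s *\<^sub>R (s ^ m * (1 / (2 * cosh s)))) (\<Sum>j. fact m * ((-1) ^ j / (2 * real j + 1) ^ (m + 1)))"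
    by (rule has_bochner_integral_odd_exponentials[OF _ assms]) (use sums_odd_exponentials(2) in auto)
  also have "(\<Sum>j. fact m * ((-1) ^ j / (2 * real j + 1) ^ (m + 1))) = fact m * L_chi_minus4 (m + 1)"
  proof -
    have "summable (\<lambda>j. (-1) ^ j / (2 * real j + 1) ^ (m + 1))"
      by (rule summable_comparison_test'[OF summable_odd_powers[of "m + 1"], of 0]) (use assms in auto)
    thus ?thesis using assms by (subst suminf_mult, simp, subst suminf_alternating_odd_powers) auto
  qed
  finally have "has_bochner_integral lborel (\<lambda>s. 2 * (indicator {0..} s *\<^sub>R (s ^ m * (1 / (2 * cosh s))))) (2 * (fact m * L_chi_minus4 (m + 1)))"
    by (rule has_bochner_integral_mult_right)
  thus ?thesis by (simp add: mult.assoc)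
qed

section \<open>Densities as polynomials in s^2, and their absolute moments\<close>

lemma prod_list_nth_elem_sym:
  "(\<Prod>i<length as. y + as ! i) = (\<Sum>h\<le>length as. elem_sym (length as - h) as * y ^ h)"
proof -
  let ?n = "length as"
  have "(\<Prod>i<?n. as ! i + y) = (\<Sum>B\<in>Pow {..<?n}. (\<Prod>i\<in>B. as ! i) * (\<Prod>i\<in>{..<?n} - B. y))"
    by (rule prod_add) simp
  also have "\<dots> = (\<Sum>B\<in>Pow {..<?n}. (\<Prod>i\<in>B. as ! i) * y ^ (?n - card B))"
    by (intro sum.cong refl arg_cong2[where f = "(*)"]) (auto simp: card_Diff_subset finite_subset)
  also have "\<dots> = (\<Sum>l\<le>?n. \<Sum>B | B \<in> Pow {..<?n} \<and> card B = l. (\<Prod>i\<in>B. as ! i) * y ^ (?n - card B))"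
    by (rule sum.group[symmetric]) (auto dest: card_mono[rotated])
  also have "\<dots> = (\<Sum>l\<le>?n. elem_sym l as * y ^ (?n - l))"
    unfolding elem_sym_def sum_distrib_right by (intro sum.cong refl) auto
  also have "\<dots> = (\<Sum>h\<le>?n. elem_sym (?n - h) as * y ^ h)"
    by (rule sum.reindex_bij_witness[of _ "\<lambda>h. ?n - h" "\<lambda>h. ?n - h"]) auto
  finally show ?thesis by (simp add: add.commute)
qed

lemma prod_even_squares: "(\<Prod>j=1..n. y + (2 * real j)\<^sup>2) = (\<Sum>h\<le>n. elem_sym (n - h) (even_squares n) * y ^ h)"
proof -
  have "(\<Prod>j=1..n. y + (2 * real j)\<^sup>2) = (\<Prod>i<n. y + even_squares n ! i)"
    by (rule prod.reindex_bij_witness[of _ "\<lambda>i. i + 1" "\<lambda>j. j - 1"]) (auto simp: even_squares_def simp del: upt_Suc)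
  thus ?thesis using prod_list_nth_elem_sym[where as = "even_squares n" and y = y] by (simp only: even_squares_def length_map length_upt diff_Suc_1)
qed

lemma prod_odd_squares: "(\<Prod>j=1..n. y + (2 * real j - 1)\<^sup>2) = (\<Sum>h\<le>n. elem_sym (n - h) (odd_squares n) * y ^ h)"
proof -
  have "(\<Prod>j=1..n. y + (2 * real j - 1)\<^sup>2) = (\<Prod>i<n. y + odd_squares n ! i)"
    by (rule prod.reindex_bij_witness[of _ "\<lambda>i. i + 1" "\<lambda>j. j - 1"]) (auto simp: odd_squares_def simp del: upt_Suc)
  thus ?thesis using prod_list_nth_elem_sym[where as = "odd_squares n" and y = y] by (simp only: odd_squares_def length_map length_upt diff_Suc_1)
qed

lemma sech_density_odd:
  "sech_density (2 * n + 1) s = (\<Prod>j=1..n. 4 * s\<^sup>2 / pi\<^sup>2 + (2 * real j - 1)\<^sup>2) / fact (2 * n) * (1 / (pi * cosh s))"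
proof (induction n)
  case 0 show ?case by (simp add: sech_density_1)
next
  case (Suc n)
  have "sech_density (2 * Suc n + 1) s = sech_density ((2 * n + 1) + 2) s" by (rule arg_cong[where f = "\<lambda>k. sech_density k s"]) simp
  also have "\<dots> = (4 * s\<^sup>2 / pi\<^sup>2 + (real (2 * n + 1))\<^sup>2) / (real (2 * n + 1) * (real (2 * n + 1) + 1)) * sech_density (2 * n + 1) s"
    by (rule sech_density_step) simp
  also have "\<dots> = (\<Prod>j=1..Suc n. 4 * s\<^sup>2 / pi\<^sup>2 + (2 * real j - 1)\<^sup>2) / fact (2 * Suc n) * (1 / (pi * cosh s))"
  proof -
    have "(fact (2 * Suc n) :: real) = real (2 * n + 1) * (real (2 * n + 1) + 1) * fact (2 * n)" by (simp add: algebra_simps)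
    moreover have "(\<Prod>j=1..Suc n. 4 * s\<^sup>2 / pi\<^sup>2 + (2 * real j - 1)\<^sup>2) = (\<Prod>j=1..n. 4 * s\<^sup>2 / pi\<^sup>2 + (2 * real j - 1)\<^sup>2) * (4 * s\<^sup>2 / pi\<^sup>2 + (real (2 * n + 1))\<^sup>2)"
      by (simp add: algebra_simps)
    moreover have "x / (a * b) * (P / f * c) = (P * x) / (a * b * f) * c" for x a b P f c :: real by simp
    ultimately show ?thesis unfolding Suc.IH by (simp only:)
  qed
  finally show ?case .
qed

lemma sech_density_even_index:
  "sech_density (2 * n + 2) s = (\<Prod>j=1..n. 4 * s\<^sup>2 / pi\<^sup>2 + (2 * real j)\<^sup>2) / fact (2 * n + 1) * (2 / pi\<^sup>2 * (s / sinh s))"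
proof (induction n)
  case 0 show ?case by (simp add: numeral_2_eq_2 sech_density.simps(3))
next
  case (Suc n)
  have "sech_density (2 * Suc n + 2) s = sech_density ((2 * n + 2) + 2) s" by (rule arg_cong[where f = "\<lambda>k. sech_density k s"]) simp
  also have "\<dots> = (4 * s\<^sup>2 / pi\<^sup>2 + (real (2 * n + 2))\<^sup>2) / (real (2 * n + 2) * (real (2 * n + 2) + 1)) * sech_density (2 * n + 2) s"
    by (rule sech_density_step) simp
  also have "\<dots> = (\<Prod>j=1..Suc n. 4 * s\<^sup>2 / pi\<^sup>2 + (2 * real j)\<^sup>2) / fact (2 * Suc n + 1) * (2 / pi\<^sup>2 * (s / sinh s))"
  proof -
    have "(fact (2 * Suc n + 1) :: real) = real (2 * n + 2) * (real (2 * n + 2) + 1) * fact (2 * n + 1)" by (simp add: algebra_simps)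
    moreover have "(\<Prod>j=1..Suc n. 4 * s\<^sup>2 / pi\<^sup>2 + (2 * real j)\<^sup>2) = (\<Prod>j=1..n. 4 * s\<^sup>2 / pi\<^sup>2 + (2 * real j)\<^sup>2) * (4 * s\<^sup>2 / pi\<^sup>2 + (real (2 * n + 2))\<^sup>2)"
    proof -
      have "real (2 * n + 2) = 2 * real (Suc n)" by simp
      thus ?thesis by (simp del: of_nat_Suc of_nat_add)
    qed
    moreover have "x / (a * b) * (P / f * c) = (P * x) / (a * b * f) * c" for x a b P f c :: real by simp
    ultimately show ?thesis unfolding Suc.IH by (simp only:)
  qed
  finally show ?case .
qed

lemma integral_abs_power_even:
  assumes n: "n \<ge> 1" and q: "odd q"
  shows "(\<integral>s. \<bar>s\<bar> ^ q \<partial>sech_law (2 * n)) =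
    1 / fact (2 * n - 1) * (\<Sum>h=1..n. elem_sym (n - h) (even_squares (n - 1)) * (2 / pi) ^ (2 * h) *
      (2 * fact (2 * h - 1 + q) * (1 - 1 / 2 ^ (2 * h + q)) * zeta_nat (2 * h + q)))"
proof -
  obtain N where N: "n = Suc N" using n by (cases n) auto
  define I where "I = (\<lambda>h s::real. indicator {0..} s *\<^sub>R (s ^ (2 * h + 1 + q) / sinh s))"
  define c where "c = (\<lambda>h. 1 / fact (2 * N + 1) * (elem_sym (N - h) (even_squares N) * (2 / pi) ^ (2 * h) * (2 / pi\<^sup>2)))"
  define f where "f = (\<lambda>s. \<bar>s\<bar> ^ q * sech_density (2 * n) s)"
  have k: "2 * n = 2 * N + 2" using N by simp
  have fI: "indicator {0..} s *\<^sub>R f s = (\<Sum>h\<le>N. c h * I h s)" for s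
  proof (cases "s \<ge> 0")
    case True
    have p: "(4 * s\<^sup>2 / pi\<^sup>2) ^ h = (2 / pi) ^ (2 * h) * s ^ (2 * h)" for h
      by (simp add: power_mult power_mult_distrib power_divide)
    have "f s = s ^ q * ((\<Sum>h\<le>N. elem_sym (N - h) (even_squares N) * (4 * s\<^sup>2 / pi\<^sup>2) ^ h) / fact (2 * N + 1) * (2 / pi\<^sup>2 * (s / sinh s)))"
      unfolding f_def k sech_density_even_index prod_even_squares using True by simp
    also have "\<dots> = (\<Sum>h\<le>N. c h * (s ^ (2 * h + 1 + q) / sinh s))"
      unfolding p sum_divide_distrib sum_distrib_left sum_distrib_right c_def
      by (intro sum.cong refl) (simp add: power_add mult_ac)
    finally show ?thesis using True by (simp add: I_def)
  qed (simp add: I_def)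
  have hb: "has_bochner_integral lborel (\<lambda>s. indicator {0..} s *\<^sub>R f s) (\<Sum>h\<le>N. c h * (2 * fact (2 * h + 1 + q) * (1 - 1 / 2 ^ (2 * h + 1 + q + 1)) * zeta_nat (2 * h + 1 + q + 1)))"
    unfolding fI I_def by (intro has_bochner_integral_sum has_bochner_integral_mult_right has_bochner_integral_power_csch) simp
  have "(\<integral>s. \<bar>s\<bar> ^ q \<partial>sech_law (2 * n)) = (\<integral>s. f s \<partial>lborel)"
    unfolding f_def using n by (intro integral_sech_law) auto
  also have "\<dots> = 2 * (\<integral>s. indicator {0..} s *\<^sub>R f s \<partial>lborel)"
    by (rule integrable_even_extension(2)) (use hb in \<open>auto simp: has_bochner_integral_iff f_def\<close>)
  also have "\<dots> = (\<Sum>h\<le>N. 2 * (c h * (2 * fact (2 * h + 1 + q) * (1 - 1 / 2 ^ (2 * h + 1 + q + 1)) * zeta_nat (2 * h + 1 + q + 1))))"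
    using hb by (simp add: has_bochner_integral_iff sum_distrib_left)
  also have "\<dots> = (\<Sum>h=1..n. 1 / fact (2 * n - 1) * (elem_sym (n - h) (even_squares (n - 1)) * (2 / pi) ^ (2 * h) *
      (2 * fact (2 * h - 1 + q) * (1 - 1 / 2 ^ (2 * h + q)) * zeta_nat (2 * h + q))))"
  proof (rule sum.reindex_bij_witness[of _ "\<lambda>h. h - 1" Suc])
    fix h assume h: "h \<in> {..N}"
    have e: "n - Suc h = N - h" "n - 1 = N" "2 * n - 1 = 2 * N + 1" "2 * Suc h - 1 + q = 2 * h + 1 + q" "2 * Suc h + q = 2 * h + 1 + q + 1"
      using N by auto
    \<comment> \<open>The prefactor \<open>2 / pi^2\<close> of the density, doubled by the two half
      lines, supplies the additional \<open>(2 / pi)^2\<close> when the index is raised by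
      one.\<close>
    have "(2 / pi) ^ (2 * Suc h) = (2 / pi) ^ (2 * h) * (4 / pi\<^sup>2)" by (simp add: power2_eq_square)
    thus "1 / fact (2 * n - 1) * (elem_sym (n - Suc h) (even_squares (n - 1)) * (2 / pi) ^ (2 * Suc h) *
      (2 * fact (2 * Suc h - 1 + q) * (1 - 1 / 2 ^ (2 * Suc h + q)) * zeta_nat (2 * Suc h + q))) =
       2 * (c h * (2 * fact (2 * h + 1 + q) * (1 - 1 / 2 ^ (2 * h + 1 + q + 1)) * zeta_nat (2 * h + 1 + q + 1)))"
      unfolding e c_def by simp
  qed (use N in auto)
  finally show ?thesis by (simp only: sum_distrib_left)
qed

lemma sech_density_odd_sum:
  "sech_density (2 * n + 1) s = (\<Sum>h\<le>n. elem_sym (n - h) (odd_squares n) * (2 / pi) ^ (2 * h) / (pi * fact (2 * n)) * (s ^ (2 * h) / cosh s))"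
proof -
  have p: "(4 * s\<^sup>2 / pi\<^sup>2) ^ h = (2 / pi) ^ (2 * h) * s ^ (2 * h)" for h
    by (simp add: power_mult power_mult_distrib power_divide)
  show ?thesis unfolding sech_density_odd prod_odd_squares p sum_divide_distrib sum_distrib_left sum_distrib_right
    by (intro sum.cong refl) (simp add: mult_ac)
qed

lemma integral_abs_odd:
  "(\<integral>s. \<bar>s\<bar> \<partial>sech_law (2 * n + 1)) =
    1 / fact (2 * n) * (\<Sum>h=0..n. elem_sym (n - h) (odd_squares n) * (2 / pi) ^ (2 * h) * (4 / pi * fact (2 * h + 1) * L_chi_minus4 (2 * h + 2)))"
proof -
  define I where "I = (\<lambda>h s::real. indicator {0..} s *\<^sub>R (s ^ (2 * h + 1) / cosh s))"
  define c where "c = (\<lambda>h. elem_sym (n - h) (odd_squares n) * (2 / pi) ^ (2 * h) / (pi * fact (2 * n)))"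
  define f where "f = (\<lambda>s. \<bar>s\<bar> * sech_density (2 * n + 1) s)"
  have fI: "indicator {0..} s *\<^sub>R f s = (\<Sum>h\<le>n. c h * I h s)" for s
  proof (cases "s \<ge> 0")
    case True
    thus ?thesis unfolding f_def sech_density_odd_sum sum_distrib_left I_def c_def by (simp add: mult.left_commute)
  qed (simp add: I_def)
  have hb: "has_bochner_integral lborel (\<lambda>s. indicator {0..} s *\<^sub>R f s) (\<Sum>h\<le>n. c h * (2 * fact (2 * h + 1) * L_chi_minus4 (2 * h + 1 + 1)))"
    unfolding fI I_def by (intro has_bochner_integral_sum has_bochner_integral_mult_right has_bochner_integral_power_sech) simp
  have "(\<integral>s. \<bar>s\<bar> \<partial>sech_law (2 * n + 1)) = (\<integral>s. f s \<partial>lborel)"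
    unfolding f_def by (intro integral_sech_law) auto
  also have "\<dots> = 2 * (\<integral>s. indicator {0..} s *\<^sub>R f s \<partial>lborel)"
    by (rule integrable_even_extension(2)) (use hb in \<open>auto simp: has_bochner_integral_iff f_def\<close>)
  also have "\<dots> = (\<Sum>h\<le>n. 2 * (c h * (2 * fact (2 * h + 1) * L_chi_minus4 (2 * h + 1 + 1))))"
    using hb by (simp add: has_bochner_integral_iff sum_distrib_left)
  also have "\<dots> = (\<Sum>h=0..n. 1 / fact (2 * n) * (elem_sym (n - h) (odd_squares n) * (2 / pi) ^ (2 * h) * (4 / pi * fact (2 * h + 1) * L_chi_minus4 (2 * h + 2))))"
    unfolding atMost_atLeast0 c_def by (intro sum.cong refl) (simp add: mult_ac)
  finally show ?thesis by (simp only: sum_distrib_left)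
qed

section \<open>The mean of ln (1 + cosh s cosh t)\<close>

lemma integral_ln_cosh_centered:
  "has_bochner_integral (sech_law 1) (\<lambda>t. ln (2 * cosh t) - 2 * ln 2) 0"
proof -
  interpret L: prob_space "sech_law 1" by (rule prob_space_sech_law)
  have b: "\<bar>ln (2 * cosh t)\<bar> \<le> 1 * (1 + \<bar>t\<bar>) ^ 1" for t :: real using ln_two_cosh_bound[of t] by auto
  have i: "integrable (sech_law 1) (\<lambda>t. ln (2 * cosh t))" by (rule integrable_sech_law[OF _ b]) measurable
  have v: "(\<integral>t. ln (2 * cosh t) \<partial>sech_law 1) = 2 * ln 2"
    using integral_ln_cosh_shift[of 0] unfolding sech_law_1[symmetric] by simp
  have c: "has_bochner_integral (sech_law 1) (\<lambda>_. 2 * ln 2 :: real) (2 * ln 2)"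
    unfolding has_bochner_integral_iff using L.prob_space by (intro conjI L.integrable_const) simp
  show ?thesis
    using has_bochner_integral_diff[OF has_bochner_integral_integrable[OF i, unfolded v] c] by simp
qed

text \<open>Both means have the same second derivative in \<open>s\<close>, twice the density of one
  step, and the same asymptotics. In detail, \<open>E = (F - s) / 2\<close> satisfies
  \<open>E' = -Q\<close>, where \<open>Q s\<close> is the probability that one step \<open>T\<close>
  exceeds \<open>s\<close>, and \<open>E\<close> tends to 0; hence \<open>E s\<close> is the mean of
  \<open>max 0 (T - s)\<close>, and \<open>|T - s| = 2 max 0 (T - s) - (T - s)\<close> gives the
  value.\<close>

lemma integrable_ln_one_plus_cosh_cosh: "integrable (sech_law 1) (\<lambda>t. ln (1 + cosh s * cosh t))"
  and integral_ln_one_plus_cosh_cosh: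
  "(\<integral>t. ln (1 + cosh s * cosh t) \<partial>sech_law 1) = (\<integral>t. \<bar>s + t\<bar> \<partial>sech_law 1)"
proof -
  interpret L: prob_space "sech_law 1" by (rule prob_space_sech_law)
  define F where "F = (\<lambda>s. \<integral>t. ln (1 + cosh s * cosh t) \<partial>sech_law 1)"
  define Q where "Q = (\<lambda>s::real. 1 / 2 - 2 / pi * arctan (tanh (s / 2)))"
  define E where "E = (\<lambda>s. (F s - s) / 2)"
  have cp: "1 + cosh a * cosh b > 0" for a b :: real using cosh_real_pos[of a] cosh_real_pos[of b] by (simp add: add_pos_pos)
  have lower: "exp \<bar>a\<bar> / 2 \<le> cosh a" and upper: "cosh a \<le> exp \<bar>a\<bar>" for a :: real
    by (auto simp: cosh_def abs_if)
  have bnd: "\<bar>ln (1 + cosh s * cosh t) - \<bar>s\<bar>\<bar> \<le> 1 * (1 + \<bar>t\<bar>) ^ 1" for s t :: real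
  proof -
    have "1 + cosh s * cosh t \<le> 2 * (exp \<bar>s\<bar> * exp \<bar>t\<bar>)"
      using mult_mono[OF upper[of s] upper[of t]] mult_mono[of 1 "exp \<bar>s\<bar>" 1 "exp \<bar>t\<bar>"] by simp
    hence "ln (1 + cosh s * cosh t) \<le> ln (2 * (exp \<bar>s\<bar> * exp \<bar>t\<bar>))" using cp by (simp add: ln_le_cancel_iff del: ln_mult)
    also have "\<dots> = ln 2 + \<bar>s\<bar> + \<bar>t\<bar>" by (simp add: ln_mult)
    finally have 1: "ln (1 + cosh s * cosh t) - \<bar>s\<bar> \<le> 1 + \<bar>t\<bar>" using ln_2_less_1 by linarith
    have "exp \<bar>s\<bar> / 2 \<le> 1 + cosh s * cosh t"
      using mult_mono[OF lower[of s] cosh_real_ge_1[of t]] cosh_real_pos[of s] by simp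
    hence "ln (exp \<bar>s\<bar> / 2) \<le> ln (1 + cosh s * cosh t)" using cp by (simp add: ln_le_cancel_iff del: ln_div)
    hence 2: "\<bar>s\<bar> - ln 2 \<le> ln (1 + cosh s * cosh t)" by (simp add: ln_div)
    show ?thesis using 1 2 ln_2_less_1 abs_ge_zero[of t] unfolding power_one_right mult_1 abs_le_iff by linarith
  qed
  have int0: "integrable (sech_law 1) (\<lambda>t. ln (1 + cosh s * cosh t) - \<bar>s\<bar>)" for s
    by (rule integrable_sech_law[OF _ bnd]) measurable
  have intF: "integrable (sech_law 1) (\<lambda>t. ln (1 + cosh s * cosh t))" for s
    using Bochner_Integration.integrable_add[OF int0[of s] L.integrable_const[of "\<bar>s\<bar>"]] by simp
  show "integrable (sech_law 1) (\<lambda>t. ln (1 + cosh s * cosh t))" by (rule intF)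
  have dF: "(F has_real_derivative (\<integral>t. sinh s * cosh t / (1 + cosh s * cosh t) \<partial>sech_law 1)) (at s)" for s
    unfolding F_def
  proof (rule has_real_derivative_integral[OF intF, where g = "\<lambda>_. 1" and f' = "\<lambda>s t. sinh s * cosh t / (1 + cosh s * cosh t)"])
    show "((\<lambda>s. ln (1 + cosh s * cosh t)) has_real_derivative sinh s * cosh t / (1 + cosh s * cosh t)) (at s)" for s t :: real
      using cp[of s t] by (auto intro!: derivative_eq_intros)
    show "\<bar>sinh s * cosh t / (1 + cosh s * cosh t)\<bar> \<le> 1" for s t :: real
    proof -
      have "\<bar>sinh s\<bar> \<le> cosh s" by (auto simp: sinh_def cosh_def abs_le_iff field_simps)
      hence "\<bar>sinh s\<bar> * cosh t \<le> cosh s * cosh t" by (intro mult_right_mono) auto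
      hence "\<bar>sinh s\<bar> * cosh t \<le> 1 + cosh s * cosh t" by linarith
      thus ?thesis using cp[of s t] by (simp add: abs_mult)
    qed
    show "(\<lambda>t. sinh s * cosh t / (1 + cosh s * cosh t)) \<in> borel_measurable (sech_law 1)" for s :: real by measurable
  qed (rule L.integrable_const)
  \<comment> \<open>The weight \<open>1 / (pi cosh t)\<close> cancels the \<open>cosh t\<close> in
    the numerator, and \<open>1 / (1 + cosh s cosh t)\<close> has the primitive
    \<open>(2 / sinh s) arctan (tanh (s / 2) tanh (t / 2))\<close>.\<close>
  have slope: "(\<integral>t. sinh s * cosh t / (1 + cosh s * cosh t) \<partial>sech_law 1) = 4 / pi * arctan (tanh (s / 2))" for s
  proof (cases "s = 0")
    case False
    define a where "a = s / 2"
    have s: "s = a + a" by (simp add: a_def)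
    have snz: "sinh s \<noteq> 0" "sinh a \<noteq> 0" using False by (auto simp: a_def)
    have "has_bochner_integral lborel (\<lambda>t. 1 / (1 + cosh s * cosh t)) (2 / sinh s * arctan (tanh a) - (- (2 / sinh s * arctan (tanh a))))"
    proof (rule has_bochner_integral_FTC_UNIV[where F = "\<lambda>t. 2 / sinh s * arctan (tanh a * tanh (t / 2))"])
      fix t :: real
      define b where "b = t / 2"
      define D where "D = (cosh a)\<^sup>2 * (cosh b)\<^sup>2 + (sinh a)\<^sup>2 * (sinh b)\<^sup>2"
      have t: "t = b + b" by (simp add: b_def)
      have c: "1 + cosh s * cosh t = 2 * D" unfolding s t cosh_add D_def
        by (simp add: sinh_square_eq power2_eq_square[symmetric] algebra_simps)
      have D: "D > 0" using cp[of s t] c by linarith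
      have "((\<lambda>t. arctan (tanh a * tanh (t / 2))) has_real_derivative
         tanh a * ((1 - (tanh b)\<^sup>2) * (1 / 2)) / (1 + (tanh a * tanh b)\<^sup>2)) (at t)"
        unfolding b_def by (auto intro!: derivative_eq_intros simp: field_simps power2_eq_square)
      also have "tanh a * ((1 - (tanh b)\<^sup>2) * (1 / 2)) / (1 + (tanh a * tanh b)\<^sup>2) = sinh a * cosh a / (2 * D)"
      proof -
        have ca: "cosh a > 0" "cosh b > 0" by auto
        have 1: "1 - (tanh b)\<^sup>2 = 1 / (cosh b)\<^sup>2"
          using ca by (simp add: tanh_def power_divide field_simps sinh_square_eq)
        have 2: "1 + (tanh a * tanh b)\<^sup>2 = D / ((cosh a)\<^sup>2 * (cosh b)\<^sup>2)"
          using ca by (simp add: tanh_def D_def power_divide power_mult_distrib field_simps)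
        show ?thesis unfolding 1 2 using ca D by (simp add: tanh_def field_simps power2_eq_square)
      qed
      finally have d: "((\<lambda>t. arctan (tanh a * tanh (t / 2))) has_real_derivative sinh a * cosh a / (2 * D)) (at t)" .
      have "2 / sinh s * (sinh a * cosh a / (2 * D)) = 1 / (1 + cosh s * cosh t)"
        unfolding c using snz D unfolding s sinh_add by (simp add: field_simps)
      thus "((\<lambda>t. 2 / sinh s * arctan (tanh a * tanh (t / 2))) has_real_derivative 1 / (1 + cosh s * cosh t)) (at t)"
        using DERIV_cmult[OF d, of "2 / sinh s"] by simp
    next
      show "continuous_on UNIV (\<lambda>t. 1 / (1 + cosh s * cosh t))"
        using cp by (intro continuous_intros) (auto simp: less_imp_neq[symmetric])
      show "1 / (1 + cosh s * cosh t) \<ge> 0" for t using cp[of s t] by simp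
      have T: "((\<lambda>t::real. tanh (t / 2)) \<longlongrightarrow> 1) at_top" "((\<lambda>t::real. tanh (t / 2)) \<longlongrightarrow> - 1) at_bot" by real_asymp+
      show "((\<lambda>t. 2 / sinh s * arctan (tanh a * tanh (t / 2))) \<longlongrightarrow> 2 / sinh s * arctan (tanh a)) at_top"
        using tendsto_mult_left[OF tendsto_arctan[OF tendsto_mult_left[OF T(1), of "tanh a"]], of "2 / sinh s"] by simp
      show "((\<lambda>t. 2 / sinh s * arctan (tanh a * tanh (t / 2))) \<longlongrightarrow> - (2 / sinh s * arctan (tanh a))) at_bot"
        using tendsto_mult_left[OF tendsto_arctan[OF tendsto_mult_left[OF T(2), of "tanh a"]], of "2 / sinh s"] by (simp add: arctan_minus)
    qed
    hence I: "(\<integral>t. 1 / (1 + cosh s * cosh t) \<partial>lborel) = 4 / sinh s * arctan (tanh a)"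
      by (simp add: has_bochner_integral_iff)
    have "(\<integral>t. sinh s * cosh t / (1 + cosh s * cosh t) \<partial>sech_law 1) =
      (\<integral>t. sinh s * cosh t / (1 + cosh s * cosh t) * sech_density 1 t \<partial>lborel)"
      by (rule integral_sech_law) auto
    also have "\<dots> = (\<integral>t. sinh s / pi * (1 / (1 + cosh s * cosh t)) \<partial>lborel)"
      by (intro Bochner_Integration.integral_cong[OF refl]) (simp add: sech_density_1)
    also have "\<dots> = 4 / pi * arctan (tanh a)" unfolding integral_mult_right_zero I using snz by simp
    finally show ?thesis by (simp add: a_def)
  qed simp
  have dE: "(E has_real_derivative - Q s) (at s)" for s
    unfolding E_def using dF[of s] unfolding slope
    by (auto intro!: derivative_eq_intros simp: Q_def field_simps)
  have dQ: "(Q has_real_derivative - (1 / (pi * cosh s))) (at s)" for s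
  proof -
    have c2: "cosh s = (cosh (s / 2))\<^sup>2 + (sinh (s / 2))\<^sup>2" using cosh_add[of "s / 2" "s / 2"] by (simp add: power2_eq_square)
    have "(1 - (tanh (s / 2))\<^sup>2) / (1 + (tanh (s / 2))\<^sup>2) = 1 / cosh s"
    proof -
      have p: "cosh (s / 2) > 0" by simp
      have 1: "1 - (tanh (s / 2))\<^sup>2 = 1 / (cosh (s / 2))\<^sup>2"
        using p by (simp add: tanh_def power_divide field_simps sinh_square_eq)
      have 2: "1 + (tanh (s / 2))\<^sup>2 = cosh s / (cosh (s / 2))\<^sup>2"
        unfolding c2 using p by (simp add: tanh_def power_divide field_simps)
      show ?thesis unfolding 1 2 using p by simp
    qed
    moreover have "((\<lambda>s. arctan (tanh (s / 2))) has_real_derivative (1 - (tanh (s / 2))\<^sup>2) / (1 + (tanh (s / 2))\<^sup>2) * (1 / 2)) (at s)"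
      by (auto intro!: derivative_eq_intros simp: field_simps power2_eq_square)
    ultimately have "((\<lambda>s. arctan (tanh (s / 2))) has_real_derivative 1 / cosh s * (1 / 2)) (at s)"
      by (simp only:)
    from DERIV_diff[OF DERIV_const DERIV_cmult[OF this, of "2 / pi"]] show ?thesis by (simp add: Q_def)
  qed
  \<comment> \<open>For large \<open>s\<close> the integrand minus \<open>s\<close> tends to
    \<open>ln (cosh t / 2) = ln (2 cosh t) - 2 ln 2\<close>, which has mean 0 by
    \<open>integral_ln_cosh_centered\<close>. The bound \<open>bnd\<close>, uniform in
    \<open>s\<close>, justifies the limit.\<close>
  have lim: "(E \<longlongrightarrow> 0) at_top"
  proof -
    have "((\<lambda>s. \<integral>t. ln (1 + cosh s * cosh t) - \<bar>s\<bar> \<partial>sech_law 1) \<longlongrightarrow> (\<integral>t. ln (2 * cosh t) - 2 * ln 2 \<partial>sech_law 1)) at_top"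
    proof (rule integral_dominated_convergence_at_top[where w = "\<lambda>t. 1 + \<bar>t\<bar>"])
      show "integrable (sech_law 1) (\<lambda>t. 1 + \<bar>t\<bar>)" by (rule integrable_sech_law[of _ 1 1]) auto
      show "\<forall>\<^sub>F s in at_top. AE t in sech_law 1. norm (ln (1 + cosh s * cosh t) - \<bar>s\<bar>) \<le> 1 + \<bar>t\<bar>"
        using bnd by auto
      show "AE t in sech_law 1. ((\<lambda>s. ln (1 + cosh s * cosh t) - \<bar>s\<bar>) \<longlongrightarrow> ln (2 * cosh t) - 2 * ln 2) at_top"
      proof (rule AE_I2)
        fix t :: real
        have "((\<lambda>s. exp (- s) + (1 + exp (- 2 * s)) / 2 * cosh t) \<longlongrightarrow> 0 + (1 + 0) / 2 * cosh t) at_top"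
        proof (intro tendsto_add tendsto_mult_right tendsto_divide tendsto_const)
          show "((\<lambda>s::real. exp (- s)) \<longlongrightarrow> 0) at_top" "((\<lambda>s::real. exp (- 2 * s)) \<longlongrightarrow> 0) at_top" by real_asymp+
        qed simp
        hence "((\<lambda>s. ln (exp (- s) + (1 + exp (- 2 * s)) / 2 * cosh t)) \<longlongrightarrow> ln (cosh t / 2)) at_top"
          using cosh_real_pos[of t] by (intro tendsto_ln) auto
        moreover have "ln (cosh t / 2) = ln (2 * cosh t) - 2 * ln 2" by (simp add: ln_div ln_mult)
        moreover have "\<forall>\<^sub>F s in at_top. ln (exp (- s) + (1 + exp (- 2 * s)) / 2 * cosh t) = ln (1 + cosh s * cosh t) - \<bar>s\<bar>"
          using eventually_ge_at_top[of 0]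
        proof eventually_elim
          case (elim s)
          have e: "exp (- 2 * s) = exp (- s) * exp (- s)" "exp s * exp (- s) = (1::real)" by (simp_all flip: exp_add)
          have "exp (- s) + (1 + exp (- 2 * s)) / 2 * cosh t = (1 + cosh s * cosh t) * exp (- s)"
            unfolding cosh_def[of s] e(1) using e(2) by (simp add: field_simps)
          thus ?case using elim cp[of s t] by (simp add: ln_mult)
        qed
        ultimately show "((\<lambda>s. ln (1 + cosh s * cosh t) - \<bar>s\<bar>) \<longlongrightarrow> ln (2 * cosh t) - 2 * ln 2) at_top"
          by (simp only: tendsto_cong)
      qed
    qed measurable
    moreover have "(\<integral>t. ln (2 * cosh t) - 2 * ln 2 \<partial>sech_law 1) = 0"
      using integral_ln_cosh_centered by (simp only: has_bochner_integral_iff)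
    ultimately have "((\<lambda>s. (\<integral>t. ln (1 + cosh s * cosh t) - \<bar>s\<bar> \<partial>sech_law 1) / 2) \<longlongrightarrow> 0) at_top"
      by (auto intro!: tendsto_eq_intros)
    moreover have "\<forall>\<^sub>F s in at_top. (\<integral>t. ln (1 + cosh s * cosh t) - \<bar>s\<bar> \<partial>sech_law 1) / 2 = E s"
      using eventually_ge_at_top[of 0]
    proof eventually_elim
      case (elim s)
      have "(\<integral>t. ln (1 + cosh s * cosh t) - \<bar>s\<bar> \<partial>sech_law 1) = F s - s"
        unfolding F_def Bochner_Integration.integral_diff[OF intF L.integrable_const] using elim L.prob_space by simp
      thus ?case by (simp only: E_def)
    qed
    ultimately show ?thesis by (rule Lim_transform_eventually)
  qed
  \<comment> \<open>\<open>arctan (tanh (t / 2)) = pi / 4 - arctan (e^(-t))\<close> rewrites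
    \<open>Q t\<close> as \<open>(2 / pi) arctan (e^(-t))\<close>, which makes the exponential decay
    visible.\<close>
  have Qlim: "((\<lambda>t. (t - s) * Q t) \<longlongrightarrow> 0) at_top" for s
  proof -
    have "\<forall>\<^sub>F t in at_top. (t - s) * (2 / pi * arctan (exp (- t))) = (t - s) * Q t"
      using eventually_gt_at_top[of 0]
    proof eventually_elim
      case (elim t)
      define y where "y = exp (- t)"
      have y: "0 < y" "y < 1" using elim by (auto simp: y_def)
      have h: "y = exp (- (t / 2)) * exp (- (t / 2))" "exp (t / 2) * exp (- (t / 2)) = (1::real)"
        by (simp_all add: y_def flip: exp_add)
      have "tanh (t / 2) = exp (- (t / 2)) * (exp (t / 2) - exp (- (t / 2))) / (exp (- (t / 2)) * (exp (t / 2) + exp (- (t / 2))))"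
        by (simp add: tanh_altdef)
      also have "\<dots> = (1 - y) / (1 + y)" using h by (simp add: algebra_simps)
      finally have x: "tanh (t / 2) = (1 - y) / (1 + y)" .
      have "arctan ((1 - y) / (1 + y)) + arctan y = arctan (((1 - y) / (1 + y) + y) / (1 - (1 - y) / (1 + y) * y))"
        by (rule arctan_add) (use y in \<open>auto simp: abs_if field_simps\<close>)
      also have "((1 - y) / (1 + y) + y) / (1 - (1 - y) / (1 + y) * y) = 1"
      proof -
        have "1 - (1 - y) / (1 + y) * y = (1 - y) / (1 + y) + y" using y by (simp add: field_simps)
        moreover have "(1 - y) / (1 + y) + y > 0" using y by (intro add_pos_pos) auto
        ultimately show ?thesis by simp
      qed
      finally have "arctan (tanh (t / 2)) = pi / 4 - arctan y" unfolding x by (simp add: arctan_one)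
      hence "Q t = 1 / 2 - 2 / pi * (pi / 4 - arctan y)" by (simp only: Q_def)
      hence "Q t = 2 / pi * arctan y" by (simp add: right_diff_distrib)
      thus ?case by (simp add: y_def)
    qed
    moreover have "((\<lambda>t. (t - s) * (2 / pi * arctan (exp (- t)))) \<longlongrightarrow> 0) at_top" by real_asymp
    ultimately show ?thesis by (rule Lim_transform_eventually[rotated])
  qed
  have ramp: "(\<integral>t. max 0 (t - s) \<partial>sech_law 1) = E s" for s
  proof -
    have Q0: "Q t \<ge> 0" for t
    proof -
      have "arctan (tanh (t / 2)) \<le> arctan 1"
        using tanh_real_lt_1[of "t / 2"] by (simp only: arctan_le_iff less_imp_le)
      hence "2 / pi * arctan (tanh (t / 2)) \<le> 2 / pi * (pi / 4)" by (intro mult_left_mono) (auto simp: arctan_one)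
      thus ?thesis by (simp add: Q_def)
    qed
    have E0: "E s \<ge> 0"
    proof (rule tendsto_upperbound[OF lim])
      show "\<forall>\<^sub>F x in at_top. E x \<le> E s"
        using eventually_ge_at_top[of s]
      proof eventually_elim
        case (elim x)
        show ?case by (rule DERIV_nonpos_imp_nonincreasing[OF elim]) (use dE Q0 in force)
      qed
    qed simp
    have "(\<integral>\<^sup>+t. ennreal ((t - s) * (1 / (pi * cosh t))) * indicator {s..} t \<partial>lborel) = ennreal (0 - (- E s))"
    \<comment> \<open>Two integrations by parts: \<open>-(t - s) Q t - E t\<close> is a primitive of
      \<open>t - s\<close> times the density.\<close>
    proof (rule nn_integral_FTC_atLeast[where F = "\<lambda>t. - ((t - s) * Q t) - E t", THEN trans])
      show "((\<lambda>t. - ((t - s) * Q t) - E t) \<longlongrightarrow> 0) at_top"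
        using tendsto_diff[OF tendsto_minus[OF Qlim[of s]] lim] by simp
      show "DERIV (\<lambda>t. - ((t - s) * Q t) - E t) t :> (t - s) * (1 / (pi * cosh t))" for t
        using dQ[of t] dE[of t] by (auto intro!: derivative_eq_intros simp: algebra_simps diff_divide_distrib)
    qed auto
    moreover have "(\<integral>t. max 0 (t - s) \<partial>sech_law 1) = (\<integral>t. max 0 (t - s) * sech_density 1 t \<partial>lborel)"
      by (rule integral_sech_law) auto
    moreover have "\<dots> = (\<integral>t. ((t - s) * (1 / (pi * cosh t))) * indicator {s..} t \<partial>lborel)"
      by (intro Bochner_Integration.integral_cong[OF refl]) (auto simp: sech_density_1 max_def indicator_def)
    moreover have "\<dots> = E s"
    proof (rule has_bochner_integral_integral_eq, rule has_bochner_integral_nn_integral)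
      have "(\<integral>\<^sup>+t. ennreal ((t - s) * (1 / (pi * cosh t)) * indicator {s..} t) \<partial>lborel) =
         (\<integral>\<^sup>+t. ennreal ((t - s) * (1 / (pi * cosh t))) * indicator {s..} t \<partial>lborel)"
        by (intro nn_integral_cong) (auto simp: indicator_def)
      thus "(\<integral>\<^sup>+t. ennreal ((t - s) * (1 / (pi * cosh t)) * indicator {s..} t) \<partial>lborel) = ennreal (E s)"
        using calculation by simp
    qed (use E0 in \<open>auto simp: indicator_def\<close>)
    ultimately show ?thesis by simp
  qed
  have "(\<integral>t. \<bar>s + t\<bar> \<partial>sech_law 1) = (\<integral>t. \<bar>s + (- t)\<bar> \<partial>sech_law 1)"
    by (rule integral_sech_law_reflect[symmetric]) auto
  also have "\<dots> = (\<integral>t. 2 * max 0 (t - s) - (t - s) \<partial>sech_law 1)"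
    by (intro Bochner_Integration.integral_cong[OF refl]) (auto simp: max_def abs_if)
  also have "\<dots> = 2 * E s + s"
  proof -
    have "integrable (sech_law 1) (\<lambda>t. max 0 (t - s))"
      by (intro integrable_max Bochner_Integration.integrable_diff L.integrable_const integrable_sech_law_ln_exp(4))
    note i = integrable_mult_right[OF this, of 2] Bochner_Integration.integrable_diff[OF integrable_sech_law_ln_exp(4)[of 1] L.integrable_const[of s]]
    have "(\<integral>t. t - s \<partial>sech_law 1) = - s"
      unfolding Bochner_Integration.integral_diff[OF integrable_sech_law_ln_exp(4)[of 1] L.integrable_const[of s]]
      using integral_sech_law_id[of 1] L.prob_space by simp
    thus ?thesis unfolding Bochner_Integration.integral_diff[OF i] integral_mult_right_zero ramp by simp
  qed
  also have "\<dots> = F s" by (simp add: E_def field_simps)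
  finally show "(\<integral>t. ln (1 + cosh s * cosh t) \<partial>sech_law 1) = (\<integral>t. \<bar>s + t\<bar> \<partial>sech_law 1)" by (simp only: F_def)
qed

text \<open>
  With \<open>\<rho> = 2q / (1 + q\<^sup>2)\<close> and \<open>\<bar>q\<bar> = e\<^sup>s\<close> one has \<open>\<bar>\<rho>\<bar> = 1 / cosh s\<close>, and in the
  half-angle variable \<open>sin t = \<plusminus>1 / cosh v\<close>.
\<close>

lemma integral_ln_max_one_sin:
  fixes s \<rho> :: real
  assumes \<rho>: "\<bar>\<rho>\<bar> = 1 / cosh s"
  shows "(\<integral>t. ln (max 1 (1 - \<rho> * sin t)) \<partial>angle_unif) = ((\<integral>t. \<bar>s + t\<bar> \<partial>sech_law 1) - ln (2 * cosh s)) / 2"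
    and "integrable angle_unif (\<lambda>t. ln (max 1 (1 - \<rho> * sin t)))"
proof -
  interpret L: prob_space "sech_law 1" by (rule prob_space_sech_law)
  define f where "f = (\<lambda>\<tau>::real. ln (max 1 (1 - \<rho> * (2 * \<tau> / (1 + \<tau>\<^sup>2)))))"
  have fm: "f \<in> borel_measurable borel" unfolding f_def by measurable
  have r1: "\<bar>\<rho>\<bar> \<le> 1" unfolding \<rho> by (simp add: cosh_real_ge_1)
  \<comment> \<open>The formula needs no exception: if \<open>cos (t / 2) = 0\<close>, then
    \<open>sin t = 0\<close> and the tangent has its default value 0.\<close>
  have sn: "sin t = 2 * tan (t / 2) / (1 + (tan (t / 2))\<^sup>2)" for t :: real
  proof -
    define x where "x = t / 2"
    have t: "t = 2 * x" by (simp add: x_def)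
    show ?thesis
    proof (cases "cos x = 0")
      case True thus ?thesis unfolding x_def[symmetric] unfolding t sin_double by (simp add: tan_def)
    next
      case False
      have "1 + (tan x)\<^sup>2 = 1 / (cos x)\<^sup>2" using False tan_sec[of x] by (simp add: power_inverse inverse_eq_divide power_divide)
      thus ?thesis unfolding x_def[symmetric] unfolding t sin_double using False by (simp add: tan_def power2_eq_square)
    qed
  qed
  have ft: "f (tan (t / 2)) = ln (max 1 (1 - \<rho> * sin t))" for t by (simp only: f_def sn)
  have b: "\<bar>ln (max 1 (1 - \<rho> * w))\<bar> \<le> 1" if "\<bar>w\<bar> \<le> 1" for w :: real
  proof -
    have "\<bar>\<rho> * w\<bar> \<le> 1 * 1" unfolding abs_mult using r1 that by (intro mult_mono) auto
    hence "max 1 (1 - \<rho> * w) \<le> 2" by auto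
    hence "ln (max 1 (1 - \<rho> * w)) \<le> ln 2" by (subst ln_le_cancel_iff) auto
    moreover have "0 \<le> ln (max 1 (1 - \<rho> * w))" by (rule ln_ge_zero) simp
    ultimately show ?thesis using ln_2_less_1 by linarith
  qed
  show ii: "integrable angle_unif (\<lambda>t. ln (max 1 (1 - \<rho> * sin t)))"
    by (rule angle.integrable_const_bound[of _ 1]) (use b in \<open>auto intro!: measurable_compose[OF _ borel_measurable_ln]\<close>)
  have ex: "2 * exp v / (1 + (exp v)\<^sup>2) = 1 / cosh v" for v :: real
  proof -
    have "exp v * exp (- v) = 1" by (simp flip: exp_add)
    hence "(1 + (exp v)\<^sup>2) = 2 * exp v * cosh v" by (simp add: cosh_def power2_eq_square algebra_simps)
    thus ?thesis by simp
  qed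
  have fe: "f (exp v) = ln (max 1 (1 - \<rho> * (1 / cosh v)))" "f (- exp v) = ln (max 1 (1 + \<rho> * (1 / cosh v)))" for v
    unfolding f_def ex[of v, symmetric] by simp_all
  have cb: "\<bar>1 / cosh v\<bar> \<le> 1" "\<bar>- (1 / cosh v)\<bar> \<le> 1" for v :: real by (simp_all add: cosh_real_ge_1)
  have i1: "integrable (sech_law (card {0::nat})) (\<lambda>v. f (exp v))"
    by (rule integrable_sech_law[of _ 1 0]) (use b[OF cb(1)] fm in \<open>auto simp: fe(1) intro: measurable_compose[OF _ fm]\<close>)
  have i2: "integrable (sech_law (card {0::nat})) (\<lambda>v. f (- exp v))"
    by (rule integrable_sech_law[of _ 1 0]) (use b[OF cb(2)] fm in \<open>auto simp: fe(2) intro: measurable_compose[OF _ fm]\<close>)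
  have "(\<integral>t. ln (max 1 (1 - \<rho> * sin t)) \<partial>angle_unif) = (\<integral>\<theta>. f (tan (\<theta> (0::nat) / 2)) \<partial>torus {0})"
    using integrable_torus_component(2)[OF _ ii, of "0::nat" "{0}"] by (simp add: ft)
  also have "\<dots> = ((\<integral>v. f (exp v) \<partial>sech_law 1) + (\<integral>v. f (- exp v) \<partial>sech_law 1)) / 2"
    using integral_torus_tan_prod(2)[OF _ _ fm i1 i2] by simp
  also have "\<dots> = (\<integral>v. f (exp v) + f (- exp v) \<partial>sech_law 1) / 2" using i1 i2 by simp
  also have "(\<lambda>v. f (exp v) + f (- exp v)) = (\<lambda>v. ln (1 + cosh s * cosh v) - ln (2 * cosh s) - (ln (2 * cosh v) - 2 * ln 2))"
  proof
    fix v
    have p: "cosh s > 0" "cosh v > 0" "cosh s * cosh v > 0" "1 + cosh s * cosh v > 0" by (auto intro: add_pos_pos)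
    \<comment> \<open>The two values of the sine are opposite, so one of the two maxima is 1 and the
      other is \<open>1 + w\<close>, whatever the sign of \<open>\<rho>\<close>.\<close>
    have "f (exp v) + f (- exp v) = ln (1 + 1 / cosh s * (1 / cosh v))"
    proof -
      define w where "w = 1 / cosh s * (1 / cosh v)"
      have w: "w > 0" using p by (simp add: w_def)
      have "\<rho> * (1 / cosh v) = w \<or> \<rho> * (1 / cosh v) = - w"
      proof (cases "\<rho> \<ge> 0")
        case True
        hence "\<rho> = 1 / cosh s" using \<rho> by simp
        thus ?thesis by (simp add: w_def)
      next
        case False
        hence "\<rho> = - (1 / cosh s)" using \<rho> by simp
        thus ?thesis by (simp add: w_def)
      qed
      thus ?thesis using w unfolding fe w_def[symmetric] by (auto simp: max_def)
    qed
    also have "1 + 1 / cosh s * (1 / cosh v) = (1 + cosh s * cosh v) / (cosh s * cosh v)" using p by (simp add: field_simps)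
    finally show "f (exp v) + f (- exp v) = ln (1 + cosh s * cosh v) - ln (2 * cosh s) - (ln (2 * cosh v) - 2 * ln 2)"
      using p by (simp add: ln_div ln_mult)
  qed
  also have "(\<integral>v. ln (1 + cosh s * cosh v) - ln (2 * cosh s) - (ln (2 * cosh v) - 2 * ln 2) \<partial>sech_law 1) =
     (\<integral>t. \<bar>s + t\<bar> \<partial>sech_law 1) - ln (2 * cosh s)"
  proof -
    have 1: "integrable (sech_law 1) (\<lambda>v. ln (2 * cosh v) - 2 * ln 2)"
      using integral_ln_cosh_centered by (simp only: has_bochner_integral_iff)
    have 2: "(\<integral>t. ln (2 * cosh t) - 2 * ln 2 \<partial>sech_law 1) = 0"
      using integral_ln_cosh_centered by (simp only: has_bochner_integral_iff)
    have 3: "integrable (sech_law 1) (\<lambda>t. ln (1 + cosh s * cosh t))" by (rule integrable_ln_one_plus_cosh_cosh)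
    show ?thesis using 2 L.prob_space
      by (subst Bochner_Integration.integral_diff[OF Bochner_Integration.integrable_diff[OF 3 L.integrable_const] 1],
          subst Bochner_Integration.integral_diff[OF 3 L.integrable_const], subst integral_ln_one_plus_cosh_cosh) simp
  qed
  finally show "(\<integral>t. ln (max 1 (1 - \<rho> * sin t)) \<partial>angle_unif) = ((\<integral>t. \<bar>s + t\<bar> \<partial>sech_law 1) - ln (2 * cosh s)) / 2" .
qed

text \<open>For odd \<open>k\<close> one has \<open>A = i q\<close> with \<open>q\<close> real,
  \<open>|1 - A|^2 = 1 + q^2\<close> and \<open>|1 + A x|^2 = (1 + q^2) (1 - rho sin t)\<close> for
  \<open>rho = 2 q / (1 + q^2)\<close>. The inner mean is therefore \<open>ln (1 + q^2) / 2\<close>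
  plus half the mean of \<open>ln max (1, 1 - rho sin t)\<close>. The latter involves the mean of
  \<open>|s + T|\<close> over a further step \<open>T\<close>, which is how the law of
  \<open>k + 1\<close> steps appears.\<close>

theorem mahler_imaginary_cayley_prod:
  assumes k: "odd k"
  shows "mahler_measure (k + 2) (\<lambda>u. 1 + cayley_prod k u * u (k + 1) + (1 - cayley_prod k u) * u (k + 2)) =
    ((\<integral>s. ln (2 * cosh s) \<partial>sech_law k) + (\<integral>s. \<bar>s\<bar> \<partial>sech_law (k + 1))) / 4"
proof -
  have k1: "k \<ge> 1" using k by (cases k) auto
  define \<sigma> :: real where "\<sigma> = - ((-1) ^ (k div 2))"
  have \<sigma>: "\<sigma> = 1 \<or> \<sigma> = -1" by (cases "even (k div 2)") (auto simp: \<sigma>_def)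
  have A: "(- \<i>) ^ k * of_real p = \<i> * of_real (\<sigma> * p)" for p
  proof -
    have "(- \<i>) ^ k = (- \<i>) ^ (2 * (k div 2) + 1)" using k by simp
    also have "\<dots> = \<i> * of_real \<sigma>" unfolding power_add power_mult \<sigma>_def by simp
    finally show ?thesis by (simp only: of_real_mult mult.assoc)
  qed
  define \<Psi> where "\<Psi> = (\<lambda>s. (\<integral>t. \<bar>s + t\<bar> \<partial>sech_step) - ln (2 * cosh s))"
  define \<phi> where "\<phi> = (\<lambda>\<tau>::real. ln (1 + \<tau>\<^sup>2) / 2 + \<Psi> (ln \<bar>\<tau>\<bar>) / 4)"
  have absb: "\<bar>\<bar>s\<bar>\<bar> \<le> 1 * (1 + \<bar>s\<bar>) ^ 1" for s :: real by simp
  have lcb: "\<bar>ln (2 * cosh s)\<bar> \<le> 1 * (1 + \<bar>s\<bar>) ^ 1" for s :: real using ln_two_cosh_bound[of s] by auto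
  have mi: "integrable (sech_law k) (\<lambda>s. \<integral>t. \<bar>s + t\<bar> \<partial>sech_step)"
    by (rule sech_law_Suc_integral(2)[OF _ absb]) simp
  have ci: "integrable (sech_law k) (\<lambda>s. ln (2 * cosh s))" by (rule integrable_sech_law[OF _ lcb]) measurable
  have \<Psi>i: "integrable (sech_law k) \<Psi>" unfolding \<Psi>_def by (rule Bochner_Integration.integrable_diff[OF mi ci])
  have \<Psi>m [measurable]: "\<Psi> \<in> borel_measurable borel" using borel_measurable_integrable[OF \<Psi>i] by simp
  have \<phi>m: "\<phi> \<in> borel_measurable borel" unfolding \<phi>_def by measurable
  have \<phi>e: "(\<lambda>s. \<phi> (exp s)) = (\<lambda>s. ln (1 + (exp s)\<^sup>2) / 2 + \<Psi> s / 4)" "(\<lambda>s. \<phi> (- exp s)) = (\<lambda>s. ln (1 + (exp s)\<^sup>2) / 2 + \<Psi> s / 4)"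
    by (auto simp: \<phi>_def)
  have \<phi>law: "integrable (sech_law k) (\<lambda>s. ln (1 + (exp s)\<^sup>2) / 2 + \<Psi> s / 4)"
    using integrable_sech_law_ln_exp(3)[of k] \<Psi>i by simp
  have "mahler_measure (k + 2) (\<lambda>u. 1 + cayley_prod k u * u (k + 1) + (1 - cayley_prod k u) * u (k + 2)) =
    ((\<integral>s. \<phi> (exp s) \<partial>sech_law k) + (\<integral>s. \<phi> (- exp s) \<partial>sech_law k)) / 2"
  proof (rule mahler_triangle_reduction[OF k1 \<phi>m])
    show "integrable (sech_law k) (\<lambda>s. \<phi> (exp s))" "integrable (sech_law k) (\<lambda>s. \<phi> (- exp s))"
      unfolding \<phi>e by (rule \<phi>law)+
    fix p :: real assume p0: "p \<noteq> 0"
    define q where "q = \<sigma> * p"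
    have q0: "q \<noteq> 0" using p0 \<sigma> by (auto simp: q_def)
    define g where "g = (\<lambda>t. ln (max (cmod (1 + \<i> * of_real q * cis t)) (cmod (1 - \<i> * of_real q))))"
    define s where "s = ln \<bar>q\<bar>"
    define \<rho> where "\<rho> = 2 * q / (1 + q\<^sup>2)"
    have q: "\<bar>q\<bar> = exp s" using q0 by (simp add: s_def)
    have q2: "q\<^sup>2 = (exp s)\<^sup>2" using q by (metis power2_abs)
    have p: "1 + q\<^sup>2 > 0" by (simp add: add_pos_nonneg)
    have \<rho>: "\<bar>\<rho>\<bar> = 1 / cosh s"
    proof -
      have "exp s * exp (- s) = 1" by (simp flip: exp_add)
      hence "1 + q\<^sup>2 = 2 * exp s * cosh s" unfolding q2 by (simp add: cosh_def power2_eq_square algebra_simps)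
      thus ?thesis unfolding \<rho>_def abs_divide abs_mult q by simp
    qed
    have c1: "cmod (1 - \<i> * of_real q) = sqrt (1 + q\<^sup>2)" by (simp add: cmod_def)
    have c2: "cmod (1 + \<i> * of_real q * cis t) = sqrt ((1 + q\<^sup>2) * (1 - \<rho> * sin t))" for t
    proof -
      have "(1 - q * sin t)\<^sup>2 + (q * cos t)\<^sup>2 = 1 - 2 * q * sin t + q\<^sup>2 * ((sin t)\<^sup>2 + (cos t)\<^sup>2)"
        unfolding power2_eq_square distrib_left by (simp add: algebra_simps del: sin_cos_squared_add3)
      also have "\<dots> = (1 + q\<^sup>2) * (1 - \<rho> * sin t)" using p by (simp add: \<rho>_def field_simps)
      finally show ?thesis by (simp add: cmod_def)
    qed
    have g1: "g t = ln (1 + q\<^sup>2) / 2 + ln (max 1 (1 - \<rho> * sin t)) / 2" for t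
    proof -
      have "max (sqrt ((1 + q\<^sup>2) * (1 - \<rho> * sin t))) (sqrt (1 + q\<^sup>2)) = sqrt ((1 + q\<^sup>2) * max 1 (1 - \<rho> * sin t))"
        using p by (auto simp: max_def real_sqrt_le_iff mult_le_cancel_left)
      moreover have "ln (sqrt ((1 + q\<^sup>2) * max 1 (1 - \<rho> * sin t))) = ln (1 + q\<^sup>2) / 2 + ln (max 1 (1 - \<rho> * sin t)) / 2"
        using p by (simp add: ln_sqrt ln_mult add_divide_distrib)
      ultimately show ?thesis unfolding g_def c1 c2 by simp
    qed
    note J = integral_ln_max_one_sin[OF \<rho>]
    note J = integral_ln_max_one_sin[OF \<rho>]
    have gi: "integrable angle_unif g" unfolding g1[abs_def]
      by (intro Bochner_Integration.integrable_add integrable_divide J(2) angle.integrable_const)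
    have gv: "(\<integral>t. g t \<partial>angle_unif) = \<phi> p"
    proof -
      have Qq: "p\<^sup>2 = q\<^sup>2" "\<bar>p\<bar> = \<bar>q\<bar>" using \<sigma> by (auto simp: q_def)
      have "(\<integral>t. g t \<partial>angle_unif) = ln (1 + q\<^sup>2) / 2 + \<Psi> s / 2 / 2"
        unfolding g1 using J angle.prob_space by (simp add: \<Psi>_def sech_law_1 del: One_nat_def)
      thus ?thesis unfolding \<phi>_def Qq s_def by simp
    qed
    have "g t \<ge> 0" for t
      unfolding g1 by (intro add_nonneg_nonneg divide_nonneg_nonneg ln_ge_zero) auto
    hence "(\<integral>t. \<bar>g t\<bar> \<partial>angle_unif) = \<phi> p" using gv by simp
    moreover have "\<phi> p \<le> \<bar>\<phi> p\<bar> + 2 * ln 2" by (rule order_trans[OF abs_ge_self]) simp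
    ultimately have "integrable angle_unif g \<and> (\<integral>t. g t \<partial>angle_unif) = \<phi> p \<and> (\<integral>t. \<bar>g t\<bar> \<partial>angle_unif) \<le> \<bar>\<phi> p\<bar> + 2 * ln 2"
      using gi gv by simp
    thus "integrable angle_unif (\<lambda>t. ln (max (cmod (1 + (- \<i>) ^ k * of_real p * cis t)) (cmod (1 - (- \<i>) ^ k * of_real p)))) \<and>
      (\<integral>t. ln (max (cmod (1 + (- \<i>) ^ k * of_real p * cis t)) (cmod (1 - (- \<i>) ^ k * of_real p))) \<partial>angle_unif) = \<phi> p \<and>
      (\<integral>t. \<bar>ln (max (cmod (1 + (- \<i>) ^ k * of_real p * cis t)) (cmod (1 - (- \<i>) ^ k * of_real p)))\<bar> \<partial>angle_unif) \<le> \<bar>\<phi> p\<bar> + 2 * ln 2"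
      unfolding A g_def q_def .
  qed
  also have "\<dots> = (\<integral>s. ln (1 + (exp s)\<^sup>2) / 2 + \<Psi> s / 4 \<partial>sech_law k)" unfolding \<phi>e by simp
  also have "\<dots> = (\<integral>s. ln (1 + (exp s)\<^sup>2) / 2 \<partial>sech_law k) + (\<integral>s. \<Psi> s \<partial>sech_law k) / 4"
    using integrable_sech_law_ln_exp(3)[of k] \<Psi>i by simp
  also have "(\<integral>s. \<Psi> s \<partial>sech_law k) = (\<integral>s. \<bar>s\<bar> \<partial>sech_law (Suc k)) - (\<integral>s. ln (2 * cosh s) \<partial>sech_law k)"
    unfolding \<Psi>_def using sech_law_Suc_integral(1)[OF _ absb, of k] mi ci by simp
  also have "(\<integral>s. ln (1 + (exp s)\<^sup>2) / 2 \<partial>sech_law k) = (\<integral>s. (ln (2 * cosh s) + s) / 2 \<partial>sech_law k)"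
    by (intro Bochner_Integration.integral_cong[OF refl]) (simp add: ln_two_cosh)
  also have "\<dots> = (\<integral>s. ln (2 * cosh s) \<partial>sech_law k) / 2"
    using ci integrable_sech_law_ln_exp(4)[of k] integral_sech_law_id[OF k1] by simp
  finally show ?thesis by (simp add: field_simps)
qed

section \<open>Double polylogarithms\<close>

text \<open>Twice a partial sum of \<open>g\<close> is the partial sum of
  \<open>g n + g (n + 2)\<close> up to four boundary terms. Meant for sequences in which
  \<open>g (n + 2)\<close> is close to \<open>- g n\<close>.\<close>

lemma summable_antiperiodic:
  fixes g :: "nat \<Rightarrow> complex"
  assumes s: "summable (\<lambda>n. g n + g (n + 2))" and z: "g \<longlonglongrightarrow> 0"
  shows "summable g"
proof -
  have e: "(\<Sum>n<N. g n) = ((\<Sum>n<N. g n + g (n + 2)) + g 0 + g 1 - g N - g (N + 1)) / 2" for N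
    by (induction N) (auto simp: field_simps)
  have "(\<lambda>N. ((\<Sum>n<N. g n + g (n + 2)) + g 0 + g 1 - g N - g (N + 1)) / 2) \<longlonglongrightarrow> ((\<Sum>n. g n + g (n + 2)) + g 0 + g 1 - 0 - 0) / 2"
    by (intro tendsto_intros summable_LIMSEQ s z LIMSEQ_ignore_initial_segment) auto
  hence "g sums (((\<Sum>n. g n + g (n + 2)) + g 0 + g 1 - 0 - 0) / 2)"
    unfolding sums_def e[symmetric] .
  thus ?thesis by (rule sums_summable)
qed

lemma summable_polylog2:
  fixes x y :: complex
  assumes x: "norm x = 1" and y: "norm y = 1" "y\<^sup>2 = -1" and s: "s \<ge> 1"
  shows "summable (\<lambda>k2. \<Sum>k1=1..<k2. (x ^ k1 * y ^ k2) / (of_nat k1 ^ 3 * of_nat k2 ^ s))"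
proof -
  define c where "c = (\<lambda>n. \<Sum>k=1..<n. x ^ k / of_nat k ^ 3)"
  define a where "a = (\<lambda>n. inverse (real n ^ s))"
  define B where "B = (\<Sum>n. inverse (real n ^ 3))"
  define g where "g = (\<lambda>n. y ^ n * (c n * of_real (a n)))"
  have s3: "summable (\<lambda>n. inverse (real n ^ 3))" by (rule inverse_power_summable) simp
  have cB: "norm (c n) \<le> B" for n
  proof -
    have "norm (c n) \<le> (\<Sum>k=1..<n. inverse (real k ^ 3))" unfolding c_def
      by (rule order_trans[OF norm_sum]) (simp add: norm_divide norm_power x inverse_eq_divide)
    also have "\<dots> \<le> B" unfolding B_def by (rule sum_le_suminf[OF s3]) auto
    finally show ?thesis .
  qed
  have a0: "a \<longlonglongrightarrow> 0" unfolding a_def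
    using s by (intro tendsto_inverse_0_at_top filterlim_pow_at_top filterlim_real_sequentially) auto
  have dec: "a (Suc n) \<le> a n" if "n \<ge> 1" for n
    unfolding a_def using that by (intro le_imp_inverse_le power_mono) auto
  have dec2: "a (n + 2) \<le> a n" if "n \<ge> 1" for n
    using dec[OF that] dec[of "Suc n"] by simp
  have a1: "0 \<le> a n" "n \<ge> 1 \<Longrightarrow> a n \<le> 1" for n
    unfolding a_def by (auto simp: inverse_le_1_iff)
  have ds: "summable (\<lambda>n. a n - a (n + 2))"
  proof -
    have "summable (\<lambda>n. (a n - a (Suc n)) + (a (Suc n) - a (Suc (Suc n))))"
      by (intro summable_add telescope_summable'[OF a0] telescope_summable'[OF LIMSEQ_Suc[OF a0]])
    thus ?thesis by simp
  qed
  have gb: "norm (g n) \<le> B * a n" for n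
    unfolding g_def using cB[of n] a1(1)[of n] by (simp add: norm_mult norm_power y mult_right_mono)
  have "g \<longlonglongrightarrow> 0"
  proof (rule Lim_null_comparison)
    show "\<forall>\<^sub>F n in sequentially. norm (g n) \<le> B * a n" using gb by simp
    show "(\<lambda>n. B * a n) \<longlonglongrightarrow> 0" using tendsto_mult_left[OF a0, of B] by simp
  qed
  moreover have "summable (\<lambda>n. g n + g (n + 2))"
  proof (rule summable_comparison_test'[where N = 1])
    show "summable (\<lambda>n. B * (a n - a (n + 2)) + 2 * inverse (real n ^ 3))"
      by (intro summable_add summable_mult ds s3)
    fix n :: nat assume n: "n \<ge> 1"
    let ?d = "x ^ n / of_nat n ^ 3 + x ^ (n + 1) / of_nat (n + 1) ^ 3"
    have step: "c (n + 2) = c n + ?d"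
      using n by (simp add: c_def)
    have y2: "y ^ (n + 2) = - (y ^ n)" unfolding power_add y(2) by simp
    have "g n + g (n + 2) = y ^ n * (c n * of_real (a n - a (n + 2)) - ?d * of_real (a (n + 2)))"
      unfolding g_def y2 step by (simp add: algebra_simps)
    hence "norm (g n + g (n + 2)) = norm (c n * of_real (a n - a (n + 2)) - ?d * of_real (a (n + 2)))"
      by (simp add: norm_mult norm_power y)
    also have "\<dots> \<le> norm (c n * of_real (a n - a (n + 2))) + norm (?d * of_real (a (n + 2)))"
      by (rule norm_triangle_ineq4)
    also have "norm (c n * of_real (a n - a (n + 2))) = norm (c n) * (a n - a (n + 2))"
      unfolding norm_mult norm_of_real using dec2[OF n] by simp
    also have "norm (c n) * (a n - a (n + 2)) \<le> B * (a n - a (n + 2))"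
      by (rule mult_right_mono[OF cB]) (use dec2[OF n] in simp)
    also have "norm (?d * of_real (a (n + 2))) \<le> 2 * inverse (real n ^ 3)"
    proof -
      have "norm (x ^ (n + 1) / of_nat (n + 1) ^ 3) = inverse (real (n + 1) ^ 3)"
        unfolding norm_divide norm_power x norm_of_nat by (simp add: inverse_eq_divide)
      also have "\<dots> \<le> inverse (real n ^ 3)" using n by (intro le_imp_inverse_le power_mono) auto
      finally have 1: "norm (x ^ (n + 1) / of_nat (n + 1) ^ 3) \<le> inverse (real n ^ 3)" .
      have 2: "norm (x ^ n / of_nat n ^ 3) = inverse (real n ^ 3)"
        unfolding norm_divide norm_power x norm_of_nat by (simp add: inverse_eq_divide)
      have 3: "norm ?d \<le> 2 * inverse (real n ^ 3)"
        using norm_triangle_ineq[of "x ^ n / of_nat n ^ 3" "x ^ (n + 1) / of_nat (n + 1) ^ 3"] 1 2 by linarith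
      have "norm (?d * of_real (a (n + 2))) =
        norm ?d * a (n + 2)"
        unfolding norm_mult norm_of_real using a1(1) by simp
      also have "\<dots> \<le> (2 * inverse (real n ^ 3)) * 1" using 3 a1 by (intro mult_mono) auto
      finally show ?thesis by simp
    qed
    finally show "norm (g n + g (n + 2)) \<le> B * (a n - a (n + 2)) + 2 * inverse (real n ^ 3)" by simp
  qed
  ultimately have "summable g" by (rule summable_antiperiodic[rotated])
  also have "g = (\<lambda>k2. \<Sum>k1=1..<k2. (x ^ k1 * y ^ k2) / (of_nat k1 ^ 3 * of_nat k2 ^ s))"
    unfolding g_def c_def a_def sum_distrib_left sum_distrib_right
    by (intro ext sum.cong refl) (simp add: divide_inverse mult_ac)
  finally show ?thesis .
qed

text \<open>The coefficient of \<open>e^(-(2 p + 2) s)\<close> in the product of the series with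
  terms \<open>e^(-(2 k + 1) s) / (2 k + 1)^3\<close> and the alternating series of
  \<open>1 / (2 cosh s)\<close>. It is also what remains of the inner sums of the double
  polylogarithms after cancellation, and so connects the two.\<close>

definition alternating_cubes :: "nat \<Rightarrow> real" where
  "alternating_cubes p = (\<Sum>k\<le>p. (-1) ^ (p - k) / (2 * real k + 1) ^ 3)"

lemma sum_odd_indices:
  fixes F :: "nat \<Rightarrow> complex"
  assumes "\<And>k. F (2 * k) = 0"
  shows "(\<Sum>k=1..<2*p+2. F k) = (\<Sum>k\<le>p. F (2 * k + 1))"
proof (induction p)
  case 0 show ?case by (simp add: numeral_2_eq_2)
next
  case (Suc p)
  have "{1..<2 * Suc p + 2} = insert (2 * Suc p + 1) (insert (2 * Suc p) {1..<2 * p + 2})" by auto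
  thus ?case using Suc.IH assms[of "Suc p"] by (simp add: add.commute)
qed

text \<open>The four terms combine to the product of \<open>i^k1 - (-i)^k1\<close>, which vanishes
  for even \<open>k1\<close>, and \<open>i^k2 + (-i)^k2\<close>, which vanishes for odd
  \<open>k2\<close>. For \<open>k1 = 2 k + 1\<close> and \<open>k2 = 2 p + 2\<close> the factors
  \<open>2 i\<close>, \<open>2 i\<close> and \<open>-2\<close> multiply to 8, with the sign
  \<open>(-1)^(p - k)\<close>.\<close>

lemma L_script_alternating:
  assumes s: "s \<ge> 1"
  shows "\<i> * L_script 3 s \<i> = of_real (8 * (\<Sum>p. alternating_cubes p / real (2 * p + 2) ^ s))"
    and "summable (\<lambda>p. alternating_cubes p / real (2 * p + 2) ^ s)"
proof -
  define t :: "complex \<Rightarrow> complex \<Rightarrow> nat \<Rightarrow> complex" where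
    "t = (\<lambda>x y k2. \<Sum>k1=1..<k2. (x ^ k1 * y ^ k2) / (of_nat k1 ^ 3 * of_nat k2 ^ s))"
  have ts: "summable (t x y)" if "x = \<i> \<or> x = - \<i>" "y = \<i> \<or> y = - \<i>" for x y
    unfolding t_def by (rule summable_polylog2) (use that s in auto)
  define u where "u = (\<lambda>k2. \<i> * (2 * (t \<i> \<i> k2 - t (- \<i>) \<i> k2 + t \<i> (- \<i>) k2 - t (- \<i>) (- \<i>) k2)))"
  have us: "u sums (\<i> * L_script 3 s \<i>)"
    unfolding u_def L_script_def polylog2_def t_def[symmetric]
    using summable_sums[OF ts] by (intro sums_mult sums_diff sums_add) (auto simp: t_def)
  have ue: "u k2 = (\<Sum>k1=1..<k2. 2 * \<i> * ((\<i> ^ k1 - (- \<i>) ^ k1) * (\<i> ^ k2 + (- \<i>) ^ k2)) / (of_nat k1 ^ 3 * of_nat k2 ^ s))" for k2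
    unfolding u_def t_def sum_subtractf[symmetric] sum.distrib[symmetric] sum_distrib_left
    by (intro sum.cong refl) (simp add: algebra_simps add_divide_distrib diff_divide_distrib)
  have uo: "u k2 = 0" if "odd k2" for k2 using that by (simp add: ue power_minus_odd)
  have uv: "u (2 * p + 2) = of_real (8 * (alternating_cubes p / real (2 * p + 2) ^ s))" for p
  proof -
    define F where "F = (\<lambda>k1. 2 * \<i> * ((\<i> ^ k1 - (- \<i>) ^ k1) * (\<i> ^ (2 * p + 2) + (- \<i>) ^ (2 * p + 2))) / (of_nat k1 ^ 3 * of_nat (2 * p + 2) ^ s))"
    have "u (2 * p + 2) = (\<Sum>k\<le>p. F (2 * k + 1))"
      unfolding ue F_def[symmetric] by (rule sum_odd_indices) (simp add: F_def)
    also have "\<dots> = (\<Sum>k\<le>p. of_real (8 * ((-1) ^ (p - k) / (2 * real k + 1) ^ 3 / real (2 * p + 2) ^ s)))"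
    proof (intro sum.cong refl)
      fix k assume "k \<in> {..p}"
      then obtain d where d: "p = k + d" using le_Suc_ex by auto
      have 1: "\<i> ^ (2 * k + 1) - (- \<i>) ^ (2 * k + 1) = 2 * \<i> * (-1) ^ k"
        unfolding power_add power_mult by simp
      have 2: "\<i> ^ (2 * p + 2) + (- \<i>) ^ (2 * p + 2) = - 2 * (-1) ^ p"
        unfolding power_add power_mult by simp
      have 3: "(-1) ^ k * (-1) ^ p = ((-1) ^ (p - k) :: complex)"
        by (cases "even k"; cases "even d") (simp_all add: d power_add)
      have "2 * \<i> * ((\<i> ^ (2 * k + 1) - (- \<i>) ^ (2 * k + 1)) * (\<i> ^ (2 * p + 2) + (- \<i>) ^ (2 * p + 2))) = 8 * (-1) ^ (p - k)"
        unfolding 1 2 3[symmetric] by simp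
      thus "F (2 * k + 1) = of_real (8 * ((-1) ^ (p - k) / (2 * real k + 1) ^ 3 / real (2 * p + 2) ^ s))"
        unfolding F_def by (simp add: add.commute)
    qed
    also have "\<dots> = of_real (8 * (alternating_cubes p / real (2 * p + 2) ^ s))"
      unfolding alternating_cubes_def sum_divide_distrib sum_distrib_left by simp
    finally show ?thesis .
  qed
  \<comment> \<open>Besides the odd indices only \<open>k2 = 0\<close> is dropped, where the inner
    sum is empty.\<close>
  have "(\<lambda>p. u (2 * p + 2)) sums (\<i> * L_script 3 s \<i>)"
  proof (subst sums_mono_reindex)
    show "strict_mono (\<lambda>p::nat. 2 * p + 2)" by (auto simp: strict_mono_def)
    show "u k = 0" if "k \<notin> range (\<lambda>p. 2 * p + 2)" for k
    proof (cases "k = 0")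
      case True thus ?thesis by (simp add: ue)
    next
      case False
      have "odd k"
      proof
        assume "even k"
        then obtain j where "k = 2 * j" by auto
        with False have "k = 2 * (j - 1) + 2" by auto
        thus False using that by blast
      qed
      thus ?thesis by (rule uo)
    qed
  qed (rule us)
  hence *: "(\<lambda>p. complex_of_real (8 * (alternating_cubes p / real (2 * p + 2) ^ s))) sums (\<i> * L_script 3 s \<i>)"
    unfolding uv .
  hence **: "(\<lambda>p. 8 * (alternating_cubes p / real (2 * p + 2) ^ s)) sums Re (\<i> * L_script 3 s \<i>)"
    using sums_Re by fastforce
  hence "summable (\<lambda>p. 8 * (alternating_cubes p / real (2 * p + 2) ^ s))" by (rule sums_summable)
  thus sm: "summable (\<lambda>p. alternating_cubes p / real (2 * p + 2) ^ s)" using summable_mult[of _ "1 / 8"] by fastforce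
  have "(\<lambda>p. complex_of_real (8 * (alternating_cubes p / real (2 * p + 2) ^ s))) sums of_real (8 * (\<Sum>p. alternating_cubes p / real (2 * p + 2) ^ s))"
    by (intro sums_of_real sums_mult summable_sums sm)
  thus "\<i> * L_script 3 s \<i> = of_real (8 * (\<Sum>p. alternating_cubes p / real (2 * p + 2) ^ s))"
    using * sums_unique2 by blast
qed

text \<open>By \<open>sech_geometric\<close> a partial sum is half the difference of
  \<open>1 / cosh s\<close> and a remainder of at most the same size. The bound is uniform in
  \<open>n\<close>.\<close>

lemma sum_alternating_exp_bound:
  "\<bar>\<Sum>j<n. (-1) ^ j * exp (- (2 * real j + 1) * s)\<bar> \<le> 1 / cosh s" if "s \<ge> 0"
proof -
  define A where "A = (\<Sum>j<n. (-1) ^ j * exp (- (2 * real j + 1) * s))"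
  define r where "r = (-1) ^ n * (exp (- 2 * real n * s) / cosh s)"
  have "1 / cosh s = 2 * A + r" unfolding A_def r_def by (rule sech_geometric)
  moreover have "\<bar>r\<bar> \<le> 1 / cosh s"
    unfolding r_def using that by (simp add: abs_mult divide_right_mono)
  ultimately show ?thesis unfolding A_def[symmetric] by linarith
qed

text \<open>The triangle \<open>k + j < P\<close> of the Cauchy product is summed along
  \<open>k\<close>, so that the alternating factor enters through its own partial sums, which have a
  bound independent of their length.\<close>

lemma sum_alternating_cubes_exp:
  "(\<Sum>p<P. alternating_cubes p * exp (- (2 * real p + 2) * s)) =
   (\<Sum>k<P. exp (- (2 * real k + 1) * s) / (2 * real k + 1) ^ 3 * (\<Sum>j<P - k. (-1) ^ j * exp (- (2 * real j + 1) * s)))"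
  (is "?l = ?r")
  and alternating_cubes_exp_convolution:
  "alternating_cubes p * exp (- (2 * real p + 2) * s) =
    (\<Sum>k\<le>p. exp (- (2 * real k + 1) * s) / (2 * real k + 1) ^ 3 * ((-1) ^ (p - k) * exp (- (2 * real (p - k) + 1) * s)))"
proof -
  have e: "alternating_cubes p * exp (- (2 * real p + 2) * s) =
    (\<Sum>k\<le>p. exp (- (2 * real k + 1) * s) / (2 * real k + 1) ^ 3 * ((-1) ^ (p - k) * exp (- (2 * real (p - k) + 1) * s)))" for p
    unfolding alternating_cubes_def sum_distrib_right
  proof (intro sum.cong refl)
    fix k assume k: "k \<in> {..p}"
    have "exp (- (2 * real k + 1) * s) * exp (- (2 * real (p - k) + 1) * s) = exp (- (2 * real p + 2) * s)"
      unfolding exp_add[symmetric] using k by (simp add: of_nat_diff algebra_simps)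
    from this[symmetric] show "(-1) ^ (p - k) / (2 * real k + 1) ^ 3 * exp (- (2 * real p + 2) * s) =
      exp (- (2 * real k + 1) * s) / (2 * real k + 1) ^ 3 * ((-1) ^ (p - k) * exp (- (2 * real (p - k) + 1) * s))"
      by (simp only:) simp
  qed
  show "alternating_cubes p * exp (- (2 * real p + 2) * s) =
    (\<Sum>k\<le>p. exp (- (2 * real k + 1) * s) / (2 * real k + 1) ^ 3 * ((-1) ^ (p - k) * exp (- (2 * real (p - k) + 1) * s)))" by (rule e)
  let ?g = "\<lambda>k j. exp (- (2 * real k + 1) * s) / (2 * real k + 1) ^ 3 * ((-1) ^ j * exp (- (2 * real j + 1) * s))"
  have "?l = (\<Sum>(i, j)\<in>{(i, j). i + j < P}. ?g i j)"
    unfolding e by (rule sum.triangle_reindex[symmetric])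
  also have "{(i, j). i + j < P} = Sigma {..<P} (\<lambda>i. {..<P - i})" by auto
  also have "(\<Sum>(i, j)\<in>Sigma {..<P} (\<lambda>i. {..<P - i}). ?g i j) = ?r"
    by (subst sum.Sigma[symmetric]) (auto simp: sum_distrib_left)
  finally show "?l = ?r" .
qed

text \<open>For \<open>m = 0\<close> the series converges only conditionally, so the exchange with
  the integral is carried out on partial sums: these are dominated by \<open>2 C e^(-s)\<close>,
  with \<open>C\<close> the sum of the inverse odd cubes, and they converge for \<open>s > 0\<close>
  by the Cauchy product.\<close>

lemma alternating_cubes_sums:
  "(\<lambda>p. fact m * alternating_cubes p / real (2 * p + 2) ^ (m + 1)) sums
    (pi\<^sup>2 / 8 * (\<integral>s. indicator {0..} s *\<^sub>R (s ^ m / cosh s * odd_trilog s) \<partial>lborel))"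
proof -
  define T where "T = (\<lambda>P s. \<Sum>p<P. alternating_cubes p * exp (- (2 * real p + 2) * s))"
  define C where "C = (\<Sum>k. 1 / (2 * real k + 1) ^ 3)"
  have sc: "summable (\<lambda>k. 1 / (2 * real k + 1) ^ 3)" by (rule summable_odd_cubes)
  define f where "f = (\<lambda>P s. indicator {0..} s *\<^sub>R (s ^ m * T P s))"
  define l where "l = (\<lambda>s. pi\<^sup>2 / 8 * (indicator {0..} s *\<^sub>R (s ^ m / cosh s * odd_trilog s)))"
  define w where "w = (\<lambda>s::real. 2 * C * (indicator {0..} s *\<^sub>R (s ^ m * exp (- 1 * s))))"
  have wi: "integrable lborel w" unfolding w_def
    using has_bochner_integral_power_exp[of 1 m] by (intro integrable_mult_right) (simp add: has_bochner_integral_iff)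
  have Tb: "\<bar>T P s\<bar> \<le> 2 * C * exp (- s)" if "s \<ge> 0" for P s
  proof -
    have "\<bar>T P s\<bar> \<le> (\<Sum>k<P. \<bar>exp (- (2 * real k + 1) * s) / (2 * real k + 1) ^ 3 * (\<Sum>j<P - k. (-1) ^ j * exp (- (2 * real j + 1) * s))\<bar>)"
      unfolding T_def sum_alternating_cubes_exp by (rule sum_abs)
    also have "\<dots> \<le> (\<Sum>k<P. 1 / (2 * real k + 1) ^ 3 * (2 * exp (- s)))"
    proof (rule sum_mono)
      fix k
      have "\<bar>\<Sum>j<P - k. (-1) ^ j * exp (- (2 * real j + 1) * s)\<bar> \<le> 2 * exp (- s)"
        using sum_alternating_exp_bound[OF that, of "P - k"] sech_le_exp[of s] that by simp
      moreover have "exp (- (2 * real k + 1) * s) / (2 * real k + 1) ^ 3 \<le> 1 / (2 * real k + 1) ^ 3"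
        using that by (intro divide_right_mono) (auto simp: mult_nonpos_nonneg)
      ultimately show "\<bar>exp (- (2 * real k + 1) * s) / (2 * real k + 1) ^ 3 * (\<Sum>j<P - k. (-1) ^ j * exp (- (2 * real j + 1) * s))\<bar> \<le> 1 / (2 * real k + 1) ^ 3 * (2 * exp (- s))"
        unfolding abs_mult by (intro mult_mono) (auto simp: abs_of_nonneg)
    qed
    also have "\<dots> = (\<Sum>k<P. 1 / (2 * real k + 1) ^ 3) * (2 * exp (- s))" by (simp only: sum_distrib_right)
    also have "\<dots> \<le> C * (2 * exp (- s))" unfolding C_def by (intro mult_right_mono sum_le_suminf[OF sc]) auto
    finally show ?thesis by simp
  qed
  have Tl: "(\<lambda>P. T P s) \<longlonglongrightarrow> pi\<^sup>2 / 8 * (odd_trilog s / cosh s)" if s: "s > 0" for s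
  proof -
    define b where "b = (\<lambda>k. exp (- (2 * real k + 1) * s) / (2 * real k + 1) ^ 3)"
    define a where "a = (\<lambda>j. (-1) ^ j * exp (- (2 * real j + 1) * s))"
    have bs: "summable (\<lambda>k. norm (b k))"
    proof (rule summable_comparison_test'[OF sc, of 0])
      show "norm (norm (b k)) \<le> 1 / (2 * real k + 1) ^ 3" for k
        unfolding b_def using s by (auto intro!: divide_right_mono simp: mult_nonpos_nonneg)
    qed
    have q: "norm (exp (- 2 * s)) < 1" using s by simp
    have e: "exp (- (2 * real j + 1) * s) = exp (- s) * exp (- 2 * s) ^ j" for j
      by (simp add: exp_of_nat_mult[symmetric] exp_add[symmetric] algebra_simps)
    have as: "summable (\<lambda>j. norm (a j))"
      unfolding a_def e using summable_mult[OF summable_geometric[OF q], of "exp (- s)"] by (simp add: abs_mult)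
    have av: "a sums (1 / (2 * cosh s))"
    proof -
      have "(\<lambda>n. (1 / cosh s - (-1) ^ n * (exp (- 2 * real n * s) / cosh s)) / 2) \<longlonglongrightarrow> (1 / cosh s - 0) / 2"
      proof (intro tendsto_intros)
        have "(\<lambda>n. exp (- 2 * real n * s)) \<longlonglongrightarrow> 0" using s by real_asymp
        hence "(\<lambda>n. exp (- 2 * real n * s) / cosh s) \<longlonglongrightarrow> 0 / cosh s" by (intro tendsto_divide) auto
        thus "(\<lambda>n. (-1) ^ n * (exp (- 2 * real n * s) / cosh s)) \<longlonglongrightarrow> 0"
          by (intro tendsto_norm_zero_cancel[of "\<lambda>n. (-1) ^ n * (exp (- 2 * real n * s) / cosh s)"]) (simp add: abs_mult)
      qed auto
      moreover have "(\<Sum>j<n. a j) = (1 / cosh s - (-1) ^ n * (exp (- 2 * real n * s) / cosh s)) / 2" for n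
        using sech_geometric[of s n] unfolding a_def by simp
      ultimately have "(\<lambda>n. \<Sum>j<n. a j) \<longlonglongrightarrow> (1 / cosh s - 0) / 2" by (simp only:)
      thus ?thesis unfolding sums_def by (simp add: mult.commute)
    qed
    have bv: "suminf b = pi\<^sup>2 / 4 * odd_trilog s"
      unfolding odd_trilog_def b_def[symmetric] using suminf_mult[OF summable_norm_cancel[OF bs], of "4 / pi\<^sup>2"] s
      by (simp add: b_def)
    have "(\<lambda>p. \<Sum>k\<le>p. b k * a (p - k)) sums (suminf b * suminf a)"
      by (rule Cauchy_product_sums[OF bs as])
    hence "(\<lambda>p. alternating_cubes p * exp (- (2 * real p + 2) * s)) sums (suminf b * suminf a)"
      unfolding alternating_cubes_exp_convolution a_def b_def .
    hence "(\<lambda>P. T P s) \<longlonglongrightarrow> suminf b * suminf a" unfolding sums_def T_def .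
    also have "suminf b * suminf a = pi\<^sup>2 / 8 * (odd_trilog s / cosh s)"
      unfolding bv using av by (simp add: sums_iff)
    finally show ?thesis .
  qed
  have fm: "f P \<in> borel_measurable lborel" for P unfolding f_def T_def by measurable
  have lm: "l \<in> borel_measurable lborel" unfolding l_def by measurable
  have conv: "(\<lambda>P. \<integral>s. f P s \<partial>lborel) \<longlonglongrightarrow> (\<integral>s. l s \<partial>lborel)"
  proof (rule integral_dominated_convergence[OF lm fm wi])
    have "AE s in lborel. s \<noteq> (0::real)" by (rule AE_lborel_singleton)
    thus "AE s in lborel. (\<lambda>P. f P s) \<longlonglongrightarrow> l s"
    proof eventually_elim
      case (elim s)
      show ?case
      proof (cases "s > 0")
        case True
        have "(\<lambda>P. s ^ m * T P s) \<longlonglongrightarrow> s ^ m * (pi\<^sup>2 / 8 * (odd_trilog s / cosh s))" by (intro tendsto_intros Tl True)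
        thus ?thesis using True by (simp add: f_def l_def mult.left_commute)
      next
        case False thus ?thesis using elim by (simp add: f_def l_def)
      qed
    qed
    show "AE s in lborel. norm (f P s) \<le> w s" for P
    proof (rule AE_I2)
      fix s show "norm (f P s) \<le> w s"
      proof (cases "s \<ge> 0")
        case True
        have "s ^ m * \<bar>T P s\<bar> \<le> s ^ m * (2 * C * exp (- s))" using True by (intro mult_left_mono Tb) auto
        thus ?thesis using True by (simp add: f_def w_def abs_mult mult_ac)
      qed (simp add: f_def w_def)
    qed
  qed
  have fv: "(\<integral>s. f P s \<partial>lborel) = (\<Sum>p<P. fact m * alternating_cubes p / real (2 * p + 2) ^ (m + 1))" for P
  proof -
    have "has_bochner_integral lborel (\<lambda>s. \<Sum>p<P. alternating_cubes p * (indicator {0..} s *\<^sub>R (s ^ m * exp (- (2 * real p + 2) * s))))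
       (\<Sum>p<P. alternating_cubes p * (fact m / (2 * real p + 2) ^ (m + 1)))"
      by (intro has_bochner_integral_sum has_bochner_integral_mult_right has_bochner_integral_power_exp) (simp add: add_nonneg_pos)
    moreover have "(\<lambda>s. \<Sum>p<P. alternating_cubes p * (indicator {0..} s *\<^sub>R (s ^ m * exp (- (2 * real p + 2) * s)))) = f P"
      unfolding f_def T_def sum_distrib_left scaleR_sum_right by (intro ext sum.cong refl) simp
    ultimately show ?thesis by (simp add: has_bochner_integral_iff mult.commute add.commute)
  qed
  have "(\<integral>s. l s \<partial>lborel) = pi\<^sup>2 / 8 * (\<integral>s. indicator {0..} s *\<^sub>R (s ^ m / cosh s * odd_trilog s) \<partial>lborel)"
    unfolding l_def by (rule integral_mult_right_zero)
  thus ?thesis using conv unfolding fv sums_def by (simp only:)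
qed

lemma integral_odd_trilog_sech:
  "of_real (pi\<^sup>2 * (\<integral>s. indicator {0..} s *\<^sub>R (s ^ (2 * h) / cosh s * odd_trilog s) \<partial>lborel)) = \<i> * fact (2 * h) * L_script 3 (2 * h + 1) \<i>"
proof -
  let ?K = "\<integral>s. indicator {0..} s *\<^sub>R (s ^ (2 * h) / cosh s * odd_trilog s) \<partial>lborel"
  note L = L_script_alternating[of "2 * h + 1"]
  have "(\<lambda>p. fact (2 * h) * (alternating_cubes p / real (2 * p + 2) ^ (2 * h + 1))) sums (pi\<^sup>2 / 8 * ?K)"
    using alternating_cubes_sums[of "2 * h"] by (simp only: times_divide_eq_right)
  moreover have "(\<lambda>p. fact (2 * h) * (alternating_cubes p / real (2 * p + 2) ^ (2 * h + 1))) sums (fact (2 * h) * (\<Sum>p. alternating_cubes p / real (2 * p + 2) ^ (2 * h + 1)))"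
    by (intro sums_mult summable_sums L(2)) simp
  ultimately have "pi\<^sup>2 / 8 * ?K = fact (2 * h) * (\<Sum>p. alternating_cubes p / real (2 * p + 2) ^ (2 * h + 1))"
    by (rule sums_unique2)
  hence "pi\<^sup>2 * ?K = fact (2 * h) * (8 * (\<Sum>p. alternating_cubes p / real (2 * p + 2) ^ (2 * h + 1)))" by simp
  hence "complex_of_real (pi\<^sup>2 * ?K) = fact (2 * h) * of_real (8 * (\<Sum>p. alternating_cubes p / real (2 * p + 2) ^ (2 * h + 1)))" by simp
  also have "\<dots> = fact (2 * h) * (\<i> * L_script 3 (2 * h + 1) \<i>)" using L(1) by simp
  finally show ?thesis by (simp only: mult_ac)
qed

section \<open>Bernoulli numbers and difference operators\<close>

text \<open>
  A polynomial of degree at most \<open>M\<close> is encoded by the sequence \<open>Q\<close> of its derivatives at \<open>0\<close>: it is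
  \<open>egf M Q\<close>. Then \<open>contract M f Q\<close> encodes the image of this polynomial under the operator \<open>f(D)\<close>.
\<close>

definition contract :: "nat \<Rightarrow> real fps \<Rightarrow> (nat \<Rightarrow> real) \<Rightarrow> nat \<Rightarrow> real" where
  "contract M f Q m = (\<Sum>k\<le>M. fps_nth f k * Q (m + k))"

definition egf :: "nat \<Rightarrow> (nat \<Rightarrow> real) \<Rightarrow> real \<Rightarrow> real" where
  "egf M Q y = (\<Sum>m\<le>M. Q m / fact m * y ^ m)"

lemma contract_add: "contract M (f + g) Q m = contract M f Q m + contract M g Q m"
  by (simp add: contract_def sum.distrib algebra_simps)

lemma contract_diff: "contract M (f - g) Q m = contract M f Q m - contract M g Q m"
  by (simp add: contract_def sum_subtractf algebra_simps)

lemma contract_one: "contract M 1 Q m = Q m"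
  by (simp add: contract_def sum.delta if_distrib[of "\<lambda>x. x * _"] cong: if_cong)

lemma contract_outside: "(\<And>m. m > M \<Longrightarrow> Q m = 0) \<Longrightarrow> m > M \<Longrightarrow> contract M f Q m = 0"
  by (simp add: contract_def)

lemma contract_X:
  assumes "\<And>m. m > M \<Longrightarrow> Q m = 0"
  shows "contract M fps_X Q m = Q (m + 1)"
proof -
  have "contract M fps_X Q m = (\<Sum>k\<le>M. if k = 1 then Q (m + 1) else 0)"
    unfolding contract_def by (intro sum.cong refl) (auto simp: fps_X_def)
  thus ?thesis using assms[of "m + 1"] by (auto simp: sum.delta)
qed

lemma sum_square_triangle:
  fixes F :: "nat \<Rightarrow> nat \<Rightarrow> real"
  assumes "\<And>i j. i + j > M \<Longrightarrow> F i j = 0"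
  shows "(\<Sum>i\<le>M. \<Sum>j\<le>M. F i j) = (\<Sum>N\<le>M. \<Sum>i\<le>N. F i (N - i))"
proof -
  have "(\<Sum>i\<le>M. \<Sum>j\<le>M. F i j) = (\<Sum>(i, j)\<in>{..M} \<times> {..M}. F i j)" by (rule sum.cartesian_product)
  also have "\<dots> = (\<Sum>(i, j)\<in>{(i, j). i + j \<le> M}. F i j)"
    by (rule sum.mono_neutral_right) (auto intro!: assms)
  also have "\<dots> = (\<Sum>N\<le>M. \<Sum>i\<le>N. F i (N - i))" by (rule sum.triangle_reindex_eq)
  finally show ?thesis .
qed

text \<open>Composition of operators, \<open>(f g)(D) = f(D) g(D)\<close>. The truncation at
  \<open>M\<close> does no harm since \<open>Q\<close> vanishes beyond \<open>M\<close>.\<close>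

lemma contract_mult:
  assumes "\<And>m. m > M \<Longrightarrow> Q m = 0"
  shows "contract M (f * g) Q m = contract M f (contract M g Q) m"
proof -
  have "contract M f (contract M g Q) m = (\<Sum>i\<le>M. \<Sum>j\<le>M. fps_nth f i * (fps_nth g j * Q (m + i + j)))"
    by (simp add: contract_def sum_distrib_left)
  also have "\<dots> = (\<Sum>N\<le>M. \<Sum>i\<le>N. fps_nth f i * (fps_nth g (N - i) * Q (m + i + (N - i))))"
    by (rule sum_square_triangle) (simp add: assms)
  also have "\<dots> = contract M (f * g) Q m"
    unfolding contract_def fps_mult_nth sum_distrib_right atLeast0AtMost by (intro sum.cong refl) simp
  finally show ?thesis by simp
qed

text \<open>Taylor's formula: \<open>e^(c D)\<close> is the translation by \<open>c\<close>, a
  finite sum on polynomials.\<close>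

lemma egf_contract_exp:
  assumes "\<And>m. m > M \<Longrightarrow> Q m = 0"
  shows "egf M (contract M (fps_exp c) Q) y = egf M Q (y + c)"
proof -
  have "egf M (contract M (fps_exp c) Q) y = (\<Sum>i\<le>M. \<Sum>j\<le>M. c ^ j / fact j * Q (i + j) / fact i * y ^ i)"
    by (simp add: egf_def contract_def sum_distrib_right sum_divide_distrib)
  also have "\<dots> = (\<Sum>N\<le>M. \<Sum>i\<le>N. c ^ (N - i) / fact (N - i) * Q (i + (N - i)) / fact i * y ^ i)"
    by (rule sum_square_triangle) (simp add: assms)
  also have "\<dots> = egf M Q (y + c)"
    unfolding egf_def binomial_ring sum_distrib_left
    by (intro sum.cong refl) (simp add: binomial_fact mult_ac)
  finally show ?thesis .
qed

lemma egf_inject: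
  assumes "\<And>y. egf M P y = egf M Q y" "m \<le> M"
  shows "P m = Q m"
proof -
  have "\<forall>y. (\<Sum>i\<le>M. P i / fact i * y ^ i) = (\<Sum>i\<le>M. Q i / fact i * y ^ i)"
    using assms(1) by (simp add: egf_def)
  hence "P m / fact m = Q m / fact m" using assms(2) by (simp only: polyfun_eq_coeffs)
  thus ?thesis by simp
qed

lemma egf_add: "egf M (\<lambda>m. P m + Q m) y = egf M P y + egf M Q y"
  by (simp add: egf_def sum.distrib add_divide_distrib algebra_simps)

lemma egf_diff: "egf M (\<lambda>m. P m - Q m) y = egf M P y - egf M Q y"
  by (simp add: egf_def sum_subtractf diff_divide_distrib algebra_simps)

text \<open>The operator \<open>exp (c D) - 1\<close> on polynomials has only the constants in its kernel.\<close>

lemma difference_operator_inverse: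
  assumes c: "c \<noteq> 0" and Q: "\<And>m. m > M \<Longrightarrow> Q m = 0" and W: "\<And>m. m > M \<Longrightarrow> W m = 0"
    and G: "(fps_exp c - 1) * G = K * fps_X"
    and eq: "\<And>y. egf M W (y + c) - egf M W y = egf M (contract M K (\<lambda>m. Q (m + 1))) y"
    and m: "m \<ge> 1"
  shows "W m = contract M G Q m"
proof -
  define d where "d = (\<lambda>m. W m - contract M G Q m)"
  have ds: "d m = 0" if "m > M" for m using that W Q by (simp add: d_def contract_outside)
  have 1: "contract M (fps_exp c - 1) W m = contract M K (\<lambda>m. Q (m + 1)) m" if "m \<le> M" for m
  proof (rule egf_inject[OF _ that])
    fix y
    show "egf M (contract M (fps_exp c - 1) W) y = egf M (contract M K (\<lambda>m. Q (m + 1))) y"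
      unfolding eq[symmetric] contract_diff[abs_def] egf_diff contract_one using W by (subst egf_contract_exp) auto
  qed
  have 2: "contract M (fps_exp c - 1) (contract M G Q) m = contract M K (\<lambda>m. Q (m + 1)) m" for m
  proof -
    have "contract M (fps_exp c - 1) (contract M G Q) m = contract M (K * fps_X) Q m"
      unfolding G[symmetric] by (rule contract_mult[symmetric]) (rule Q)
    also have "\<dots> = contract M K (contract M fps_X Q) m" by (rule contract_mult) (rule Q)
    also have "contract M fps_X Q = (\<lambda>m. Q (m + 1))" by (intro ext contract_X Q)
    finally show ?thesis .
  qed
  have z: "contract M (fps_exp c - 1) d m = 0" if "m \<le> M" for m
  proof -
    have "contract M (fps_exp c - 1) d m = contract M (fps_exp c - 1) W m - contract M (fps_exp c - 1) (contract M G Q) m"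
      unfolding d_def contract_def[of M "fps_exp c - 1"] by (simp only: right_diff_distrib sum_subtractf)
    thus ?thesis using 1[OF that] 2 by simp
  qed
  \<comment> \<open>Downward induction from the top degree: once all higher entries of
    \<open>d\<close> vanish, the operator applied to \<open>d\<close> has at index \<open>m\<close>
    only the term \<open>c d (m + 1)\<close> left.\<close>
  have "d (m + 1) = 0" for m
  proof (induction "M - m" arbitrary: m rule: less_induct)
    case less
    show ?case
    proof (cases "m + 1 \<le> M")
      case True
      have "d (m + k) = 0" if "k \<ge> 2" for k
      proof (cases "m + k \<le> M")
        case True
        thus ?thesis using less[of "m + k - 1"] that by simp
      qed (use ds in simp)
      hence "fps_nth (fps_exp c - 1) k * d (m + k) = (if k = 1 then c * d (m + 1) else 0)" for k
        by (cases "k = 0 \<or> k = 1") (auto simp: numeral_2_eq_2 not_less_eq_eq)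
      hence "contract M (fps_exp c - 1) d m = c * d (m + 1)"
        unfolding contract_def using True by (simp add: sum.delta)
      thus ?thesis using z[of m] True c by simp
    qed (use ds in simp)
  qed
  from this[of "m - 1"] m show ?thesis by (simp add: d_def)
qed

text \<open>The series \<open>c X / (e^(c X) - 1)\<close>, by which \<open>e^(c D) - 1\<close> is
  inverted up to one derivative.\<close>

definition bernoulli_fps :: "real \<Rightarrow> real fps" where
  "bernoulli_fps c = Abs_fps (\<lambda>m. c ^ m * (bernoulli_num m / fact m))"

lemma bernoulli_fps_mult: "(fps_exp c - 1) * bernoulli_fps c = fps_const c * fps_X"
proof -
  have "bernoulli_fps c = fps_compose (Abs_fps (\<lambda>m. bernoulli_num m / fact m)) (fps_const c * fps_X)"
    by (simp add: bernoulli_fps_def fps_compose_linear)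
  moreover have "fps_exp c - 1 = fps_compose (fps_exp 1 - 1) (fps_const c * fps_X)"
    by (simp add: fps_compose_sub_distrib fps_exp_compose_linear)
  ultimately have "(fps_exp c - 1) * bernoulli_fps c = fps_compose ((fps_exp 1 - 1) * Abs_fps (\<lambda>m. bernoulli_num m / fact m)) (fps_const c * fps_X)"
    by (simp add: fps_compose_mult_distrib)
  thus ?thesis unfolding bernoulli_num_egf by (simp add: fps_X_fps_compose_startby0)
qed

section \<open>Difference equations for products over arithmetic progressions\<close>

lemma sum_even_indices:
  fixes F :: "nat \<Rightarrow> real"
  assumes "\<And>k. odd k \<Longrightarrow> F k = 0"
  shows "(\<Sum>k\<le>2 * n. F k) = (\<Sum>l\<le>n. F (2 * l))"
  by (induction n) (simp_all add: assms)

lemma egf_odd_shift: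
  assumes "\<And>k. odd k \<Longrightarrow> Q k = 0"
  shows "egf (2 * n) (\<lambda>m. Q (m + 1)) y = (\<Sum>h=1..n. Q (2 * h) / fact (2 * h - 1) * y ^ (2 * h - 1))"
  unfolding egf_def by (induction n) (simp_all add: assms)

text \<open>For \<open>n >= 1\<close> the monic odd polynomial with zeros
  \<open>0, 2, -2, ..., 2 n - 2, -(2 n - 2)\<close>. At \<open>y = 2 i s / pi\<close> its quadratic
  factors are, up to sign, those of the density of \<open>2 n\<close> steps, so its coefficients are
  the symmetric polynomials of the even squares.\<close>

definition sinh_prod :: "nat \<Rightarrow> real \<Rightarrow> real" where
  "sinh_prod n y = y * (\<Prod>j=1..n-1. y\<^sup>2 - (2 * real j)\<^sup>2)"

lemma sinh_prod_1: "sinh_prod (Suc 0) y = y"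
  by (simp add: sinh_prod_def)

lemma sinh_prod_Suc: "n \<ge> 1 \<Longrightarrow> sinh_prod (Suc n) y = sinh_prod n y * (y\<^sup>2 - (2 * real n)\<^sup>2)"
  by (cases n) (simp_all add: sinh_prod_def del: of_nat_Suc)

lemma sinh_prod_minus: "sinh_prod n (- y) = - sinh_prod n y"
  by (simp add: sinh_prod_def)

lemma sinh_prod_expand:
  assumes n: "n \<ge> 1"
  shows "sinh_prod n y = (\<Sum>h=1..n. (-1) ^ (n - h) * elem_sym (n - h) (even_squares (n - 1)) * y ^ (2 * h - 1))"
proof -
  obtain N where N: "n = Suc N" using n by (cases n) auto
  have "(\<Prod>j=1..N. y\<^sup>2 - (2 * real j)\<^sup>2) = (\<Prod>j=1..N. (-1) * (- y\<^sup>2 + (2 * real j)\<^sup>2))"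
    by (intro prod.cong refl) simp
  also have "\<dots> = (-1) ^ N * (\<Sum>h\<le>N. elem_sym (N - h) (even_squares N) * (- y\<^sup>2) ^ h)"
    unfolding prod.distrib prod_even_squares by simp
  also have "\<dots> = (\<Sum>h\<le>N. (-1) ^ (N - h) * elem_sym (N - h) (even_squares N) * y ^ (2 * h))"
    unfolding sum_distrib_left
  proof (intro sum.cong refl)
    fix h assume h: "h \<in> {..N}"
    have "(- y\<^sup>2) ^ h = (-1) ^ h * y ^ (2 * h)" unfolding power_mult by (rule power_minus)
    moreover have "(-1) ^ N * (-1) ^ h = ((-1) ^ (N - h) :: real)"
      using h by (metis (no_types, lifting) atMost_iff minus_one_power_iff even_add even_diff_nat le_antisym nat_le_linear mult_minus1 mult_1 not_le minus_minus mult_minus_right mult_1_right)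
    ultimately show "(-1) ^ N * (elem_sym (N - h) (even_squares N) * (- y\<^sup>2) ^ h) = (-1) ^ (N - h) * elem_sym (N - h) (even_squares N) * y ^ (2 * h)"
      by (simp add: mult_ac)
  qed
  finally have "sinh_prod n y = (\<Sum>h\<le>N. (-1) ^ (N - h) * elem_sym (N - h) (even_squares N) * y ^ (2 * h + 1))"
    unfolding sinh_prod_def N diff_Suc_1 by (simp add: sum_distrib_left mult_ac)
  also have "\<dots> = (\<Sum>h=1..n. (-1) ^ (n - h) * elem_sym (n - h) (even_squares (n - 1)) * y ^ (2 * h - 1))"
    by (rule sum.reindex_bij_witness[of _ "\<lambda>h. h - 1" Suc]) (auto simp: N)
  finally show ?thesis .
qed

text \<open>\<open>sinh_prod n y\<close> is the product of \<open>y + 2 i\<close> over the integers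
  \<open>|i| < n\<close>, an arithmetic progression of step 2. A shift by 2 drops the factor at one
  end and adds one at the other.\<close>

lemma sinh_prod_shift: "n \<ge> 1 \<Longrightarrow> sinh_prod n (y + 2) * (y + 2 - 2 * real n) = sinh_prod n y * (y + 2 * real n)"
proof (induction n rule: nat_induct_at_least)
  case base show ?case by (simp add: sinh_prod_1 algebra_simps)
next
  case (Suc n)
  have "sinh_prod (Suc n) (y + 2) * (y + 2 - 2 * real (Suc n)) =
    (sinh_prod n (y + 2) * (y + 2 - 2 * real n)) * ((y + 2 + 2 * real n) * (y - 2 * real n))"
    by (simp add: sinh_prod_Suc[OF Suc(1)] power2_eq_square algebra_simps)
  also have "\<dots> = sinh_prod (Suc n) y * (y + 2 * real (Suc n))"
    unfolding Suc.IH by (simp add: sinh_prod_Suc[OF Suc(1)] power2_eq_square algebra_simps)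
  finally show ?case .
qed

text \<open>The same progression, lengthened at both ends and then shifted: compared with
  \<open>sinh_prod n u\<close> only the two top factors are new.\<close>

lemma sinh_prod_Suc_shift: "n \<ge> 1 \<Longrightarrow> sinh_prod (Suc n) (u + 2) = sinh_prod n u * ((u + 2 * real n) * (u + 2 * real n + 2))"
proof (induction n rule: nat_induct_at_least)
  case base show ?case by (simp add: sinh_prod_1 sinh_prod_Suc power2_eq_square algebra_simps)
next
  case (Suc n)
  have "sinh_prod (Suc (Suc n)) (u + 2) = sinh_prod (Suc n) (u + 2) * ((u - 2 * real n) * (u + 2 * real n + 4))"
    by (simp add: sinh_prod_Suc[of "Suc n"] power2_eq_square algebra_simps)
  also have "\<dots> = sinh_prod (Suc n) u * ((u + 2 * real (Suc n)) * (u + 2 * real (Suc n) + 2))"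
    unfolding Suc.IH by (simp add: sinh_prod_Suc[OF Suc(1)] power2_eq_square algebra_simps)
  finally show ?case .
qed

text \<open>A polynomial solution of \<open>W (y + 4) - W y = 2 sinh_prod n (y + 2)\<close> for
  \<open>n >= 1\<close>. Its weights \<open>1 / (2 j)!\<close> are those of the absolute moment of
  \<open>2 j\<close> steps divided by \<open>2 j\<close>, so that its coefficients are the ones of
  the sum of moments in (iii).\<close>

definition sinh_prod_sum :: "nat \<Rightarrow> real \<Rightarrow> real" where
  "sinh_prod_sum n y = (\<Sum>j=1..n. (-1) ^ (n - j) * (fact (2 * n - 1) / 2 / fact (2 * j)) * (y * sinh_prod j y))"

lemma sinh_prod_sum_Suc:
  assumes "n \<ge> 1"
  shows "sinh_prod_sum (Suc n) y = y * sinh_prod (Suc n) y / (4 * (real n + 1)) - (2 * real n + 1) * (2 * real n) * sinh_prod_sum n y"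
proof -
  have f: "fact (2 * Suc n - 1) = (2 * real n + 1) * (2 * real n) * (fact (2 * n - 1) :: real)"
  proof -
    obtain m where "n = Suc m" using assms by (cases n) auto
    thus ?thesis by (simp add: algebra_simps)
  qed
  have "fact (2 * Suc n - 1) / 2 / (fact (2 * Suc n) :: real) = 1 / (4 * (real n + 1))"
  proof -
    have "(fact (2 * Suc n) :: real) = (2 * (real n + 1)) * fact (2 * Suc n - 1)"
      by (subst fact_reduce) simp_all
    moreover have "F / 2 / ((2 * (real n + 1)) * F) = 1 / (4 * (real n + 1))" if "F > 0" for F :: real
      using that by simp
    ultimately show ?thesis using fact_gt_zero by metis
  qed
  moreover have "(\<Sum>j=1..n. (-1) ^ (Suc n - j) * (fact (2 * Suc n - 1) / 2 / fact (2 * j)) * (y * sinh_prod j y)) = - ((2 * real n + 1) * (2 * real n)) * sinh_prod_sum n y"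
    unfolding sinh_prod_sum_def sum_distrib_left f
    by (intro sum.cong refl) (simp add: Suc_diff_le)
  ultimately show ?thesis by (simp add: sinh_prod_sum_def)
qed

lemma sinh_prod_sum_shift: "n \<ge> 1 \<Longrightarrow> sinh_prod_sum n (y + 4) - sinh_prod_sum n y = 2 * sinh_prod n (y + 2)"
proof (induction n rule: nat_induct_at_least)
  case base show ?case by (simp add: sinh_prod_1 sinh_prod_sum_def field_simps)
next
  case (Suc n)
  \<comment> \<open>Centring at \<open>y + 2\<close> makes the arguments \<open>u + 2\<close> and
    \<open>u - 2\<close>, which oddness relates, so that both products become multiples of
    \<open>p\<close>.\<close>
  define u where "u = y + 2"
  define p where "p = sinh_prod n u"
  define N where "N = real n"
  have y: "y + 4 = u + 2" "y = u - 2" "y + 2 = u" by (auto simp: u_def)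
  have N0: "N + 1 \<noteq> 0" by (simp add: N_def)
  have plus: "sinh_prod (Suc n) (u + 2) = p * ((u + 2 * N) * (u + 2 * N + 2))"
    unfolding p_def N_def by (rule sinh_prod_Suc_shift[OF Suc(1)])
  have minus: "sinh_prod (Suc n) (u - 2) = p * ((u - 2 * N) * (u - 2 * N - 2))"
  proof -
    have "sinh_prod (Suc n) (u - 2) = - sinh_prod (Suc n) (- u + 2)" using sinh_prod_minus[of "Suc n" "- u + 2"] by simp
    also have "\<dots> = - (- p * ((- u + 2 * N) * (- u + 2 * N + 2)))"
      unfolding sinh_prod_Suc_shift[OF Suc(1)] sinh_prod_minus p_def N_def ..
    finally show ?thesis by (simp add: algebra_simps)
  qed
  have IH: "sinh_prod_sum n (u + 2) = sinh_prod_sum n (u - 2) + 2 * p" using Suc.IH unfolding y(1,3) p_def by (simp add: y(2))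
  have "sinh_prod_sum (Suc n) (u + 2) - sinh_prod_sum (Suc n) (u - 2) =
    ((u + 2) * (p * ((u + 2 * N) * (u + 2 * N + 2))) - (u - 2) * (p * ((u - 2 * N) * (u - 2 * N - 2)))) / (4 * (N + 1)) - (2 * N + 1) * (2 * N) * (2 * p)"
  proof -
    have "A / c - k * (S + b) - (B / c - k * S) = (A - B) / c - k * b" for A B c k S b :: real
      by (simp add: algebra_simps diff_divide_distrib)
    thus ?thesis unfolding sinh_prod_sum_Suc[OF Suc(1)] plus minus IH N_def[symmetric] .
  qed
  also have "(u + 2) * (p * ((u + 2 * N) * (u + 2 * N + 2))) - (u - 2) * (p * ((u - 2 * N) * (u - 2 * N - 2))) = (4 * (N + 1)) * (p * (2 * u\<^sup>2 + 4 * N))"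
    by (simp add: power2_eq_square algebra_simps)
  also have "(4 * (N + 1)) * (p * (2 * u\<^sup>2 + 4 * N)) / (4 * (N + 1)) = p * (2 * u\<^sup>2 + 4 * N)" using N0 by simp
  also have "p * (2 * u\<^sup>2 + 4 * N) - (2 * N + 1) * (2 * N) * (2 * p) = 2 * (p * (u\<^sup>2 - (2 * N)\<^sup>2))"
    by (simp add: power2_eq_square algebra_simps)
  finally show ?case unfolding y(1,3) sinh_prod_Suc[OF Suc(1)] p_def N_def by (simp add: u_def)
qed

lemma minus_one_power_split:
  assumes "l + h \<le> (n::nat)" shows "(-1) ^ (n - h - l) = (-1) ^ (n - h) * ((-1) ^ l :: real)"
proof -
  obtain d where "n = l + h + d" using assms le_Suc_ex by blast
  thus ?thesis by (cases "even d"; cases "even l") auto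
qed

text \<open>Brings the factorials that arise from comparing derivatives into the form of the
  binomials in the statement.\<close>

lemma fact_ratio_choose:
  assumes "h \<ge> 1"
  shows "fact (2 * (l + h) - 1) / fact (2 * l) = real ((2 * (l + h)) choose (2 * l)) * fact (2 * h) / (2 * real (l + h))"
proof -
  have "(fact (2 * (l + h)) :: real) = real (2 * (l + h)) * fact (2 * (l + h) - 1)"
    by (rule fact_reduce) (use assms in simp)
  moreover have "real ((2 * (l + h)) choose (2 * l)) = fact (2 * (l + h)) / (fact (2 * l) * fact (2 * h))"
    using binomial_fact[of "2 * l" "2 * (l + h)"] by simp
  ultimately show ?thesis using assms by (simp add: field_simps)
qed

context
  fixes n :: nat
  assumes n: "n \<ge> 1"
begin

text \<open>Derivatives at 0 of the primitive of \<open>sinh_prod n\<close> that vanishes at 0.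
  Working with a primitive makes room for the factor \<open>D\<close> in the numerator of
  \<open>c D / (e^(c D) - 1)\<close>.\<close>

definition "sinh_prod_primitive m =
  (if even m \<and> 2 \<le> m \<and> m \<le> 2 * n then fact (m - 1) * (-1) ^ (n - m div 2) * elem_sym (n - m div 2) (even_squares (n - 1)) else 0 :: real)"

lemma sinh_prod_primitive_outside: "m > 2 * n \<Longrightarrow> sinh_prod_primitive m = 0" "odd m \<Longrightarrow> sinh_prod_primitive m = 0"
  by (auto simp: sinh_prod_primitive_def)

lemma sinh_prod_primitive_egf: "egf (2 * n) (\<lambda>m. sinh_prod_primitive (m + 1)) y = sinh_prod n y"
  by (subst egf_odd_shift, erule sinh_prod_primitive_outside(2), subst sinh_prod_expand[OF n], intro sum.cong refl)
     (simp add: sinh_prod_primitive_def)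

lemma contract_sinh_prod_primitive:
  assumes h: "h \<ge> 1" "h \<le> n"
  shows "contract (2 * n) G sinh_prod_primitive (2 * h) =
    (\<Sum>l=0..n-h. fps_nth G (2 * l) * (fact (2 * (l + h) - 1) * (-1) ^ (n - h - l) * elem_sym (n - h - l) (even_squares (n - 1))))"
proof -
  have "contract (2 * n) G sinh_prod_primitive (2 * h) = (\<Sum>l\<le>n. fps_nth G (2 * l) * sinh_prod_primitive (2 * h + 2 * l))"
    unfolding contract_def by (rule sum_even_indices) (simp add: sinh_prod_primitive_def)
  also have "\<dots> = (\<Sum>l=0..n-h. fps_nth G (2 * l) * sinh_prod_primitive (2 * h + 2 * l))"
    by (rule sum.mono_neutral_right) (use h in \<open>auto simp: sinh_prod_primitive_def\<close>)
  also have "\<dots> = (\<Sum>l=0..n-h. fps_nth G (2 * l) * (fact (2 * (l + h) - 1) * (-1) ^ (n - h - l) * elem_sym (n - h - l) (even_squares (n - 1))))"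
  proof (intro sum.cong refl)
    fix l assume "l \<in> {0..n-h}"
    hence l: "l + h \<le> n" using h by auto
    have e: "2 * h + 2 * l = 2 * (l + h)" "2 * (l + h) div 2 = l + h" "n - (l + h) = n - h - l" by auto
    show "fps_nth G (2 * l) * sinh_prod_primitive (2 * h + 2 * l) =
      fps_nth G (2 * l) * (fact (2 * (l + h) - 1) * (-1) ^ (n - h - l) * elem_sym (n - h - l) (even_squares (n - 1)))"
      unfolding sinh_prod_primitive_def e using l h by simp
  qed
  finally show ?thesis .
qed

text \<open>Two solutions of \<open>W (y + 2) - W y = P (y + 2) + P y\<close> with
  \<open>P = sinh_prod n\<close> are compared: the explicit \<open>y P y / (2 n)\<close>, by
  \<open>sinh_prod_shift\<close>, and \<open>D coth D\<close> applied to the primitive of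
  \<open>P\<close>, since \<open>2 X / (e^(2 X) - 1) + X = X coth X\<close>. They agree up to a
  constant, and the derivatives of order \<open>2 h\<close> at 0 give the identity; the Bernoulli
  numbers are the coefficients of \<open>X coth X\<close>.\<close>

lemma elem_sym_even_squares_coth:
  assumes h: "h \<ge> 1" "h \<le> n"
  shows "(\<Sum>l=0..n-h. elem_sym (n-h-l) (even_squares (n-1)) * real ((2*(l+h)) choose (2*h)) * (-1) ^ l
      * (2 ^ (2*l) / real (l+h)) * bernoulli_num (2*l)) = elem_sym (n - h) (even_squares (n - 1)) / real n"
proof -
  define W where "W = (\<lambda>m. if even m \<and> 2 \<le> m \<and> m \<le> 2 * n then fact m * (-1) ^ (n - m div 2) * elem_sym (n - m div 2) (even_squares (n - 1)) / (2 * real n) else 0)"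
  let ?G = "bernoulli_fps 2 + fps_X"
  have We: "egf (2 * n) W y = y * sinh_prod n y / (2 * real n)" for y
  proof -
    have "egf (2 * n) W y = (\<Sum>h\<le>n. W (2 * h) / fact (2 * h) * y ^ (2 * h))"
      unfolding egf_def by (rule sum_even_indices) (simp add: W_def)
    also have "\<dots> = (\<Sum>h=1..n. W (2 * h) / fact (2 * h) * y ^ (2 * h))"
      by (rule sum.mono_neutral_right) (auto simp: W_def)
    also have "\<dots> = y * sinh_prod n y / (2 * real n)"
      unfolding sinh_prod_expand[OF n] sum_distrib_left sum_divide_distrib
    proof (intro sum.cong refl)
      fix h assume "h \<in> {1..n}"
      moreover from this have "y ^ (2 * h) = y * y ^ (2 * h - 1)" by (cases h) auto
      ultimately show "W (2 * h) / fact (2 * h) * y ^ (2 * h) = y * ((-1) ^ (n - h) * elem_sym (n - h) (even_squares (n - 1)) * y ^ (2 * h - 1)) / (2 * real n)"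
        by (simp add: W_def)
    qed
    finally show ?thesis .
  qed
  have "W (2 * h) = contract (2 * n) ?G sinh_prod_primitive (2 * h)"
  proof (rule difference_operator_inverse[where c = 2 and K = "fps_exp 2 + 1"])
    show "(fps_exp 2 - 1) * ?G = (fps_exp 2 + 1) * fps_X"
      unfolding distrib_left bernoulli_fps_mult by (simp add: algebra_simps numeral_fps_const[symmetric] mult_2)
    fix y
    have "egf (2 * n) (contract (2 * n) (fps_exp 2 + 1) (\<lambda>m. sinh_prod_primitive (m + 1))) y = sinh_prod n (y + 2) + sinh_prod n y"
      unfolding contract_add[abs_def] egf_add contract_one sinh_prod_primitive_egf
      by (subst egf_contract_exp) (simp_all add: sinh_prod_primitive_outside sinh_prod_primitive_egf[unfolded add_0_right, simplified])
    also have "\<dots> = egf (2 * n) W (y + 2) - egf (2 * n) W y"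
      unfolding We using sinh_prod_shift[OF n, of y] n by (simp add: field_simps)
    finally show "egf (2 * n) W (y + 2) - egf (2 * n) W y = egf (2 * n) (contract (2 * n) (fps_exp 2 + 1) (\<lambda>m. sinh_prod_primitive (m + 1))) y" ..
  qed (use h in \<open>auto simp: W_def sinh_prod_primitive_outside\<close>)
  also have "\<dots> = (\<Sum>l=0..n-h. fact (2 * h) * (-1) ^ (n - h) / 2 * (elem_sym (n-h-l) (even_squares (n-1)) * real ((2*(l+h)) choose (2*h)) * (-1) ^ l
      * (2 ^ (2*l) / real (l+h)) * bernoulli_num (2*l)))"
    unfolding contract_sinh_prod_primitive[OF h]
  proof (intro sum.cong refl)
    fix l assume "l \<in> {0..n-h}"
    hence l: "l + h \<le> n" using h by auto
    have c: "(2 * (l + h)) choose (2 * l) = (2 * (l + h)) choose (2 * h)"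
      using binomial_symmetric[of "2 * l" "2 * (l + h)"] by simp
    have "fps_nth ?G (2 * l) = 2 ^ (2 * l) * bernoulli_num (2 * l) / fact (2 * l)" by (auto simp: bernoulli_fps_def fps_X_def)
    hence "fps_nth ?G (2 * l) * (fact (2 * (l + h) - 1) * (-1) ^ (n - h - l) * elem_sym (n - h - l) (even_squares (n - 1))) =
      2 ^ (2 * l) * bernoulli_num (2 * l) * (-1) ^ (n - h - l) * elem_sym (n - h - l) (even_squares (n - 1)) * (fact (2 * (l + h) - 1) / fact (2 * l))"
      by simp
    thus "fps_nth ?G (2 * l) * (fact (2 * (l + h) - 1) * (-1) ^ (n - h - l) * elem_sym (n - h - l) (even_squares (n - 1))) =
      fact (2 * h) * (-1) ^ (n - h) / 2 * (elem_sym (n-h-l) (even_squares (n-1)) * real ((2*(l+h)) choose (2*h)) * (-1) ^ l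
      * (2 ^ (2*l) / real (l+h)) * bernoulli_num (2*l))"
      unfolding fact_ratio_choose[OF h(1)] minus_one_power_split[OF l] c by (simp add: mult_ac)
  qed
  finally have E1: "W (2 * h) = fact (2 * h) * (-1) ^ (n - h) / 2 * (\<Sum>l=0..n-h. elem_sym (n-h-l) (even_squares (n-1)) * real ((2*(l+h)) choose (2*h)) * (-1) ^ l
      * (2 ^ (2*l) / real (l+h)) * bernoulli_num (2*l))" (is "_ = _ * ?S")
    by (simp only: sum_distrib_left)
  have E2: "W (2 * h) = fact (2 * h) * (-1) ^ (n - h) / 2 * (elem_sym (n - h) (even_squares (n - 1)) / real n)"
    using h by (simp add: W_def)
  have "fact (2 * h) * (-1) ^ (n - h) / 2 \<noteq> (0::real)" by simp
  from mult_left_cancel[OF this, THEN iffD1, OF trans[OF E1[symmetric] E2]] show ?thesis .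
qed

text \<open>The same comparison for \<open>W (y + 4) - W y = 2 P (y + 2)\<close>: the explicit
  solution is \<open>sinh_prod_sum\<close>, and the operator is \<open>X / sinh (2 X)\<close>,
  written as \<open>2 X / (e^(2 X) - 1) - 2 X / (e^(4 X) - 1)\<close>. The difference of the two
  Bernoulli series is the origin of the factor \<open>2^(2 l - 1) - 1\<close>.\<close>

lemma sum_elem_sym_even_squares_csch:
  assumes h: "h \<ge> 1" "h \<le> n"
  shows "(\<Sum>l=0..n-h. elem_sym (n-h-l) (even_squares (n-1)) * real ((2*(l+h)) choose (2*l)) * (-1) ^ (l+1)
      * (2 ^ (2*l) * (2 powi (2 * int l - 1) - 1) / real (l+h)) * bernoulli_num (2*l)) =
    fact (2 * n - 1) * (\<Sum>j=h..n. elem_sym (j - h) (even_squares (j - 1)) / fact (2 * j))"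
proof -
  define w where "w = (\<lambda>k. fact (2 * n - 1) / 2 * (-1) ^ (n - k) * (\<Sum>j=k..n. elem_sym (j - k) (even_squares (j - 1)) / fact (2 * j)))"
  define W where "W = (\<lambda>m. if even m \<and> 2 \<le> m \<and> m \<le> 2 * n then fact m * w (m div 2) else 0)"
  let ?G = "bernoulli_fps 2 - fps_const (1 / 2) * bernoulli_fps 4"
  have We: "egf (2 * n) W y = sinh_prod_sum n y" for y
  proof -
    have "egf (2 * n) W y = (\<Sum>k\<le>n. W (2 * k) / fact (2 * k) * y ^ (2 * k))"
      unfolding egf_def by (rule sum_even_indices) (simp add: W_def)
    also have "\<dots> = (\<Sum>k=1..n. W (2 * k) / fact (2 * k) * y ^ (2 * k))"
      by (rule sum.mono_neutral_right) (auto simp: W_def)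
    also have "\<dots> = (\<Sum>k=1..n. \<Sum>j=k..n. fact (2 * n - 1) / 2 * (-1) ^ (n - k) * (elem_sym (j - k) (even_squares (j - 1)) / fact (2 * j)) * y ^ (2 * k))"
    proof (intro sum.cong refl)
      fix k assume "k \<in> {1..n}"
      hence "W (2 * k) / fact (2 * k) = w k" by (simp add: W_def)
      thus "W (2 * k) / fact (2 * k) * y ^ (2 * k) = (\<Sum>j=k..n. fact (2 * n - 1) / 2 * (-1) ^ (n - k) * (elem_sym (j - k) (even_squares (j - 1)) / fact (2 * j)) * y ^ (2 * k))"
        by (simp only: w_def sum_distrib_left sum_distrib_right)
    qed
    \<comment> \<open>For fixed \<open>j\<close> the sum over \<open>k\<close> is, up to a factor,
      the expansion of \<open>y sinh_prod j y\<close>.\<close>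
    also have "\<dots> = (\<Sum>j=1..n. \<Sum>k=1..j. fact (2 * n - 1) / 2 * (-1) ^ (n - k) * (elem_sym (j - k) (even_squares (j - 1)) / fact (2 * j)) * y ^ (2 * k))"
      unfolding sum.Sigma[OF finite_atLeastAtMost ballI[OF finite_atLeastAtMost]]
      by (rule sum.reindex_bij_witness[of _ "\<lambda>(j, k). (k, j)" "\<lambda>(k, j). (j, k)"]) auto
    also have "\<dots> = sinh_prod_sum n y"
      unfolding sinh_prod_sum_def
    proof (intro sum.cong refl)
      fix j assume j: "j \<in> {1..n}"
      hence j1: "j \<ge> 1" by simp
      show "(\<Sum>k=1..j. fact (2 * n - 1) / 2 * (-1) ^ (n - k) * (elem_sym (j - k) (even_squares (j - 1)) / fact (2 * j)) * y ^ (2 * k)) =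
        (-1) ^ (n - j) * (fact (2 * n - 1) / 2 / fact (2 * j)) * (y * sinh_prod j y)"
        unfolding sinh_prod_expand[OF j1] sum_distrib_left
      proof (intro sum.cong refl)
        fix k assume k: "k \<in> {1..j}"
        have s: "(-1) ^ (n - k) = (-1) ^ (n - j) * ((-1) ^ (j - k) :: real)"
          unfolding power_add[symmetric] using j k by (intro arg_cong[where f = "\<lambda>i. (-1) ^ i"]) auto
        have y: "y ^ (2 * k) = y * y ^ (2 * k - 1)" using k by (cases k) auto
        show "fact (2 * n - 1) / 2 * (-1) ^ (n - k) * (elem_sym (j - k) (even_squares (j - 1)) / fact (2 * j)) * y ^ (2 * k) =
          (-1) ^ (n - j) * (fact (2 * n - 1) / 2 / fact (2 * j)) * (y * ((-1) ^ (j - k) * elem_sym (j - k) (even_squares (j - 1)) * y ^ (2 * k - 1)))"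
          unfolding s y by simp
      qed
    qed
    finally show ?thesis .
  qed
  have "W (2 * h) = contract (2 * n) ?G sinh_prod_primitive (2 * h)"
  proof (rule difference_operator_inverse[where c = 4 and K = "fps_exp 2 + fps_exp 2"])
    show "(fps_exp 4 - 1) * ?G = (fps_exp 2 + fps_exp 2) * (fps_X :: real fps)"
    proof -
      have e: "fps_exp (4::real) - 1 = (fps_exp 2 + 1) * (fps_exp 2 - 1)"
        using fps_exp_add_mult[of 2 "2::real"] by (simp add: algebra_simps)
      have "(fps_exp 4 - 1) * ?G = (fps_exp 2 + 1) * ((fps_exp 2 - 1) * bernoulli_fps 2) - fps_const (1 / 2) * ((fps_exp 4 - 1) * bernoulli_fps 4)"
        unfolding e by (simp add: algebra_simps)
      also have "\<dots> = (fps_exp 2 + 1) * (fps_const 2 * fps_X) - fps_const (1 / 2) * (fps_const 4 * fps_X)"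
        unfolding bernoulli_fps_mult ..
      also have "fps_const (1 / 2) * (fps_const 4 * fps_X) = fps_const 2 * (fps_X :: real fps)"
        unfolding mult.assoc[symmetric] fps_const_mult by simp
      also have "(fps_exp 2 + 1) * (fps_const 2 * fps_X) - fps_const 2 * fps_X = (fps_exp 2 + fps_exp 2) * (fps_X :: real fps)"
      proof -
        have t: "fps_const 2 * fps_X = fps_X + (fps_X :: real fps)"
          unfolding numeral_fps_const[symmetric] by (rule mult_2)
        show ?thesis unfolding t by (simp add: algebra_simps)
      qed
      finally show ?thesis .
    qed
    fix y
    have "egf (2 * n) (contract (2 * n) (fps_exp 2 + fps_exp 2) (\<lambda>m. sinh_prod_primitive (m + 1))) y = sinh_prod n (y + 2) + sinh_prod n (y + 2)"
      unfolding contract_add[abs_def] egf_add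
      by (subst (1 2) egf_contract_exp) (simp_all add: sinh_prod_primitive_outside sinh_prod_primitive_egf[unfolded add_0_right, simplified])
    also have "\<dots> = egf (2 * n) W (y + 4) - egf (2 * n) W y"
      unfolding We using sinh_prod_sum_shift[OF n, of y] by simp
    finally show "egf (2 * n) W (y + 4) - egf (2 * n) W y = egf (2 * n) (contract (2 * n) (fps_exp 2 + fps_exp 2) (\<lambda>m. sinh_prod_primitive (m + 1))) y" ..
  qed (use h in \<open>auto simp: W_def sinh_prod_primitive_outside\<close>)
  also have "\<dots> = (\<Sum>l=0..n-h. fact (2 * h) * (-1) ^ (n - h) / 2 * (elem_sym (n-h-l) (even_squares (n-1)) * real ((2*(l+h)) choose (2*l)) * (-1) ^ (l+1)
      * (2 ^ (2*l) * (2 powi (2 * int l - 1) - 1) / real (l+h)) * bernoulli_num (2*l)))"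
    unfolding contract_sinh_prod_primitive[OF h]
  proof (intro sum.cong refl)
    fix l assume "l \<in> {0..n-h}"
    hence l: "l + h \<le> n" using h by auto
    \<comment> \<open>The exponent is \<open>-1\<close> at \<open>l = 0\<close>, hence the integer
      power.\<close>
    have "(2::real) powi (2 * int l - 1) = 2 ^ (2 * l) / 2"
    proof -
      have "(2::real) powi (int (2 * l) - 1) = 2 powi int (2 * l) / 2 powi 1" by (rule power_int_diff) simp
      moreover have "(2::real) powi int (2 * l) = 2 ^ (2 * l)" by (rule power_int_of_nat)
      ultimately show ?thesis unfolding power_int_1_right of_nat_mult of_nat_numeral by (simp only:)
    qed
    moreover have "(4::real) ^ (2 * l) = 2 ^ (2 * l) * 2 ^ (2 * l)" by (simp flip: power_mult_distrib)
    ultimately have "fps_nth ?G (2 * l) = - (2 ^ (2 * l) * (2 powi (2 * int l - 1) - 1) * bernoulli_num (2 * l) / fact (2 * l))"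
      by (simp add: bernoulli_fps_def field_simps)
    hence "fps_nth ?G (2 * l) * (fact (2 * (l + h) - 1) * (-1) ^ (n - h - l) * elem_sym (n - h - l) (even_squares (n - 1))) =
      - (2 ^ (2 * l) * (2 powi (2 * int l - 1) - 1) * bernoulli_num (2 * l) * (-1) ^ (n - h - l) * elem_sym (n - h - l) (even_squares (n - 1)) * (fact (2 * (l + h) - 1) / fact (2 * l)))"
      by simp
    thus "fps_nth ?G (2 * l) * (fact (2 * (l + h) - 1) * (-1) ^ (n - h - l) * elem_sym (n - h - l) (even_squares (n - 1))) =
      fact (2 * h) * (-1) ^ (n - h) / 2 * (elem_sym (n-h-l) (even_squares (n-1)) * real ((2*(l+h)) choose (2*l)) * (-1) ^ (l+1)
      * (2 ^ (2*l) * (2 powi (2 * int l - 1) - 1) / real (l+h)) * bernoulli_num (2*l))"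
      unfolding fact_ratio_choose[OF h(1)] minus_one_power_split[OF l] by (simp add: mult_ac)
  qed
  finally have E1: "W (2 * h) = fact (2 * h) * (-1) ^ (n - h) / 2 * (\<Sum>l=0..n-h. elem_sym (n-h-l) (even_squares (n-1)) * real ((2*(l+h)) choose (2*l)) * (-1) ^ (l+1)
      * (2 ^ (2*l) * (2 powi (2 * int l - 1) - 1) / real (l+h)) * bernoulli_num (2*l))" (is "_ = _ * ?S")
    by (simp only: sum_distrib_left)
  have E2: "W (2 * h) = fact (2 * h) * (-1) ^ (n - h) / 2 * (fact (2 * n - 1) * (\<Sum>j=h..n. elem_sym (j - h) (even_squares (j - 1)) / fact (2 * j)))"
    using h by (simp add: W_def w_def)
  have "fact (2 * h) * (-1) ^ (n - h) / 2 \<noteq> (0::real)" by simp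
  from mult_left_cancel[OF this, THEN iffD1, OF trans[OF E1[symmetric] E2]] show ?thesis .
qed

end

section \<open>The six identities\<close>

definition abs_moment :: "nat \<Rightarrow> real" where
  "abs_moment k = (\<integral>s. \<bar>s\<bar> \<partial>sech_law k)"

lemma pi_power_diff: "h \<le> n \<Longrightarrow> pi ^ (2 * n) / pi ^ (2 * h) = pi ^ (2 * n - 2 * h)"
  by (simp add: power_diff)

lemma integral_positive_part_sech_law:
  assumes "k \<ge> 1" shows "(\<integral>s. max 0 s \<partial>sech_law k) = abs_moment k / 2"
proof -
  have "(\<integral>s. max 0 s \<partial>sech_law k) = (\<integral>s. (\<bar>s\<bar> + s) / 2 \<partial>sech_law k)"
    by (intro Bochner_Integration.integral_cong[OF refl]) auto
  also have "\<dots> = abs_moment k / 2"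
    using integrable_sech_law_ln_exp(4)[of k] integral_sech_law_id[OF assms]
    by (simp add: abs_moment_def)
  finally show ?thesis .
qed

lemma abs_moment_even:
  assumes n: "n \<ge> 1"
  shows "abs_moment (2 * n) = 1 / fact (2 * n - 1) * (\<Sum>h=1..n. elem_sym (n - h) (even_squares (n - 1)) *
    (fact (2 * h) * (2 ^ (2 * h + 1) - 1) / pi ^ (2 * h) * zeta_nat (2 * h + 1)))"
proof -
  have "abs_moment (2 * n) = (\<integral>s. \<bar>s\<bar> ^ 1 \<partial>sech_law (2 * n))" by (simp add: abs_moment_def)
  also have "\<dots> = 1 / fact (2 * n - 1) * (\<Sum>h=1..n. elem_sym (n - h) (even_squares (n - 1)) *
    (fact (2 * h) * (2 ^ (2 * h + 1) - 1) / pi ^ (2 * h) * zeta_nat (2 * h + 1)))"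
    unfolding integral_abs_power_even[OF n odd_one]
  proof (rule arg_cong2[where f = "(*)", OF refl], rule sum.cong[OF refl])
    fix h assume "h \<in> {1..n}"
    hence e: "2 * h - 1 + 1 = 2 * h" by simp
    have "(2 / pi) ^ (2 * h) * (2 * F * (1 - 1 / 2 ^ (2 * h + 1)) * Z) = F * (2 ^ (2 * h + 1) - 1) / pi ^ (2 * h) * Z" for F Z :: real
      by (simp add: power_divide field_simps)
    thus "elem_sym (n - h) (even_squares (n - 1)) * (2 / pi) ^ (2 * h) * (2 * fact (2 * h - 1 + 1) * (1 - 1 / 2 ^ (2 * h + 1)) * zeta_nat (2 * h + 1)) =
      elem_sym (n - h) (even_squares (n - 1)) * (fact (2 * h) * (2 ^ (2 * h + 1) - 1) / pi ^ (2 * h) * zeta_nat (2 * h + 1))"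
      unfolding e by (simp only: mult.assoc)
  qed
  finally show ?thesis .
qed

lemma abs_cube_moment_even:
  assumes n: "n \<ge> 1"
  shows "(\<integral>s. \<bar>s\<bar> ^ 3 \<partial>sech_law (2 * n)) = 1 / fact (2 * n - 1) * (\<Sum>h=1..n. elem_sym (n - h) (even_squares (n - 1)) *
    (fact (2 * h + 2) * (2 ^ (2 * h + 3) - 1) / (4 * pi ^ (2 * h)) * zeta_nat (2 * h + 3)))"
proof -
  have "odd (3::nat)" by simp
  note M = integral_abs_power_even[OF n this]
  show ?thesis unfolding M
  proof (rule arg_cong2[where f = "(*)", OF refl], rule sum.cong[OF refl])
    fix h assume "h \<in> {1..n}"
    hence e: "2 * h - 1 + 3 = 2 * h + 2" by simp
    have "(2 / pi) ^ (2 * h) * (2 * F * (1 - 1 / 2 ^ (2 * h + 3)) * Z) = F * (2 ^ (2 * h + 3) - 1) / (4 * pi ^ (2 * h)) * Z" for F Z :: real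
      by (simp add: power_divide power_add field_simps)
    thus "elem_sym (n - h) (even_squares (n - 1)) * (2 / pi) ^ (2 * h) * (2 * fact (2 * h - 1 + 3) * (1 - 1 / 2 ^ (2 * h + 3)) * zeta_nat (2 * h + 3)) =
      elem_sym (n - h) (even_squares (n - 1)) * (fact (2 * h + 2) * (2 ^ (2 * h + 3) - 1) / (4 * pi ^ (2 * h)) * zeta_nat (2 * h + 3))"
      unfolding e by (simp only: mult.assoc)
  qed
qed

text \<open>Exchanging the sums over \<open>j\<close> and \<open>h\<close> collects, for each zeta
  value, the coefficients of all moments with \<open>j >= h\<close>; this inner sum is the one that
  \<open>sum_elem_sym_even_squares_csch\<close> expresses by Bernoulli numbers. For
  \<open>n = 0\<close> both sums are empty.\<close>

lemma sum_abs_moments_even: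
  "(\<Sum>j=1..n. abs_moment (2 * j) / real (2 * j)) =
    1 / fact (2 * n - 1) * (\<Sum>h=1..n. fact (2 * h) * (2 ^ (2 * h + 1) - 1) / pi ^ (2 * h) * zeta_nat (2 * h + 1) *
      (\<Sum>l=0..n-h. elem_sym (n-h-l) (even_squares (n-1)) * real ((2*(l+h)) choose (2*l)) * (-1) ^ (l+1)
      * (2 ^ (2*l) * (2 powi (2 * int l - 1) - 1) / real (l+h)) * bernoulli_num (2*l)))"
proof (cases "n = 0")
  case False
  hence n: "n \<ge> 1" by simp
  define V where "V = (\<lambda>h. fact (2 * h) * (2 ^ (2 * h + 1) - 1) / pi ^ (2 * h) * zeta_nat (2 * h + 1))"
  have "(\<Sum>j=1..n. abs_moment (2 * j) / real (2 * j)) = (\<Sum>j=1..n. \<Sum>h=1..j. V h * (elem_sym (j - h) (even_squares (j - 1)) / fact (2 * j)))"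
  proof (intro sum.cong refl)
    fix j assume "j \<in> {1..n}"
    hence j: "j \<ge> 1" by simp
    have f: "(fact (2 * j) :: real) = real (2 * j) * fact (2 * j - 1)" by (rule fact_reduce) (use j in simp)
    show "abs_moment (2 * j) / real (2 * j) = (\<Sum>h=1..j. V h * (elem_sym (j - h) (even_squares (j - 1)) / fact (2 * j)))"
      unfolding abs_moment_even[OF j] f V_def sum_distrib_left sum_divide_distrib
      by (intro sum.cong refl) (simp add: mult_ac)
  qed
  also have "\<dots> = (\<Sum>h=1..n. \<Sum>j=h..n. V h * (elem_sym (j - h) (even_squares (j - 1)) / fact (2 * j)))"
    unfolding sum.Sigma[OF finite_atLeastAtMost ballI[OF finite_atLeastAtMost]]
    by (rule sum.reindex_bij_witness[of _ "\<lambda>(h, j). (j, h)" "\<lambda>(j, h). (h, j)"]) auto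
  also have "\<dots> = (\<Sum>h=1..n. 1 / fact (2 * n - 1) * (V h * (\<Sum>l=0..n-h. elem_sym (n-h-l) (even_squares (n-1)) * real ((2*(l+h)) choose (2*l)) * (-1) ^ (l+1)
      * (2 ^ (2*l) * (2 powi (2 * int l - 1) - 1) / real (l+h)) * bernoulli_num (2*l))))"
  proof (intro sum.cong refl)
    fix h assume "h \<in> {1..n}"
    hence h: "h \<ge> 1" "h \<le> n" by auto
    have "1 / F * (v * (F * S)) = v * S" if "F > 0" for F v S :: real using that by simp
    thus "(\<Sum>j=h..n. V h * (elem_sym (j - h) (even_squares (j - 1)) / fact (2 * j))) =
      1 / fact (2 * n - 1) * (V h * (\<Sum>l=0..n-h. elem_sym (n-h-l) (even_squares (n-1)) * real ((2*(l+h)) choose (2*l)) * (-1) ^ (l+1)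
      * (2 ^ (2*l) * (2 powi (2 * int l - 1) - 1) / real (l+h)) * bernoulli_num (2*l)))"
      unfolding sum_elem_sym_even_squares_csch[OF n h] sum_distrib_left[symmetric] by (simp only: fact_gt_zero)
  qed
  finally show ?thesis unfolding V_def sum_distrib_left[symmetric] .
qed simp

lemma mahler_ladder_even:
  assumes n: "n \<ge> 1"
  shows "pi ^ (2*n) * mahler_measure (2*n+1) (\<lambda>u. 1 + cayley_prod (2*n) u * u (2*n+1)) =
        1 / fact (2*n-1) *
        (\<Sum>h=1..n. elem_sym (n-h) (even_squares (n-1)) * (fact (2*h) * (2 ^ (2*h+1) - 1) / 2)
                   * pi ^ (2*n-2*h) * zeta_nat (2*h+1))"
proof -
  have k: "2 * n \<ge> 1" using n by simp
  show ?thesis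
    unfolding mahler_one_plus_cayley_prod[OF k] integral_positive_part_sech_law[OF k] abs_moment_even[OF n] sum_distrib_left sum_divide_distrib
  proof (intro sum.cong refl)
    fix h assume "h \<in> {1..n}"
    hence p: "pi ^ (2 * n - 2 * h) = pi ^ (2 * n) / pi ^ (2 * h)" using pi_power_diff[of h n] by simp
    show "pi ^ (2 * n) * (1 / fact (2 * n - 1) * (elem_sym (n - h) (even_squares (n - 1)) *
        (fact (2 * h) * (2 ^ (2 * h + 1) - 1) / pi ^ (2 * h) * zeta_nat (2 * h + 1))) / 2) =
      1 / fact (2 * n - 1) * (elem_sym (n-h) (even_squares (n-1)) * (fact (2*h) * (2 ^ (2*h+1) - 1) / 2) * pi ^ (2*n-2*h) * zeta_nat (2*h+1))"
      unfolding p by (simp add: mult_ac)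
  qed
qed

lemma mahler_ladder_odd:
  "pi ^ (2*n+1) * mahler_measure (2*n+2) (\<lambda>u. 1 + cayley_prod (2*n+1) u * u (2*n+2)) =
        1 / fact (2*n) *
        (\<Sum>h=0..n. elem_sym (n-h) (odd_squares n) * fact (2*h+1) * 2 ^ (2*h+1)
                   * pi ^ (2*n-2*h) * L_chi_minus4 (2*h+2))"
proof -
  have k: "2 * n + 1 \<ge> 1" by simp
  have e: "2 * n + 2 = 2 * n + 1 + 1" by simp
  show ?thesis
    unfolding e mahler_one_plus_cayley_prod[OF k] integral_positive_part_sech_law[OF k] abs_moment_def integral_abs_odd sum_distrib_left sum_divide_distrib
  proof (intro sum.cong refl)
    fix h assume "h \<in> {0..n}"
    hence p: "pi ^ (2 * n - 2 * h) = pi ^ (2 * n) / pi ^ (2 * h)" using pi_power_diff[of h n] by simp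
    show "pi ^ (2 * n + 1) * (1 / fact (2 * n) * (elem_sym (n - h) (odd_squares n) * (2 / pi) ^ (2 * h) * (4 / pi * fact (2 * h + 1) * L_chi_minus4 (2 * h + 2))) / 2) =
      1 / fact (2 * n) * (elem_sym (n - h) (odd_squares n) * fact (2 * h + 1) * 2 ^ (2 * h + 1) * pi ^ (2 * n - 2 * h) * L_chi_minus4 (2 * h + 2))"
      unfolding p by (simp add: power_divide)
  qed
qed

text \<open>The cubic moment produces no Bernoulli number; its division by \<open>2 n\<close> leaves
  the symmetric polynomial divided by \<open>n\<close>, and this is the closed form to which
  \<open>elem_sym_even_squares_coth\<close> reduces the Bernoulli sum.\<close>

lemma mahler_two_linear_even:
  assumes n: "n \<ge> 1"
  shows "pi ^ (2*n+2) *
        mahler_measure (2*n+3)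
          (\<lambda>u. 1 + u (2*n+1) + cayley_prod (2*n) u * (1 + u (2*n+2)) * u (2*n+3)) =
        1 / fact (2*n-1) *
        (\<Sum>h=1..n. fact (2*h+2) * (2 ^ (2*h+3) - 1) / 8
                   * (\<Sum>l=0..n-h. elem_sym (n-h-l) (even_squares (n-1))
                        * real ((2*(l+h)) choose (2*h)) * (-1) ^ l
                        * (2 ^ (2*l) / real (l+h)) * bernoulli_num (2*l))
                   * pi ^ (2*n-2*h) * zeta_nat (2*h+3))"
proof -
  have k: "2 * n \<ge> 1" using n by simp
  show ?thesis
    unfolding mahler_two_linear_cayley_prod[OF k] abs_cube_moment_even[OF n] sum_distrib_left[of "1 / fact (2 * n - 1)"] sum_divide_distrib sum_distrib_left[of "pi ^ (2 * n + 2)"]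
  proof (intro sum.cong refl)
    fix h assume "h \<in> {1..n}"
    hence h: "h \<ge> 1" "h \<le> n" by auto
    hence p: "pi ^ (2 * n - 2 * h) = pi ^ (2 * n) / pi ^ (2 * h)" using pi_power_diff[of h n] by simp
    show "pi ^ (2 * n + 2) * (1 / fact (2 * n - 1) * (elem_sym (n - h) (even_squares (n - 1)) *
        (fact (2 * h + 2) * (2 ^ (2 * h + 3) - 1) / (4 * pi ^ (2 * h)) * zeta_nat (2 * h + 3))) / (real (2 * n) * pi\<^sup>2)) =
      1 / fact (2 * n - 1) * (fact (2*h+2) * (2 ^ (2*h+3) - 1) / 8
                   * (\<Sum>l=0..n-h. elem_sym (n-h-l) (even_squares (n-1))
                        * real ((2*(l+h)) choose (2*h)) * (-1) ^ l
                        * (2 ^ (2*l) / real (l+h)) * bernoulli_num (2*l))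
                   * pi ^ (2*n-2*h) * zeta_nat (2*h+3))"
      unfolding elem_sym_even_squares_coth[OF n h] p power_add[of pi "2 * n" 2] by (simp add: mult_ac)
  qed
qed

lemma integral_odd_trilog_law:
  "(\<integral>s. odd_trilog s \<partial>sech_law (2 * n + 1)) =
    (\<Sum>h=0..n. elem_sym (n - h) (odd_squares n) * (2 / pi) ^ (2 * h) / (pi * fact (2 * n)) *
      (2 * (\<integral>s. indicator {0..} s *\<^sub>R (s ^ (2 * h) / cosh s * odd_trilog s) \<partial>lborel)))"
proof -
  define c where "c = (\<lambda>h. elem_sym (n - h) (odd_squares n) * (2 / pi) ^ (2 * h) / (pi * fact (2 * n)))"
  define I where "I = (\<lambda>h s. indicator {0..} s *\<^sub>R (s ^ (2 * h) / cosh s * odd_trilog s))"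
  define f where "f = (\<lambda>s. odd_trilog s * sech_density (2 * n + 1) s)"
  have Ii: "integrable lborel (I h)" for h
  proof (rule Bochner_Integration.integrable_bound)
    show "integrable lborel (\<lambda>s. 2 * odd_trilog 0 * (indicator {0..} s *\<^sub>R (s ^ (2 * h) * exp (- 1 * s))))"
      using has_bochner_integral_power_exp[of 1 "2 * h"] by (intro integrable_mult_right) (simp add: has_bochner_integral_iff)
    show "AE s in lborel. norm (I h s) \<le> norm (2 * odd_trilog 0 * (indicator {0..} s *\<^sub>R (s ^ (2 * h) * exp (- 1 * s))))"
    proof (rule AE_I2)
      fix s :: real
      show "norm (I h s) \<le> norm (2 * odd_trilog 0 * (indicator {0..} s *\<^sub>R (s ^ (2 * h) * exp (- 1 * s))))"
      proof (cases "s \<ge> 0")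
        case True
        have "s ^ (2 * h) * (1 / cosh s) * odd_trilog s \<le> s ^ (2 * h) * (2 * exp (- s)) * odd_trilog 0"
          using True sech_le_exp[of s] odd_trilog_nonneg[of s] odd_trilog_bound[of s] by (intro mult_mono mult_left_mono) auto
        thus ?thesis using True odd_trilog_nonneg[of s] odd_trilog_nonneg[of 0] by (simp add: I_def abs_mult mult_ac)
      qed (simp add: I_def)
    qed
  qed (simp add: I_def)
  have fI: "indicator {0..} s *\<^sub>R f s = (\<Sum>h\<le>n. c h * I h s)" for s
    unfolding f_def sech_density_odd_sum I_def c_def sum_distrib_left scaleR_sum_right
    by (intro sum.cong refl) (simp add: mult_ac)
  have i: "integrable lborel (\<lambda>s. indicator {0..} s *\<^sub>R f s)" unfolding fI by (intro Bochner_Integration.integrable_sum integrable_mult_right Ii)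
  have "(\<integral>s. odd_trilog s \<partial>sech_law (2 * n + 1)) = (\<integral>s. f s \<partial>lborel)"
    unfolding f_def by (intro integral_sech_law) auto
  also have "\<dots> = 2 * (\<integral>s. indicator {0..} s *\<^sub>R f s \<partial>lborel)"
    by (rule integrable_even_extension(2)[OF i]) (simp add: f_def odd_trilog_def)
  also have "(\<integral>s. indicator {0..} s *\<^sub>R f s \<partial>lborel) = (\<Sum>h\<le>n. c h * (\<integral>s. I h s \<partial>lborel))"
    unfolding fI using Ii by (subst Bochner_Integration.integral_sum) auto
  finally show ?thesis unfolding c_def I_def atMost_atLeast0 sum_distrib_left by (simp add: mult_ac)
qed

text \<open>Here the cubic moment is not evaluated: \<open>nn_integral_ramp_odd_trilog_law\<close>
  is read backwards, so that the value is the mean of \<open>max 0 S\<close> plus that of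
  \<open>odd_trilog S\<close>. The first gives the \<open>L\<close> values; the second, integrated
  against \<open>s^(2 h) / cosh s\<close>, gives the double polylogarithms. The equation is stated
  over the complex numbers because \<open>L_script\<close> is complex; the factor \<open>i\<close>
  makes its contribution real.\<close>

lemma mahler_two_linear_odd:
  "complex_of_real (pi ^ (2*n+3) *
          mahler_measure (2*n+4)
            (\<lambda>u. 1 + u (2*n+2) + cayley_prod (2*n+1) u * (1 + u (2*n+3)) * u (2*n+4))) =
        1 / fact (2*n) *
        (\<Sum>h=0..n. of_real (elem_sym (n-h) (odd_squares n)) * 2 ^ (2*h+1)
                   * of_real pi ^ (2*n-2*h)
                   * (\<i> * fact (2*h) * L_script 3 (2*h+1) \<i>
                      + fact (2*h+1) * of_real pi ^ 2 * of_real (L_chi_minus4 (2*h+2))))"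
proof -
  let ?k = "2 * n + 1"
  define K where "K = (\<lambda>h. \<integral>s. indicator {0..} s *\<^sub>R (s ^ (2 * h) / cosh s * odd_trilog s) \<partial>lborel)"
  have I: "(\<integral>s. odd_trilog s \<partial>sech_law ?k) = (\<Sum>h=0..n. elem_sym (n - h) (odd_squares n) * (2 / pi) ^ (2 * h) / (pi * fact (2 * n)) * (2 * K h))"
    unfolding K_def by (rule integral_odd_trilog_law)
  define V where "V = (\<integral>s. \<bar>s\<bar> ^ 3 \<partial>sech_law ?k) / (real ?k * pi\<^sup>2)"
  have V0: "V \<ge> 0" unfolding V_def by (intro divide_nonneg_nonneg Bochner_Integration.integral_nonneg) auto
  have k: "?k \<ge> 1" by simp
  have oi: "integrable (sech_law ?k) odd_trilog"
    by (rule integrable_sech_law[of _ "odd_trilog 0" 0]) (use odd_trilog_nonneg odd_trilog_bound in auto)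
  have "V = (\<integral>s. max 0 s + odd_trilog s \<partial>sech_law ?k)"
  proof -
    have "(\<integral>s. max 0 s + odd_trilog s \<partial>sech_law ?k) = enn2real (\<integral>\<^sup>+s. ennreal (max 0 s + odd_trilog s) \<partial>sech_law ?k)"
      by (rule integral_eq_nn_integral) (auto intro!: AE_I2 add_nonneg_nonneg simp: odd_trilog_nonneg)
    thus ?thesis unfolding nn_integral_ramp_odd_trilog_law[OF k] V_def[symmetric] using V0 by simp
  qed
  also have "\<dots> = abs_moment ?k / 2 + (\<integral>s. odd_trilog s \<partial>sech_law ?k)"
    unfolding integral_positive_part_sech_law[OF k, symmetric]
    by (rule Bochner_Integration.integral_add[OF integrable_sech_law_ln_exp(2) oi])
  finally have "pi ^ (2 * n + 3) * V = pi ^ (2 * n + 3) * (abs_moment ?k / 2 + (\<integral>s. odd_trilog s \<partial>sech_law ?k))" by simp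
  also have "\<dots> = 1 / fact (2 * n) * (\<Sum>h=0..n. elem_sym (n-h) (odd_squares n) * 2 ^ (2*h+1) * pi ^ (2*n-2*h) * (pi\<^sup>2 * K h + fact (2*h+1) * pi ^ 2 * L_chi_minus4 (2*h+2)))"
    unfolding abs_moment_def integral_abs_odd I sum_distrib_left sum_divide_distrib sum.distrib[symmetric]
  proof (intro sum.cong refl)
    fix h assume "h \<in> {0..n}"
    hence p: "pi ^ (2 * n - 2 * h) = pi ^ (2 * n) / pi ^ (2 * h)" using pi_power_diff[of h n] by simp
    have q: "pi ^ (2 * n + 3) = pi ^ (2 * n) * pi * pi\<^sup>2" by (simp add: power_add power2_eq_square power3_eq_cube)
    have pz: "pi ^ (2 * h) \<noteq> 0" "fact (2 * n) \<noteq> (0::real)" by auto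
    have E: "x * pi * y * (1 / F * (e * (2 / pi) ^ (2 * h) * (4 / pi * b * c)) / 2 + e * (2 / pi) ^ (2 * h) / (pi * F) * (2 * d)) =
        1 / F * (e * 2 ^ (2 * h + 1) * (x / pi ^ (2 * h)) * (y * d + b * y * c))" if "F \<noteq> 0" for x y e b c d F :: real
      using that by (simp add: power_divide field_simps)
    show "pi ^ (2 * n + 3) * (1 / fact (2 * n) * (elem_sym (n - h) (odd_squares n) * (2 / pi) ^ (2 * h) * (4 / pi * fact (2 * h + 1) * L_chi_minus4 (2 * h + 2))) / 2 +
        elem_sym (n - h) (odd_squares n) * (2 / pi) ^ (2 * h) / (pi * fact (2 * n)) * (2 * K h)) =
      1 / fact (2 * n) * (elem_sym (n-h) (odd_squares n) * 2 ^ (2*h+1) * pi ^ (2*n-2*h) * (pi\<^sup>2 * K h + fact (2*h+1) * pi ^ 2 * L_chi_minus4 (2*h+2)))"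
      unfolding p q by (rule E[OF pz(2)])
  qed
  finally have R: "pi ^ (2 * n + 3) * V = 1 / fact (2 * n) * (\<Sum>h=0..n. elem_sym (n-h) (odd_squares n) * 2 ^ (2*h+1) * pi ^ (2*n-2*h) * (pi\<^sup>2 * K h + fact (2*h+1) * pi ^ 2 * L_chi_minus4 (2*h+2)))" .
  have e: "2 * n + 4 = ?k + 3" "2 * n + 2 = ?k + 1" "2 * n + 3 = ?k + 2" by auto
  have M: "mahler_measure (2*n+4) (\<lambda>u. 1 + u (2*n+2) + cayley_prod (2*n+1) u * (1 + u (2*n+3)) * u (2*n+4)) = V"
    unfolding e mahler_two_linear_cayley_prod[OF k] V_def ..
  have "complex_of_real (pi ^ (2 * n + 3) * V) = 1 / fact (2 * n) * (\<Sum>h=0..n. of_real (elem_sym (n-h) (odd_squares n)) * 2 ^ (2*h+1) * of_real pi ^ (2*n-2*h) * (of_real (pi\<^sup>2 * K h) + fact (2*h+1) * of_real pi ^ 2 * of_real (L_chi_minus4 (2*h+2))))"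
    unfolding R by simp
  also have "\<dots> = 1 / fact (2 * n) * (\<Sum>h=0..n. of_real (elem_sym (n-h) (odd_squares n)) * 2 ^ (2*h+1) * of_real pi ^ (2*n-2*h) * (\<i> * fact (2 * h) * L_script 3 (2 * h + 1) \<i> + fact (2*h+1) * of_real pi ^ 2 * of_real (L_chi_minus4 (2*h+2))))"
    unfolding K_def integral_odd_trilog_sech ..
  finally show ?thesis unfolding M .
qed

text \<open>\<open>ln (1 + e^s) = ln (2 cosh (s / 2)) + s / 2\<close>, and \<open>s\<close> has mean
  0; the doubled logarithm is the quantity that the two-step recursion evaluates.\<close>

lemma mahler_triangle_even:
  assumes n: "n \<ge> 1"
  shows "pi ^ (2*n+1) *
        mahler_measure (2*n+2)
          (\<lambda>u. 1 + cayley_prod (2*n) u * u (2*n+1) + (1 - cayley_prod (2*n) u) * u (2*n+2)) =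
        pi ^ (2*n+1) / 2 * ln 2
        + 1 / fact (2*n-1) *
          (\<Sum>h=1..n. elem_sym (n-h) (even_squares (n-1)) * (fact (2*h) * (2 ^ (2*h+1) - 1) / 4)
                     * pi ^ (2*n-2*h+1) * zeta_nat (2*h+1))
        + 1 / fact (2*n-1) *
          (\<Sum>h=1..n. fact (2*h) * (2 ^ (2*h+1) - 1) / 4
                     * (\<Sum>l=0..n-h. elem_sym (n-h-l) (even_squares (n-1))
                          * real ((2*(l+h)) choose (2*l)) * (-1) ^ (l+1)
                          * (2 ^ (2*l) * (2 powi (2 * int l - 1) - 1) / real (l+h))
                          * bernoulli_num (2*l))
                     * pi ^ (2*n-2*h+1) * zeta_nat (2*h+1))"
proof -
  have k: "2 * n \<ge> 1" "even (2 * n)" using n by auto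
  have "(\<integral>s. ln (1 + exp s) \<partial>sech_law (2 * n)) = (\<integral>s. (2 * ln (2 * cosh (s / 2)) + s) / 2 \<partial>sech_law (2 * n))"
    by (intro Bochner_Integration.integral_cong[OF refl]) (simp add: ln_two_cosh_half)
  also have "\<dots> = (\<integral>s. 2 * ln (2 * cosh (s / 2)) \<partial>sech_law (2 * n)) / 2"
  proof -
    have "integrable (sech_law (2 * n)) (\<lambda>s. 2 * ln (2 * cosh (s / 2)))"
      unfolding ln_two_cosh_half using integrable_sech_law_ln_exp(1,4)[of "2 * n"] by simp
    thus ?thesis using integrable_sech_law_ln_exp(4)[of "2 * n"] integral_sech_law_id[OF k(1)] by simp
  qed
  finally have M: "mahler_measure (2*n+2) (\<lambda>u. 1 + cayley_prod (2*n) u * u (2*n+1) + (1 - cayley_prod (2*n) u) * u (2*n+2)) =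
     ln 2 / 2 + abs_moment (2 * n) / 4 + (\<Sum>j=1..n. abs_moment (2 * j) / real (2 * j)) / 4"
    unfolding mahler_real_cayley_prod[OF k] integral_positive_part_sech_law[OF k(1)] integral_ln_cosh_half_sech_law abs_moment_def[symmetric]
    by (simp add: field_simps)
  have p: "pi ^ (2 * n - 2 * h + 1) = pi ^ (2 * n + 1) / pi ^ (2 * h)" if "h \<in> {1..n}" for h
    using that by (simp add: pi_power_diff[symmetric] power_add)
  have 1: "pi ^ (2*n+1) * (abs_moment (2 * n) / 4) = 1 / fact (2*n-1) *
          (\<Sum>h=1..n. elem_sym (n-h) (even_squares (n-1)) * (fact (2*h) * (2 ^ (2*h+1) - 1) / 4)
                     * pi ^ (2*n-2*h+1) * zeta_nat (2*h+1))"
    unfolding abs_moment_even[OF n] sum_distrib_left sum_divide_distrib by (intro sum.cong refl) (simp only: p, simp add: mult_ac)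
  have 2: "pi ^ (2*n+1) * ((\<Sum>j=1..n. abs_moment (2 * j) / real (2 * j)) / 4) = 1 / fact (2*n-1) *
          (\<Sum>h=1..n. fact (2*h) * (2 ^ (2*h+1) - 1) / 4
                     * (\<Sum>l=0..n-h. elem_sym (n-h-l) (even_squares (n-1))
                          * real ((2*(l+h)) choose (2*l)) * (-1) ^ (l+1)
                          * (2 ^ (2*l) * (2 powi (2 * int l - 1) - 1) / real (l+h))
                          * bernoulli_num (2*l))
                     * pi ^ (2*n-2*h+1) * zeta_nat (2*h+1))"
    unfolding sum_abs_moments_even sum_distrib_left[of "1 / fact (2 * n - 1)"] sum_divide_distrib sum_distrib_left[of "pi ^ (2 * n + 1)"]
    by (intro sum.cong refl) (simp only: p, simp add: mult_ac)
  show ?thesis unfolding M distrib_left 1 2 by simp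
qed

text \<open>The step added by the average over \<open>x\<close> makes the separate moment that of
  \<open>2 (n + 1)\<close> steps, hence the squares up to \<open>(2 n)^2\<close> and the factorial
  of \<open>2 n + 1\<close>. The recursion for \<open>ln (2 cosh)\<close> contributes the even
  moments up to \<open>2 n\<close>, the same sum as in the even case.\<close>

lemma mahler_triangle_odd:
  "pi ^ (2*n+2) *
        mahler_measure (2*n+3)
          (\<lambda>u. 1 + cayley_prod (2*n+1) u * u (2*n+2) + (1 - cayley_prod (2*n+1) u) * u (2*n+3)) =
        pi ^ (2*n+2) / 2 * ln 2
        + 1 / fact (2*n+1) *
          (\<Sum>h=0..n. elem_sym (n-h) (even_squares n) * (fact (2*h+2) * (2 ^ (2*h+3) - 1) / 4)
                     * pi ^ (2*n-2*h) * zeta_nat (2*h+3))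
        + 1 / fact (2*n-1) *
          (\<Sum>h=1..n. fact (2*h) * (2 ^ (2*h+1) - 1) / 4
                     * (\<Sum>l=0..n-h. elem_sym (n-h-l) (even_squares (n-1))
                          * real ((2*(l+h)) choose (2*l)) * (-1) ^ (l+1)
                          * (2 ^ (2*l) * (2 powi (2 * int l - 1) - 1) / real (l+h))
                          * bernoulli_num (2*l))
                     * pi ^ (2*n-2*h+2) * zeta_nat (2*h+1))"
proof -
  have k: "odd (2 * n + 1)" by simp
  have e: "2 * n + 1 + 1 = 2 * n + 2" "2 * n + 1 + 2 = 2 * n + 3" by auto
  have M: "mahler_measure (2*n+3) (\<lambda>u. 1 + cayley_prod (2*n+1) u * u (2*n+2) + (1 - cayley_prod (2*n+1) u) * u (2*n+3)) =
     ln 2 / 2 + abs_moment (2 * (n + 1)) / 4 + (\<Sum>j=1..n. abs_moment (2 * j) / real (2 * j)) / 4"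
  proof -
    have "mahler_measure (2*n+3) (\<lambda>u. 1 + cayley_prod (2*n+1) u * u (2*n+2) + (1 - cayley_prod (2*n+1) u) * u (2*n+3)) =
       ((2 * ln 2 + (\<Sum>j=1..n. abs_moment (2 * j) / real (2 * j))) + abs_moment (2 * n + 2)) / 4"
      using mahler_imaginary_cayley_prod[OF k] unfolding e integral_ln_cosh_sech_law abs_moment_def[symmetric] .
    moreover have "2 * n + 2 = 2 * (n + 1)" by simp
    ultimately show ?thesis by (simp add: add_divide_distrib)
  qed
  have p: "pi ^ (2 * n - 2 * h + 2) = pi ^ (2 * n + 2) / pi ^ (2 * h)" if "h \<in> {1..n}" for h
    using that by (simp add: pi_power_diff[symmetric] power_add)
  have 1: "pi ^ (2*n+2) * (abs_moment (2 * (n + 1)) / 4) = 1 / fact (2*n+1) *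
          (\<Sum>h=0..n. elem_sym (n-h) (even_squares n) * (fact (2*h+2) * (2 ^ (2*h+3) - 1) / 4)
                     * pi ^ (2*n-2*h) * zeta_nat (2*h+3))"
  proof -
    have n1: "n + 1 \<ge> 1" "2 * (n + 1) - 1 = 2 * n + 1" "n + 1 - 1 = n" by auto
    show ?thesis
      unfolding abs_moment_even[OF n1(1)] n1(2,3) sum_distrib_left sum_divide_distrib
    \<comment> \<open>Lowering \<open>h\<close> by one moves \<open>zeta (2 h + 1)\<close> to
      \<open>zeta (2 h + 3)\<close> and lets the sum start at 0.\<close>
    proof (rule sum.reindex_bij_witness[of _ Suc "\<lambda>h. h - 1"])
      fix h assume "h \<in> {1..n + 1}"
      then obtain g where g: "h = Suc g" "g \<le> n" by (cases h) auto
      have q: "pi ^ (2 * n - 2 * g) = pi ^ (2 * n + 2) / pi ^ (2 * Suc g)"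
        using pi_power_diff[OF g(2)] by simp
      have e: "n + 1 - Suc g = n - g" "Suc g - 1 = g" "2 * Suc g = 2 * g + 2" "2 * g + 2 + 1 = 2 * g + 3" by auto
      show "1 / fact (2 * n + 1) * (elem_sym (n - (h - 1)) (even_squares n) * (fact (2 * (h - 1) + 2) * (2 ^ (2 * (h - 1) + 3) - 1) / 4) * pi ^ (2 * n - 2 * (h - 1)) * zeta_nat (2 * (h - 1) + 3)) =
        pi ^ (2 * n + 2) * (1 / fact (2 * n + 1) * (elem_sym (n + 1 - h) (even_squares n) * (fact (2 * h) * (2 ^ (2 * h + 1) - 1) / pi ^ (2 * h) * zeta_nat (2 * h + 1))) / 4)"
        unfolding g(1) e(1,2) q unfolding e(3,4) by (simp add: mult_ac)
    qed auto
  qed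
  have 2: "pi ^ (2*n+2) * ((\<Sum>j=1..n. abs_moment (2 * j) / real (2 * j)) / 4) = 1 / fact (2*n-1) *
          (\<Sum>h=1..n. fact (2*h) * (2 ^ (2*h+1) - 1) / 4
                     * (\<Sum>l=0..n-h. elem_sym (n-h-l) (even_squares (n-1))
                          * real ((2*(l+h)) choose (2*l)) * (-1) ^ (l+1)
                          * (2 ^ (2*l) * (2 powi (2 * int l - 1) - 1) / real (l+h))
                          * bernoulli_num (2*l))
                     * pi ^ (2*n-2*h+2) * zeta_nat (2*h+1))"
    unfolding sum_abs_moments_even sum_distrib_left[of "1 / fact (2 * n - 1)"] sum_divide_distrib sum_distrib_left[of "pi ^ (2 * n + 2)"]
    by (intro sum.cong refl) (simp only: p, simp add: mult_ac)
  have 0: "pi ^ (2 * n + 2) * (ln 2 / 2) = pi ^ (2 * n + 2) / 2 * ln 2" by simp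
  show ?thesis unfolding M distrib_left[of "pi ^ (2 * n + 2)"] 0 1 2 ..
qed

theorem theorem1:
  shows
    "(\<forall>n\<ge>1.
        pi ^ (2*n) * mahler_measure (2*n+1) (\<lambda>u. 1 + cayley_prod (2*n) u * u (2*n+1)) =
        1 / fact (2*n-1) *
        (\<Sum>h=1..n. elem_sym (n-h) (even_squares (n-1)) * (fact (2*h) * (2 ^ (2*h+1) - 1) / 2)
                   * pi ^ (2*n-2*h) * zeta_nat (2*h+1)))
   \<and> (\<forall>n\<ge>0.
        pi ^ (2*n+1) * mahler_measure (2*n+2) (\<lambda>u. 1 + cayley_prod (2*n+1) u * u (2*n+2)) =
        1 / fact (2*n) *
        (\<Sum>h=0..n. elem_sym (n-h) (odd_squares n) * fact (2*h+1) * 2 ^ (2*h+1)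
                   * pi ^ (2*n-2*h) * L_chi_minus4 (2*h+2)))
   \<and> (\<forall>n\<ge>1.
        pi ^ (2*n+2) *
        mahler_measure (2*n+3)
          (\<lambda>u. 1 + u (2*n+1) + cayley_prod (2*n) u * (1 + u (2*n+2)) * u (2*n+3)) =
        1 / fact (2*n-1) *
        (\<Sum>h=1..n. fact (2*h+2) * (2 ^ (2*h+3) - 1) / 8
                   * (\<Sum>l=0..n-h. elem_sym (n-h-l) (even_squares (n-1))
                        * real ((2*(l+h)) choose (2*h)) * (-1) ^ l
                        * (2 ^ (2*l) / real (l+h)) * bernoulli_num (2*l))
                   * pi ^ (2*n-2*h) * zeta_nat (2*h+3)))
   \<and> (\<forall>n\<ge>0.
        complex_of_real (pi ^ (2*n+3) *
          mahler_measure (2*n+4)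
            (\<lambda>u. 1 + u (2*n+2) + cayley_prod (2*n+1) u * (1 + u (2*n+3)) * u (2*n+4))) =
        1 / fact (2*n) *
        (\<Sum>h=0..n. of_real (elem_sym (n-h) (odd_squares n)) * 2 ^ (2*h+1)
                   * of_real pi ^ (2*n-2*h)
                   * (\<i> * fact (2*h) * L_script 3 (2*h+1) \<i>
                      + fact (2*h+1) * of_real pi ^ 2 * of_real (L_chi_minus4 (2*h+2)))))
   \<and> (\<forall>n\<ge>1.
        pi ^ (2*n+1) *
        mahler_measure (2*n+2)
          (\<lambda>u. 1 + cayley_prod (2*n) u * u (2*n+1) + (1 - cayley_prod (2*n) u) * u (2*n+2)) =
        pi ^ (2*n+1) / 2 * ln 2
        + 1 / fact (2*n-1) *
          (\<Sum>h=1..n. elem_sym (n-h) (even_squares (n-1)) * (fact (2*h) * (2 ^ (2*h+1) - 1) / 4)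
                     * pi ^ (2*n-2*h+1) * zeta_nat (2*h+1))
        + 1 / fact (2*n-1) *
          (\<Sum>h=1..n. fact (2*h) * (2 ^ (2*h+1) - 1) / 4
                     * (\<Sum>l=0..n-h. elem_sym (n-h-l) (even_squares (n-1))
                          * real ((2*(l+h)) choose (2*l)) * (-1) ^ (l+1)
                          * (2 ^ (2*l) * (2 powi (2 * int l - 1) - 1) / real (l+h))
                          * bernoulli_num (2*l))
                     * pi ^ (2*n-2*h+1) * zeta_nat (2*h+1)))
   \<and> (\<forall>n\<ge>0.
        pi ^ (2*n+2) *
        mahler_measure (2*n+3)
          (\<lambda>u. 1 + cayley_prod (2*n+1) u * u (2*n+2) + (1 - cayley_prod (2*n+1) u) * u (2*n+3)) =
        pi ^ (2*n+2) / 2 * ln 2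
        + 1 / fact (2*n+1) *
          (\<Sum>h=0..n. elem_sym (n-h) (even_squares n) * (fact (2*h+2) * (2 ^ (2*h+3) - 1) / 4)
                     * pi ^ (2*n-2*h) * zeta_nat (2*h+3))
        + 1 / fact (2*n-1) *
          (\<Sum>h=1..n. fact (2*h) * (2 ^ (2*h+1) - 1) / 4
                     * (\<Sum>l=0..n-h. elem_sym (n-h-l) (even_squares (n-1))
                          * real ((2*(l+h)) choose (2*l)) * (-1) ^ (l+1)
                          * (2 ^ (2*l) * (2 powi (2 * int l - 1) - 1) / real (l+h))
                          * bernoulli_num (2*l))
                     * pi ^ (2*n-2*h+2) * zeta_nat (2*h+1)))"
  by (intro conjI allI impI mahler_ladder_even mahler_ladder_odd mahler_two_linear_even mahler_two_linear_odd
      mahler_triangle_even mahler_triangle_odd)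

end
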